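(* Let $\hat W_n=\arg\min_{W\in\Theta_s}U_n(W)$ and let $$W_n^*:=\arg\min_{W\in\Theta_s}\frac1n\sum_{t=1}^n (Y_t-F_W(Z_t))^T\Gamma_0^{-1}(Y_t-F_W(Z_t))$$ be the generalized least squares estimator using the true noise covariance matrix $\Gamma_0$. Then, as $n\to\infty$, both $\sqrt n(\hat W_n-W^0)$ and $\sqrt n(W_n^*-W^0)$ converge in law to $\mathcal N(0,I_0^{-1})$, where $I_0$ is the matrix whose component $(k,l)$ is $$\mathrm{tr}\left(\Gamma_0^{-1}E\left(\frac{\partial F_{W^0}(Z)}{\partial W_k}\frac{\partial F_{W^0}(Z)}{\partial W_l}^T\right)\right).$$ Thus $\hat W_n$ has the same asymptotic behavior as $W_n^*$, which is asymptotically optimal, and therefore $\hat W_n$ is asymptotically optimal too (it is "efficient", meaning that it has the same asymptotic variance as $W_n^*$).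
   Context: Model. $(Y_t,Z_t)_{t\in\mathbb N}$ is an i.i.d. sequence of random vectors, each with the same law as a generic pair $(Y,Z)$, where $Y_t$ is $d$-dimensional, $Z_t$ is $L$-dimensional, and $Y_t=F_{W^0}(Z_t)+\varepsilon_t$, where $(\varepsilon_t)$ is an i.i.d. centered noise with unknown invertible covariance matrix $\Gamma_0$. It is assumed that the square of the noise and the cube of $Z$ are integrable: $E\|\varepsilon_t\|^2<\infty$ and $E\|Z\|^3<\infty$. MLP functions. $F_W=(F_W^1,\dots,F_W^d)^T$ is the function represented by a one-hidden-layer multilayer perceptron (MLP) with $H$ hidden units and weight vector $W$ (the $a_{ij}$ and $w_{jk}$): $F_W^i(z)=\sum_{j=1}^H a_{ij}\tanh\left(\sum_{k=1}^L w_{jk}z_k+w_{j0}\right)+a_{i0}$. $\frac{\partial F_W(z)}{\partial W_k}$ denotes the $d$-dimensional vector of partial derivatives of the components of $F_W(z)$ with respect to the weight $W_k$. Parameter set and identifiability. The parameter set $\Theta_s\subset\mathbb R^s$ is compact. Two weight vectors are considered equivalent if one is obtained from the other by a transformation in the finite group generated by sign changes of hidden units (flipping the sign of all incoming and outgoing weights of a unit) and permutations of hidden units; parameters are considered in the quotient space by this group. In this space the model is assumed identifiable: the true model belongs to the considered family and the MLPs considered have no redundant units, so that $W^0$ is the only parameter representing the true function. The assumptions are taken to be such that the limiting Hessian matrix $2I_0$ of $U_n$ at $W^0$ is positive definite. Cost function. $U_n(W):=\log\det\left(\frac1n\sum_{t=1}^n (Y_t-F_W(Z_t))(Y_t-F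_W(Z_t))^T\right)$.
   Formalization: The formal theorem adds that W⁰ is interior to the parameter set (in the quotient; normality fails at the boundary), that the noise ε_t is independent of Z_t, and that identifiability means F_W(Z)=F_{W⁰}(Z) almost surely only for W equivalent to W⁰. *)

theory Defs
  imports "HOL-Probability.Probability"
begin

section \<open>Matrices and random vectors\<close>

definition outer_prod :: "real^'m \<Rightarrow> real^'n \<Rightarrow> real^'n^'m" where
  "outer_prod u v = (\<chi> i j. u $ i * v $ j)"

definition pos_semidef :: "real^'n^'n \<Rightarrow> bool" where
  "pos_semidef A \<longleftrightarrow> transpose A = A \<and> (\<forall>x. 0 \<le> x \<bullet> (A *v x))"

definition pos_def :: "real^'n^'n \<Rightarrow> bool" where
  "pos_def A \<longleftrightarrow> transpose A = A \<and> (\<forall>x. x \<noteq> 0 \<longrightarrow> 0 < x \<bullet> (A *v x))"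

definition covariance_matrix :: "'w measure \<Rightarrow> ('w \<Rightarrow> real^'n) \<Rightarrow> real^'n^'n" where
  "covariance_matrix M X =
     (let m = integral\<^sup>L M X in integral\<^sup>L M (\<lambda>\<omega>. outer_prod (X \<omega> - m) (X \<omega> - m)))"

text \<open>The multivariate normal law is given by its density; it is only used for positive definite
  covariance matrices \<open>S\<close>.\<close>

definition mv_normal :: "real^'n \<Rightarrow> real^'n^'n \<Rightarrow> (real^'n) measure" where
  "mv_normal m S = density lborel (\<lambda>x. ennreal
     (exp (- ((x - m) \<bullet> (matrix_inv S *v (x - m))) / 2) / sqrt ((2 * pi) ^ CARD('n) * det S)))"

text \<open>The library's weak convergence only covers measures on the real line.\<close>

definition converges_in_law ::
  "'w measure \<Rightarrow> (nat \<Rightarrow> 'w \<Rightarrow> 'a::euclidean_space) \<Rightarrow> 'a measure \<Rightarrow> bool" where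
  "converges_in_law M X \<nu> \<longleftrightarrow>
     (\<forall>f :: 'a \<Rightarrow> real. continuous_on UNIV f \<and> bounded (range f) \<longrightarrow>
        (\<lambda>n. \<integral>\<omega>. f (X n \<omega>) \<partial>M) \<longlonglongrightarrow> (\<integral>x. f x \<partial>\<nu>))"

section \<open>One-hidden-layer perceptrons\<close>

text \<open>Outputs are indexed by \<open>'d\<close>, hidden units by \<open>'h\<close> and inputs by \<open>'l\<close>; \<open>None\<close> plays the role
  of the bias index \<open>0\<close>. The component \<open>Inl (i, j)\<close> of a weight vector is $a_{ij}$ and the
  component \<open>Inr (j, k)\<close> is $w_{jk}$.\<close>

type_synonym ('d, 'h, 'l) weight_index = "('d \<times> 'h option) + ('h \<times> 'l option)"

type_synonym ('d, 'h, 'l) weights = "(real, ('d, 'h, 'l) weight_index) vec"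

definition mlp :: "('d::finite, 'h::finite, 'l::finite) weights \<Rightarrow> real^'l \<Rightarrow> real^'d" where
  "mlp W z = (\<chi> i.
     (\<Sum>j\<in>UNIV. W $ Inl (i, Some j) *
        tanh ((\<Sum>k\<in>UNIV. W $ Inr (j, Some k) * z $ k) + W $ Inr (j, None)))
     + W $ Inl (i, None))"

definition mlp_partial ::
  "('d::finite, 'h::finite, 'l::finite) weights \<Rightarrow> ('d, 'h, 'l) weight_index \<Rightarrow> real^'l \<Rightarrow> real^'d"
where
  "mlp_partial W k z = vector_derivative (\<lambda>t. mlp (W + t *\<^sub>R axis k 1) z) (at 0)"

text \<open>Permute the hidden units by \<open>\<pi>\<close> and multiply all incoming (bias included) and outgoing
  weights of unit \<open>j\<close> by the sign \<open>\<sigma> j\<close>.\<close>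

definition unit_transform :: "('h \<Rightarrow> 'h) \<Rightarrow> ('h \<Rightarrow> real) \<Rightarrow>
    ('d::finite, 'h::finite, 'l::finite) weights \<Rightarrow> ('d, 'h, 'l) weights" where
  "unit_transform \<pi> \<sigma> W = (\<chi> q. case q of
       Inl (i, None) \<Rightarrow> W $ Inl (i, None)
     | Inl (i, Some j) \<Rightarrow> \<sigma> j * W $ Inl (i, Some (\<pi> j))
     | Inr (j, k) \<Rightarrow> \<sigma> j * W $ Inr (\<pi> j, k))"

definition weight_equiv ::
  "('d::finite, 'h::finite, 'l::finite) weights \<Rightarrow> ('d, 'h, 'l) weights \<Rightarrow> bool" where
  "weight_equiv V W \<longleftrightarrow>
     (\<exists>\<pi> \<sigma>. bij \<pi> \<and> (\<forall>j. \<sigma> j \<in> {1, -1}) \<and> W = unit_transform \<pi> \<sigma> V)"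

text \<open>A hidden unit is redundant if the same function is represented without its contribution.\<close>

definition redundant_unit ::
  "('d::finite, 'h::finite, 'l::finite) weights \<Rightarrow> 'h \<Rightarrow> bool" where
  "redundant_unit W j \<longleftrightarrow> (\<exists>V. (\<forall>i. V $ Inl (i, Some j) = 0) \<and> mlp V = mlp W)"

text \<open>All weight vectors whose equivalence class meets \<open>\<Theta>\<close>.\<close>

definition saturation ::
  "('d::finite, 'h::finite, 'l::finite) weights set \<Rightarrow> ('d, 'h, 'l) weights set" where
  "saturation \<Theta> = {W. \<exists>V\<in>\<Theta>. weight_equiv V W}"

section \<open>Estimators\<close>

definition residual :: "(nat \<Rightarrow> 'w \<Rightarrow> real^'d) \<Rightarrow> (nat \<Rightarrow> 'w \<Rightarrow> real^'l) \<Rightarrow> 'w \<Rightarrow>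
    ('d::finite, 'h::finite, 'l::finite) weights \<Rightarrow> nat \<Rightarrow> real^'d" where
  "residual Y Z \<omega> W t = Y t \<omega> - mlp W (Z t \<omega>)"

text \<open>The convention $\log 0 = -\infty$ matters: the empirical covariance matrix may be singular, e.g.
  whenever \<open>n < d\<close>, whereas the real-valued logarithm would return \<open>ln 0 = 0\<close>.\<close>

definition log_det_cost :: "(nat \<Rightarrow> 'w \<Rightarrow> real^'d) \<Rightarrow> (nat \<Rightarrow> 'w \<Rightarrow> real^'l) \<Rightarrow> nat \<Rightarrow> 'w \<Rightarrow>
    ('d::finite, 'h::finite, 'l::finite) weights \<Rightarrow> ereal" where
  "log_det_cost Y Z n \<omega> W =
     (let D = det ((1 / real n) *\<^sub>R
                (\<Sum>t=1..n. outer_prod (residual Y Z \<omega> W t) (residual Y Z \<omega> W t)))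
      in if D > 0 then ereal (ln D) else - \<infinity>)"

definition gls_cost :: "real^'d^'d \<Rightarrow> (nat \<Rightarrow> 'w \<Rightarrow> real^'d) \<Rightarrow> (nat \<Rightarrow> 'w \<Rightarrow> real^'l) \<Rightarrow>
    nat \<Rightarrow> 'w \<Rightarrow> ('d::finite, 'h::finite, 'l::finite) weights \<Rightarrow> real" where
  "gls_cost \<Gamma> Y Z n \<omega> W =
     (1 / real n) *
     (\<Sum>t=1..n. residual Y Z \<omega> W t \<bullet> (matrix_inv \<Gamma> *v residual Y Z \<omega> W t))"

text \<open>A minimiser is a point of the quotient space. In order to form the difference with \<open>W0\<close> it is
  represented by an element of its class that is closest to \<open>W0\<close> (symmetries are isometries, so the
  distance to \<open>W0\<close> is then the quotient distance).\<close>

definition nearest_representative :: "('d::finite, 'h::finite, 'l::finite) weights \<Rightarrow>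
    ('d, 'h, 'l) weights \<Rightarrow> ('d, 'h, 'l) weights \<Rightarrow> bool" where
  "nearest_representative W0 V W \<longleftrightarrow>
     weight_equiv V W \<and> (\<forall>W'. weight_equiv V W' \<longrightarrow> dist W W0 \<le> dist W' W0)"

definition minimum_estimator :: "'w measure \<Rightarrow> ('d, 'h, 'l) weights set \<Rightarrow> ('d, 'h, 'l) weights \<Rightarrow>
    (nat \<Rightarrow> 'w \<Rightarrow> ('d::finite, 'h::finite, 'l::finite) weights \<Rightarrow> 'c::ord) \<Rightarrow>
    (nat \<Rightarrow> 'w \<Rightarrow> ('d, 'h, 'l) weights) \<Rightarrow> bool" where
  "minimum_estimator M \<Theta> W0 C T \<longleftrightarrow>
     (\<forall>n\<ge>1. T n \<in> borel_measurable M \<and>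
        (\<forall>\<omega>\<in>space M. \<exists>V. is_arg_min (C n \<omega>) (\<lambda>W. W \<in> \<Theta>) V \<and>
                            nearest_representative W0 V (T n \<omega>)))"

section \<open>Asymptotic covariance and optimality\<close>

definition asymptotic_covariance ::
  "'w measure \<Rightarrow> real^'s \<Rightarrow> (nat \<Rightarrow> 'w \<Rightarrow> real^'s) \<Rightarrow> real^'s^'s \<Rightarrow> bool" where
  "asymptotic_covariance M \<theta> T V \<longleftrightarrow> pos_def V \<and>
     converges_in_law M (\<lambda>n \<omega>. sqrt (real n) *\<^sub>R (T n \<omega> - \<theta>)) (mv_normal 0 V)"

definition same_asymptotic_covariance ::
  "'w measure \<Rightarrow> real^'s \<Rightarrow> (nat \<Rightarrow> 'w \<Rightarrow> real^'s) \<Rightarrow> (nat \<Rightarrow> 'w \<Rightarrow> real^'s) \<Rightarrow> bool" where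
  "same_asymptotic_covariance M \<theta> S T \<longleftrightarrow>
     (\<exists>V. asymptotic_covariance M \<theta> S V \<and> asymptotic_covariance M \<theta> T V)"

text \<open>Smallest asymptotic covariance, in the Loewner order, among the asymptotically normal
  estimators of a class \<open>\<C>\<close>.\<close>

definition asymptotically_optimal :: "'w measure \<Rightarrow> real^'s \<Rightarrow>
    (nat \<Rightarrow> 'w \<Rightarrow> real^'s) set \<Rightarrow> (nat \<Rightarrow> 'w \<Rightarrow> real^'s) \<Rightarrow> bool" where
  "asymptotically_optimal M \<theta> \<C> T \<longleftrightarrow>
     (\<exists>V. asymptotic_covariance M \<theta> T V \<and>
        (\<forall>T'\<in>\<C>. \<forall>V'. asymptotic_covariance M \<theta> T' V' \<longrightarrow> pos_semidef (V' - V)))"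

definition gls_estimators :: "'w measure \<Rightarrow> (nat \<Rightarrow> 'w \<Rightarrow> real^'d) \<Rightarrow> (nat \<Rightarrow> 'w \<Rightarrow> real^'l) \<Rightarrow>
    ('d, 'h, 'l) weights set \<Rightarrow> ('d, 'h, 'l) weights \<Rightarrow>
    (nat \<Rightarrow> 'w \<Rightarrow> ('d::finite, 'h::finite, 'l::finite) weights) set" where
  "gls_estimators M Y Z \<Theta> W0 =
     {T. \<exists>\<Gamma>. pos_def \<Gamma> \<and> minimum_estimator M \<Theta> W0 (gls_cost \<Gamma> Y Z) T}"

definition information_matrix :: "'w measure \<Rightarrow> real^'d^'d \<Rightarrow> ('w \<Rightarrow> real^'l) \<Rightarrow>
    ('d::finite, 'h::finite, 'l::finite) weights \<Rightarrow>
    real^(('d, 'h, 'l) weight_index)^(('d, 'h, 'l) weight_index)" where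
  "information_matrix M \<Gamma> Z W = (\<chi> k l. trace (matrix_inv \<Gamma> **
     (\<integral>\<omega>. outer_prod (mlp_partial W k (Z \<omega>)) (mlp_partial W l (Z \<omega>)) \<partial>M)))"

end

theory Submission
  imports Defs
begin

text \<open>Since \<open>det A \<le> det B\<close> forces \<open>tr (A\<^sup>-\<^sup>1 B) \<ge> d\<close>, the minimiser of the log-determinant is itself a
  weighted least squares estimator, with the inverse of its own empirical residual covariance as
  weight. So both estimators can be treated pathwise in the same manner, on the event where the
  empirical means that occur converge. Compactness and identifiability give consistency, hence the
  weight tends to \<open>\<Gamma>\<^sub>0\<^sup>-\<^sup>1\<close>. Comparing the values of the quadratic expansion of the
  weighted criterion at the estimator and at the minimiser of that expansion shows that
  \<open>T\<^sub>n - W\<^sub>0\<close> is \<open>I\<^sub>0\<^sup>-\<^sup>1\<close> applied to the mean score, up to an error that is small compared with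
  the norm of that mean. The one-dimensional central limit theorem for the inner products with
  fixed vectors and Levy continuity then give the normal limit. Optimality is a Cauchy-Schwarz
  inequality between the variances belonging to two weights.\<close>

section \<open>Positive definite matrices and Gaussian measures\<close>

text \<open>The law of large numbers is proved here in L1 form, so almost sure convergence is
  available along subsequences only. Pathwise statements therefore carry a sequence \<open>N\<close>
  of sample sizes, and the limits are recovered because a sequence converges once every subsequence
  has a further subsequence with the right limit. The pathwise error bound is relative,
  \<open>\<eta> * norm v\<close> with \<open>v\<close> the mean score and \<open>\<eta>\<close>
  arbitrary: after multiplication by \<open>sqrt n\<close> the factor \<open>norm v\<close> is
  bounded in L2, so the bound gives convergence in probability without any rate for
  \<open>\<eta>\<close>. No stationarity equation is used. The minimiser is compared in value with
  two points, \<open>W0\<close> and \<open>W0 + lin\<close>; both eventually lie in the saturation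
  of \<open>\<Theta>\<close>, while \<open>W0\<close> may lie on the boundary of
  \<open>\<Theta>\<close> itself. The weight of the log-determinant estimator depends on the data,
  so the score is kept matrix valued and contracted with a weight only afterwards. The expansion is
  arranged so that its cubic remainder asks for no more than the assumed third moment of the
  input.\<close>

lemma matrix_inv_mult:
  fixes A :: "real^'n^'n"
  assumes "invertible A"
  shows "A ** matrix_inv A = mat 1" "matrix_inv A ** A = mat 1"
proof -
  have "A ** matrix_inv A = mat 1 \<and> matrix_inv A ** A = mat 1"
    using assms unfolding invertible_def matrix_inv_def by (rule someI_ex)
  then show "A ** matrix_inv A = mat 1" "matrix_inv A ** A = mat 1" by auto
qed

lemma matrix_inv_eqI:
  fixes A :: "real^'n^'n"
  assumes "A ** B = mat 1"
  shows "matrix_inv A = B"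
proof -
  have inv: "invertible A" using assms by (meson invertible_right_inverse)
  have "matrix_inv A = matrix_inv A ** (A ** B)" by (simp add: assms)
  also have "\<dots> = B" by (simp add: matrix_mul_assoc matrix_inv_mult[OF inv])
  finally show ?thesis .
qed

lemma inner_matrix_transpose:
  fixes A :: "real^'n^'m"
  shows "x \<bullet> (A *v y) = (transpose A *v x) \<bullet> y"
  by (simp add: dot_lmul_matrix)

lemma inner_outer_prod:
  fixes G :: "real^'n^'m"
  shows "G \<bullet> outer_prod x y = x \<bullet> (G *v y)"
  by (simp add: outer_prod_def inner_vec_def matrix_vector_mult_def sum_distrib_left mult_ac)

lemma trace_mult_inner:
  fixes A B :: "real^'n^'n"
  shows "trace (A ** B) = transpose A \<bullet> B"
  unfolding trace_def matrix_matrix_mult_def inner_vec_def transpose_def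
  by (simp, subst sum.swap, simp)

text \<open>Gram-Schmidt for the inner product \<open>x \<bullet> (Q *v y)\<close>, by induction on
  the index set: as long as \<open>A\<close> is not the whole index type, the vectors found so far
  cannot span the space, and a vector outside their span is projected and normalised. It stands in
  for the spectral theorem.\<close>

lemma pos_def_orthonormal_family:
  fixes Q :: "real^'n^'n"
  assumes Q: "pos_def Q"
  shows "\<exists>v::'n \<Rightarrow> real^'n. \<forall>i\<in>A. \<forall>j\<in>A. v i \<bullet> (Q *v v j) = (if i = j then 1 else 0)"
proof -
  have "finite A" by simp
  then show ?thesis
  proof (induction A)
    case empty show ?case by simp
  next
    case (insert a A)
    then obtain v where v: "\<And>i j. i \<in> A \<Longrightarrow> j \<in> A \<Longrightarrow> v i \<bullet> (Q *v v j) = (if i = j then 1 else 0)"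
      by blast
    have sym: "x \<bullet> (Q *v y) = y \<bullet> (Q *v x)" for x y
      using Q by (metis inner_commute inner_matrix_transpose pos_def_def)
    have "card A < CARD('n)"
      using insert by (metis card_seteq finite_UNIV insertI1 not_le subset_UNIV UNIV_I finite)
    then have "dim (v ` A) < DIM(real^'n)"
      using dim_le_card'[of "v ` A"] card_image_le[of A v] insert by (simp add: dim_le_card)
    then have "span (v ` A) \<noteq> UNIV" by (metis dim_UNIV dim_span nat_neq_iff)
    then obtain x where x: "x \<notin> span (v ` A)" by blast
    define y where "y = x - (\<Sum>i\<in>A. (v i \<bullet> (Q *v x)) *\<^sub>R v i)"
    have "y \<noteq> 0"
    proof
      assume "y = 0"
      then have "x = (\<Sum>i\<in>A. (v i \<bullet> (Q *v x)) *\<^sub>R v i)" by (simp add: y_def)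
      also have "\<dots> \<in> span (v ` A)" by (intro span_sum span_mul span_base) auto
      finally show False using x by simp
    qed
    then have pos: "0 < y \<bullet> (Q *v y)" using Q by (auto simp: pos_def_def)
    have orth: "v j \<bullet> (Q *v y) = 0" if "j \<in> A" for j
    proof -
      have "v j \<bullet> (Q *v y) = v j \<bullet> (Q *v x) - (\<Sum>i\<in>A. (v i \<bullet> (Q *v x)) * (v j \<bullet> (Q *v v i)))"
        by (simp add: y_def matrix_vector_mult_diff_distrib inner_diff_right
            vec.linear_sum[OF matrix_vector_mul_linear_gen] inner_sum_right
            matrix_vector_mult_scaleR linear_sum[OF matrix_vector_mul_linear])
      also have "(\<Sum>i\<in>A. (v i \<bullet> (Q *v x)) * (v j \<bullet> (Q *v v i)))
          = (\<Sum>i\<in>A. if i = j then v j \<bullet> (Q *v x) else 0)"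
        using that by (intro sum.cong) (auto simp: v)
      finally show ?thesis using that insert by simp
    qed
    define w where "w = (1 / sqrt (y \<bullet> (Q *v y))) *\<^sub>R y"
    have ww: "w \<bullet> (Q *v w) = 1"
      using pos by (simp add: w_def matrix_vector_mult_scaleR)
    have vw: "v j \<bullet> (Q *v w) = 0" "w \<bullet> (Q *v v j) = 0" if "j \<in> A" for j
      using orth[OF that] sym[of w "v j"] by (simp_all add: w_def matrix_vector_mult_scaleR)
    show ?case
      using insert(2) v vw ww by (intro exI[of _ "v(a := w)"]) auto
  qed
qed

text \<open>The columns of \<open>P\<close> are orthonormal for \<open>S\<close>, that is
  \<open>transpose P ** (S ** P) = mat 1\<close>, so the inverse of \<open>transpose P\<close> is a
  root of the required form. Through this factor every Gaussian computation is reduced to the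
  standard law.\<close>

lemma pos_def_root:
  fixes S :: "real^'n^'n"
  assumes S: "pos_def S"
  obtains R :: "real^'n^'n" where "invertible R" "S = R ** transpose R"
proof -
  obtain v :: "'n \<Rightarrow> real^'n" where v: "\<And>i j. v i \<bullet> (S *v v j) = (if i = j then 1 else 0)"
    using pos_def_orthonormal_family[OF S, of UNIV] by auto
  define P :: "real^'n^'n" where "P = (\<chi> i j. v j $ i)"
  have PSP: "transpose P ** (S ** P) = mat 1"
  proof -
    have "(transpose P ** (S ** P)) $ i $ j = v i \<bullet> (S *v v j)" for i j
      by (simp add: matrix_matrix_mult_def transpose_def inner_vec_def matrix_vector_mult_def P_def)
    then show ?thesis by (simp add: vec_eq_iff v mat_def)
  qed
  then have iP: "invertible (transpose P)" "invertible P"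
    by (metis invertible_right_inverse, metis invertible_left_inverse matrix_mul_assoc)
  let ?R = "matrix_inv (transpose P)"
  have R: "transpose P ** ?R = mat 1" "?R ** transpose P = mat 1"
    using matrix_inv_mult[OF iP(1)] by auto
  have Rt: "P ** transpose ?R = mat 1"
    by (metis R(2) matrix_transpose_mul transpose_mat transpose_transpose)
  have "S = (?R ** transpose P) ** S ** (P ** transpose ?R)" by (simp add: R Rt)
  also have "\<dots> = ?R ** (transpose P ** (S ** P)) ** transpose ?R" by (simp add: matrix_mul_assoc)
  also have "\<dots> = ?R ** transpose ?R" by (simp add: PSP)
  finally have "S = ?R ** transpose ?R" .
  moreover have "invertible ?R" using R invertible_def by blast
  ultimately show ?thesis using that by blast
qed

lemma inner_root:
  fixes R :: "real^'n^'n"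
  shows "x \<bullet> ((R ** transpose R) *v y) = (transpose R *v x) \<bullet> (transpose R *v y)"
  by (simp add: matrix_vector_mul_assoc[symmetric] inner_matrix_transpose)

lemma pos_def_root_iff:
  fixes R :: "real^'n^'n"
  assumes "invertible R"
  shows "pos_def (R ** transpose R)"
proof -
  have "transpose R *v x \<noteq> 0" if "x \<noteq> 0" for x
    using assms that
    by (metis invertible_left_inverse invertible_right_inverse left_invertible_transpose matrix_left_invertible_ker)
  then show ?thesis
    unfolding pos_def_def inner_root by (simp add: matrix_transpose_mul)
qed

lemma pos_def_det:
  fixes S :: "real^'n^'n"
  assumes "pos_def S" shows "det S > 0"
proof -
  obtain R :: "real^'n^'n" where R: "invertible R" "S = R ** transpose R" using pos_def_root[OF assms] .
  then show ?thesis by (simp add: det_mul invertible_det_nz flip: power2_eq_square)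
qed

lemma pos_def_invertible: "pos_def S \<Longrightarrow> invertible (S :: real^'n^'n)"
  using pos_def_det[of S] by (simp add: invertible_det_nz)

lemma pos_def_matrix_inv:
  fixes S :: "real^'n^'n"
  assumes "pos_def S" shows "pos_def (matrix_inv S)" 
proof -
  have inv: "invertible S" using assms by (rule pos_def_invertible)
  have sym: "transpose (matrix_inv S) = matrix_inv S"
    by (metis assms inv matrix_inv_eqI matrix_inv_mult(2) matrix_transpose_mul pos_def_def transpose_mat)
  have "0 < x \<bullet> (matrix_inv S *v x)" if "x \<noteq> 0" for x
  proof -
    let ?y = "matrix_inv S *v x"
    have x: "x = S *v ?y" by (simp add: matrix_vector_mul_assoc matrix_inv_mult[OF inv])
    then have "?y \<noteq> 0" using that by (metis matrix_vector_mult_0_right)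
    then have "0 < ?y \<bullet> (S *v ?y)" using assms by (simp add: pos_def_def)
    then show ?thesis using x by (simp add: inner_commute)
  qed
  then show ?thesis using sym by (simp add: pos_def_def)
qed

lemma matrix_inv_involutive:
  fixes S :: "real^'n^'n"
  assumes "invertible S" shows "matrix_inv (matrix_inv S) = S"
  by (intro matrix_inv_eqI matrix_inv_mult assms)

section \<open>Lebesgue measure under linear maps\<close>

lemma emeasure_lborel_box_cart:
  fixes l u :: "real^'n"
  assumes "\<And>i. l $ i \<le> u $ i"
  shows "emeasure lborel (box l u) = ennreal (\<Prod>i\<in>UNIV. u $ i - l $ i)"
proof -
  have B: "(Basis :: (real^'n) set) = range (\<lambda>i. axis i 1)"
    by (auto simp: Basis_vec_def)
  have inj: "inj (\<lambda>i::'n. axis i (1::real))" by (auto simp: inj_def axis_eq_axis)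
  have "l \<bullet> b \<le> u \<bullet> b" if "b \<in> Basis" for b
    using that assms by (auto simp: B inner_axis)
  then have "emeasure lborel (box l u) = ennreal (\<Prod>b\<in>Basis. (u - l) \<bullet> b)"
    by (simp add: emeasure_lborel_box_eq)
  also have "(\<Prod>b\<in>Basis. (u - l) \<bullet> b) = (\<Prod>i\<in>UNIV. u $ i - l $ i)"
    unfolding B by (subst prod.reindex[OF inj]) (simp add: inner_axis)
  finally show ?thesis .
qed

lemma borel_measurable_matrix_vector_mult [measurable]:
  "(\<lambda>x. (A :: real^'n^'m) *v x) \<in> borel_measurable borel"
  by (intro borel_measurable_continuous_onI linear_continuous_on linear_linear[THEN iffD2] matrix_vector_mul_linear
      matrix_vector_mul_bounded_linear)

text \<open>Swapping two coordinates maps boxes to boxes and only permutes the factors of their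
  volume, and boxes determine Lebesgue measure.\<close>

lemma nn_integral_lborel_swap:
  fixes f :: "real^'n \<Rightarrow> ennreal"
  assumes [measurable]: "f \<in> borel_measurable borel" and "m \<noteq> n"
  shows "(\<integral>\<^sup>+x. f ((\<chi> i j. mat 1 $ i $ Transposition.transpose m n j) *v x) \<partial>lborel) = integral\<^sup>N lborel f"
proof -
  define A :: "real^'n^'n" where "A = (\<chi> i j. mat 1 $ i $ Transposition.transpose m n j)"
  define s where "s = Transposition.transpose m n"
  have s: "s (s i) = i" "bij s" for i by (auto simp: s_def bij_def)
  have A: "(A *v x) $ i = x $ s i" for x i
  proof -
    have "(A *v x) $ i = (\<Sum>j\<in>UNIV. if j = s i then x $ j else 0)"
      unfolding A_def matrix_vector_mult_def mat_def vec_lambda_beta s_def[symmetric] using s(1)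
      by (intro sum.cong) auto
    then show ?thesis by simp
  qed
  have "lborel = distr lborel borel ((*v) A)"
  proof (rule lborel_eqI)
    fix l u :: "real^'n" assume le: "\<And>b. b \<in> Basis \<Longrightarrow> l \<bullet> b \<le> u \<bullet> b"
    have le': "l $ i \<le> u $ i" for i using le[of "axis i 1"] by (simp add: inner_axis)
    have iff: "x \<in> (*v) A -` box l u \<longleftrightarrow> x \<in> box (A *v l) (A *v u)" for x
      unfolding vimage_def mem_box_cart mem_Collect_eq A using s(1) by metis
    have "emeasure (distr lborel borel ((*v) A)) (box l u) = emeasure lborel (box (A *v l) (A *v u))"
      using iff by (subst emeasure_distr) (auto intro!: arg_cong[where f="emeasure lborel"])
    also have "\<dots> = ennreal (\<Prod>i\<in>UNIV. u $ s i - l $ s i)"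
      by (subst emeasure_lborel_box_cart) (auto simp: A le')
    also have "(\<Prod>i\<in>UNIV. u $ s i - l $ s i) = (\<Prod>i\<in>UNIV. u $ i - l $ i)"
      using prod.reindex_bij_betw[of s UNIV UNIV] s(2) by simp
    also have "ennreal \<dots> = emeasure lborel (box l u)"
      by (simp add: emeasure_lborel_box_cart le')
    finally show "emeasure (distr lborel borel ((*v) A)) (box l u) = ennreal (\<Prod>b\<in>Basis. (u - l) \<bullet> b)"
      using le by (simp add: emeasure_lborel_box_eq)
  qed simp
  then have "integral\<^sup>N lborel f = integral\<^sup>N (distr lborel borel ((*v) A)) f" by simp
  also have "\<dots> = (\<integral>\<^sup>+x. f (A *v x) \<partial>lborel)" by (subst nn_integral_distr) auto
  finally show ?thesis by (simp add: A_def)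
qed

lemma nn_integral_lborel_diagonal:
  fixes f :: "real^'n \<Rightarrow> ennreal" and A :: "real^'n^'n"
  assumes [measurable]: "f \<in> borel_measurable borel"
    and diag: "\<And>i j. i \<noteq> j \<Longrightarrow> A $ i $ j = 0" and det: "det A \<noteq> 0"
  shows "ennreal \<bar>det A\<bar> * (\<integral>\<^sup>+x. f (A *v x) \<partial>lborel) = integral\<^sup>N lborel f"
proof -
  have dA: "det A = (\<Prod>i\<in>UNIV. A $ i $ i)" by (rule det_diagonal) (rule diag)
  have B: "(Basis :: (real^'n) set) = range (\<lambda>i. axis i 1)"
    by (auto simp: Basis_vec_def)
  have inj: "inj (\<lambda>i::'n. axis i (1::real))" by (auto simp: inj_def axis_eq_axis)
  \<comment> \<open>\<open>lborel_affine_euclidean\<close> takes its scale factors indexed by basis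
    vectors. The sum picks out the only index whose axis is \<open>b\<close>, so no inverse of
    \<open>axis\<close> has to be chosen.\<close>
  define c :: "real^'n \<Rightarrow> real" where "c b = (\<Sum>i\<in>UNIV. if b = axis i 1 then A $ i $ i else 0)" for b
  have c: "c (axis i 1) = A $ i $ i" for i by (simp add: c_def axis_eq_axis)
  have nz: "c b \<noteq> 0" if "b \<in> Basis" for b
    using that det by (auto simp: B c dA)
  have "(\<lambda>x. 0 + (\<Sum>j\<in>Basis. (c j * (x \<bullet> j)) *\<^sub>R j)) = (*v) A"
  proof (rule ext)
    fix x :: "real^'n"
    have "(\<Sum>j\<in>Basis. (c j * (x \<bullet> j)) *\<^sub>R j) = (\<Sum>i\<in>UNIV. (A $ i $ i * x $ i) *\<^sub>R axis i 1)"
      unfolding B by (subst sum.reindex[OF inj]) (simp add: c inner_axis)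
    also have "\<dots> $ i = (A *v x) $ i" for i
    proof -
      have "(A *v x) $ i = (\<Sum>j\<in>UNIV. if j = i then A $ i $ i * x $ i else 0)"
        unfolding matrix_vector_mult_def vec_lambda_beta using diag by (intro sum.cong) auto
      then show ?thesis by (simp add: axis_def if_distrib cong: if_cong)
    qed
    ultimately show "0 + (\<Sum>j\<in>Basis. (c j * (x \<bullet> j)) *\<^sub>R j) = A *v x" by (simp add: vec_eq_iff)
  qed
  moreover have "(\<Prod>j\<in>Basis. \<bar>c j\<bar>) = \<bar>det A\<bar>"
    unfolding B by (subst prod.reindex[OF inj]) (simp add: c dA abs_prod)
  ultimately have "lborel = density (distr lborel borel ((*v) A)) (\<lambda>_. \<bar>det A\<bar>)"
    using lborel_affine_euclidean[of c 0] nz by simp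
  then have "integral\<^sup>N lborel f = integral\<^sup>N (density (distr lborel borel ((*v) A)) (\<lambda>_. \<bar>det A\<bar>)) f" by simp
  also have "\<dots> = ennreal \<bar>det A\<bar> * (\<integral>\<^sup>+x. f (A *v x) \<partial>lborel)"
    by (subst nn_integral_density) (auto simp: nn_integral_distr nn_integral_cmult)
  finally show ?thesis by simp
qed

text \<open>Fubini with coordinate \<open>m\<close> innermost: once the other coordinates are fixed,
  among them coordinate \<open>n\<close>, the shear translates coordinate \<open>m\<close> by a
  constant.\<close>

lemma nn_integral_lborel_shear:
  fixes f :: "real^'n \<Rightarrow> ennreal"
  assumes [measurable]: "f \<in> borel_measurable borel" and mn: "m \<noteq> n"
  shows "(\<integral>\<^sup>+x. f (x + (x $ n * c) *\<^sub>R axis m 1) \<partial>lborel) = integral\<^sup>N lborel f"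
proof -
  interpret product_sigma_finite "\<lambda>_::real^'n. lborel :: real measure" ..
  let ?a = "axis m (1::real)" let ?B = "Basis :: (real^'n) set"
  let ?v = "\<lambda>y. \<Sum>b\<in>?B. y b *\<^sub>R b"
  have Bs: "?B = insert ?a (?B - {?a})" by auto
  have vn: "?v y $ n = y (axis n 1)" for y
  proof -
    have "?v y $ n = ?v y \<bullet> axis n 1" by (simp add: inner_axis)
    also have "\<dots> = y (axis n 1)" by (rule inner_sum_left_Basis) simp
    finally show ?thesis .
  qed
  have v_upd: "?v (y(?a := t)) = t *\<^sub>R ?a + (\<Sum>b\<in>?B - {?a}. y b *\<^sub>R b)" for y t
    by (subst sum.remove[of _ ?a]) (auto intro!: sum.cong)
  have *: "integral\<^sup>N lborel g = (\<integral>\<^sup>+y. \<integral>\<^sup>+t. g (?v (y(?a := t))) \<partial>lborel \<partial>Pi\<^sub>M (?B - {?a}) (\<lambda>_. lborel))"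
    if [measurable]: "g \<in> borel_measurable borel" for g :: "real^'n \<Rightarrow> ennreal"
  proof -
    have "integral\<^sup>N lborel g = (\<integral>\<^sup>+y. g (?v y) \<partial>Pi\<^sub>M ?B (\<lambda>_. lborel))"
      by (subst lborel_eq) (simp add: nn_integral_distr)
    also have "\<dots> = (\<integral>\<^sup>+y. g (?v y) \<partial>Pi\<^sub>M (insert ?a (?B - {?a})) (\<lambda>_. lborel))"
      using Bs by simp
    also have "\<dots> = (\<integral>\<^sup>+y. \<integral>\<^sup>+t. g (?v (y(?a := t))) \<partial>lborel \<partial>Pi\<^sub>M (?B - {?a}) (\<lambda>_. lborel))"
      by (rule product_nn_integral_insert) (use Bs in auto)
    finally show ?thesis .
  qed
  show ?thesis
  proof (subst (1 2) *)
    show "(\<lambda>x. f (x + (x $ n * c) *\<^sub>R ?a)) \<in> borel_measurable borel" by measurable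
    show "f \<in> borel_measurable borel" by fact
    show "(\<integral>\<^sup>+ y. \<integral>\<^sup>+ t. f (?v (y(?a := t)) + (?v (y(?a := t)) $ n * c) *\<^sub>R ?a) \<partial>lborel \<partial>Pi\<^sub>M (?B - {?a}) (\<lambda>_. lborel))
      = (\<integral>\<^sup>+ y. \<integral>\<^sup>+ t. f (?v (y(?a := t))) \<partial>lborel \<partial>Pi\<^sub>M (?B - {?a}) (\<lambda>_. lborel))"
    proof (rule nn_integral_cong)
      fix y :: "real^'n \<Rightarrow> real"
      have vn': "?v (y(?a := t)) $ n = y (axis n 1)" for t
        unfolding vn using mn by (simp add: axis_eq_axis)
      have "(\<integral>\<^sup>+ t. f (?v (y(?a := t))) \<partial>lborel) = (\<integral>\<^sup>+ t. f (?v (y(?a := y (axis n 1) * c + 1 * t))) \<partial>lborel)"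
        unfolding v_upd by (subst nn_integral_real_affine[where c=1 and t="y (axis n 1) * c"]) auto
      also have "\<dots> = (\<integral>\<^sup>+ t. f (?v (y(?a := t)) + (?v (y(?a := t)) $ n * c) *\<^sub>R ?a) \<partial>lborel)"
        unfolding vn' unfolding v_upd by (simp add: algebra_simps)
      finally show "(\<integral>\<^sup>+ t. f (?v (y(?a := t)) + (?v (y(?a := t)) $ n * c) *\<^sub>R ?a) \<partial>lborel)
        = (\<integral>\<^sup>+ t. f (?v (y(?a := t))) \<partial>lborel)" by simp
    qed
  qed
qed

text \<open>Induction over products of elementary matrices. The quantifier over \<open>f\<close>
  stands inside the predicate because the product case applies the hypothesis for \<open>B\<close>
  to \<open>\<lambda>x. f (A *v x)\<close>. A matrix with a zero row satisfies the predicate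
  vacuously, since its determinant vanishes.\<close>

lemma nn_integral_lborel_linear:
  fixes A :: "real^'n^'n"
  assumes "f \<in> borel_measurable borel" "det A \<noteq> 0"
  shows "ennreal \<bar>det A\<bar> * (\<integral>\<^sup>+x. f (A *v x) \<partial>lborel) = integral\<^sup>N lborel f"
proof -
  have "\<forall>f. f \<in> borel_measurable borel \<longrightarrow> det A \<noteq> 0 \<longrightarrow>
     ennreal \<bar>det A\<bar> * (\<integral>\<^sup>+x. f (A *v x) \<partial>lborel) = integral\<^sup>N lborel f" (is "?P A")
  proof (rule induct_matrix_elementary[of ?P])
    fix A B :: "real^'n^'n" assume A: "?P A" and B: "?P B"
    show "?P (A ** B)"
    proof (intro allI impI)
      fix f :: "real^'n \<Rightarrow> ennreal" assume [measurable]: "f \<in> borel_measurable borel" and d: "det (A ** B) \<noteq> 0"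
      have "integral\<^sup>N lborel f = ennreal \<bar>det A\<bar> * (\<integral>\<^sup>+x. f (A *v x) \<partial>lborel)"
        using A d by (simp add: det_mul)
      also have "(\<integral>\<^sup>+x. f (A *v x) \<partial>lborel) = ennreal \<bar>det B\<bar> * (\<integral>\<^sup>+x. f (A *v (B *v x)) \<partial>lborel)"
        using B[rule_format, of "\<lambda>x. f (A *v x)"] d by (simp add: det_mul)
      finally show "ennreal \<bar>det (A ** B)\<bar> * (\<integral>\<^sup>+x. f (A ** B *v x) \<partial>lborel) = integral\<^sup>N lborel f"
        by (simp add: det_mul abs_mult ennreal_mult mult.assoc matrix_vector_mul_assoc)
    qed
  next
    fix A :: "real^'n^'n" and i assume "row i A = 0"
    then have "det A = 0" by (rule det_zero_row)
    then show "?P A" by simp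
  next
    fix A :: "real^'n^'n" assume "\<And>i j. i \<noteq> j \<Longrightarrow> A $ i $ j = 0"
    then show "?P A" by (auto intro!: nn_integral_lborel_diagonal)
  next
    fix m n :: 'n assume mn: "m \<noteq> n"
    let ?A = "(\<chi> i j. mat 1 $ i $ Transposition.transpose m n j) :: real^'n^'n"
    have "\<bar>det ?A\<bar> = 1" using mn
      by (simp add: det_permute_columns permutes_swap_id sign_swap_id abs_mult)
    then show "?P ?A" by (auto simp: nn_integral_lborel_swap[OF _ mn])
  next
    fix m n :: 'n and c :: real assume mn: "m \<noteq> n"
    let ?A = "(\<chi> i j. if i = m \<and> j = n then c else of_bool (i = j)) :: real^'n^'n"
    have Ax: "?A *v x = x + (x $ n * c) *\<^sub>R axis m 1" for x
    proof -
      have "(?A *v x) $ i = (\<Sum>j\<in>UNIV. (if j = i then x $ i else 0) + (if j = n then (if i = m then c * x $ n else 0) else 0))" for i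
        unfolding matrix_vector_mult_def vec_lambda_beta using mn by (intro sum.cong) auto
      then show ?thesis by (simp add: vec_eq_iff sum.distrib axis_def)
    qed
    have "?A = (\<chi> k. if k = m then row m (mat 1 :: real^'n^'n) + c *s row n (mat 1) else row k (mat 1))"
      using mn by (auto simp: vec_eq_iff row_def mat_def)
    then have "det ?A = 1" using det_row_operation[OF mn, of "mat 1 :: real^'n^'n" c] by simp
    then show "?P ?A" unfolding Ax by (auto simp: nn_integral_lborel_shear[OF _ mn])
  qed
  then show ?thesis using assms by blast
qed

lemma lborel_linear:
  fixes A :: "real^'n^'n"
  assumes "det A \<noteq> 0"
  shows "density (distr lborel borel ((*v) A)) (\<lambda>_. ennreal \<bar>det A\<bar>) = lborel"
proof (rule measure_eqI)
  fix X assume "X \<in> sets (density (distr lborel borel ((*v) A)) (\<lambda>_. ennreal \<bar>det A\<bar>))"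
  then have [measurable]: "X \<in> sets borel" by simp
  have "emeasure (density (distr lborel borel ((*v) A)) (\<lambda>_. ennreal \<bar>det A\<bar>)) X
      = ennreal \<bar>det A\<bar> * (\<integral>\<^sup>+x. indicator X (A *v x) \<partial>lborel)"
    by (simp add: emeasure_density nn_integral_cmult nn_integral_distr del: nn_integral_indicator)
  also have "\<dots> = emeasure lborel X"
    by (simp add: nn_integral_lborel_linear[OF _ assms])
  finally show "emeasure (density (distr lborel borel ((*v) A)) (\<lambda>_. ennreal \<bar>det A\<bar>)) X = emeasure lborel X" .
qed simp

section \<open>Gaussian laws: characteristic function, linear images, second moments\<close>

lemma lborel_prod_complex:
  fixes f :: "'a::euclidean_space \<Rightarrow> real \<Rightarrow> complex"
  assumes int: "\<And>b. b \<in> Basis \<Longrightarrow> integrable lborel (f b)"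
  shows "integrable lborel (\<lambda>x. \<Prod>b\<in>Basis. f b (x \<bullet> b))"
    and "(\<integral>x. (\<Prod>b\<in>Basis. f b (x \<bullet> b)) \<partial>lborel) = (\<Prod>b\<in>Basis. integral\<^sup>L lborel (f b))"
proof -
  interpret product_sigma_finite "\<lambda>_::'a. lborel :: real measure" ..
  have [measurable]: "b \<in> Basis \<Longrightarrow> f b \<in> borel_measurable borel" for b
    using int[of b] by auto
  have m: "(\<lambda>x::'a. \<Prod>b\<in>Basis. f b (x \<bullet> b)) \<in> borel_measurable borel" by measurable
  have e: "(\<Prod>b\<in>Basis. f b ((\<Sum>b\<in>Basis. y b *\<^sub>R b) \<bullet> b)) = (\<Prod>b\<in>Basis. f b (y b))" for y
    by (intro prod.cong refl) (simp add: inner_sum_left_Basis)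
  show "integrable lborel (\<lambda>x. \<Prod>b\<in>Basis. f b (x \<bullet> b))"
    using product_integrable_prod[of Basis f] int m
    by (subst lborel_eq) (simp add: integrable_distr_eq e)
  show "(\<integral>x. (\<Prod>b\<in>Basis. f b (x \<bullet> b)) \<partial>lborel) = (\<Prod>b\<in>Basis. integral\<^sup>L lborel (f b))"
    using product_integral_prod[of Basis f] int m
    by (subst lborel_eq) (simp add: integral_distr e)
qed

abbreviation std_gauss_density :: "real^'n \<Rightarrow> real" where
  "std_gauss_density x \<equiv> exp (- (x \<bullet> x) / 2) / sqrt ((2 * pi) ^ CARD('n))"

lemma mv_normal_std: "mv_normal 0 (mat 1 :: real^'n^'n) = density lborel (\<lambda>x. ennreal (std_gauss_density x))"
proof -
  have "matrix_inv (mat 1 :: real^'n^'n) = mat 1" by (intro matrix_inv_eqI) simp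
  then show ?thesis unfolding mv_normal_def by simp
qed

lemma std_gauss_density_prod:
  "std_gauss_density (x :: real^'n) = (\<Prod>b\<in>Basis. std_normal_density (x \<bullet> b))"
proof -
  have "(\<Prod>b\<in>(Basis::(real^'n) set). std_normal_density (x \<bullet> b))
      = (\<Prod>b\<in>(Basis::(real^'n) set). 1 / sqrt (2 * pi)) * exp (\<Sum>b\<in>Basis. - ((x \<bullet> b)\<^sup>2) / 2)"
    by (simp add: std_normal_density_def prod.distrib exp_sum prod_dividef power_divide)
  also have "(\<Sum>b\<in>Basis. - ((x \<bullet> b)\<^sup>2) / 2) = - (x \<bullet> x) / 2"
    by (subst (2) euclidean_inner) (simp add: sum_divide_distrib sum_negf power2_eq_square)
  also have "(\<Prod>b\<in>(Basis::(real^'n) set). 1 / sqrt (2 * pi)) = 1 / sqrt ((2 * pi) ^ CARD('n))"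
    unfolding real_sqrt_power by (simp add: power_one_over)
  finally show ?thesis by simp
qed

text \<open>Density and \<open>cis\<close> both factor over the coordinates, so the one-dimensional
  characteristic function gives the multidimensional one. The case \<open>u = 0\<close> is the
  normalisation used in \<open>std_gauss_prob\<close>.\<close>

lemma std_gauss_cis:
  fixes u :: "real^'n"
  shows "integrable lborel (\<lambda>x. std_gauss_density x *\<^sub>R cis (u \<bullet> x))"
    and "(\<integral>x. std_gauss_density x *\<^sub>R cis (u \<bullet> x) \<partial>lborel) = exp (- (u \<bullet> u) / 2)"
proof -
  let ?f = "\<lambda>b t. std_normal_density t *\<^sub>R iexp ((u \<bullet> b) * t)"
  have int: "integrable lborel (?f b)" for b
  proof -
    interpret real_distribution std_normal_distribution by (rule real_dist_normal_dist)
    have "integrable std_normal_distribution (\<lambda>t. iexp ((u \<bullet> b) * t))"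
      by (rule integrable_iexp) auto
    then show ?thesis by (subst (asm) integrable_density) (auto simp: normal_density_nonneg)
  qed
  have val: "integral\<^sup>L lborel (?f b) = of_real (exp (- ((u \<bullet> b)\<^sup>2) / 2))" for b
  proof -
    have "char std_normal_distribution (u \<bullet> b) = integral\<^sup>L lborel (?f b)"
      unfolding char_def by (subst integral_density) (auto simp: normal_density_nonneg)
    then show ?thesis by (simp add: char_std_normal_distribution)
  qed
  have eq: "std_gauss_density x *\<^sub>R cis (u \<bullet> x) = (\<Prod>b\<in>Basis. ?f b (x \<bullet> b))" for x :: "real^'n"
  proof -
    have "cis (u \<bullet> x) = (\<Prod>b\<in>Basis. iexp ((u \<bullet> b) * (x \<bullet> b)))"
      unfolding cis_conv_exp by (subst euclidean_inner) (simp add: exp_sum sum_distrib_left)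
    then show ?thesis unfolding std_gauss_density_prod
      by (simp add: scaleR_conv_of_real prod.distrib)
  qed
  show "integrable lborel (\<lambda>x. std_gauss_density x *\<^sub>R cis (u \<bullet> x))"
    unfolding eq by (rule lborel_prod_complex(1)[OF int])
  have "(\<Prod>b\<in>(Basis::(real^'n) set). integral\<^sup>L lborel (?f b))
      = of_real (exp (\<Sum>b\<in>(Basis::(real^'n) set). - ((u \<bullet> b)\<^sup>2) / 2))"
    unfolding val by (simp only: exp_sum of_real_prod finite_Basis)
  also have "(\<Sum>b\<in>(Basis::(real^'n) set). - ((u \<bullet> b)\<^sup>2) / 2) = - (u \<bullet> u) / 2"
    by (subst (2) euclidean_inner) (simp add: sum_divide_distrib sum_negf power2_eq_square)
  finally show "(\<integral>x. std_gauss_density x *\<^sub>R cis (u \<bullet> x) \<partial>lborel) = exp (- (u \<bullet> u) / 2)"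
    unfolding eq lborel_prod_complex(2)[OF int] .
qed

lemma sets_mv_normal [simp, measurable_cong]: "sets (mv_normal m S) = sets borel"
  and space_mv_normal [simp]: "space (mv_normal m S) = UNIV"
  by (simp_all add: mv_normal_def)

lemma std_gauss_prob: "prob_space (mv_normal 0 (mat 1 :: real^'n^'n))"
proof
  have i: "integrable lborel (\<lambda>x::real^'n. std_gauss_density x)"
    using integrable_Re[OF std_gauss_cis(1)[of "0::real^'n"]] by simp
  have "(\<integral>x. std_gauss_density (x::real^'n) \<partial>lborel) = Re (\<integral>x. std_gauss_density x *\<^sub>R cis ((0::real^'n) \<bullet> x) \<partial>lborel)"
    by (subst integral_Re[symmetric, OF std_gauss_cis(1)]) simp
  also have "\<dots> = 1" by (subst std_gauss_cis(2)) simp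
  finally have 1: "(\<integral>x. std_gauss_density (x::real^'n) \<partial>lborel) = 1" .
  have nonneg: "0 \<le> std_gauss_density (x::real^'n)" for x by simp
  have "(\<integral>\<^sup>+x. ennreal (std_gauss_density (x::real^'n)) \<partial>lborel) = 1"
    unfolding nn_integral_eq_integral[OF i AE_I2[OF nonneg]] 1 by (rule ennreal_1)
  then show "emeasure (mv_normal 0 (mat 1 :: real^'n^'n)) (space (mv_normal 0 (mat 1 :: real^'n^'n))) = 1"
    by (simp add: mv_normal_std emeasure_density)
qed

text \<open>Substitution by \<open>R\<close> turns the quadratic form of \<open>matrix_inv S\<close>
  into \<open>x \<bullet> x\<close>, because
  \<open>transpose R ** (matrix_inv S ** R) = mat 1\<close>. As \<open>det S\<close> is the square
  of \<open>det R\<close>, the Jacobian cancels the normalising factor.\<close>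

lemma mv_normal_eq_distr:
  fixes R S :: "real^'n^'n"
  assumes R: "invertible R" and S: "S = R ** transpose R"
  shows "mv_normal 0 S = distr (mv_normal 0 (mat 1 :: real^'n^'n)) borel ((*v) R)"
proof -
  have dR: "det R \<noteq> 0" using R by (simp add: invertible_det_nz)
  let ?p = "\<lambda>x::real^'n. ennreal (exp (- (x \<bullet> (matrix_inv S *v x)) / 2) / sqrt ((2 * pi) ^ CARD('n) * det S))"
  have RS: "transpose R ** (matrix_inv S ** R) = mat 1"
  proof -
    let ?T = "transpose R"
    have T: "invertible ?T" by (metis R transpose_invertible)
    have "(?T ** (matrix_inv S ** R)) ** ?T = ?T ** (matrix_inv S ** S)" by (simp add: S matrix_mul_assoc)
    also have "\<dots> = ?T" using pos_def_root_iff[OF R] by (simp add: S matrix_inv_mult pos_def_invertible)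
    finally have "(?T ** (matrix_inv S ** R)) ** (?T ** matrix_inv ?T) = ?T ** matrix_inv ?T"
      by (simp add: matrix_mul_assoc)
    then show ?thesis by (simp add: matrix_inv_mult[OF T])
  qed
  have p: "ennreal \<bar>det R\<bar> * ?p (R *v x) = ennreal (std_gauss_density x)" for x
  proof -
    have "(R *v x) \<bullet> (matrix_inv S *v (R *v x)) = x \<bullet> (transpose R *v (matrix_inv S *v (R *v x)))"
      by (metis dot_lmul_matrix inner_commute inner_matrix_transpose transpose_transpose)
    also have "\<dots> = x \<bullet> x"
      using RS by (simp add: matrix_vector_mul_assoc matrix_mul_assoc)
    finally show ?thesis using dR
      by (simp add: S det_mul real_sqrt_mult ennreal_mult[symmetric] flip: power2_eq_square)
  qed
  have "mv_normal 0 S = density (density (distr lborel borel ((*v) R)) (\<lambda>_. ennreal \<bar>det R\<bar>)) ?p"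
    unfolding lborel_linear[OF dR] by (simp add: mv_normal_def)
  also have "\<dots> = density (distr lborel borel ((*v) R)) (\<lambda>x. ennreal \<bar>det R\<bar> * ?p x)"
    by (subst density_density_eq) auto
  also have "\<dots> = distr (density lborel (\<lambda>x. ennreal \<bar>det R\<bar> * ?p (R *v x))) borel ((*v) R)"
    by (subst density_distr) auto
  also have "\<dots> = distr (mv_normal 0 (mat 1)) borel ((*v) R)"
    unfolding p mv_normal_std ..
  finally show ?thesis .
qed

lemma mv_normal_prob:
  fixes S :: "real^'n^'n"
  assumes "pos_def S" shows "prob_space (mv_normal 0 S)"
proof -
  obtain R :: "real^'n^'n" where R: "invertible R" "S = R ** transpose R" using pos_def_root[OF assms] .
  show ?thesis unfolding mv_normal_eq_distr[OF R]
    by (rule prob_space.prob_space_distr[OF std_gauss_prob]) simp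
qed

lemma mv_normal_char:
  fixes S :: "real^'n^'n"
  assumes "pos_def S"
  shows "(\<integral>x. cis (u \<bullet> x) \<partial>mv_normal 0 S) = exp (- (u \<bullet> (S *v u)) / 2)"
proof -
  obtain R :: "real^'n^'n" where R: "invertible R" "S = R ** transpose R" using pos_def_root[OF assms] .
  have [measurable]: "(\<lambda>x. cis (v \<bullet> x)) \<in> borel_measurable borel" for v :: "real^'n"
    by (intro borel_measurable_continuous_onI continuous_intros)
  have "(\<integral>x. cis (u \<bullet> x) \<partial>mv_normal 0 S) = (\<integral>x. cis ((transpose R *v u) \<bullet> x) \<partial>mv_normal 0 (mat 1))"
    unfolding mv_normal_eq_distr[OF R] by (subst integral_distr) (auto simp: inner_matrix_transpose)
  also have "\<dots> = (\<integral>x. std_gauss_density x *\<^sub>R cis ((transpose R *v u) \<bullet> x) \<partial>lborel)"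
    unfolding mv_normal_std by (subst integral_density) auto
  also have "\<dots> = exp (- (u \<bullet> (S *v u)) / 2)"
    by (simp only: std_gauss_cis(2) R(2) inner_root)
  finally show ?thesis .
qed

text \<open>The variable \<open>w \<bullet> x\<close> and \<open>norm w\<close> times a
  one-dimensional standard normal variable have the same characteristic function, hence the same
  law, and the moments of the latter are known.\<close>

lemma std_gauss_second_moment:
  fixes w :: "real^'n"
  shows "integrable (mv_normal 0 (mat 1)) (\<lambda>x. (w \<bullet> x)\<^sup>2)"
    and "(\<integral>x. (w \<bullet> x)\<^sup>2 \<partial>mv_normal 0 (mat 1)) = w \<bullet> w"
proof -
  interpret G: prob_space "mv_normal 0 (mat 1 :: real^'n^'n)" by (rule std_gauss_prob)
  interpret N: real_distribution std_normal_distribution by (rule real_dist_normal_dist)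
  let ?D = "distr (mv_normal 0 (mat 1)) borel (\<lambda>x. w \<bullet> x)"
  let ?E = "distr std_normal_distribution borel (\<lambda>t. norm w * t)"
  have rd: "real_distribution ?D" "real_distribution ?E"
    by (rule G.real_distribution_distr N.real_distribution_distr; simp)+
  have "char ?D t = char ?E t" for t
  proof -
    have "char ?D t = (\<integral>x. cis ((t *\<^sub>R w) \<bullet> x) \<partial>mv_normal 0 (mat 1))"
      unfolding char_def by (subst integral_distr) (auto simp: cis_conv_exp)
    also have "\<dots> = exp (- ((t *\<^sub>R w) \<bullet> (t *\<^sub>R w)) / 2)"
      by (subst mv_normal_char) (auto simp: pos_def_def)
    also have "\<dots> = char std_normal_distribution (t * norm w)"
      by (simp add: char_std_normal_distribution dot_square_norm power_mult_distrib power2_eq_square)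
    also have "\<dots> = char ?E t"
      unfolding char_def by (subst integral_distr) (auto simp: mult_ac)
    finally show ?thesis .
  qed
  then have DE: "?D = ?E" by (intro Levy_uniqueness rd ext)
  have "integrable ?E (\<lambda>t. t\<^sup>2)"
    by (subst integrable_distr_eq) (auto simp: power_mult_distrib integrable_std_normal_distribution_moment)
  then have "integrable ?D (\<lambda>t. t\<^sup>2)" by (simp add: DE)
  then show "integrable (mv_normal 0 (mat 1)) (\<lambda>x. (w \<bullet> x)\<^sup>2)"
    by (subst (asm) integrable_distr_eq) auto
  have "(\<integral>x. (w \<bullet> x)\<^sup>2 \<partial>mv_normal 0 (mat 1)) = (\<integral>t. t\<^sup>2 \<partial>?D)"
    by (subst integral_distr) auto
  also have "\<dots> = (norm w)\<^sup>2 * (\<integral>t. t\<^sup>2 \<partial>std_normal_distribution)"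
    by (simp add: DE integral_distr power_mult_distrib)
  also have "\<dots> = w \<bullet> w"
    using std_normal_distribution_even_moments(1)[of 1] by (simp add: dot_square_norm)
  finally show "(\<integral>x. (w \<bullet> x)\<^sup>2 \<partial>mv_normal 0 (mat 1)) = w \<bullet> w" .
qed

text \<open>\<open>exp y \<ge> 1 + y\<close> with \<open>y = (x \<bullet> x - x \<bullet> (B *v x)) / 2\<close>, integrated against the standard
  Gaussian density, compares the normalisation constant of \<open>B\<close> with its trace.\<close>

lemma trace_ge_card_of_det_ge_1:
  fixes B :: "real^'n^'n"
  assumes B: "pos_def B" and det: "det B \<ge> 1"
  shows "trace B \<ge> CARD('n)"
proof -
  let ?g = "mv_normal 0 (mat 1 :: real^'n^'n)"
  interpret G: prob_space ?g by (rule std_gauss_prob)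
  let ?c = "sqrt ((2 * pi) ^ CARD('n)) :: real"
  obtain R :: "real^'n^'n" where R: "invertible R" "B = R ** transpose R" using pos_def_root[OF B] .
  let ?C = "matrix_inv B"
  have C: "pos_def ?C" by (rule pos_def_matrix_inv[OF B])
  have CB: "matrix_inv ?C = B" by (rule matrix_inv_involutive[OF pos_def_invertible[OF B]])
  have detC: "det ?C * det B = 1"
    using matrix_inv_mult(2)[OF pos_def_invertible[OF B]] by (metis det_I det_mul)
  interpret C: prob_space "mv_normal 0 ?C" by (rule mv_normal_prob[OF C])
  have quad: "x \<bullet> (B *v x) = (\<Sum>i\<in>UNIV. (column i R \<bullet> x)\<^sup>2)" for x
  proof -
    have "x \<bullet> (B *v x) = (transpose R *v x) \<bullet> (transpose R *v x)" by (simp add: R inner_root)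
    also have "\<dots> = (\<Sum>i\<in>UNIV. (column i R \<bullet> x)\<^sup>2)"
      by (simp add: inner_vec_def matrix_vector_mult_def transpose_def column_def power2_eq_square)
    finally show ?thesis .
  qed
  have tr: "trace B = (\<Sum>i\<in>UNIV. column i R \<bullet> column i R)"
    unfolding R trace_def matrix_matrix_mult_def transpose_def column_def inner_vec_def
    by (simp, subst sum.swap, simp)
  have id: "x \<bullet> x = (\<Sum>i\<in>UNIV. (axis i 1 \<bullet> x)\<^sup>2)" for x :: "real^'n"
    by (simp add: inner_vec_def[of x x] inner_axis' power2_eq_square)
  have iB: "integrable ?g (\<lambda>x. x \<bullet> (B *v x))" "(\<integral>x. x \<bullet> (B *v x) \<partial>?g) = trace B"
    unfolding quad tr by (auto simp: std_gauss_second_moment integral_sum)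
  have iI: "integrable ?g (\<lambda>x. x \<bullet> x)" "(\<integral>x. x \<bullet> x \<partial>?g) = CARD('n)"
    unfolding id by (auto simp: std_gauss_second_moment integral_sum inner_axis)
  \<comment> \<open>Multiplying the standard density by \<open>?h\<close> gives
    \<open>sqrt (det ?C)\<close> times the density of \<open>mv_normal 0 ?C\<close>; this is why the
    integral of \<open>?h\<close> can be evaluated.\<close>
  let ?h = "\<lambda>x::real^'n. exp ((x \<bullet> x - x \<bullet> (B *v x)) / 2)"
  have dens: "integral\<^sup>N ?g (\<lambda>x. ennreal (?h x)) = ennreal (sqrt (det ?C))"
  proof -
    have "integral\<^sup>N ?g (\<lambda>x. ennreal (?h x)) = (\<integral>\<^sup>+x. ennreal (exp (- (x \<bullet> (B *v x)) / 2) / ?c) \<partial>lborel)"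
      unfolding mv_normal_std
      by (subst nn_integral_density)
        (auto simp: ennreal_mult[symmetric] exp_add[symmetric] exp_diff field_simps intro!: nn_integral_cong
          simp flip: exp_add)
    also have "\<dots> = (\<integral>\<^sup>+x. ennreal (sqrt (det ?C)) *
        ennreal (exp (- (x \<bullet> (B *v x)) / 2) / sqrt ((2 * pi) ^ CARD('n) * det ?C)) \<partial>lborel)"
      using pos_def_det[OF C] by (intro nn_integral_cong) (simp add: ennreal_mult[symmetric] real_sqrt_mult)
    also have "\<dots> = ennreal (sqrt (det ?C)) * emeasure (mv_normal 0 ?C) UNIV"
      by (subst nn_integral_cmult) (auto simp: mv_normal_def emeasure_density CB)
    also have "emeasure (mv_normal 0 ?C) UNIV = 1" using C.emeasure_space_1 by simp
    finally show ?thesis by simp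
  qed
  have ih: "integrable ?g ?h" "integral\<^sup>L ?g ?h = sqrt (det ?C)"
  proof -
    have m: "?h \<in> borel_measurable ?g" by (simp add: mv_normal_def)
    show "integrable ?g ?h"
      by (rule integrableI_nonneg) (auto simp: dens m)
    show "integral\<^sup>L ?g ?h = sqrt (det ?C)"
      by (rule integral_eq_nn_integral[THEN trans]) (use m dens pos_def_det[OF C] in auto)
  qed
  have "1 + (CARD('n) - trace B) / 2 = (\<integral>x. 1 + (x \<bullet> x - x \<bullet> (B *v x)) / 2 \<partial>?g)"
    using iB iI G.prob_space by simp
  also have "\<dots> \<le> integral\<^sup>L ?g ?h"
    using iB(1) iI(1) ih(1) by (intro integral_mono) (auto intro!: exp_ge_add_one_self)
  also have "\<dots> = sqrt (det ?C)" by (rule ih)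
  also have "\<dots> \<le> 1"
  proof -
    have "det ?C \<le> 1" using detC det pos_def_det[OF C]
      by (metis mult.right_neutral mult_le_cancel_left_pos)
    then show ?thesis by simp
  qed
  finally show ?thesis by simp
qed

text \<open>Congruence with the inverse root of \<open>A\<close> reduces the claim to
  \<open>A = mat 1\<close>: the matrix \<open>?C\<close> has determinant
  \<open>det B / det A\<close> and the same trace as \<open>matrix_inv A ** B\<close>. It is used
  twice, for consistency of the log-determinant estimator and for reading that estimator as a
  weighted one.\<close>

lemma inner_matrix_inv_ge_card:
  fixes A B :: "real^'n^'n"
  assumes A: "pos_def A" and B: "pos_def B" and det: "det A \<le> det B"
  shows "matrix_inv A \<bullet> B \<ge> CARD('n)"
proof -
  obtain R :: "real^'n^'n" where R: "invertible R" "A = R ** transpose R" using pos_def_root[OF A] .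
  obtain Q :: "real^'n^'n" where Q: "invertible Q" "B = Q ** transpose Q" using pos_def_root[OF B] .
  let ?S = "matrix_inv R"
  let ?C = "(?S ** Q) ** transpose (?S ** Q)"
  have S: "R ** ?S = mat 1" "?S ** R = mat 1" by (rule matrix_inv_mult[OF R(1)])+
  have "invertible (?S ** Q)"
    by (intro invertible_mult Q) (use S invertible_def in blast)
  then have C: "pos_def ?C" by (rule pos_def_root_iff)
  have dS: "det R * det ?S = 1" using S(1) by (metis det_I det_mul)
  have "det ?C * det A = det B"
    by (simp add: det_mul R Q) (metis dS mult.assoc mult.commute mult_1)
  then have "det ?C \<ge> 1" using det pos_def_det[OF A]
    by (metis mult_le_cancel_right_pos mult_1)
  then have "trace ?C \<ge> CARD('n)" by (rule trace_ge_card_of_det_ge_1[OF C])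
  also have "trace ?C = trace ((transpose ?S ** ?S) ** B)"
    by (simp add: Q matrix_transpose_mul matrix_mul_assoc) (metis matrix_mul_assoc trace_mul_sym)
  also have "transpose ?S ** ?S = matrix_inv A"
  proof (rule matrix_inv_eqI[symmetric])
    have "A ** (transpose ?S ** ?S) = R ** (transpose R ** transpose ?S) ** ?S"
      by (simp add: R matrix_mul_assoc)
    also have "transpose R ** transpose ?S = mat 1"
      by (simp add: matrix_transpose_mul[symmetric] S)
    finally show "A ** (transpose ?S ** ?S) = mat 1" by (simp add: S)
  qed
  also have "trace (matrix_inv A ** B) = matrix_inv A \<bullet> B"
    using pos_def_matrix_inv[OF A] by (simp add: trace_mult_inner pos_def_def)
  finally show ?thesis .
qed

section \<open>Levy continuity in several dimensions\<close>

abbreviation std_gauss :: "(real^'n) measure" where "std_gauss \<equiv> mv_normal 0 (mat 1)"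

text \<open>Convolution of \<open>f\<close> with the centred Gaussian law of standard deviation
  \<open>s\<close> in every coordinate.\<close>

definition gauss_smooth :: "real \<Rightarrow> (real^'n \<Rightarrow> real) \<Rightarrow> real^'n \<Rightarrow> real" where
  "gauss_smooth s f x = (\<integral>u. f (x + s *\<^sub>R u) \<partial>std_gauss)"

lemma borel_measurable_cis_inner [measurable]:
  "(\<lambda>x. cis (v \<bullet> x)) \<in> borel_measurable (borel :: ('a::euclidean_space) measure)"
  by (intro borel_measurable_continuous_onI continuous_intros)

lemma borel_measurable_cis [measurable]: "cis \<in> borel_measurable borel"
  by (intro borel_measurable_continuous_onI continuous_intros)

lemma norm_sq_std_gauss:
  "integrable std_gauss (\<lambda>x::real^'n. (norm x)\<^sup>2)" "(\<integral>x. (norm (x::real^'n))\<^sup>2 \<partial>std_gauss) = CARD('n)"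
proof -
  have id: "(norm x)\<^sup>2 = (\<Sum>i\<in>UNIV. (axis i 1 \<bullet> x)\<^sup>2)" for x :: "real^'n"
    unfolding power2_norm_eq_inner by (simp add: inner_vec_def[of x x] inner_axis' power2_eq_square)
  show "integrable std_gauss (\<lambda>x::real^'n. (norm x)\<^sup>2)" "(\<integral>x. (norm (x::real^'n))\<^sup>2 \<partial>std_gauss) = CARD('n)"
    unfolding id by (auto simp: std_gauss_second_moment integral_sum inner_axis)
qed

text \<open>After an affine change of variable, \<open>x\<close> enters only through the Gaussian
  kernel. Convergence of smoothed integrals thereby becomes convergence of integrals of this
  kernel.\<close>

lemma gauss_smooth_kernel:
  fixes f :: "real^'n \<Rightarrow> real"
  assumes [measurable]: "f \<in> borel_measurable borel" and s: "s > 0"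
  shows "gauss_smooth s f x = (\<integral>y. f y * exp (- (norm ((y - x) /\<^sub>R s))\<^sup>2 / 2) \<partial>lborel) / (sqrt ((2 * pi) ^ CARD('n)) * s ^ CARD('n))"
proof -
  have "(\<integral>y. f y * exp (- (norm ((y - x) /\<^sub>R s))\<^sup>2 / 2) \<partial>lborel)
      = (\<integral>y. f y * exp (- (norm ((y - x) /\<^sub>R s))\<^sup>2 / 2) \<partial>density (distr lborel borel (\<lambda>u. x + s *\<^sub>R u)) (\<lambda>_. \<bar>s\<bar> ^ DIM(real^'n)))"
    using lborel_affine[of s x] s by simp
  also have "\<dots> = (\<integral>u. s ^ CARD('n) * (f (x + s *\<^sub>R u) * exp (- (norm u)\<^sup>2 / 2)) \<partial>lborel)"
    using s by (subst integral_density) (auto simp: integral_distr mult.assoc[symmetric])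
  also have "\<dots> = (\<integral>u. s ^ CARD('n) * sqrt ((2 * pi) ^ CARD('n)) * (std_gauss_density u *\<^sub>R f (x + s *\<^sub>R u)) \<partial>lborel)"
    by (intro Bochner_Integration.integral_cong) (auto simp: dot_square_norm)
  also have "\<dots> = s ^ CARD('n) * sqrt ((2 * pi) ^ CARD('n)) * gauss_smooth s f x"
    unfolding gauss_smooth_def mv_normal_std by (subst integral_density) auto
  finally show ?thesis using s by (simp add: mult.commute)
qed

text \<open>Where \<open>norm (s *\<^sub>R u) < d\<close> the modulus of continuity applies.
  Elsewhere the crude bound \<open>2 * B\<close> is multiplied by the square of
  \<open>norm (s *\<^sub>R u) / d\<close>, which is at least 1 there and has a finite mean, as in
  Chebyshev's inequality.\<close>

lemma gauss_smooth_close: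
  fixes f :: "real^'n \<Rightarrow> real"
  assumes [measurable]: "f \<in> borel_measurable borel"
    and B: "\<And>x. \<bar>f x\<bar> \<le> B" and d: "d > 0"
    and uc: "\<And>x y. dist x y < d \<Longrightarrow> \<bar>f x - f y\<bar> \<le> e"
  shows "\<bar>gauss_smooth s f x - f x\<bar> \<le> e + 2 * B * s\<^sup>2 * CARD('n) / d\<^sup>2"
proof -
  interpret G: prob_space "std_gauss :: (real^'n) measure" by (rule std_gauss_prob)
  have e: "0 \<le> e" using uc[of x x] d by simp
  have B0: "0 \<le> B" using B[of 0] by linarith
  have pt: "\<bar>f (x + s *\<^sub>R u) - f x\<bar> \<le> e + 2 * B * s\<^sup>2 / d\<^sup>2 * (norm u)\<^sup>2" for u
  proof (cases "norm (s *\<^sub>R u) < d")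
    case True
    have "\<bar>f (x + s *\<^sub>R u) - f x\<bar> \<le> e" using True by (intro uc) (simp add: dist_norm)
    then show ?thesis using B0 by (simp add: add_increasing2)
  next
    case False
    then have "1 \<le> (norm (s *\<^sub>R u) / d)\<^sup>2" using d by simp
    also have "\<dots> = s\<^sup>2 / d\<^sup>2 * (norm u)\<^sup>2" by (simp add: power_divide power_mult_distrib)
    finally have "2 * B * 1 \<le> 2 * B * (s\<^sup>2 / d\<^sup>2 * (norm u)\<^sup>2)" using B0 by (intro mult_left_mono) auto
    then show ?thesis using B[of "x + s *\<^sub>R u"] B[of x] e by (simp add: abs_le_iff)
  qed
  have i: "integrable std_gauss (\<lambda>u. f (x + s *\<^sub>R u))"
    by (rule G.integrable_const_bound[of _ B]) (auto simp: B)
  have "\<bar>gauss_smooth s f x - f x\<bar> = \<bar>\<integral>u. f (x + s *\<^sub>R u) - f x \<partial>std_gauss\<bar>"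
    using i G.prob_space by (simp add: gauss_smooth_def)
  also have "\<dots> \<le> (\<integral>u. \<bar>f (x + s *\<^sub>R u) - f x\<bar> \<partial>std_gauss)" by (rule integral_abs_bound)
  also have "\<dots> \<le> (\<integral>u. e + 2 * B * s\<^sup>2 / d\<^sup>2 * (norm (u :: real^'n))\<^sup>2 \<partial>std_gauss)"
  proof (rule integral_mono)
    show "integrable std_gauss (\<lambda>u. e + 2 * B * s\<^sup>2 / d\<^sup>2 * (norm (u :: real^'n))\<^sup>2)"
      by (intro Bochner_Integration.integrable_add G.integrable_const integrable_mult_right norm_sq_std_gauss(1))
  qed (use i pt in auto)
  also have "\<dots> = e + 2 * B * s\<^sup>2 * CARD('n) / d\<^sup>2"
    using G.prob_space by (simp add: norm_sq_std_gauss)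
  finally show ?thesis .
qed

context
  fixes N :: "nat \<Rightarrow> (real^'n) measure" and \<nu> :: "(real^'n) measure"
  assumes N: "\<And>n. prob_space (N n)" "\<And>n. sets (N n) = sets borel"
    and \<nu>: "prob_space \<nu>" "sets \<nu> = sets borel"
    and char: "\<And>u. (\<lambda>n. \<integral>x. cis (u \<bullet> x) \<partial>N n) \<longlonglongrightarrow> (\<integral>x. cis (u \<bullet> x) \<partial>\<nu>)"
begin

text \<open>The Gaussian kernel is a Gaussian average of cosines. By Fubini its integral against a
  law \<open>Q\<close> is an average of values of the characteristic function of \<open>Q\<close>,
  and these values are bounded by 1, so dominated convergence applies.\<close>

lemma levy_gauss_kernel:
  assumes s: "s > 0"
  shows "(\<lambda>n. \<integral>x. exp (- (norm ((y - x) /\<^sub>R s))\<^sup>2 / 2) \<partial>N n) \<longlonglongrightarrow> (\<integral>x. exp (- (norm ((y - x) /\<^sub>R s))\<^sup>2 / 2) \<partial>\<nu>)"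
proof -
  interpret G: prob_space "std_gauss :: (real^'n) measure" by (rule std_gauss_prob)
  have G1: "pos_def (mat 1 :: real^'n^'n)" by (auto simp: pos_def_def)
  \<comment> \<open>The real part of the characteristic function of \<open>P\<close> at
    \<open>- u /\<^sub>R s\<close>, rotated by the phase that belongs to \<open>y\<close>;
    equivalently the mean of \<open>cos (u \<bullet> ((y - x) /\<^sub>R s))\<close> over
    \<open>x\<close>.\<close>
  let ?F = "\<lambda>P u. Re (cis (u \<bullet> (y /\<^sub>R s)) * (\<integral>x. cis ((- u /\<^sub>R s) \<bullet> x) \<partial>P))"
  have *: "(\<integral>x. exp (- (norm ((y - x) /\<^sub>R s))\<^sup>2 / 2) \<partial>Q) = (\<integral>u. ?F Q u \<partial>std_gauss)" "?F Q \<in> borel_measurable borel"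
      "\<bar>?F Q u\<bar> \<le> 1"
    if Q: "prob_space Q" "sets Q = sets borel" for Q u
  proof -
    interpret Q: prob_space Q by fact
    note Q(2)[measurable_cong]
    interpret pair_prob_space "std_gauss :: (real^'n) measure" Q ..
    have int: "integrable Q (\<lambda>x. cis (v \<bullet> x))" for v
      by (rule Q.integrable_const_bound[of _ 1]) auto
    have F: "?F Q u = (\<integral>x. cos (u \<bullet> ((y - x) /\<^sub>R s)) \<partial>Q)" for u
    proof -
      have "cis (u \<bullet> (y /\<^sub>R s)) * (\<integral>x. cis ((- u /\<^sub>R s) \<bullet> x) \<partial>Q)
          = (\<integral>x. cis (u \<bullet> (y /\<^sub>R s)) * cis ((- u /\<^sub>R s) \<bullet> x) \<partial>Q)"
        by (rule integral_mult_right_zero[symmetric])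
      also have "\<dots> = (\<integral>x. cis (u \<bullet> ((y - x) /\<^sub>R s)) \<partial>Q)"
        by (intro Bochner_Integration.integral_cong refl)
          (simp add: cis_mult inner_diff_right algebra_simps)
      finally have "?F Q u = Re (\<integral>x. cis (u \<bullet> ((y - x) /\<^sub>R s)) \<partial>Q)" by simp
      also have "\<dots> = (\<integral>x. cos (u \<bullet> ((y - x) /\<^sub>R s)) \<partial>Q)"
        by (subst integral_Re[symmetric]) (auto intro!: Q.integrable_const_bound[of _ 1])
      finally show ?thesis .
    qed
    have "(\<lambda>u. \<integral>x. cos (u \<bullet> ((y - x) /\<^sub>R s)) \<partial>Q) \<in> borel_measurable borel" by measurable
    then show "?F Q \<in> borel_measurable borel" unfolding F .
    have "\<bar>?F Q u\<bar> \<le> (\<integral>x. \<bar>cos (u \<bullet> ((y - x) /\<^sub>R s))\<bar> \<partial>Q)" unfolding F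
      by (rule integral_abs_bound)
    also have "\<dots> \<le> (\<integral>x. 1 \<partial>Q)"
      by (intro integral_mono Q.integrable_const_bound[of _ 1]) auto
    finally show "\<bar>?F Q u\<bar> \<le> 1" by (simp add: Q.prob_space)
    have k: "exp (- (norm z)\<^sup>2 / 2) = (\<integral>u. cos (u \<bullet> z) \<partial>std_gauss)" for z :: "real^'n"
    proof -
      have "(\<integral>u. cos (u \<bullet> z) \<partial>std_gauss) = (\<integral>u. Re (cis (z \<bullet> u)) \<partial>std_gauss)"
        by (simp add: inner_commute)
      also have "\<dots> = Re (\<integral>u. cis (z \<bullet> u) \<partial>std_gauss)"
        by (subst integral_Re) (auto intro!: G.integrable_const_bound[of _ 1])
      finally show ?thesis by (simp add: mv_normal_char[OF G1] dot_square_norm)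
    qed
    have "(\<integral>x. exp (- (norm ((y - x) /\<^sub>R s))\<^sup>2 / 2) \<partial>Q) = (\<integral>x. \<integral>u. cos (u \<bullet> ((y - x) /\<^sub>R s)) \<partial>std_gauss \<partial>Q)"
      unfolding k ..
    also have "\<dots> = (\<integral>u. \<integral>x. cos (u \<bullet> ((y - x) /\<^sub>R s)) \<partial>Q \<partial>std_gauss)"
      by (rule Fubini_integral[of "\<lambda>u x. cos (u \<bullet> ((y - x) /\<^sub>R s))"], rule integrable_const_bound[of _ 1]) auto
    finally show "(\<integral>x. exp (- (norm ((y - x) /\<^sub>R s))\<^sup>2 / 2) \<partial>Q) = (\<integral>u. ?F Q u \<partial>std_gauss)" unfolding F .
  qed
  have lim: "(\<lambda>n. ?F (N n) u) \<longlonglongrightarrow> ?F \<nu> u" for u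
    by (intro tendsto_intros char)
  show ?thesis
    unfolding *(1)[OF N] *(1)[OF \<nu>]
  proof (rule integral_dominated_convergence[where w="\<lambda>_. 1"])
    show "?F \<nu> \<in> borel_measurable std_gauss" "?F (N n) \<in> borel_measurable std_gauss" for n
      using *(2)[OF \<nu>] *(2)[OF N] by simp_all
    show "AE u in std_gauss. (\<lambda>n. ?F (N n) u) \<longlonglongrightarrow> ?F \<nu> u" using lim by (intro AE_I2)
    show "AE u in std_gauss. norm (?F (N n) u) \<le> 1" for n
      unfolding real_norm_def using *(3)[OF N] by (intro AE_I2)
  qed simp
qed

text \<open>Replace \<open>f\<close> by its smoothing, uniformly close to it. Fubini writes the
  smoothed integral as an integral over \<open>y\<close> of \<open>f y\<close> times a kernel
  average, where \<open>levy_gauss_kernel\<close> gives pointwise convergence; compact support makes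
  \<open>f\<close> integrable, so that \<open>\<bar>f y\<bar>\<close> dominates.\<close>

lemma levy_compact_support:
  fixes f :: "real^'n \<Rightarrow> real"
  assumes f: "continuous_on UNIV f" and R: "\<And>x. norm x > R \<Longrightarrow> f x = 0"
  shows "(\<lambda>n. \<integral>x. f x \<partial>N n) \<longlonglongrightarrow> (\<integral>x. f x \<partial>\<nu>)"
proof -
  have [measurable]: "f \<in> borel_measurable borel" using f by (rule borel_measurable_continuous_onI)
  have K: "compact (f ` cball 0 R)" using f by (intro compact_continuous_image) (auto intro: continuous_on_subset)
  then obtain B where B': "\<And>y. y \<in> f ` cball 0 R \<Longrightarrow> norm y \<le> B"
    using compact_imp_bounded bounded_iff by metis
  define B0 where "B0 = max B 0"
  have B: "\<bar>f x\<bar> \<le> B0" for x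
    using B'[of "f x"] R[of x] by (cases "norm x > R") (auto simp: B0_def max_def not_less)
  have B0: "0 \<le> B0" by (simp add: B0_def)
  have uc: "\<exists>d>0. \<forall>x y. dist x y < d \<longrightarrow> \<bar>f x - f y\<bar> \<le> e" if "e > 0" for e
  proof -
    have "uniformly_continuous_on (cball 0 (R + 1)) f"
      by (intro compact_uniformly_continuous continuous_on_subset[OF f]) auto
    then obtain d where d: "d > 0"
      "\<And>x y. x \<in> cball 0 (R+1) \<Longrightarrow> y \<in> cball 0 (R+1) \<Longrightarrow> dist y x < d \<Longrightarrow> dist (f y) (f x) < e"
      unfolding uniformly_continuous_on_def using \<open>e > 0\<close> by metis
    \<comment> \<open>The cap at 1 places both points in the ball of radius \<open>R + 1\<close>,
      where \<open>f\<close> is uniformly continuous, as soon as one of them lies in the ball of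
      radius \<open>R\<close>.\<close>
    have "\<bar>f x - f y\<bar> \<le> e" if xy: "dist x y < min d 1" for x y
    proof (cases "norm x \<le> R \<or> norm y \<le> R")
      case True
      have "norm x \<le> norm y + dist x y" "norm y \<le> norm x + dist x y"
        by (simp_all add: dist_norm norm_triangle_sub norm_minus_commute)
          (metis norm_minus_commute norm_triangle_sub)
      then have "x \<in> cball 0 (R+1)" "y \<in> cball 0 (R+1)" using True xy by auto
      then show ?thesis using d(2)[of y x] xy by (simp add: dist_real_def)
    next
      case False then show ?thesis using R[of x] R[of y] \<open>e > 0\<close> by simp
    qed
    then show ?thesis using d(1) by (intro exI[of _ "min d 1"]) auto
  qed
  have fint: "integrable lborel f"
  proof -
    have "integrable lborel (\<lambda>x. indicator (cball 0 R) x *\<^sub>R f x)"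
      by (rule borel_integrable_compact) (auto intro: continuous_on_subset[OF f])
    also have "(\<lambda>x. indicator (cball 0 R) x *\<^sub>R f x) = f"
    proof
      show "indicator (cball 0 R) x *\<^sub>R f x = f x" for x
        using R[of x] by (cases "norm x > R") (auto simp: indicator_def)
    qed
    finally show ?thesis .
  qed
  define k where "k s y x = exp (- (norm ((y - x) /\<^sub>R s))\<^sup>2 / 2)" for s and y x :: "real^'n"
  have k: "0 \<le> k s y x" "k s y x \<le> 1" for s y x by (auto simp: k_def)
  have [measurable]: "(\<lambda>p. k s (fst p) (snd p)) \<in> borel_measurable (borel \<Otimes>\<^sub>M borel)" for s
    unfolding k_def by measurable
  have [measurable]: "(\<lambda>p. k s (snd p) (fst p)) \<in> borel_measurable (borel \<Otimes>\<^sub>M borel)" for s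
    unfolding k_def by measurable
  have km [measurable]: "(\<lambda>y. k s y x) \<in> borel_measurable borel" "(\<lambda>x. k s y x) \<in> borel_measurable borel" for s x y
    unfolding k_def by measurable
  define c where "c s = sqrt ((2 * pi) ^ CARD('n)) * s ^ CARD('n)" for s
  have sm: "(\<integral>x. gauss_smooth s f x \<partial>Q) = (\<integral>y. f y * (\<integral>x. k s y x \<partial>Q) \<partial>lborel) / c s"
      "gauss_smooth s f \<in> borel_measurable borel"
      "(\<lambda>y. \<integral>x. k s y x \<partial>Q) \<in> borel_measurable borel"
      "0 \<le> (\<integral>x. k s y x \<partial>Q)" "(\<integral>x. k s y x \<partial>Q) \<le> 1"
    if Q: "prob_space Q" "sets Q = sets borel" and s: "s > 0" for Q s y
  proof -
    interpret Q: prob_space Q by fact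
    note Q(2)[measurable_cong]
    interpret pair_sigma_finite Q "lborel :: (real^'n) measure" ..
    have e: "gauss_smooth s f = (\<lambda>x. (\<integral>y. f y * k s y x \<partial>lborel) / c s)"
      unfolding k_def c_def by (rule ext) (rule gauss_smooth_kernel[OF _ s], simp)
    show "gauss_smooth s f \<in> borel_measurable borel" unfolding e by measurable
    show "(\<lambda>y. \<integral>x. k s y x \<partial>Q) \<in> borel_measurable borel" by measurable
    show "0 \<le> (\<integral>x. k s y x \<partial>Q)" using k by simp
    have "(\<integral>x. k s y x \<partial>Q) \<le> (\<integral>x. 1 \<partial>Q)"
      by (rule integral_mono) (use k in \<open>auto intro!: Q.integrable_const_bound[of _ 1]\<close>)
    then show "(\<integral>x. k s y x \<partial>Q) \<le> 1" by (simp add: Q.prob_space)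
    have i1: "integrable lborel (\<lambda>y. f y * k s y x)" for x
      by (rule Bochner_Integration.integrable_bound[OF fint]) (use k in \<open>auto simp: abs_mult mult_left_le\<close>)
    have i1': "integrable lborel (\<lambda>y. \<bar>f y\<bar> * k s y x)" for x
      by (rule Bochner_Integration.integrable_bound[OF fint]) (use k in \<open>auto simp: abs_mult mult_left_le\<close>)
    have "integrable (Q \<Otimes>\<^sub>M lborel) (\<lambda>(x, y). f y * k s y x)"
    proof (rule Fubini_integrable)
      show "integrable Q (\<lambda>x. \<integral>y. norm (case (x, y) of (x, y) \<Rightarrow> f y * k s y x) \<partial>lborel)"
      proof (rule Q.integrable_const_bound[of _ "\<integral>y. norm (f y) \<partial>lborel"])
        show "AE x in Q. norm (\<integral>y. norm (case (x, y) of (x, y) \<Rightarrow> f y * k s y x) \<partial>lborel) \<le> (\<integral>y. norm (f y) \<partial>lborel)"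
          using i1' fint k by (auto intro!: AE_I2 integral_mono integrable_norm simp: abs_mult mult_left_le)
      qed measurable
    qed (use i1 in auto)
    then have "(\<integral>y. (\<integral>x. f y * k s y x \<partial>Q) \<partial>lborel) = (\<integral>x. (\<integral>y. f y * k s y x \<partial>lborel) \<partial>Q)"
      by (rule Fubini_integral)
    then show "(\<integral>x. gauss_smooth s f x \<partial>Q) = (\<integral>y. f y * (\<integral>x. k s y x \<partial>Q) \<partial>lborel) / c s"
      unfolding e by simp
  qed
  have lim: "(\<lambda>n. \<integral>x. gauss_smooth s f x \<partial>N n) \<longlonglongrightarrow> (\<integral>x. gauss_smooth s f x \<partial>\<nu>)" if s: "s > 0" for s
    unfolding sm(1)[OF N s] sm(1)[OF \<nu> s]
  proof (intro tendsto_divide tendsto_const, rule integral_dominated_convergence[where w="\<lambda>y. \<bar>f y\<bar>"])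
    show "AE y in lborel. (\<lambda>n. f y * (\<integral>x. k s y x \<partial>N n)) \<longlonglongrightarrow> f y * (\<integral>x. k s y x \<partial>\<nu>)"
      unfolding k_def by (intro AE_I2 tendsto_intros levy_gauss_kernel s)
    show "AE y in lborel. norm (f y * (\<integral>x. k s y x \<partial>N n)) \<le> \<bar>f y\<bar>" for n
      using sm(4,5)[OF N s] by (auto simp: abs_mult mult_left_le)
    show "c s \<noteq> 0" using s by (simp add: c_def)
  qed (use fint sm(3)[OF N s] sm(3)[OF \<nu> s] in auto)
  show ?thesis
  proof (rule LIMSEQ_I)
    fix e :: real assume e: "e > 0"
    \<comment> \<open>Smoothing costs at most \<open>e / 8 + e / 8\<close> under each of the two
      laws, and the smoothed integrals will differ by less than \<open>e / 4\<close>, so only three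
      quarters of \<open>e\<close> are spent.\<close>
    then obtain d where d: "d > 0" "\<And>x y. dist x y < d \<Longrightarrow> \<bar>f x - f y\<bar> \<le> e / 8"
      using uc[of "e / 8"] by auto
    have "((\<lambda>s. 2 * B0 * s\<^sup>2 * CARD('n) / d\<^sup>2) \<longlongrightarrow> 2 * B0 * 0\<^sup>2 * CARD('n) / d\<^sup>2) (at_right 0)"
      using d by (intro tendsto_intros) auto
    then have "\<forall>\<^sub>F s in at_right 0. 2 * B0 * s\<^sup>2 * CARD('n) / d\<^sup>2 < e / 8"
      using e by (intro order_tendstoD) auto
    moreover have "\<forall>\<^sub>F s in at_right (0::real). 0 < s" by (rule eventually_at_right_less)
    ultimately obtain s where s: "s > 0" "2 * B0 * s\<^sup>2 * CARD('n) / d\<^sup>2 < e / 8"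
      by (metis (no_types, lifting) eventually_conj eventually_happens trivial_limit_at_right_real)
    have close: "\<bar>gauss_smooth s f x - f x\<bar> \<le> e / 4" for x
      using gauss_smooth_close[of f B0 d "e/8" s x] B d s by simp
    have dif: "\<bar>(\<integral>x. gauss_smooth s f x \<partial>Q) - (\<integral>x. f x \<partial>Q)\<bar> \<le> e / 4"
      if Q: "prob_space Q" "sets Q = sets borel" for Q
    proof -
      interpret Q: prob_space Q by fact
      note Q(2)[measurable_cong] sm(2)[OF Q s(1), measurable]
      have i: "integrable Q f" by (rule Q.integrable_const_bound[of _ B0]) (use B in auto)
      have j: "integrable Q (gauss_smooth s f)"
      proof (rule Q.integrable_const_bound[of _ "B0 + e/4"])
        show "AE x in Q. norm (gauss_smooth s f x) \<le> B0 + e / 4"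
          using close B by (intro AE_I2) (smt (verit, best) real_norm_def)
      qed simp
      have "\<bar>(\<integral>x. gauss_smooth s f x \<partial>Q) - (\<integral>x. f x \<partial>Q)\<bar> = \<bar>\<integral>x. gauss_smooth s f x - f x \<partial>Q\<bar>"
        using i j by simp
      also have "\<dots> \<le> (\<integral>x. \<bar>gauss_smooth s f x - f x\<bar> \<partial>Q)" by (rule integral_abs_bound)
      also have "\<dots> \<le> (\<integral>x. e / 4 \<partial>Q)"
        using i j close by (intro integral_mono) auto
      finally show ?thesis by (simp add: Q.prob_space)
    qed
    obtain n0 where n0: "\<And>n. n \<ge> n0 \<Longrightarrow> norm ((\<integral>x. gauss_smooth s f x \<partial>N n) - (\<integral>x. gauss_smooth s f x \<partial>\<nu>)) < e / 4"
      using LIMSEQ_D[OF lim[OF s(1)], of "e/4"] e by auto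
    have "norm ((\<integral>x. f x \<partial>N n) - (\<integral>x. f x \<partial>\<nu>)) < e" if "n \<ge> n0" for n
      using n0[OF that] dif[OF N(1)[of n] N(2)[of n]] dif[OF \<nu>] e unfolding real_norm_def by linarith
    then show "\<exists>n0. \<forall>n\<ge>n0. norm ((\<integral>x. f x \<partial>N n) - (\<integral>x. f x \<partial>\<nu>)) < e" by blast
  qed
qed

text \<open>Tightness comes for free: the cutoff \<open>c r\<close> has compact support itself, so
  its integrals converge to that under \<open>\<nu>\<close>, which is close to 1 for large
  \<open>r\<close>. The mass lost by cutting off \<open>f\<close> is thereby controlled for all
  large \<open>n\<close>.\<close>

theorem levy_continuity_multidim:
  fixes f :: "real^'n \<Rightarrow> real"
  assumes f: "continuous_on UNIV f" and B: "\<And>x. \<bar>f x\<bar> \<le> B"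
  shows "(\<lambda>n. \<integral>x. f x \<partial>N n) \<longlonglongrightarrow> (\<integral>x. f x \<partial>\<nu>)"
proof -
  have [measurable]: "f \<in> borel_measurable borel" using f by (rule borel_measurable_continuous_onI)
  have B0: "0 \<le> B" using B[of 0] by linarith
  define c where "c r x = max 0 (min 1 (r + 1 - norm x))" for r and x :: "real^'n"
  have c: "0 \<le> c r x" "c r x \<le> 1" "norm x > r + 1 \<Longrightarrow> c r x = 0" for r x by (auto simp: c_def)
  have cc: "continuous_on UNIV (c r)" for r unfolding c_def by (intro continuous_intros)
  then have [measurable]: "c r \<in> borel_measurable borel" for r by (rule borel_measurable_continuous_onI)
  interpret V: prob_space \<nu> by (rule \<nu>)
  note \<nu>(2)[measurable_cong]
  have "(\<lambda>r. \<integral>x. c (real r) x \<partial>\<nu>) \<longlonglongrightarrow> (\<integral>x. 1 \<partial>\<nu>)"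
  proof (rule integral_dominated_convergence[where w="\<lambda>_. 1"])
    show "AE x in \<nu>. (\<lambda>r. c (real r) x) \<longlonglongrightarrow> 1"
    proof (intro AE_I2 tendsto_eventually)
      fix x
      show "\<forall>\<^sub>F r in sequentially. c (real r) x = 1"
        using eventually_ge_at_top[of "nat \<lceil>norm x\<rceil>"]
        by eventually_elim (simp add: c_def nat_le_iff ceiling_le_iff)
    qed
  qed (use c in auto)
  then have tight: "(\<lambda>r. \<integral>x. c (real r) x \<partial>\<nu>) \<longlonglongrightarrow> 1" by (simp add: V.prob_space)
  have dif: "\<bar>(\<integral>x. f x \<partial>Q) - (\<integral>x. f x * c r x \<partial>Q)\<bar> \<le> B * (1 - (\<integral>x. c r x \<partial>Q))"
    if Q: "prob_space Q" "sets Q = sets borel" for Q r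
  proof -
    interpret Q: prob_space Q by fact
    note Q(2)[measurable_cong]
    have i: "integrable Q f" by (rule Q.integrable_const_bound[of _ B]) (use B in auto)
    have j: "integrable Q (\<lambda>x. f x * c r x)"
      by (rule Bochner_Integration.integrable_bound[OF i]) (use c in \<open>auto simp: abs_mult mult_left_le\<close>)
    have k: "integrable Q (c r)" by (rule Q.integrable_const_bound[of _ 1]) (use c in auto)
    have "\<bar>(\<integral>x. f x \<partial>Q) - (\<integral>x. f x * c r x \<partial>Q)\<bar> = \<bar>\<integral>x. f x - f x * c r x \<partial>Q\<bar>"
      using i j by simp
    also have "\<dots> \<le> (\<integral>x. \<bar>f x - f x * c r x\<bar> \<partial>Q)" by (rule integral_abs_bound)
    also have "\<dots> \<le> (\<integral>x. B * (1 - c r x) \<partial>Q)"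
    proof (rule integral_mono)
      fix x
      have "\<bar>f x - f x * c r x\<bar> = \<bar>f x\<bar> * (1 - c r x)"
      proof -
        have "f x - f x * c r x = f x * (1 - c r x)" by (simp add: right_diff_distrib)
        then show ?thesis using c[of r x] by (simp add: abs_mult)
      qed
      then show "\<bar>f x - f x * c r x\<bar> \<le> B * (1 - c r x)"
        using B[of x] c[of r x] by (simp add: mult_right_mono)
    qed (use i j k in auto)
    finally show ?thesis using k by (simp add: Q.prob_space)
  qed
  have lim1: "(\<lambda>n. \<integral>x. f x * c r x \<partial>N n) \<longlonglongrightarrow> (\<integral>x. f x * c r x \<partial>\<nu>)" for r
  proof (rule levy_compact_support)
    show "continuous_on UNIV (\<lambda>x. f x * c r x)" by (rule continuous_on_mult[OF f cc])
    show "f x * c r x = 0" if "norm x > r + 1" for x using c(3)[OF that] by simp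
  qed
  have lim2: "(\<lambda>n. \<integral>x. c r x \<partial>N n) \<longlonglongrightarrow> (\<integral>x. c r x \<partial>\<nu>)" for r
    by (rule levy_compact_support[OF cc c(3)])
  show ?thesis
  proof (rule LIMSEQ_I)
    fix e :: real assume e: "e > 0"
    have "(\<lambda>r. B * (1 - (\<integral>x. c (real r) x \<partial>\<nu>))) \<longlonglongrightarrow> B * (1 - 1)"
      by (intro tendsto_intros tight)
    then have "\<forall>\<^sub>F r in sequentially. B * (1 - (\<integral>x. c (real r) x \<partial>\<nu>)) < e / 4"
      using e by (intro order_tendstoD) auto
    then obtain r :: nat where r: "B * (1 - (\<integral>x. c r x \<partial>\<nu>)) < e / 4"
      unfolding eventually_sequentially by blast
    have "(\<lambda>n. B * (1 - (\<integral>x. c r x \<partial>N n))) \<longlonglongrightarrow> B * (1 - (\<integral>x. c r x \<partial>\<nu>))"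
      by (intro tendsto_intros lim2)
    then have "\<forall>\<^sub>F n in sequentially. B * (1 - (\<integral>x. c r x \<partial>N n)) < e / 4"
      using r by (intro order_tendstoD) auto
    moreover have "\<forall>\<^sub>F n in sequentially. dist (\<integral>x. f x * c r x \<partial>N n) (\<integral>x. f x * c r x \<partial>\<nu>) < e / 4"
      using lim1[of r] e by (intro tendstoD) auto
    ultimately have "\<forall>\<^sub>F n in sequentially. norm ((\<integral>x. f x \<partial>N n) - (\<integral>x. f x \<partial>\<nu>)) < e"
    proof eventually_elim
      case (elim n)
      then show ?case using dif[OF N(1)[of n] N(2)[of n], of r] dif[OF \<nu>, of r] r e
        unfolding real_norm_def dist_real_def by linarith
    qed
    then show "\<exists>n0. \<forall>n\<ge>n0. norm ((\<integral>x. f x \<partial>N n) - (\<integral>x. f x \<partial>\<nu>)) < e"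
      by (simp add: eventually_sequentially)
  qed
qed

end

lemma converges_in_law_mv_normalI:
  fixes X :: "nat \<Rightarrow> 'w \<Rightarrow> real^'n"
  assumes M: "prob_space M" and X: "\<And>n. X n \<in> borel_measurable M" and S: "pos_def S"
    and char: "\<And>u. (\<lambda>n. \<integral>\<omega>. cis (u \<bullet> X n \<omega>) \<partial>M) \<longlonglongrightarrow> exp (- (u \<bullet> (S *v u)) / 2)"
  shows "converges_in_law M X (mv_normal 0 S)"
  unfolding converges_in_law_def
proof (intro allI impI, elim conjE)
  fix f :: "real^'n \<Rightarrow> real" assume f: "continuous_on UNIV f" "bounded (range f)"
  then obtain B where B: "\<And>x. \<bar>f x\<bar> \<le> B" unfolding bounded_iff by auto
  have [measurable]: "f \<in> borel_measurable borel" using f(1) by (rule borel_measurable_continuous_onI)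
  note X[measurable]
  have "(\<lambda>n. \<integral>x. f x \<partial>distr M borel (X n)) \<longlonglongrightarrow> (\<integral>x. f x \<partial>mv_normal 0 S)"
  proof (rule levy_continuity_multidim[OF _ _ _ _ _ f(1) B])
    show "prob_space (distr M borel (X n))" for n
      by (rule prob_space.prob_space_distr[OF M]) simp
    show "prob_space (mv_normal 0 S)" by (rule mv_normal_prob[OF S])
    show "(\<lambda>n. \<integral>x. cis (u \<bullet> x) \<partial>distr M borel (X n)) \<longlonglongrightarrow> (\<integral>x. cis (u \<bullet> x) \<partial>mv_normal 0 S)" for u
      using char[of u] by (simp add: mv_normal_char[OF S] integral_distr)
  qed simp_all
  then show "(\<lambda>n. \<integral>\<omega>. f (X n \<omega>) \<partial>M) \<longlonglongrightarrow> (\<integral>x. f x \<partial>mv_normal 0 S)"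
    by (simp add: integral_distr)
qed

text \<open>Only the cosine appears because \<open>converges_in_law\<close> tests real functions;
  nothing is lost, as the limiting characteristic function is real.\<close>

lemma converges_in_law_mv_normal_char:
  fixes X :: "nat \<Rightarrow> 'w \<Rightarrow> real^'n"
  assumes S: "pos_def S" and lim: "converges_in_law M X (mv_normal 0 S)"
  shows "(\<lambda>n. \<integral>\<omega>. cos (u \<bullet> X n \<omega>) \<partial>M) \<longlonglongrightarrow> exp (- (u \<bullet> (S *v u)) / 2)"
proof -
  interpret V: prob_space "mv_normal 0 S" by (rule mv_normal_prob[OF S])
  have "continuous_on UNIV (\<lambda>x. cos (u \<bullet> x))" by (intro continuous_intros)
  moreover have "bounded (range (\<lambda>x. cos (u \<bullet> x)))" by (rule boundedI[of _ 1]) auto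
  ultimately have "(\<lambda>n. \<integral>\<omega>. cos (u \<bullet> X n \<omega>) \<partial>M) \<longlonglongrightarrow> (\<integral>x. cos (u \<bullet> x) \<partial>mv_normal 0 S)"
    using lim unfolding converges_in_law_def by blast
  also have "(\<integral>x. cos (u \<bullet> x) \<partial>mv_normal 0 S) = Re (\<integral>x. cis (u \<bullet> x) \<partial>mv_normal 0 S)"
    by (subst integral_Re[symmetric]) (auto intro!: V.integrable_const_bound[of _ 1])
  finally show ?thesis by (simp add: mv_normal_char[OF S])
qed

section \<open>Averages of independent identically distributed variables\<close>

text \<open>The sample is a bare sequence, so that a single path can be studied deterministically.
  The index range is that of the cost functions, and the value at \<open>n = 0\<close> is 0.\<close>

definition emp_mean :: "(nat \<Rightarrow> 'x) \<Rightarrow> nat \<Rightarrow> ('x \<Rightarrow> 'b::real_vector) \<Rightarrow> 'b" where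
  "emp_mean x n g = (1 / real n) *\<^sub>R (\<Sum>t=1..n. g (x t))"

lemma emp_mean_diff: "emp_mean x n (\<lambda>y. f y - g y) = emp_mean x n f - emp_mean x n g"
  by (simp add: emp_mean_def sum_subtractf scaleR_diff_right)

lemma emp_mean_linear:
  assumes "linear L" shows "L (emp_mean x n g) = emp_mean x n (\<lambda>y. L (g y))"
  using assms by (simp add: emp_mean_def linear_scale linear_sum)

lemma emp_mean_inner: "v \<bullet> emp_mean x n g = emp_mean x n (\<lambda>y. v \<bullet> g y)"
  by (rule emp_mean_linear) (simp add: linear_iff inner_add_right)

lemma emp_mean_inner_left: "emp_mean x n g \<bullet> v = emp_mean x n (\<lambda>y. g y \<bullet> v)"
  using emp_mean_inner[of v x n g] by (simp add: inner_commute)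

lemma emp_mean_scaleR: "emp_mean x n (\<lambda>y. c *\<^sub>R g y) = c *\<^sub>R emp_mean x n g"
  by (rule emp_mean_linear[symmetric]) (simp add: linear_iff scaleR_add_right)

lemma emp_mean_mult: "emp_mean x n (\<lambda>y. c * g y :: real) = c * emp_mean x n g"
  using emp_mean_scaleR[of x n c g] by simp

lemma emp_mean_sum: "emp_mean x n (\<lambda>y. \<Sum>i\<in>I. g i y) = (\<Sum>i\<in>I. emp_mean x n (g i))"
  unfolding emp_mean_def by (subst sum.swap) (simp add: scaleR_sum_right)

lemma norm_emp_mean_le:
  fixes g :: "'x \<Rightarrow> 'b::real_normed_vector"
  shows "(\<And>y. norm (g y) \<le> h y) \<Longrightarrow> norm (emp_mean x n g) \<le> emp_mean x n h"
  unfolding emp_mean_def norm_scaleR by (simp add: divide_right_mono sum_norm_le)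

text \<open>Used in two situations: for expectations, when almost sure convergence is known along
  subsequences only, and for estimates in a compact set, whose cluster points are reached along
  subsequences.\<close>

lemma LIMSEQ_subseqI:
  fixes c :: "nat \<Rightarrow> 'a::metric_space"
  assumes "\<And>r :: nat \<Rightarrow> nat. strict_mono r \<Longrightarrow> \<exists>s :: nat \<Rightarrow> nat. strict_mono s \<and> (\<lambda>k. c (r (s k))) \<longlonglongrightarrow> l"
  shows "c \<longlonglongrightarrow> l"
proof (rule ccontr)
  assume "\<not> c \<longlonglongrightarrow> l"
  then obtain e where e: "e > 0" "\<not> (\<forall>\<^sub>F n in sequentially. dist (c n) l < e)"
    unfolding tendsto_iff by auto
  then have "infinite {n. \<not> dist (c n) l < e}"
    by (simp add: eventually_cofinite flip: cofinite_eq_sequentially)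
  then obtain r :: "nat \<Rightarrow> nat" where r: "strict_mono r" "\<And>n. r n \<in> {n. \<not> dist (c n) l < e}"
    using infinite_enumerate by blast
  obtain s where "(\<lambda>k. c (r (s k))) \<longlonglongrightarrow> l" using assms[OF r(1)] by auto
  then have "\<forall>\<^sub>F k in sequentially. dist (c (r (s k))) l < e" using e by (simp add: tendstoD)
  then show False using r(2) by (auto simp: eventually_sequentially)
qed

locale iid_sequence = prob_space M for M :: "'w measure" +
  fixes X :: "nat \<Rightarrow> 'w \<Rightarrow> 'x::{second_countable_topology, topological_space}"
  assumes indep: "indep_vars (\<lambda>_. borel) X UNIV"
    and same_law: "distr M borel (X t) = distr M borel (X 0)"
begin

lemma X_measurable [measurable]: "X t \<in> borel_measurable M"
  using indep unfolding indep_vars_def by auto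

lemma distr_comp:
  fixes g :: "'x \<Rightarrow> 'b::topological_space"
  assumes [measurable]: "g \<in> borel_measurable borel"
  shows "distr M borel (\<lambda>\<omega>. g (X t \<omega>)) = distr M borel (\<lambda>\<omega>. g (X 0 \<omega>))"
proof -
  have "distr M borel (\<lambda>\<omega>. g (X t \<omega>)) = distr (distr M borel (X t)) borel g" for t
    by (simp add: distr_distr comp_def)
  then show ?thesis using same_law by metis
qed

lemma integrable_comp_iff:
  fixes g :: "'x \<Rightarrow> 'b::{banach, second_countable_topology}"
  assumes [measurable]: "g \<in> borel_measurable borel"
  shows "integrable M (\<lambda>\<omega>. g (X t \<omega>)) \<longleftrightarrow> integrable M (\<lambda>\<omega>. g (X 0 \<omega>))"
proof -
  have "integrable M (\<lambda>\<omega>. g (X t \<omega>)) \<longleftrightarrow> integrable (distr M borel (X t)) g" for t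
    by (simp add: integrable_distr_eq)
  then show ?thesis using same_law by metis
qed

lemma expectation_comp:
  fixes g :: "'x \<Rightarrow> 'b::{banach, second_countable_topology}"
  assumes [measurable]: "g \<in> borel_measurable borel"
  shows "(\<integral>\<omega>. g (X t \<omega>) \<partial>M) = (\<integral>\<omega>. g (X 0 \<omega>) \<partial>M)"
proof -
  have "(\<integral>\<omega>. g (X t \<omega>) \<partial>M) = integral\<^sup>L (distr M borel (X t)) g" for t
    by (simp add: integral_distr)
  then show ?thesis using same_law by metis
qed

lemma emp_mean_measurable [measurable]:
  fixes g :: "'x \<Rightarrow> 'b::euclidean_space"
  assumes [measurable]: "g \<in> borel_measurable borel"
  shows "(\<lambda>\<omega>. emp_mean (\<lambda>t. X t \<omega>) n g) \<in> borel_measurable M"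
  unfolding emp_mean_def by measurable

lemma second_moment_sum:
  fixes g :: "'x \<Rightarrow> real"
  assumes [measurable]: "g \<in> borel_measurable borel"
    and mean: "(\<integral>\<omega>. g (X 0 \<omega>) \<partial>M) = 0" and sq: "integrable M (\<lambda>\<omega>. (g (X 0 \<omega>))\<^sup>2)"
  shows "integrable M (\<lambda>\<omega>. (\<Sum>t\<in>A. g (X t \<omega>))\<^sup>2)"
    and "finite A \<Longrightarrow> (\<integral>\<omega>. (\<Sum>t\<in>A. g (X t \<omega>))\<^sup>2 \<partial>M) = card A * (\<integral>\<omega>. (g (X 0 \<omega>))\<^sup>2 \<partial>M)"
proof -
  have sq': "integrable M (\<lambda>\<omega>. (g (X t \<omega>))\<^sup>2)" for t
    using sq integrable_comp_iff[of "\<lambda>x. (g x)\<^sup>2" t] by simp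
  have int: "integrable M (\<lambda>\<omega>. g (X t \<omega>))" for t
    by (rule square_integrable_imp_integrable[OF _ sq']) measurable
  have cross: "integrable M (\<lambda>\<omega>. g (X s \<omega>) * g (X t \<omega>))"
      "s \<noteq> t \<Longrightarrow> (\<integral>\<omega>. g (X s \<omega>) * g (X t \<omega>) \<partial>M) = 0" for s t
  proof -
    have ind: "indep_vars (\<lambda>_. borel) (\<lambda>i \<omega>. g (X i \<omega>)) {s, t}"
      by (rule indep_vars_compose2[OF indep_vars_subset[OF indep]]) auto
    show "s \<noteq> t \<Longrightarrow> (\<integral>\<omega>. g (X s \<omega>) * g (X t \<omega>) \<partial>M) = 0"
      using indep_vars_lebesgue_integral[OF _ ind int] expectation_comp[of g] mean by simp
    show "integrable M (\<lambda>\<omega>. g (X s \<omega>) * g (X t \<omega>))"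
      using indep_vars_integrable[OF _ ind int] sq' by (cases "s = t") (auto simp: power2_eq_square)
  qed
  have e: "(\<Sum>t\<in>A. g (X t \<omega>))\<^sup>2 = (\<Sum>s\<in>A. \<Sum>t\<in>A. g (X s \<omega>) * g (X t \<omega>))" for \<omega>
    by (simp add: power2_eq_square sum_product)
  show "integrable M (\<lambda>\<omega>. (\<Sum>t\<in>A. g (X t \<omega>))\<^sup>2)"
    unfolding e by (intro Bochner_Integration.integrable_sum cross)
  assume A: "finite A"
  have "(\<integral>\<omega>. (\<Sum>t\<in>A. g (X t \<omega>))\<^sup>2 \<partial>M) = (\<Sum>s\<in>A. \<Sum>t\<in>A. \<integral>\<omega>. g (X s \<omega>) * g (X t \<omega>) \<partial>M)"
    unfolding e by (simp add: integral_sum cross)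
  also have "\<dots> = (\<Sum>s\<in>A. \<Sum>t\<in>A. if t = s then \<integral>\<omega>. (g (X 0 \<omega>))\<^sup>2 \<partial>M else 0)"
    using cross(2) expectation_comp[of "\<lambda>x. (g x)\<^sup>2"] by (intro sum.cong) (auto simp: power2_eq_square)
  also have "\<dots> = card A * (\<integral>\<omega>. (g (X 0 \<omega>))\<^sup>2 \<partial>M)" using A by simp
  finally show "(\<integral>\<omega>. (\<Sum>t\<in>A. g (X t \<omega>))\<^sup>2 \<partial>M) = card A * (\<integral>\<omega>. (g (X 0 \<omega>))\<^sup>2 \<partial>M)" .
qed

text \<open>The average has variance of order \<open>1 / n\<close>, and the L1 norm is at most the
  L2 norm, here in the form that \<open>\<bar>?S \<omega>\<bar>\<close> has nonnegative
  variance.\<close>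

lemma L1_lln_bounded:
  fixes g :: "'x \<Rightarrow> real"
  assumes [measurable]: "g \<in> borel_measurable borel" and B: "\<And>x. \<bar>g x\<bar> \<le> B"
  shows "(\<lambda>n. \<integral>\<omega>. \<bar>emp_mean (\<lambda>t. X t \<omega>) n g - (\<integral>\<omega>. g (X 0 \<omega>) \<partial>M)\<bar> \<partial>M) \<longlonglongrightarrow> 0"
proof -
  let ?m = "\<integral>\<omega>. g (X 0 \<omega>) \<partial>M"
  let ?h = "\<lambda>x. g x - ?m" let ?v = "\<integral>\<omega>. (?h (X 0 \<omega>))\<^sup>2 \<partial>M"
  have ig: "integrable M (\<lambda>\<omega>. g (X 0 \<omega>))" by (rule integrable_const_bound[of _ B]) (use B in auto)
  have mean: "(\<integral>\<omega>. ?h (X 0 \<omega>) \<partial>M) = 0" using ig by (simp add: prob_space)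
  have sq: "integrable M (\<lambda>\<omega>. (?h (X 0 \<omega>))\<^sup>2)"
  proof (rule integrable_const_bound[of _ "(B + \<bar>?m\<bar>)\<^sup>2"])
    have "(g x - ?m)\<^sup>2 \<le> (B + \<bar>?m\<bar>)\<^sup>2" for x
      using B[of x] by (intro power2_le_iff_abs_le[THEN iffD2]) auto
    then show "AE \<omega> in M. norm ((g (X 0 \<omega>) - ?m)\<^sup>2) \<le> (B + \<bar>?m\<bar>)\<^sup>2" by simp
  qed measurable
  have bound: "(\<integral>\<omega>. \<bar>emp_mean (\<lambda>t. X t \<omega>) n g - ?m\<bar> \<partial>M) \<le> sqrt (?v / n)" if n: "n > 0" for n
  proof -
    let ?S = "\<lambda>\<omega>. (\<Sum>t=1..n. ?h (X t \<omega>)) / n"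
    have e: "emp_mean (\<lambda>t. X t \<omega>) n g - ?m = ?S \<omega>" for \<omega>
      using n by (simp add: emp_mean_def sum_subtractf diff_divide_distrib)
    have i2: "integrable M (\<lambda>\<omega>. (\<bar>?S \<omega>\<bar>)\<^sup>2)"
      using second_moment_sum(1)[of ?h "{1..n}"] mean sq by (simp add: power_divide)
    have v: "(\<integral>\<omega>. (\<bar>?S \<omega>\<bar>)\<^sup>2 \<partial>M) = ?v / n"
      using second_moment_sum(2)[of ?h "{1..n}"] mean sq n by (simp add: power_divide power2_eq_square[of "real n"])
    have i1: "integrable M (\<lambda>\<omega>. \<bar>?S \<omega>\<bar>)"
      by (rule square_integrable_imp_integrable[OF _ i2]) measurable
    have "(\<integral>\<omega>. \<bar>?S \<omega>\<bar> \<partial>M)\<^sup>2 \<le> ?v / n"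
    proof -
      have "0 \<le> variance (\<lambda>\<omega>. \<bar>?S \<omega>\<bar>)" by (rule variance_positive)
      then show ?thesis unfolding variance_eq[OF i1 i2] v by linarith
    qed
    then have "\<bar>\<integral>\<omega>. \<bar>?S \<omega>\<bar> \<partial>M\<bar> \<le> sqrt (?v / n)" by (metis real_sqrt_abs real_sqrt_le_iff)
    then show ?thesis unfolding e by linarith
  qed
  have "(\<lambda>n. sqrt (?v / real n)) \<longlonglongrightarrow> sqrt 0"
    by (intro tendsto_real_sqrt lim_const_over_n)
  then have lim: "(\<lambda>n. sqrt (?v / real n)) \<longlonglongrightarrow> 0" by simp
  show ?thesis
    by (rule tendsto_sandwich[OF _ _ tendsto_const lim])
      (use bound in \<open>auto intro!: eventually_sequentiallyI[of 1]\<close>)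
qed

lemma expectation_abs_emp_mean_le:
  fixes g :: "'x \<Rightarrow> real"
  assumes [measurable]: "g \<in> borel_measurable borel" and i: "integrable M (\<lambda>\<omega>. g (X 0 \<omega>))"
  shows "integrable M (\<lambda>\<omega>. emp_mean (\<lambda>t. X t \<omega>) n g)"
    and "(\<integral>\<omega>. \<bar>emp_mean (\<lambda>t. X t \<omega>) n g\<bar> \<partial>M) \<le> (\<integral>\<omega>. \<bar>g (X 0 \<omega>)\<bar> \<partial>M)"
proof -
  have it: "integrable M (\<lambda>\<omega>. g (X t \<omega>))" for t using i integrable_comp_iff[of g t] by simp
  show im: "integrable M (\<lambda>\<omega>. emp_mean (\<lambda>t. X t \<omega>) n g)" unfolding emp_mean_def using it by auto
  have "(\<integral>\<omega>. \<bar>emp_mean (\<lambda>t. X t \<omega>) n g\<bar> \<partial>M) \<le> (\<integral>\<omega>. emp_mean (\<lambda>t. X t \<omega>) n (\<lambda>x. \<bar>g x\<bar>) \<partial>M)"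
  proof (rule integral_mono)
    show "\<bar>emp_mean (\<lambda>t. X t \<omega>) n g\<bar> \<le> emp_mean (\<lambda>t. X t \<omega>) n (\<lambda>x. \<bar>g x\<bar>)" for \<omega>
      using norm_emp_mean_le[of g "\<lambda>x. \<bar>g x\<bar>"] by simp
    show "integrable M (\<lambda>\<omega>. emp_mean (\<lambda>t. X t \<omega>) n (\<lambda>x. \<bar>g x\<bar>))" unfolding emp_mean_def using it by auto
  qed (use im in auto)
  also have "\<dots> = (\<Sum>t=1..n. \<integral>\<omega>. \<bar>g (X t \<omega>)\<bar> \<partial>M) / n"
    unfolding emp_mean_def using it by (simp add: integral_sum)
  also have "\<dots> = (\<Sum>t=1..n. \<integral>\<omega>. \<bar>g (X 0 \<omega>)\<bar> \<partial>M) / n"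
    by (intro arg_cong2[where f="(/)"] sum.cong refl expectation_comp[of "\<lambda>x. \<bar>g x\<bar>"]) measurable
  also have "\<dots> \<le> (\<integral>\<omega>. \<bar>g (X 0 \<omega>)\<bar> \<partial>M)" by (cases "n = 0") auto
  finally show "(\<integral>\<omega>. \<bar>emp_mean (\<lambda>t. X t \<omega>) n g\<bar> \<partial>M) \<le> (\<integral>\<omega>. \<bar>g (X 0 \<omega>)\<bar> \<partial>M)" .
qed

text \<open>Truncate \<open>g\<close> at a level \<open>k\<close> that does not depend on
  \<open>n\<close>. The discarded part contributes at most twice its expected absolute value,
  uniformly in \<open>n\<close>, and the bounded part is covered by
  \<open>L1_lln_bounded\<close>.\<close>

lemma L1_lln_real:
  fixes g :: "'x \<Rightarrow> real"
  assumes [measurable]: "g \<in> borel_measurable borel" and i: "integrable M (\<lambda>\<omega>. g (X 0 \<omega>))"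
  shows "(\<lambda>n. \<integral>\<omega>. \<bar>emp_mean (\<lambda>t. X t \<omega>) n g - (\<integral>\<omega>. g (X 0 \<omega>) \<partial>M)\<bar> \<partial>M) \<longlonglongrightarrow> 0"
proof (rule LIMSEQ_I)
  fix e :: real assume e: "e > 0"
  define b where "b k x = (if \<bar>g x\<bar> \<le> real k then g x else 0)" for k x
  have [measurable]: "b k \<in> borel_measurable borel" for k unfolding b_def by measurable
  have bb: "\<bar>b k x\<bar> \<le> real k" "\<bar>g x - b k x\<bar> \<le> \<bar>g x\<bar>" "\<bar>b k x\<bar> \<le> \<bar>g x\<bar>" for k x by (auto simp: b_def)
  have ib: "integrable M (\<lambda>\<omega>. b k (X 0 \<omega>))" for k
    by (rule Bochner_Integration.integrable_bound[OF i]) (use bb in auto)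
  have "(\<lambda>k. \<integral>\<omega>. \<bar>g (X 0 \<omega>) - b k (X 0 \<omega>)\<bar> \<partial>M) \<longlonglongrightarrow> (\<integral>\<omega>. 0 \<partial>M)"
  proof (rule integral_dominated_convergence[where w="\<lambda>\<omega>. \<bar>g (X 0 \<omega>)\<bar>"])
    show "AE \<omega> in M. (\<lambda>k. \<bar>g (X 0 \<omega>) - b k (X 0 \<omega>)\<bar>) \<longlonglongrightarrow> 0"
    proof (intro AE_I2 tendsto_eventually)
      fix \<omega>
      show "\<forall>\<^sub>F k in sequentially. \<bar>g (X 0 \<omega>) - b k (X 0 \<omega>)\<bar> = 0"
        using eventually_ge_at_top[of "nat \<lceil>\<bar>g (X 0 \<omega>)\<bar>\<rceil>"]
        by eventually_elim (simp add: b_def nat_le_iff ceiling_le_iff)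
    qed
  qed (use i bb in auto)
  then have "\<forall>\<^sub>F k in sequentially. (\<integral>\<omega>. \<bar>g (X 0 \<omega>) - b k (X 0 \<omega>)\<bar> \<partial>M) < e / 3"
    using e by (intro order_tendstoD) auto
  then obtain k where k: "(\<integral>\<omega>. \<bar>g (X 0 \<omega>) - b k (X 0 \<omega>)\<bar> \<partial>M) < e / 3"
    unfolding eventually_sequentially by blast
  let ?E = "\<lambda>n g. \<integral>\<omega>. \<bar>emp_mean (\<lambda>t. X t \<omega>) n g - (\<integral>\<omega>. g (X 0 \<omega>) \<partial>M)\<bar> \<partial>M"
  have le: "?E n g \<le> ?E n (b k) + 2 * (\<integral>\<omega>. \<bar>g (X 0 \<omega>) - b k (X 0 \<omega>)\<bar> \<partial>M)" for n
  proof -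
    let ?d = "\<lambda>x. g x - b k x" let ?D = "\<integral>\<omega>. ?d (X 0 \<omega>) \<partial>M"
    have id: "integrable M (\<lambda>\<omega>. ?d (X 0 \<omega>))" using i ib by auto
    note m = expectation_abs_emp_mean_le
    have "?E n g \<le> (\<integral>\<omega>. \<bar>emp_mean (\<lambda>t. X t \<omega>) n (b k) - (\<integral>\<omega>. b k (X 0 \<omega>) \<partial>M)\<bar>
        + \<bar>emp_mean (\<lambda>t. X t \<omega>) n ?d\<bar> + \<bar>?D\<bar> \<partial>M)"
    proof (rule integral_mono)
      fix \<omega>
      have "emp_mean (\<lambda>t. X t \<omega>) n g - (\<integral>\<omega>. g (X 0 \<omega>) \<partial>M)
        = (emp_mean (\<lambda>t. X t \<omega>) n (b k) - (\<integral>\<omega>. b k (X 0 \<omega>) \<partial>M)) + emp_mean (\<lambda>t. X t \<omega>) n ?d - ?D"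
        using i ib by (simp add: emp_mean_diff)
      then show "\<bar>emp_mean (\<lambda>t. X t \<omega>) n g - (\<integral>\<omega>. g (X 0 \<omega>) \<partial>M)\<bar> \<le> \<bar>emp_mean (\<lambda>t. X t \<omega>) n (b k) - (\<integral>\<omega>. b k (X 0 \<omega>) \<partial>M)\<bar>
        + \<bar>emp_mean (\<lambda>t. X t \<omega>) n ?d\<bar> + \<bar>?D\<bar>" by linarith
    qed (use m(1)[OF _ i] m(1)[OF _ ib] m(1)[OF _ id] in auto)
    also have "\<dots> = ?E n (b k) + (\<integral>\<omega>. \<bar>emp_mean (\<lambda>t. X t \<omega>) n ?d\<bar> \<partial>M) + \<bar>?D\<bar>"
      using m(1)[OF _ ib] m(1)[OF _ id] by (simp add: prob_space)
    also have "\<dots> \<le> ?E n (b k) + (\<integral>\<omega>. \<bar>?d (X 0 \<omega>)\<bar> \<partial>M) + (\<integral>\<omega>. \<bar>?d (X 0 \<omega>)\<bar> \<partial>M)"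
    proof -
      have "(\<integral>\<omega>. \<bar>emp_mean (\<lambda>t. X t \<omega>) n ?d\<bar> \<partial>M) \<le> (\<integral>\<omega>. \<bar>?d (X 0 \<omega>)\<bar> \<partial>M)"
        by (rule m(2)[OF _ id]) measurable
      then show ?thesis using integral_abs_bound[of M "\<lambda>\<omega>. ?d (X 0 \<omega>)"] by linarith
    qed
    finally show ?thesis by simp
  qed
  obtain n0 where n0: "\<And>n. n \<ge> n0 \<Longrightarrow> norm (?E n (b k) - 0) < e / 3"
    using LIMSEQ_D[OF L1_lln_bounded[of "b k" "real k"], of "e / 3"] bb e by auto
  have "norm (?E n g - 0) < e" if "n \<ge> n0" for n
  proof -
    have "0 \<le> ?E n g" by simp
    then show ?thesis using le[of n] n0[OF that] k by simp
  qed
  then show "\<exists>n0. \<forall>n\<ge>n0. norm (?E n g - 0) < e" by blast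
qed

lemma L1_lln:
  fixes g :: "'x \<Rightarrow> 'b::euclidean_space"
  assumes [measurable]: "g \<in> borel_measurable borel" and i: "integrable M (\<lambda>\<omega>. g (X 0 \<omega>))"
  shows "(\<lambda>n. \<integral>\<omega>. norm (emp_mean (\<lambda>t. X t \<omega>) n g - (\<integral>\<omega>. g (X 0 \<omega>) \<partial>M)) \<partial>M) \<longlonglongrightarrow> 0"
    and "integrable M (\<lambda>\<omega>. emp_mean (\<lambda>t. X t \<omega>) n g)"
proof -
  have it: "integrable M (\<lambda>\<omega>. g (X t \<omega>))" for t using i integrable_comp_iff[of g t] by simp
  show im: "integrable M (\<lambda>\<omega>. emp_mean (\<lambda>t. X t \<omega>) n g)" for n unfolding emp_mean_def using it by auto
  let ?D = "\<lambda>n \<omega>. emp_mean (\<lambda>t. X t \<omega>) n g - (\<integral>\<omega>. g (X 0 \<omega>) \<partial>M)"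
  have Db: "?D n \<omega> \<bullet> b = emp_mean (\<lambda>t. X t \<omega>) n (\<lambda>x. g x \<bullet> b) - (\<integral>\<omega>. g (X 0 \<omega>) \<bullet> b \<partial>M)" for n \<omega> b
    using i by (simp add: inner_diff_left emp_mean_inner_left)
  have "(\<integral>\<omega>. norm (?D n \<omega>) \<partial>M) \<le> (\<integral>\<omega>. (\<Sum>b\<in>Basis. \<bar>?D n \<omega> \<bullet> b\<bar>) \<partial>M)" for n
    by (rule integral_mono) (use im norm_le_l1 in auto)
  also have "(\<integral>\<omega>. (\<Sum>b\<in>Basis. \<bar>?D n \<omega> \<bullet> b\<bar>) \<partial>M) = (\<Sum>b\<in>Basis. \<integral>\<omega>. \<bar>?D n \<omega> \<bullet> b\<bar> \<partial>M)" for n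
    using im by (intro Bochner_Integration.integral_sum) auto
  finally have le: "(\<integral>\<omega>. norm (?D n \<omega>) \<partial>M) \<le> (\<Sum>b\<in>Basis. \<integral>\<omega>. \<bar>?D n \<omega> \<bullet> b\<bar> \<partial>M)" for n .
  have "(\<lambda>n. \<Sum>b\<in>Basis. \<integral>\<omega>. \<bar>?D n \<omega> \<bullet> b\<bar> \<partial>M) \<longlonglongrightarrow> (\<Sum>b\<in>(Basis::'b set). 0)"
    unfolding Db by (intro tendsto_sum L1_lln_real) (use i in auto)
  then have lim: "(\<lambda>n. \<Sum>b\<in>Basis. \<integral>\<omega>. \<bar>?D n \<omega> \<bullet> b\<bar> \<partial>M) \<longlonglongrightarrow> 0" by simp
  show "(\<lambda>n. \<integral>\<omega>. norm (?D n \<omega>) \<partial>M) \<longlonglongrightarrow> 0"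
    by (rule tendsto_sandwich[OF _ _ tendsto_const lim]) (use le in auto)
qed

text \<open>One subsequence serves all \<open>g i\<close> without a diagonal argument: the
  deviations, truncated at 1, are merged with geometric weights into a single variable
  \<open>U n\<close>, and L1 convergence of \<open>U\<close> yields an almost surely convergent
  subsequence.\<close>

lemma lln_subseq:
  fixes g :: "nat \<Rightarrow> 'x \<Rightarrow> 'b::euclidean_space"
  assumes [measurable]: "\<And>i. g i \<in> borel_measurable borel"
    and i: "\<And>i. integrable M (\<lambda>\<omega>. g i (X 0 \<omega>))" and r: "strict_mono (r :: nat \<Rightarrow> nat)"
  shows "\<exists>s :: nat \<Rightarrow> nat. strict_mono s \<and> (AE \<omega> in M. \<forall>i.
    (\<lambda>k. emp_mean (\<lambda>t. X t \<omega>) (r (s k)) (g i)) \<longlonglongrightarrow> (\<integral>\<omega>. g i (X 0 \<omega>) \<partial>M))"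
proof -
  define D where "D i n \<omega> = norm (emp_mean (\<lambda>t. X t \<omega>) n (g i) - (\<integral>\<omega>. g i (X 0 \<omega>) \<partial>M))" for i n \<omega>
  have D0: "0 \<le> D i n \<omega>" for i n \<omega> by (simp add: D_def)
  have [measurable]: "D i n \<in> borel_measurable M" for i n unfolding D_def by measurable
  have iD: "integrable M (D i n)" for i n
    unfolding D_def using L1_lln(2)[of "g i" n] i by auto
  have lD: "(\<lambda>n. \<integral>\<omega>. D i n \<omega> \<partial>M) \<longlonglongrightarrow> 0" for i
    unfolding D_def by (rule L1_lln) (use i in auto)
  \<comment> \<open>The number of terms grows with \<open>n\<close>: the sum stays finite and still
    controls \<open>D i n\<close> as soon as \<open>i \<le> n\<close>.\<close>
  define U where "U n \<omega> = (\<Sum>j\<le>n. (1/2) ^ j * min 1 (D j n \<omega>))" for n \<omega>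
  have imin: "integrable M (\<lambda>\<omega>. min 1 (D j n \<omega>))" for j n
    by (rule integrable_const_bound[of _ 1]) (use D0 in auto)
  have iU: "integrable M (U n)" for n
    unfolding U_def by (intro Bochner_Integration.integrable_sum integrable_mult_right imin)
  have U0: "0 \<le> U n \<omega>" for n \<omega> unfolding U_def using D0 by (intro sum_nonneg) auto
  have "(\<lambda>n. \<integral>\<omega>. U n \<omega> \<partial>M) \<longlonglongrightarrow> 0"
  proof (rule LIMSEQ_I)
    fix e :: real assume e: "e > 0"
    \<comment> \<open>Indices beyond \<open>J\<close> contribute at most \<open>(1/2) ^ J\<close>
      for every \<open>n\<close>; the finitely many others tend to 0.\<close>
    obtain J where J: "(1/2) ^ J < e / 4"
      using real_arch_pow_inv[of "e / 4" "1/2"] e by auto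
    have "(\<lambda>n. \<Sum>j\<le>J. \<integral>\<omega>. D j n \<omega> \<partial>M) \<longlonglongrightarrow> (\<Sum>j\<le>J. 0)" by (intro tendsto_sum lD)
    then have "\<forall>\<^sub>F n in sequentially. (\<Sum>j\<le>J. \<integral>\<omega>. D j n \<omega> \<partial>M) < e / 2"
      using e by (intro order_tendstoD) auto
    then obtain n0 where n0: "\<And>n. n \<ge> n0 \<Longrightarrow> (\<Sum>j\<le>J. \<integral>\<omega>. D j n \<omega> \<partial>M) < e / 2"
      unfolding eventually_sequentially by blast
    have "norm ((\<integral>\<omega>. U n \<omega> \<partial>M) - 0) < e" if n: "n \<ge> max n0 J" for n
    proof -
      let ?E = "\<lambda>j. \<integral>\<omega>. (1/2) ^ j * min 1 (D j n \<omega>) \<partial>M"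
      have "(\<integral>\<omega>. U n \<omega> \<partial>M) = (\<Sum>j\<le>n. ?E j)"
        unfolding U_def using imin by (intro Bochner_Integration.integral_sum) auto
      also have "{..n} = {..J} \<union> {Suc J..n}" using n by auto
      also have "(\<Sum>j\<in>{..J} \<union> {Suc J..n}. ?E j) = (\<Sum>j\<le>J. ?E j) + (\<Sum>j=Suc J..n. ?E j)"
        by (intro sum.union_disjoint) auto
      also have "(\<Sum>j\<le>J. ?E j) \<le> (\<Sum>j\<le>J. \<integral>\<omega>. D j n \<omega> \<partial>M)"
      proof (intro sum_mono integral_mono)
        fix j \<omega>
        have "(1/2) ^ j * min 1 (D j n \<omega>) \<le> 1 * D j n \<omega>"
          using D0[of j n \<omega>] by (intro mult_mono) (auto simp: power_le_one)
        then show "(1/2) ^ j * min 1 (D j n \<omega>) \<le> D j n \<omega>" by simp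
      qed (use imin iD in auto)
      also have "(\<Sum>j=Suc J..n. ?E j) \<le> (\<Sum>j=Suc J..n. (1/2) ^ j)"
      proof (intro sum_mono)
        fix j
        have "?E j \<le> (\<integral>\<omega>. (1/2) ^ j \<partial>M)"
          by (rule integral_mono) (use imin in auto)
        then show "?E j \<le> (1/2) ^ j" by (simp add: prob_space)
      qed
      also have "(\<Sum>j=Suc J..n. (1/2) ^ j) \<le> (1/2::real) ^ J"
        by (subst sum_gp) (auto simp: field_simps)
      finally have "(\<integral>\<omega>. U n \<omega> \<partial>M) < e" using n0[of n] n J e by simp
      moreover have "0 \<le> (\<integral>\<omega>. U n \<omega> \<partial>M)" using U0 by simp
      ultimately show ?thesis by simp
    qed
    then show "\<exists>n0. \<forall>n\<ge>n0. norm ((\<integral>\<omega>. U n \<omega> \<partial>M) - 0) < e" by blast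
  qed
  then have "(\<lambda>k. \<integral>\<omega>. U (r k) \<omega> \<partial>M) \<longlonglongrightarrow> 0"
    using LIMSEQ_subseq_LIMSEQ[OF _ r] by (simp add: o_def)
  then have "(\<lambda>k. \<integral>\<omega>. norm (U (r k) \<omega>) \<partial>M) \<longlonglongrightarrow> 0" using U0 by simp
  then obtain s where s: "strict_mono s" "AE \<omega> in M. (\<lambda>k. U (r (s k)) \<omega>) \<longlonglongrightarrow> 0"
    using tendsto_L1_AE_subseq[of M "\<lambda>k. U (r k)"] iU by auto
  have "(\<lambda>k. emp_mean (\<lambda>t. X t \<omega>) (r (s k)) (g i)) \<longlonglongrightarrow> (\<integral>\<omega>. g i (X 0 \<omega>) \<partial>M)"
    if U: "(\<lambda>k. U (r (s k)) \<omega>) \<longlonglongrightarrow> 0" for i \<omega>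
  proof -
    let ?n = "\<lambda>k. r (s k)"
    have sm: "strict_mono ?n" using r s(1) by (auto simp: strict_mono_def)
    have ev: "\<forall>\<^sub>F k in sequentially. (1/2) ^ i * min 1 (D i (?n k) \<omega>) \<le> U (?n k) \<omega>"
      using eventually_ge_at_top[of i]
    proof eventually_elim
      case (elim k)
      have "i \<le> ?n k" using elim seq_suble[OF sm, of k] by linarith
      then show ?case unfolding U_def using D0 by (intro member_le_sum) auto
    qed
    have "(\<lambda>k. (1/2) ^ i * min 1 (D i (?n k) \<omega>)) \<longlonglongrightarrow> 0"
      by (rule tendsto_sandwich[OF _ ev tendsto_const U]) (use D0 in auto)
    then have "(\<lambda>k. 2 ^ i * ((1/2) ^ i * min 1 (D i (?n k) \<omega>))) \<longlonglongrightarrow> 2 ^ i * 0" by (intro tendsto_intros)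
    then have m: "(\<lambda>k. min 1 (D i (?n k) \<omega>)) \<longlonglongrightarrow> 0" by (simp add: power_divide)
    then have "\<forall>\<^sub>F k in sequentially. min 1 (D i (?n k) \<omega>) < 1" by (rule order_tendstoD) simp
    then have "\<forall>\<^sub>F k in sequentially. min 1 (D i (?n k) \<omega>) = D i (?n k) \<omega>" by eventually_elim auto
    then have "(\<lambda>k. D i (?n k) \<omega>) \<longlonglongrightarrow> 0" using m by (rule Lim_transform_eventually[rotated])
    then show ?thesis unfolding D_def by (simp add: tendsto_norm_zero_iff LIM_zero_iff)
  qed
  then show ?thesis using s by (intro exI[of _ s]) auto
qed

end

text \<open>\<open>emp_mean\<close> averages the observations \<open>1..n\<close>, the central limit
  theorem those with index below \<open>n\<close>; the shift reconciles the two.\<close>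

lemma (in prob_space) indep_vars_Suc:
  assumes "indep_vars (\<lambda>_. N) X (UNIV :: nat set)"
  shows "indep_vars (\<lambda>_. N) (\<lambda>i. X (Suc i)) UNIV"
proof -
  let ?F = "\<lambda>i. {X i -` A \<inter> space M |A. A \<in> sets N}"
  have rv: "random_variable N (X i)" and ind: "indep_sets ?F UNIV" for i
    using assms by (auto simp: indep_vars_def2)
  have "indep_sets (\<lambda>i. ?F (Suc i)) UNIV"
    unfolding indep_sets_def
  proof (intro conjI ballI allI impI)
    show "?F (Suc i) \<subseteq> events" for i using ind by (auto simp: indep_sets_def)
    fix J :: "nat set" and A
    assume J: "J \<noteq> {}" "finite J" and A: "A \<in> (\<Pi> i\<in>J. ?F (Suc i))"
    let ?B = "\<lambda>j. A (j - 1)"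
    have B: "?B \<in> (\<Pi> j\<in>Suc ` J. ?F j)" using A by (auto simp: Pi_iff)
    have "prob (\<Inter>j\<in>Suc ` J. ?B j) = (\<Prod>j\<in>Suc ` J. prob (?B j))"
      by (rule ind[unfolded indep_sets_def, THEN conjunct2, rule_format, OF subset_UNIV _ _ B]) (use J in auto)
    then show "prob (\<Inter>j\<in>J. A j) = (\<Prod>j\<in>J. prob (A j))"
      by (simp add: prod.reindex)
  qed
  then show ?thesis using rv by (simp add: indep_vars_def2)
qed

context iid_sequence begin

text \<open>The real function \<open>e\<close> has another codomain than the family
  \<open>F\<close>; pairing it with every member lets \<open>lln_subseq\<close> treat both along one
  subsequence.\<close>

lemma lln_subseq_set:
  fixes F :: "('x \<Rightarrow> 'b::euclidean_space) set"
  assumes F: "countable F" "F \<noteq> {}" "\<And>f. f \<in> F \<Longrightarrow> f \<in> borel_measurable borel"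
      "\<And>f. f \<in> F \<Longrightarrow> integrable M (\<lambda>\<omega>. f (X 0 \<omega>))"
    and e: "e \<in> borel_measurable borel" "integrable M (\<lambda>\<omega>. e (X 0 \<omega>) :: real)"
    and r: "strict_mono (r :: nat \<Rightarrow> nat)"
  shows "\<exists>s :: nat \<Rightarrow> nat. strict_mono s \<and> (AE \<omega> in M.
    (\<forall>f\<in>F. (\<lambda>k. emp_mean (\<lambda>t. X t \<omega>) (r (s k)) f) \<longlonglongrightarrow> (\<integral>\<omega>. f (X 0 \<omega>) \<partial>M)) \<and>
    (\<lambda>k. emp_mean (\<lambda>t. X t \<omega>) (r (s k)) e) \<longlonglongrightarrow> (\<integral>\<omega>. e (X 0 \<omega>) \<partial>M))"
proof -
  define g where "g i x = (from_nat_into F i x, e x)" for i x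
  have fF: "from_nat_into F i \<in> F" for i using F(2) by (rule from_nat_into)
  note F(3)[OF fF, measurable] e(1)[measurable]
  have gm: "g i \<in> borel_measurable borel" for i unfolding g_def by measurable
  have gi: "integrable M (\<lambda>\<omega>. g i (X 0 \<omega>))" for i
  proof -
    have "bounded_linear (\<lambda>v :: 'b. (v, 0 :: real))" "bounded_linear (\<lambda>v :: real. (0 :: 'b, v))"
      by (simp_all add: bounded_linear_Pair bounded_linear_ident bounded_linear_zero)
    from Bochner_Integration.integrable_add[OF integrable_bounded_linear[OF this(1) F(4)[OF fF]]
        integrable_bounded_linear[OF this(2) e(2)]]
    have "integrable M (\<lambda>\<omega>. (from_nat_into F i (X 0 \<omega>), 0) + (0, e (X 0 \<omega>)))" .
    then show ?thesis by (simp add: g_def)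
  qed
  from lln_subseq[of g, OF gm gi r] obtain s :: "nat \<Rightarrow> nat" where s: "strict_mono s"
    "AE \<omega> in M. \<forall>i. (\<lambda>k. emp_mean (\<lambda>t. X t \<omega>) (r (s k)) (g i)) \<longlonglongrightarrow> (\<integral>\<omega>. g i (X 0 \<omega>) \<partial>M)" by blast
  have lin: "linear (fst :: 'b \<times> real \<Rightarrow> 'b)" "linear (snd :: 'b \<times> real \<Rightarrow> real)"
    by (simp_all add: linear_fst linear_snd)
  have "AE \<omega> in M. (\<forall>f\<in>F. (\<lambda>k. emp_mean (\<lambda>t. X t \<omega>) (r (s k)) f) \<longlonglongrightarrow> (\<integral>\<omega>. f (X 0 \<omega>) \<partial>M)) \<and>
    (\<lambda>k. emp_mean (\<lambda>t. X t \<omega>) (r (s k)) e) \<longlonglongrightarrow> (\<integral>\<omega>. e (X 0 \<omega>) \<partial>M)"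
    using s(2)
  proof eventually_elim
    case (elim \<omega>)
    have 1: "(\<lambda>k. fst (emp_mean (\<lambda>t. X t \<omega>) (r (s k)) (g i))) \<longlonglongrightarrow> fst (\<integral>\<omega>. g i (X 0 \<omega>) \<partial>M)"
      and 2: "(\<lambda>k. snd (emp_mean (\<lambda>t. X t \<omega>) (r (s k)) (g i))) \<longlonglongrightarrow> snd (\<integral>\<omega>. g i (X 0 \<omega>) \<partial>M)" for i
      using elim by (auto intro: tendsto_fst tendsto_snd)
    have "(\<lambda>k. emp_mean (\<lambda>t. X t \<omega>) (r (s k)) f) \<longlonglongrightarrow> (\<integral>\<omega>. f (X 0 \<omega>) \<partial>M)" if f: "f \<in> F" for f
    proof -
      obtain i where i: "from_nat_into F i = f"
        using f F(1) from_nat_into_surj by metis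
      show ?thesis
        using 1[of i] integral_bounded_linear[OF bounded_linear_fst gi[of i]]
        by (simp add: emp_mean_linear[OF lin(1)] g_def i)
    qed
    moreover have "(\<lambda>k. emp_mean (\<lambda>t. X t \<omega>) (r (s k)) e) \<longlonglongrightarrow> (\<integral>\<omega>. e (X 0 \<omega>) \<partial>M)"
      using 2[of 0] integral_bounded_linear[OF bounded_linear_snd gi[of 0]]
      by (simp add: emp_mean_linear[OF lin(2)] g_def)
    ultimately show ?case by blast
  qed
  then show ?thesis using s(1) by blast
qed

text \<open>The bound is uniform in \<open>n\<close>, and this is what turns a relative error bound
  into convergence in probability. It is an inequality because of \<open>n = 0\<close>, where the
  left side is 0.\<close>

lemma second_moment_emp_mean:
  fixes g :: "'x \<Rightarrow> 'b::euclidean_space"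
  assumes [measurable]: "g \<in> borel_measurable borel"
    and mean: "(\<integral>\<omega>. g (X 0 \<omega>) \<partial>M) = 0" and sq: "integrable M (\<lambda>\<omega>. (norm (g (X 0 \<omega>)))\<^sup>2)"
  shows "integrable M (\<lambda>\<omega>. (sqrt n * norm (emp_mean (\<lambda>t. X t \<omega>) n g))\<^sup>2)"
    and "(\<integral>\<omega>. (sqrt n * norm (emp_mean (\<lambda>t. X t \<omega>) n g))\<^sup>2 \<partial>M) \<le> (\<integral>\<omega>. (norm (g (X 0 \<omega>)))\<^sup>2 \<partial>M)"
proof -
  have nsq: "(norm v)\<^sup>2 = (\<Sum>b\<in>Basis. (v \<bullet> b)\<^sup>2)" for v :: 'b
    unfolding power2_norm_eq_inner by (subst euclidean_inner) (simp add: power2_eq_square)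
  have ig: "integrable M (\<lambda>\<omega>. g (X 0 \<omega>))"
  proof -
    have "integrable M (\<lambda>\<omega>. norm (g (X 0 \<omega>)))"
      by (rule square_integrable_imp_integrable[OF _ sq]) measurable
    then show ?thesis by (subst (asm) integrable_norm_iff) measurable
  qed
  have sqb: "integrable M (\<lambda>\<omega>. (g (X 0 \<omega>) \<bullet> b)\<^sup>2)" if "b \<in> Basis" for b
  proof (rule Bochner_Integration.integrable_bound[OF sq])
    show "AE \<omega> in M. norm ((g (X 0 \<omega>) \<bullet> b)\<^sup>2) \<le> norm ((norm (g (X 0 \<omega>)))\<^sup>2)"
      using Basis_le_norm[OF that] by (auto intro!: power_mono simp: abs_le_square_iff[symmetric])
  qed measurable
  have meanb: "(\<integral>\<omega>. g (X 0 \<omega>) \<bullet> b \<partial>M) = 0" for b using ig mean by simp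
  have e: "(sqrt n * norm (emp_mean (\<lambda>t. X t \<omega>) n g))\<^sup>2 = (\<Sum>b\<in>Basis. (\<Sum>t=1..n. g (X t \<omega>) \<bullet> b)\<^sup>2 / n)" for \<omega>
  proof -
    have "(sqrt n * norm (emp_mean (\<lambda>t. X t \<omega>) n g))\<^sup>2 = n * (\<Sum>b\<in>Basis. (emp_mean (\<lambda>t. X t \<omega>) n g \<bullet> b)\<^sup>2)"
      by (simp add: power_mult_distrib nsq)
    also have "\<dots> = (\<Sum>b\<in>Basis. n * ((\<Sum>t=1..n. g (X t \<omega>) \<bullet> b) / n)\<^sup>2)"
      by (simp add: sum_distrib_left emp_mean_inner_left) (simp add: emp_mean_def)
    also have "\<dots> = (\<Sum>b\<in>Basis. (\<Sum>t=1..n. g (X t \<omega>) \<bullet> b)\<^sup>2 / n)"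
      by (intro sum.cong refl) (cases "n = 0"; simp add: power2_eq_square)
    finally show ?thesis .
  qed
  note sm = second_moment_sum[of "\<lambda>x. g x \<bullet> b" for b, OF _ meanb sqb]
  show "integrable M (\<lambda>\<omega>. (sqrt n * norm (emp_mean (\<lambda>t. X t \<omega>) n g))\<^sup>2)"
    unfolding e by (intro Bochner_Integration.integrable_sum integrable_divide sm(1)) auto
  have "(\<integral>\<omega>. (sqrt n * norm (emp_mean (\<lambda>t. X t \<omega>) n g))\<^sup>2 \<partial>M)
      = (\<Sum>b\<in>Basis. \<integral>\<omega>. (\<Sum>t=1..n. g (X t \<omega>) \<bullet> b)\<^sup>2 / n \<partial>M)"
    unfolding e by (intro Bochner_Integration.integral_sum integrable_divide sm(1)) auto
  also have "\<dots> = (\<Sum>b\<in>Basis. real n * (\<integral>\<omega>. (g (X 0 \<omega>) \<bullet> b)\<^sup>2 \<partial>M) / n)"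
  proof (intro sum.cong refl)
    fix b :: 'b assume b: "b \<in> Basis"
    show "(\<integral>\<omega>. (\<Sum>t=1..n. g (X t \<omega>) \<bullet> b)\<^sup>2 / n \<partial>M) = real n * (\<integral>\<omega>. (g (X 0 \<omega>) \<bullet> b)\<^sup>2 \<partial>M) / n"
      using sm(2)[of b "{1..n}"] b by simp
  qed
  also have "\<dots> \<le> (\<Sum>b\<in>Basis. \<integral>\<omega>. (g (X 0 \<omega>) \<bullet> b)\<^sup>2 \<partial>M)"
    by (intro sum_mono) (cases "n = 0"; simp)
  also have "\<dots> = (\<integral>\<omega>. (norm (g (X 0 \<omega>)))\<^sup>2 \<partial>M)"
    unfolding nsq by (intro Bochner_Integration.integral_sum[symmetric] sqb)
  finally show "(\<integral>\<omega>. (sqrt n * norm (emp_mean (\<lambda>t. X t \<omega>) n g))\<^sup>2 \<partial>M) \<le> (\<integral>\<omega>. (norm (g (X 0 \<omega>)))\<^sup>2 \<partial>M)" .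
qed

text \<open>Direction and scale are absorbed into \<open>g\<close>, so the characteristic function
  is only evaluated at 1. Zero variance is a case of its own, since the sums cannot be standardised;
  then \<open>g\<close> vanishes almost surely along the whole sample.\<close>

lemma clt_char:
  fixes g :: "'x \<Rightarrow> real"
  assumes [measurable]: "g \<in> borel_measurable borel"
    and mean: "(\<integral>\<omega>. g (X 0 \<omega>) \<partial>M) = 0" and sq: "integrable M (\<lambda>\<omega>. (g (X 0 \<omega>))\<^sup>2)"
  shows "(\<lambda>n. \<integral>\<omega>. cis (sqrt n * emp_mean (\<lambda>t. X t \<omega>) n g) \<partial>M) \<longlonglongrightarrow> exp (- (\<integral>\<omega>. (g (X 0 \<omega>))\<^sup>2 \<partial>M) / 2)"
proof -
  let ?v = "\<integral>\<omega>. (g (X 0 \<omega>))\<^sup>2 \<partial>M"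
  have sq': "integrable M (\<lambda>\<omega>. (g (X t \<omega>))\<^sup>2)" for t
    using sq integrable_comp_iff[of "\<lambda>x. (g x)\<^sup>2" t] by simp
  have v': "(\<integral>\<omega>. (g (X t \<omega>))\<^sup>2 \<partial>M) = ?v" for t
    by (rule expectation_comp[of "\<lambda>x. (g x)\<^sup>2"]) measurable
  have mean': "(\<integral>\<omega>. g (X t \<omega>) \<partial>M) = 0" for t
    using expectation_comp[of g t] mean by simp
  have v0: "0 \<le> ?v" by simp
  show ?thesis
  proof (cases "?v = 0")
    case True
    have "AE \<omega> in M. g (X t \<omega>) = 0" for t
      using integral_nonneg_eq_0_iff_AE[OF sq', of t] v'[of t] True by simp
    then have ae: "AE \<omega> in M. \<forall>t. g (X t \<omega>) = 0" by (simp add: AE_all_countable)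
    have "(\<integral>\<omega>. cis (sqrt n * emp_mean (\<lambda>t. X t \<omega>) n g) \<partial>M) = (\<integral>\<omega>. 1 \<partial>M)" for n
    proof (rule integral_cong_AE)
      show "AE \<omega> in M. cis (sqrt n * emp_mean (\<lambda>t. X t \<omega>) n g) = 1"
        using ae by eventually_elim (simp add: emp_mean_def)
      show "(\<lambda>\<omega>. cis (sqrt n * emp_mean (\<lambda>t. X t \<omega>) n g)) \<in> borel_measurable M" by measurable
    qed simp
    then show ?thesis using True by (simp add: prob_space)
  next
    case False
    define \<sigma> where "\<sigma> = sqrt ?v"
    have \<sigma>: "\<sigma> > 0" "\<sigma>\<^sup>2 = ?v" using False v0 by (simp_all add: \<sigma>_def less_le)
    let ?Y = "\<lambda>i \<omega>. g (X (Suc i) \<omega>)"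
    let ?S = "\<lambda>n \<omega>. (\<Sum>i<n. ?Y i \<omega>) / sqrt (real n * \<sigma>\<^sup>2)"
    have "indep_vars (\<lambda>_. borel) ?Y UNIV"
      by (rule indep_vars_Suc[OF indep_vars_compose2[OF indep]]) auto
    moreover have "variance (?Y i) = \<sigma>\<^sup>2" for i using mean'[of "Suc i"] v'[of "Suc i"] \<sigma>(2) by simp
    moreover have "distr M borel (?Y i) = distr M borel (\<lambda>\<omega>. g (X 0 \<omega>))" for i
      by (rule distr_comp) measurable
    ultimately have w: "weak_conv_m (\<lambda>n. distr M borel (?S n)) std_normal_distribution"
      using mean' \<sigma>(1) sq' by (intro central_limit_theorem_zero_mean)
    \<comment> \<open>Evaluation at \<open>\<sigma>\<close> undoes the division by the standard
      deviation in \<open>?S n\<close>.\<close>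
    have lim: "(\<lambda>n. Characteristic_Functions.char (distr M borel (?S n)) \<sigma>) \<longlonglongrightarrow> Characteristic_Functions.char std_normal_distribution \<sigma>"
      by (rule levy_continuity1[OF _ real_dist_normal_dist w]) (rule real_distribution_distr, measurable)
    have "Characteristic_Functions.char (distr M borel (?S n)) \<sigma> = (\<integral>\<omega>. cis (sqrt n * emp_mean (\<lambda>t. X t \<omega>) n g) \<partial>M)" for n
    proof -
      have e: "\<sigma> * ?S n \<omega> = sqrt n * emp_mean (\<lambda>t. X t \<omega>) n g" for \<omega>
      proof -
        have "(\<Sum>i<n. ?Y i \<omega>) = (\<Sum>t=1..n. g (X t \<omega>))"
          by (rule sum.reindex_bij_witness[of _ "\<lambda>t. t - 1" Suc]) auto
        moreover have "sqrt n * (1 / real n) = 1 / sqrt n"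
          by (cases "n = 0") (auto simp: field_simps)
        ultimately show ?thesis
          using \<sigma>(1) by (simp add: emp_mean_def real_sqrt_mult) (metis (no_types, lifting) divide_inverse mult.assoc mult.commute mult_1)
      qed
      show ?thesis unfolding Characteristic_Functions.char_def
        by (subst integral_distr) (auto simp: cis_conv_exp e[symmetric])
    qed
    then show ?thesis using lim \<sigma>(2) by (simp add: char_std_normal_distribution)
  qed
qed

end

text \<open>On the event that \<open>V\<close> is at most \<open>K\<close> the bound forces
  \<open>D\<close> to 0 and dominated convergence applies; the complement contributes at most
  \<open>C / K\<^sup>2\<close> by Chebyshev. Since \<open>\<eta>\<close> is chosen after
  \<open>K\<close>, no rate is required.\<close>

lemma (in prob_space) expectation_min_1_tendsto_0:
  fixes D V :: "nat \<Rightarrow> 'a \<Rightarrow> real"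
  assumes [measurable]: "\<And>n. D n \<in> borel_measurable M" "\<And>n. V n \<in> borel_measurable M"
    and D0: "\<And>n \<omega>. 0 \<le> D n \<omega>" and V0: "\<And>n \<omega>. 0 \<le> V n \<omega>"
    and iV: "\<And>n. integrable M (\<lambda>\<omega>. (V n \<omega>)\<^sup>2)" and C: "\<And>n. (\<integral>\<omega>. (V n \<omega>)\<^sup>2 \<partial>M) \<le> C"
    and sub: "\<And>r :: nat \<Rightarrow> nat. strict_mono r \<Longrightarrow> \<exists>s :: nat \<Rightarrow> nat. strict_mono s \<and>
      (AE \<omega> in M. \<forall>\<eta>>0. \<forall>\<^sub>F k in sequentially. D (r (s k)) \<omega> \<le> \<eta> * V (r (s k)) \<omega>)"
  shows "(\<lambda>n. \<integral>\<omega>. min 1 (D n \<omega>) \<partial>M) \<longlonglongrightarrow> 0"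
proof (rule LIMSEQ_subseqI)
  fix r :: "nat \<Rightarrow> nat" assume "strict_mono r"
  then obtain s :: "nat \<Rightarrow> nat" where s: "strict_mono s"
    "AE \<omega> in M. \<forall>\<eta>>0. \<forall>\<^sub>F k in sequentially. D (r (s k)) \<omega> \<le> \<eta> * V (r (s k)) \<omega>"
    using sub by blast
  let ?n = "\<lambda>k. r (s k)"
  have C0: "0 \<le> C" by (rule order_trans[OF _ C[of 0]]) simp
  have imin: "integrable M (\<lambda>\<omega>. min 1 (D n \<omega>))" for n
    by (rule integrable_const_bound[of _ 1]) (use D0 in auto)
  have "(\<lambda>k. \<integral>\<omega>. min 1 (D (?n k) \<omega>) \<partial>M) \<longlonglongrightarrow> 0"
  proof (rule LIMSEQ_I)
    fix e :: real assume e: "e > 0"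
    \<comment> \<open>Chosen so that \<open>C / K\<^sup>2 < e / 2\<close>; the summand 1 makes the
      inequality strict and keeps \<open>K\<close> positive for \<open>C = 0\<close>.\<close>
    define K where "K = sqrt (2 * C / e) + 1"
    have K: "K > 0" "C / K\<^sup>2 < e / 2"
    proof -
      have sq: "0 \<le> sqrt (2 * C / e)" using C0 e by simp
      then show "K > 0" unfolding K_def by linarith
      have "2 * C / e < K\<^sup>2"
      proof -
        have "(sqrt (2 * C / e))\<^sup>2 < K\<^sup>2" unfolding K_def using sq by (intro power_strict_mono) auto
        then show ?thesis using C0 e by simp
      qed
      then show "C / K\<^sup>2 < e / 2" using e \<open>K > 0\<close> by (simp add: field_simps)
    qed
    let ?g = "\<lambda>k \<omega>. if V (?n k) \<omega> \<le> K then min 1 (D (?n k) \<omega>) else 0"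
    have "(\<lambda>k. \<integral>\<omega>. ?g k \<omega> \<partial>M) \<longlonglongrightarrow> (\<integral>\<omega>. 0 \<partial>M)"
    proof (rule integral_dominated_convergence[where w="\<lambda>_. 1"])
      show "AE \<omega> in M. (\<lambda>k. ?g k \<omega>) \<longlonglongrightarrow> 0"
        using s(2)
      proof eventually_elim
        case (elim \<omega>)
        show ?case
        proof (rule LIMSEQ_I)
          fix d :: real assume d: "d > 0"
          then have "d / (2 * K) > 0" using K by simp
          with elim have "\<forall>\<^sub>F k in sequentially. D (?n k) \<omega> \<le> d / (2 * K) * V (?n k) \<omega>" by blast
          then have "\<forall>\<^sub>F k in sequentially. norm (?g k \<omega> - 0) < d"
          proof eventually_elim
            case (elim k)
            show ?case
            proof (cases "V (?n k) \<omega> \<le> K")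
              case True
              have "d / (2 * K) * V (?n k) \<omega> \<le> d / (2 * K) * K" using True d K by (intro mult_left_mono) auto
              also have "\<dots> = d / 2" using K by simp
              also have "\<dots> < d" using d by simp
              finally have "D (?n k) \<omega> < d" using elim by linarith
              then show ?thesis using True D0[of "?n k" \<omega>] by (simp add: min_def)
            next
              case False then show ?thesis using d by simp
            qed
          qed
          then show "\<exists>n0. \<forall>k\<ge>n0. norm (?g k \<omega> - 0) < d" by (simp add: eventually_sequentially)
        qed
      qed
    qed (use D0 in auto)
    then have "(\<lambda>k. \<integral>\<omega>. ?g k \<omega> \<partial>M) \<longlonglongrightarrow> 0" by simp
    from LIMSEQ_D[OF this, of "e / 2"] e
    obtain n0 where n0: "\<And>k. k \<ge> n0 \<Longrightarrow> norm ((\<integral>\<omega>. ?g k \<omega> \<partial>M) - 0) < e / 2" by auto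
    have "norm ((\<integral>\<omega>. min 1 (D (?n k) \<omega>) \<partial>M) - 0) < e" if k: "k \<ge> n0" for k
    proof -
      have ig: "integrable M (?g k)" by (rule integrable_const_bound[of _ 1]) (use D0 in auto)
      have "(\<integral>\<omega>. min 1 (D (?n k) \<omega>) \<partial>M) \<le> (\<integral>\<omega>. ?g k \<omega> + (V (?n k) \<omega>)\<^sup>2 / K\<^sup>2 \<partial>M)"
      proof (rule integral_mono)
        fix \<omega>
        show "min 1 (D (?n k) \<omega>) \<le> ?g k \<omega> + (V (?n k) \<omega>)\<^sup>2 / K\<^sup>2"
        proof (cases "V (?n k) \<omega> \<le> K")
          case False
          then have "K\<^sup>2 \<le> (V (?n k) \<omega>)\<^sup>2" using K by (intro power_mono) auto
          then have "1 \<le> (V (?n k) \<omega>)\<^sup>2 / K\<^sup>2" using K by simp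
          then show ?thesis using False by (simp add: min_def)
        qed simp
      qed (use ig imin iV in auto)
      also have "\<dots> = (\<integral>\<omega>. ?g k \<omega> \<partial>M) + (\<integral>\<omega>. (V (?n k) \<omega>)\<^sup>2 \<partial>M) / K\<^sup>2"
        using ig iV by simp
      also have "\<dots> \<le> (\<integral>\<omega>. ?g k \<omega> \<partial>M) + C / K\<^sup>2" using C by (intro add_left_mono divide_right_mono) auto
      finally have "(\<integral>\<omega>. min 1 (D (?n k) \<omega>) \<partial>M) < e" using n0[OF k] K(2)
        by (simp only: diff_0_right real_norm_def)
      moreover have "0 \<le> (\<integral>\<omega>. min 1 (D (?n k) \<omega>) \<partial>M)" using D0 by simp
      ultimately show ?thesis by simp
    qed
    then show "\<exists>n0. \<forall>k\<ge>n0. norm ((\<integral>\<omega>. min 1 (D (?n k) \<omega>) \<partial>M) - 0) < e" by blast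
  qed
  then show "\<exists>s :: nat \<Rightarrow> nat. strict_mono s \<and> (\<lambda>k. \<integral>\<omega>. min 1 (D (r (s k)) \<omega>) \<partial>M) \<longlonglongrightarrow> 0"
    using s(1) by blast
qed

lemma norm_cis_diff_le: "norm (cis a - cis b) \<le> \<bar>a - b\<bar>"
proof -
  have "cis a - cis b = cis b * (cis (a - b) - 1)" by (simp add: cis_mult algebra_simps)
  then have "norm (cis a - cis b) = norm (iexp (a - b) - 1)"
    by (simp add: norm_mult cis_conv_exp)
  also have "\<dots> \<le> \<bar>a - b\<bar>" using iexp_approx1[of "a - b" 0] by simp
  finally show ?thesis .
qed

text \<open>The two exponentials differ by at most 2 and by at most \<open>norm u\<close> times the
  distance of the arguments; the constant \<open>2 + norm u\<close> covers both regimes of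
  \<open>min 1\<close>.\<close>

lemma (in prob_space) char_tendsto_close:
  fixes A B :: "nat \<Rightarrow> 'a \<Rightarrow> 'b::euclidean_space"
  assumes [measurable]: "\<And>n. A n \<in> borel_measurable M" "\<And>n. B n \<in> borel_measurable M"
    and close: "(\<lambda>n. \<integral>\<omega>. min 1 (norm (A n \<omega> - B n \<omega>)) \<partial>M) \<longlonglongrightarrow> 0"
    and lim: "(\<lambda>n. \<integral>\<omega>. cis (u \<bullet> B n \<omega>) \<partial>M) \<longlonglongrightarrow> c"
  shows "(\<lambda>n. \<integral>\<omega>. cis (u \<bullet> A n \<omega>) \<partial>M) \<longlonglongrightarrow> c"
proof -
  have i: "integrable M (\<lambda>\<omega>. cis (u \<bullet> A n \<omega>))" "integrable M (\<lambda>\<omega>. cis (u \<bullet> B n \<omega>))" for n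
    by (auto intro!: integrable_const_bound[of _ 1])
  have le: "norm ((\<integral>\<omega>. cis (u \<bullet> A n \<omega>) \<partial>M) - (\<integral>\<omega>. cis (u \<bullet> B n \<omega>) \<partial>M))
      \<le> (2 + norm u) * (\<integral>\<omega>. min 1 (norm (A n \<omega> - B n \<omega>)) \<partial>M)" for n
  proof -
    have "norm ((\<integral>\<omega>. cis (u \<bullet> A n \<omega>) \<partial>M) - (\<integral>\<omega>. cis (u \<bullet> B n \<omega>) \<partial>M))
        = norm (\<integral>\<omega>. cis (u \<bullet> A n \<omega>) - cis (u \<bullet> B n \<omega>) \<partial>M)"
      using i by simp
    also have "\<dots> \<le> (\<integral>\<omega>. norm (cis (u \<bullet> A n \<omega>) - cis (u \<bullet> B n \<omega>)) \<partial>M)" by (rule integral_norm_bound)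
    also have "\<dots> \<le> (\<integral>\<omega>. (2 + norm u) * min 1 (norm (A n \<omega> - B n \<omega>)) \<partial>M)"
    proof (rule integral_mono)
      fix \<omega>
      have 1: "norm (cis (u \<bullet> A n \<omega>) - cis (u \<bullet> B n \<omega>)) \<le> 2"
        using norm_triangle_ineq4[of "cis (u \<bullet> A n \<omega>)" "cis (u \<bullet> B n \<omega>)"] by simp
      have 2: "norm (cis (u \<bullet> A n \<omega>) - cis (u \<bullet> B n \<omega>)) \<le> norm u * norm (A n \<omega> - B n \<omega>)"
        using norm_cis_diff_le[of "u \<bullet> A n \<omega>" "u \<bullet> B n \<omega>"] Cauchy_Schwarz_ineq2[of u "A n \<omega> - B n \<omega>"]
        by (simp add: inner_diff_right)
      show "norm (cis (u \<bullet> A n \<omega>) - cis (u \<bullet> B n \<omega>)) \<le> (2 + norm u) * min 1 (norm (A n \<omega> - B n \<omega>))"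
      proof (cases "norm (A n \<omega> - B n \<omega>) \<le> 1")
        case True
        then have e: "min 1 (norm (A n \<omega> - B n \<omega>)) = norm (A n \<omega> - B n \<omega>)" by simp
        show ?thesis unfolding distrib_right e using 2 norm_ge_zero[of "A n \<omega> - B n \<omega>"] by linarith
      next
        case False
        then have e: "min 1 (norm (A n \<omega> - B n \<omega>)) = 1" by simp
        show ?thesis unfolding e mult_1_right using 1 norm_ge_zero[of u] by linarith
      qed
    next
      show "integrable M (\<lambda>\<omega>. (2 + norm u) * min 1 (norm (A n \<omega> - B n \<omega>)))"
        by (intro integrable_mult_right integrable_const_bound[of _ 1]) auto
    qed (use i in auto)
    finally show ?thesis by simp
  qed
  have "(\<lambda>n. (2 + norm u) * (\<integral>\<omega>. min 1 (norm (A n \<omega> - B n \<omega>)) \<partial>M)) \<longlonglongrightarrow> (2 + norm u) * 0"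
    by (intro tendsto_intros close)
  then have z: "(\<lambda>n. (2 + norm u) * (\<integral>\<omega>. min 1 (norm (A n \<omega> - B n \<omega>)) \<partial>M)) \<longlonglongrightarrow> 0" by simp
  have "(\<lambda>n. (\<integral>\<omega>. cis (u \<bullet> A n \<omega>) \<partial>M) - (\<integral>\<omega>. cis (u \<bullet> B n \<omega>) \<partial>M)) \<longlonglongrightarrow> 0"
    by (rule Lim_null_comparison[OF always_eventually[OF allI[OF le]] z])
  from tendsto_add[OF this lim] show ?thesis by simp
qed

section \<open>Second-order expansion of the perceptron in its weights\<close>

text \<open>Taylor's formula for \<open>(a + t * b) * tanh (c + t * g)\<close> between
  \<open>t = 0\<close> and \<open>t = 1\<close>. Both \<open>b\<close> and \<open>g\<close> are
  increments, so terms are grouped by their joint degree, and the remainder has degree at least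
  three.\<close>

lemma tanh_expansion:
  fixes a b c g :: real
  defines "T \<equiv> tanh c"
  shows "\<bar>(a + b) * tanh (c + g) - (a * T + (b * T + a * g * (1 - T\<^sup>2)) + (b * g * (1 - T\<^sup>2) - a * g\<^sup>2 * (T * (1 - T\<^sup>2))))\<bar>
     \<le> \<bar>b\<bar> * g\<^sup>2 + (\<bar>a\<bar> + \<bar>b\<bar>) * \<bar>g\<bar> ^ 3"
proof -
  let ?T = "\<lambda>t. tanh (c + t * g)"
  \<comment> \<open>\<open>D m\<close> is the derivative of order \<open>m\<close> in
    \<open>t\<close>, written in terms of \<open>?T\<close> alone because the derivative of
    \<open>tanh\<close> is 1 minus its square; the last branch is the third derivative.\<close>
  define D where "D m t = (if m = 0 then (a + t * b) * ?T t
     else if m = 1 then b * ?T t + (a + t * b) * g * (1 - (?T t)\<^sup>2)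
     else if m = 2 then 2 * b * g * (1 - (?T t)\<^sup>2) - 2 * (a + t * b) * g\<^sup>2 * (?T t * (1 - (?T t)\<^sup>2))
     else - (6 * b * g\<^sup>2 * (?T t * (1 - (?T t)\<^sup>2))) + (a + t * b) * g ^ 3 * ((1 - (?T t)\<^sup>2) * (6 * (?T t)\<^sup>2 - 2)))"
    for m :: nat and t :: real
  have T: "(?T has_real_derivative (1 - (?T t)\<^sup>2) * g) (at t)" for t
    by (auto intro!: derivative_eq_intros simp: cosh_real_nonzero)
  have "\<forall>m t. m < 3 \<and> 0 \<le> t \<and> t \<le> 1 \<longrightarrow> (D m has_real_derivative D (Suc m) t) (at t)"
  proof (intro allI impI, elim conjE)
    fix m :: nat and t :: real assume "m < 3"
    then consider "m = 0" | "m = 1" | "m = 2" by linarith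
    then show "(D m has_real_derivative D (Suc m) t) (at t)"
    proof cases
      case 1 show ?thesis unfolding 1 D_def
        by (auto intro!: derivative_eq_intros T simp: algebra_simps)
    next
      case 2 show ?thesis unfolding 2 D_def
        by (auto intro!: derivative_eq_intros T simp: algebra_simps power2_eq_square)
    next
      case 3 show ?thesis unfolding 3 D_def
        by (auto intro!: derivative_eq_intros T simp: algebra_simps power2_eq_square power3_eq_cube)
    qed
  qed
  then obtain t where t: "0 < t" "t < 1" "D 0 1 = (\<Sum>m<3. D m 0 / fact m * 1 ^ m) + D 3 t / fact 3 * 1 ^ 3"
    using Maclaurin[of 1 3 D "D 0"] by auto
  define S where "S = ?T t"
  have S: "\<bar>S\<bar> \<le> 1" "S\<^sup>2 \<le> 1" using tanh_real_bounds[of "c + t * g"] by (auto simp: S_def abs_le_iff power2_le_iff_abs_le abs_square_le_1)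
  have d: "D 0 1 = (a + b) * tanh (c + g)" "D 0 0 = a * T" "D 1 0 = b * T + a * g * (1 - T\<^sup>2)"
      "D 2 0 = 2 * (b * g * (1 - T\<^sup>2) - a * g\<^sup>2 * (T * (1 - T\<^sup>2)))"
    by (simp_all add: D_def T_def algebra_simps)
  have d2: "D 2 0 / 2 = b * g * (1 - T\<^sup>2) - a * g\<^sup>2 * (T * (1 - T\<^sup>2))"
    unfolding d(4) by (rule nonzero_mult_div_cancel_left) simp
  have "D 0 1 = D 0 0 + D 1 0 + D 2 0 / 2 + D 3 t / 6"
    unfolding t(3) by (simp add: eval_nat_numeral)
  then have "D 0 1 - (D 0 0 + D 1 0 + D 2 0 / 2) = D 3 t / 6" by simp
  then have "(a + b) * tanh (c + g) - (a * T + (b * T + a * g * (1 - T\<^sup>2)) + (b * g * (1 - T\<^sup>2) - a * g\<^sup>2 * (T * (1 - T\<^sup>2)))) = D 3 t / 6"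
    unfolding d(1-3) d2 .
  also have "D 3 t = - (6 * b * g\<^sup>2 * (S * (1 - S\<^sup>2))) + (a + t * b) * g ^ 3 * ((1 - S\<^sup>2) * (6 * S\<^sup>2 - 2))"
    by (simp add: D_def S_def)
  also have "\<bar>\<dots> / 6\<bar> \<le> \<bar>b\<bar> * g\<^sup>2 + (\<bar>a\<bar> + \<bar>b\<bar>) * \<bar>g\<bar> ^ 3"
  proof -
    have 1: "\<bar>S * (1 - S\<^sup>2)\<bar> \<le> 1 * 1" unfolding abs_mult using S by (intro mult_mono) auto
    have S0: "0 \<le> S\<^sup>2" by simp
    have "\<bar>1 - S\<^sup>2\<bar> \<le> 1" "\<bar>6 * S\<^sup>2 - 2\<bar> \<le> 4" using S(2) S0 by linarith+
    then have 2: "\<bar>(1 - S\<^sup>2) * (6 * S\<^sup>2 - 2)\<bar> \<le> 1 * 4" unfolding abs_mult by (intro mult_mono) auto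
    have 3: "\<bar>a + t * b\<bar> \<le> \<bar>a\<bar> + \<bar>b\<bar>"
    proof -
      have "\<bar>t * b\<bar> \<le> 1 * \<bar>b\<bar>" unfolding abs_mult using t by (intro mult_right_mono) auto
      then show ?thesis by linarith
    qed
    have 4: "\<bar>6 * b * g\<^sup>2 * (S * (1 - S\<^sup>2))\<bar> \<le> 6 * (\<bar>b\<bar> * g\<^sup>2)"
      using mult_left_mono[OF 1, of "6 * \<bar>b\<bar> * g\<^sup>2"] by (simp add: abs_mult mult_ac)
    have "\<bar>(a + t * b) * g ^ 3 * ((1 - S\<^sup>2) * (6 * S\<^sup>2 - 2))\<bar> \<le> ((\<bar>a\<bar> + \<bar>b\<bar>) * \<bar>g\<bar> ^ 3) * 4"
      using mult_mono[OF mult_right_mono[OF 3, of "\<bar>g\<bar> ^ 3"] 2] by (simp add: abs_mult power_abs)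
    moreover have "0 \<le> (\<bar>a\<bar> + \<bar>b\<bar>) * \<bar>g\<bar> ^ 3" by simp
    moreover have "\<bar>(- x + y) / 6\<bar> \<le> u + v" if "\<bar>x\<bar> \<le> 6 * u" "\<bar>y\<bar> \<le> v * 4" "0 \<le> v" for x y u v :: real
      using that unfolding abs_le_iff by (elim conjE, intro conjI) (simp_all add: field_simps)
    ultimately show ?thesis using 4 by blast
  qed
  finally show ?thesis .
qed

lemma tanh_lipschitz: "\<bar>tanh x - tanh y\<bar> \<le> \<bar>x - y :: real\<bar>"
proof -
  have "norm (tanh x - tanh y) \<le> 1 * norm (x - y)"
  proof (rule field_differentiable_bound[of UNIV tanh "\<lambda>z. 1 - (tanh z)\<^sup>2"])
    show "(tanh has_field_derivative 1 - (tanh z)\<^sup>2) (at z within UNIV)" for z :: real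
      by (auto intro!: derivative_eq_intros simp: cosh_real_nonzero)
    show "norm (1 - (tanh z)\<^sup>2) \<le> 1" for z :: real
      using tanh_real_bounds[of z] by (auto simp: abs_square_le_1 abs_le_iff)
  qed auto
  then show ?thesis by simp
qed

lemma abs_tanh_le: "\<bar>tanh (x :: real)\<bar> \<le> 1"
  using tanh_real_bounds[of x] by (auto simp: abs_le_iff)

text \<open>The pre-activation of unit \<open>j\<close>. It is linear in the weights, so
  \<open>act h j z\<close> is also its increment in the direction \<open>h\<close>.\<close>

definition act :: "('d::finite, 'h::finite, 'l::finite) weights \<Rightarrow> 'h \<Rightarrow> real^'l \<Rightarrow> real" where
  "act W j z = (\<Sum>k\<in>UNIV. W $ Inr (j, Some k) * z $ k) + W $ Inr (j, None)"

definition mlp_deriv :: "('d::finite, 'h::finite, 'l::finite) weights \<Rightarrow> ('d, 'h, 'l) weights \<Rightarrow> real^'l \<Rightarrow> real^'d" where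
  "mlp_deriv W h z = (\<chi> i. (\<Sum>j\<in>UNIV. h $ Inl (i, Some j) * tanh (act W j z)
     + W $ Inl (i, Some j) * act h j z * (1 - (tanh (act W j z))\<^sup>2)) + h $ Inl (i, None))"

text \<open>The quadratic Taylor term is \<open>mlp_deriv2 W h h z\<close>, that is half of the
  second derivative. The form is bilinear but not symmetric: in its mixed part \<open>h\<close>
  moves the outgoing and \<open>h'\<close> the incoming weights.\<close>

definition mlp_deriv2 :: "('d::finite, 'h::finite, 'l::finite) weights \<Rightarrow> ('d, 'h, 'l) weights \<Rightarrow>
    ('d, 'h, 'l) weights \<Rightarrow> real^'l \<Rightarrow> real^'d" where
  "mlp_deriv2 W h h' z = (\<chi> i. \<Sum>j\<in>UNIV. h $ Inl (i, Some j) * act h' j z * (1 - (tanh (act W j z))\<^sup>2)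
     - W $ Inl (i, Some j) * (act h j z * act h' j z) * (tanh (act W j z) * (1 - (tanh (act W j z))\<^sup>2)))"

lemma mlp_act: "mlp W z = (\<chi> i. (\<Sum>j\<in>UNIV. W $ Inl (i, Some j) * tanh (act W j z)) + W $ Inl (i, None))"
  by (simp add: mlp_def act_def)

lemma act_add: "act (W + V) j z = act W j z + act V j z"
  by (simp add: act_def sum.distrib algebra_simps)

lemma act_diff: "act (W - V) j z = act W j z - act V j z"
  by (simp add: act_def sum_subtractf algebra_simps)

lemma act_scaleR: "act (c *\<^sub>R W) j z = c * act W j z"
  by (simp add: act_def sum_distrib_left algebra_simps)

lemma abs_act_le:
  fixes W :: "('d::finite, 'h::finite, 'l::finite) weights"
  shows "\<bar>act W j z\<bar> \<le> real (CARD('l) + 1) * norm W * (1 + norm z)"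
proof -
  have "\<bar>W $ Inr (j, Some k) * z $ k\<bar> \<le> norm W * norm z" for k
    unfolding abs_mult by (intro mult_mono component_le_norm_cart) auto
  then have "\<bar>\<Sum>k\<in>UNIV. W $ Inr (j, Some k) * z $ k\<bar> \<le> (\<Sum>k\<in>(UNIV::'l set). norm W * norm z)"
    by (intro sum_abs[THEN order_trans] sum_mono)
  also have "\<dots> = real CARD('l) * (norm W * norm z)" by simp
  finally have "\<bar>act W j z\<bar> \<le> real CARD('l) * (norm W * norm z) + norm W"
    unfolding act_def using component_le_norm_cart[of W "Inr (j, None)"] by linarith
  also have "\<dots> \<le> real (CARD('l) + 1) * norm W * (1 + norm z)"
    by (simp add: algebra_simps)
  finally show ?thesis .
qed

lemma norm_le_sum_components:
  fixes x :: "real^'n"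
  assumes "\<And>i. \<bar>x $ i\<bar> \<le> c"
  shows "norm x \<le> real CARD('n) * c"
proof -
  have "norm x \<le> (\<Sum>i\<in>UNIV. \<bar>x $ i\<bar>)" by (rule norm_le_l1_cart)
  also have "\<dots> \<le> (\<Sum>i\<in>(UNIV::'n set). c)" by (intro sum_mono assms)
  finally show ?thesis by simp
qed

lemma abs_sum_le_card:
  fixes f :: "'h::finite \<Rightarrow> real"
  assumes "\<And>j. \<bar>f j\<bar> \<le> c"
  shows "\<bar>\<Sum>j\<in>UNIV. f j\<bar> \<le> real CARD('h) * c"
proof -
  have "\<bar>\<Sum>j\<in>UNIV. f j\<bar> \<le> (\<Sum>j\<in>(UNIV::'h set). c)"
    by (intro sum_abs[THEN order_trans] sum_mono assms)
  then show ?thesis by simp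
qed

lemma norm_mlp_le:
  fixes W :: "('d::finite, 'h::finite, 'l::finite) weights"
  shows "norm (mlp W z) \<le> real CARD('d) * (real CARD('h) * norm W + norm W)"
proof (rule norm_le_sum_components)
  fix i
  have "\<bar>W $ Inl (i, Some j) * tanh (act W j z)\<bar> \<le> norm W" for j
    using mult_mono[OF component_le_norm_cart[of W "Inl (i, Some j)"] abs_tanh_le[of "act W j z"]]
    by (simp add: abs_mult)
  from abs_sum_le_card[of "\<lambda>j. W $ Inl (i, Some j) * tanh (act W j z)", OF this]
  show "\<bar>mlp W z $ i\<bar> \<le> real CARD('h) * norm W + norm W"
    using component_le_norm_cart[of W "Inl (i, None)"] unfolding mlp_act vec_lambda_beta by linarith
qed

text \<open>Change the outgoing weights first, then the incoming ones: in the first part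
  \<open>tanh\<close> is bounded by 1, in the second it is 1-Lipschitz and multiplied by weights of
  \<open>V\<close>. This is why a bound on \<open>V\<close> alone suffices.\<close>

lemma mlp_lipschitz:
  fixes V W :: "('d::finite, 'h::finite, 'l::finite) weights"
  defines "K \<equiv> real (CARD('l) + 1)"
  assumes R: "norm V \<le> R"
  shows "norm (mlp W z - mlp V z) \<le> real CARD('d) * (real CARD('h) * (1 + R * K) + 1) * ((1 + norm z) * norm (W - V))"
proof -
  let ?e = "norm (W - V)"
  have R0: "0 \<le> R" using R norm_ge_zero[of V] by linarith
  have K1: "K \<ge> 1" by (simp add: K_def)
  have "norm (mlp W z - mlp V z) \<le> real CARD('d) * (real CARD('h) * (?e + R * (K * ?e * (1 + norm z))) + ?e)"
  proof (rule norm_le_sum_components)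
    fix i
    let ?t = "\<lambda>j. W $ Inl (i, Some j) * tanh (act W j z) - V $ Inl (i, Some j) * tanh (act V j z)"
    have "\<bar>?t j\<bar> \<le> ?e + R * (K * ?e * (1 + norm z))" for j
    proof -
      have "?t j = (W - V) $ Inl (i, Some j) * tanh (act W j z) + V $ Inl (i, Some j) * (tanh (act W j z) - tanh (act V j z))"
        by (simp add: algebra_simps)
      moreover have "\<bar>(W - V) $ Inl (i, Some j) * tanh (act W j z)\<bar> \<le> ?e * 1"
        unfolding abs_mult by (intro mult_mono component_le_norm_cart abs_tanh_le) auto
      moreover have "\<bar>V $ Inl (i, Some j) * (tanh (act W j z) - tanh (act V j z))\<bar> \<le> R * (K * ?e * (1 + norm z))"
        unfolding abs_mult
      proof (rule mult_mono)
        show "\<bar>V $ Inl (i, Some j)\<bar> \<le> R" using component_le_norm_cart[of V] R by (rule order_trans)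
        have "\<bar>tanh (act W j z) - tanh (act V j z)\<bar> \<le> \<bar>act (W - V) j z\<bar>"
          unfolding act_diff by (rule tanh_lipschitz)
        then show "\<bar>tanh (act W j z) - tanh (act V j z)\<bar> \<le> K * ?e * (1 + norm z)"
          using abs_act_le[of "W - V" j z] unfolding K_def by linarith
      qed (use R0 in auto)
      ultimately show ?thesis by linarith
    qed
    from abs_sum_le_card[of ?t, OF this]
    have "\<bar>(\<Sum>j\<in>UNIV. ?t j) + (W - V) $ Inl (i, None)\<bar> \<le> real CARD('h) * (?e + R * (K * ?e * (1 + norm z))) + ?e"
      using component_le_norm_cart[of "W - V" "Inl (i, None)"] by linarith
    then show "\<bar>(mlp W z - mlp V z) $ i\<bar> \<le> real CARD('h) * (?e + R * (K * ?e * (1 + norm z))) + ?e"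
      by (simp add: mlp_act sum_subtractf algebra_simps)
  qed
  also have "\<dots> \<le> real CARD('d) * (real CARD('h) * ((1 + norm z) * ?e + R * (K * ?e * (1 + norm z))) + (1 + norm z) * ?e)"
    by (intro mult_left_mono add_mono order_refl) (auto simp: mult_le_cancel_right1)
  also have "\<dots> = real CARD('d) * (real CARD('h) * (1 + R * K) + 1) * ((1 + norm z) * ?e)"
    by (simp add: algebra_simps)
  finally show ?thesis .
qed

lemma mlp_deriv_bound:
  fixes W :: "('d::finite, 'h::finite, 'l::finite) weights"
  shows "\<exists>C\<ge>0. \<forall>h z. norm (mlp_deriv W h z) \<le> C * ((1 + norm z) * norm h)"
proof -
  define K where "K = real (CARD('l) + 1)"
  have ah: "\<bar>act h j z\<bar> \<le> K * norm h * (1 + norm z)" for h :: "('d, 'h, 'l) weights" and j z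
    unfolding K_def by (rule abs_act_le)
  define C where "C = real CARD('d) * (real CARD('h) * (1 + norm W * K) + 1)"
  have "norm (mlp_deriv W h z) \<le> C * ((1 + norm z) * norm h)" for h z
  proof -
    let ?T = "\<lambda>j. tanh (act W j z)"
    have "norm (mlp_deriv W h z) \<le> real CARD('d) * (real CARD('h) * (norm h + norm W * (K * norm h * (1 + norm z))) + norm h)"
    proof (rule norm_le_sum_components)
      fix i
      let ?t = "\<lambda>j. h $ Inl (i, Some j) * ?T j + W $ Inl (i, Some j) * act h j z * (1 - (?T j)\<^sup>2)"
      have "\<bar>?t j\<bar> \<le> norm h + norm W * (K * norm h * (1 + norm z))" for j
      proof -
        have s: "\<bar>1 - (?T j)\<^sup>2\<bar> \<le> 1" using abs_tanh_le[of "act W j z"] by (simp add: abs_le_iff abs_square_le_1)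
        have "\<bar>h $ Inl (i, Some j) * ?T j\<bar> \<le> norm h * 1"
          unfolding abs_mult by (intro mult_mono component_le_norm_cart abs_tanh_le) auto
        moreover have "\<bar>W $ Inl (i, Some j) * act h j z * (1 - (?T j)\<^sup>2)\<bar> \<le> norm W * (K * norm h * (1 + norm z)) * 1"
          unfolding abs_mult
          by (intro mult_mono component_le_norm_cart ah s) (auto simp: K_def)
        ultimately show ?thesis by linarith
      qed
      from abs_sum_le_card[of ?t, OF this]
      show "\<bar>mlp_deriv W h z $ i\<bar> \<le> real CARD('h) * (norm h + norm W * (K * norm h * (1 + norm z))) + norm h"
        unfolding mlp_deriv_def vec_lambda_beta using component_le_norm_cart[of h "Inl (i, None)"] by linarith
    qed
    also have "\<dots> \<le> real CARD('d) * (real CARD('h) * ((1 + norm z) * norm h + norm W * (K * norm h * (1 + norm z))) + (1 + norm z) * norm h)"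
      by (intro mult_left_mono add_mono order_refl) (auto simp: mult_le_cancel_right1)
    also have "\<dots> = C * ((1 + norm z) * norm h)" by (simp add: C_def algebra_simps)
    finally show ?thesis .
  qed
  moreover have "C \<ge> 0" by (simp add: C_def K_def)
  ultimately show ?thesis by blast
qed

lemma mlp_deriv2_bound:
  fixes W :: "('d::finite, 'h::finite, 'l::finite) weights"
  shows "\<exists>C\<ge>0. \<forall>h h' z. norm (mlp_deriv2 W h h' z) \<le> C * ((1 + norm z)\<^sup>2 * norm h * norm h')"
proof -
  define K where "K = real (CARD('l) + 1)"
  have ah: "\<bar>act h j z\<bar> \<le> K * norm h * (1 + norm z)" for h :: "('d, 'h, 'l) weights" and j z
    unfolding K_def by (rule abs_act_le)
  define C where "C = real CARD('d) * (real CARD('h) * (K + norm W * K * K))"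
  have "norm (mlp_deriv2 W h h' z) \<le> C * ((1 + norm z)\<^sup>2 * norm h * norm h')" for h h' z
  proof -
    let ?T = "\<lambda>j. tanh (act W j z)" let ?z = "1 + norm z"
    have z1: "?z \<le> ?z\<^sup>2" using self_le_power[of ?z 2] by simp
    have "norm (mlp_deriv2 W h h' z) \<le> real CARD('d) * (real CARD('h) * (norm h * (K * norm h' * ?z) + norm W * ((K * norm h * ?z) * (K * norm h' * ?z))))"
    proof (rule norm_le_sum_components)
      fix i
      let ?t = "\<lambda>j. h $ Inl (i, Some j) * act h' j z * (1 - (?T j)\<^sup>2) - W $ Inl (i, Some j) * (act h j z * act h' j z) * (?T j * (1 - (?T j)\<^sup>2))"
      have "\<bar>?t j\<bar> \<le> norm h * (K * norm h' * ?z) + norm W * ((K * norm h * ?z) * (K * norm h' * ?z))" for j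
      proof -
        have s: "\<bar>1 - (?T j)\<^sup>2\<bar> \<le> 1" using abs_tanh_le[of "act W j z"] by (simp add: abs_le_iff abs_square_le_1)
        have "\<bar>h $ Inl (i, Some j) * act h' j z * (1 - (?T j)\<^sup>2)\<bar> \<le> norm h * (K * norm h' * ?z) * 1"
          unfolding abs_mult
          by (intro mult_mono component_le_norm_cart ah s) (auto simp: K_def)
        moreover have "\<bar>W $ Inl (i, Some j) * (act h j z * act h' j z) * (?T j * (1 - (?T j)\<^sup>2))\<bar>
            \<le> norm W * ((K * norm h * ?z) * (K * norm h' * ?z)) * (1 * 1)"
          unfolding abs_mult
          by (intro mult_mono component_le_norm_cart ah s abs_tanh_le) (auto simp: K_def)
        ultimately show ?thesis by linarith
      qed
      from abs_sum_le_card[of ?t, OF this]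
      show "\<bar>mlp_deriv2 W h h' z $ i\<bar> \<le> real CARD('h) * (norm h * (K * norm h' * ?z) + norm W * ((K * norm h * ?z) * (K * norm h' * ?z)))"
        unfolding mlp_deriv2_def vec_lambda_beta .
    qed
    also have "\<dots> \<le> real CARD('d) * (real CARD('h) * (norm h * (K * norm h' * ?z\<^sup>2) + norm W * ((K * norm h * ?z) * (K * norm h' * ?z))))"
      by (intro mult_left_mono add_mono order_refl z1) (auto simp: K_def)
    also have "\<dots> = C * (?z\<^sup>2 * norm h * norm h')" by (simp add: C_def power2_eq_square algebra_simps)
    finally show ?thesis .
  qed
  moreover have "C \<ge> 0" by (simp add: C_def K_def)
  ultimately show ?thesis by blast
qed

text \<open>\<open>tanh_expansion\<close> summed over the units; the restriction on \<open>h\<close>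
  serves to replace \<open>\<bar>a\<bar> + \<bar>b\<bar>\<close> by
  \<open>norm W + 1\<close>.\<close>

lemma mlp_expansion:
  fixes W :: "('d::finite, 'h::finite, 'l::finite) weights"
  shows "\<exists>C\<ge>0. \<forall>h z. norm h \<le> 1 \<longrightarrow>
    norm (mlp (W + h) z - (mlp W z + mlp_deriv W h z + mlp_deriv2 W h h z)) \<le> C * ((1 + norm z) ^ 3 * norm h ^ 3)"
proof -
  define K where "K = real (CARD('l) + 1)"
  have ah: "\<bar>act h j z\<bar> \<le> K * norm h * (1 + norm z)" for h :: "('d, 'h, 'l) weights" and j z
    unfolding K_def by (rule abs_act_le)
  have K: "K \<ge> 1" by (simp add: K_def)
  define C where "C = real CARD('d) * (real CARD('h) * (K\<^sup>2 + (norm W + 1) * K ^ 3))"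
  have "norm (mlp (W + h) z - (mlp W z + mlp_deriv W h z + mlp_deriv2 W h h z)) \<le> C * ((1 + norm z) ^ 3 * norm h ^ 3)"
    if h: "norm h \<le> 1" for h z
  proof -
    let ?T = "\<lambda>j. tanh (act W j z)" let ?z = "1 + norm z"
    have "norm (mlp (W + h) z - (mlp W z + mlp_deriv W h z + mlp_deriv2 W h h z))
      \<le> real CARD('d) * (real CARD('h) * (norm h * (K * norm h * ?z)\<^sup>2 + (norm W + 1) * (K * norm h * ?z) ^ 3))"
    proof (rule norm_le_sum_components)
      fix i
      let ?a = "\<lambda>j. W $ Inl (i, Some j)" let ?b = "\<lambda>j. h $ Inl (i, Some j)"
      let ?g = "\<lambda>j. act h j z"
      let ?t = "\<lambda>j. (?a j + ?b j) * tanh (act W j z + ?g j) - (?a j * ?T j + (?b j * ?T j + ?a j * ?g j * (1 - (?T j)\<^sup>2))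
         + (?b j * ?g j * (1 - (?T j)\<^sup>2) - ?a j * (?g j)\<^sup>2 * (?T j * (1 - (?T j)\<^sup>2))))"
      have "\<bar>?t j\<bar> \<le> norm h * (K * norm h * ?z)\<^sup>2 + (norm W + 1) * (K * norm h * ?z) ^ 3" for j
      proof -
        have g: "\<bar>?g j\<bar> \<le> K * norm h * ?z" by (rule ah)
        have b: "\<bar>?b j\<bar> \<le> norm h" "\<bar>?a j\<bar> \<le> norm W" by (rule component_le_norm_cart)+
        have "\<bar>?t j\<bar> \<le> \<bar>?b j\<bar> * (?g j)\<^sup>2 + (\<bar>?a j\<bar> + \<bar>?b j\<bar>) * \<bar>?g j\<bar> ^ 3" by (rule tanh_expansion)
        also have "\<dots> = \<bar>?b j\<bar> * \<bar>?g j\<bar>\<^sup>2 + (\<bar>?a j\<bar> + \<bar>?b j\<bar>) * \<bar>?g j\<bar> ^ 3" by simp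
        also have "\<dots> \<le> norm h * (K * norm h * ?z)\<^sup>2 + (norm W + 1) * (K * norm h * ?z) ^ 3"
          using b g h by (intro add_mono mult_mono power_mono) auto
        finally show ?thesis .
      qed
      from abs_sum_le_card[of ?t, OF this]
      show "\<bar>(mlp (W + h) z - (mlp W z + mlp_deriv W h z + mlp_deriv2 W h h z)) $ i\<bar>
          \<le> real CARD('h) * (norm h * (K * norm h * ?z)\<^sup>2 + (norm W + 1) * (K * norm h * ?z) ^ 3)"
        by (simp add: mlp_act mlp_deriv_def mlp_deriv2_def act_add sum.distrib sum_subtractf power2_eq_square)
    qed
    also have "\<dots> = real CARD('d) * (real CARD('h) * (K\<^sup>2 * ?z\<^sup>2 * norm h ^ 3 + (norm W + 1) * (K ^ 3 * ?z ^ 3 * norm h ^ 3)))"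
      by (simp add: power_mult_distrib power2_eq_square power3_eq_cube mult_ac)
    also have "\<dots> \<le> real CARD('d) * (real CARD('h) * (K\<^sup>2 * ?z ^ 3 * norm h ^ 3 + (norm W + 1) * (K ^ 3 * ?z ^ 3 * norm h ^ 3)))"
      by (intro mult_left_mono mult_right_mono add_mono order_refl power_increasing) auto
    also have "\<dots> = C * (?z ^ 3 * norm h ^ 3)" by (simp add: C_def algebra_simps)
    finally show ?thesis .
  qed
  moreover have "C \<ge> 0" using K by (simp add: C_def)
  ultimately show ?thesis by blast
qed

text \<open>No restriction on \<open>g\<close>: up to size 1 the second-order expansion applies, and
  beyond it the Lipschitz bound is already below \<open>g\<^sup>2\<close>.\<close>

lemma tanh_expansion1:
  fixes a b c g :: real
  shows "\<bar>(a + b) * tanh (c + g) - (a * tanh c + (b * tanh c + a * g * (1 - (tanh c)\<^sup>2)))\<bar> \<le> \<bar>b\<bar> * \<bar>g\<bar> + 2 * \<bar>a\<bar> * g\<^sup>2"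
proof -
  let ?T = "tanh c" let ?r = "tanh (c + g) - ?T - g * (1 - ?T\<^sup>2)"
  have T0: "0 \<le> ?T\<^sup>2" "?T\<^sup>2 \<le> 1" using abs_tanh_le[of c] by (simp_all add: abs_square_le_1)
  then have T2: "\<bar>1 - ?T\<^sup>2\<bar> \<le> 1" by linarith
  have T: "\<bar>?T * (1 - ?T\<^sup>2)\<bar> \<le> 1 * 1"
    unfolding abs_mult by (intro mult_mono abs_tanh_le T2) auto
  have r: "\<bar>?r\<bar> \<le> 2 * g\<^sup>2"
  proof (cases "\<bar>g\<bar> \<le> 1")
    case True
    have "\<bar>?r + g\<^sup>2 * (?T * (1 - ?T\<^sup>2))\<bar> \<le> \<bar>g\<bar> ^ 3"
      using tanh_expansion[of 1 0 c g] by simp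
    moreover have "\<bar>g\<bar> ^ 3 \<le> g\<^sup>2" using power_decreasing[of 2 3 "\<bar>g\<bar>"] True by simp
    moreover have "\<bar>g\<^sup>2 * (?T * (1 - ?T\<^sup>2))\<bar> \<le> g\<^sup>2"
      using mult_left_mono[OF T, of "g\<^sup>2"] by (simp add: abs_mult)
    ultimately show ?thesis by linarith
  next
    case False
    have "\<bar>tanh (c + g) - ?T\<bar> \<le> \<bar>g\<bar>" using tanh_lipschitz[of "c + g" c] by simp
    moreover have "\<bar>g * (1 - ?T\<^sup>2)\<bar> \<le> \<bar>g\<bar>" using mult_left_mono[OF T2, of "\<bar>g\<bar>"] by (simp add: abs_mult)
    moreover have "\<bar>g\<bar> \<le> g\<^sup>2" using False self_le_power[of "\<bar>g\<bar>" 2] by simp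
    ultimately show ?thesis by linarith
  qed
  have "(a + b) * tanh (c + g) - (a * ?T + (b * ?T + a * g * (1 - ?T\<^sup>2))) = b * (tanh (c + g) - ?T) + a * ?r"
    by (simp add: algebra_simps)
  moreover have "\<bar>b * (tanh (c + g) - ?T)\<bar> \<le> \<bar>b\<bar> * \<bar>g\<bar>"
    using mult_left_mono[OF tanh_lipschitz[of "c + g" c], of "\<bar>b\<bar>"] by (simp add: abs_mult)
  moreover have "\<bar>a * ?r\<bar> \<le> 2 * \<bar>a\<bar> * g\<^sup>2"
    using mult_left_mono[OF r, of "\<bar>a\<bar>"] by (simp add: abs_mult)
  ultimately show ?thesis by linarith
qed

text \<open>The remainder grows only quadratically in \<open>z\<close>. In
  \<open>res_prod_expansion\<close> it is multiplied by factors linear in \<open>z\<close>; the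
  second-order remainder in its place would call for a fourth moment of the input.\<close>

lemma mlp_expansion1:
  fixes W :: "('d::finite, 'h::finite, 'l::finite) weights"
  shows "\<exists>C\<ge>0. \<forall>h z. norm (mlp (W + h) z - (mlp W z + mlp_deriv W h z)) \<le> C * ((1 + norm z)\<^sup>2 * (norm h)\<^sup>2)"
proof -
  define K where "K = real (CARD('l) + 1)"
  have K: "K \<ge> 1" by (simp add: K_def)
  have ah: "\<bar>act h j z\<bar> \<le> K * norm h * (1 + norm z)" for h :: "('d, 'h, 'l) weights" and j z
    unfolding K_def by (rule abs_act_le)
  define C where "C = real CARD('d) * (real CARD('h) * (K + 2 * norm W * K\<^sup>2))"
  have "norm (mlp (W + h) z - (mlp W z + mlp_deriv W h z)) \<le> C * ((1 + norm z)\<^sup>2 * (norm h)\<^sup>2)" for h z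
  proof -
    let ?T = "\<lambda>j. tanh (act W j z)" let ?z = "1 + norm z"
    have z1: "?z \<le> ?z\<^sup>2" using self_le_power[of ?z 2] by simp
    have "norm (mlp (W + h) z - (mlp W z + mlp_deriv W h z))
      \<le> real CARD('d) * (real CARD('h) * (norm h * (K * norm h * ?z) + 2 * norm W * (K * norm h * ?z)\<^sup>2))"
    proof (rule norm_le_sum_components)
      fix i
      let ?a = "\<lambda>j. W $ Inl (i, Some j)" let ?b = "\<lambda>j. h $ Inl (i, Some j)"
      let ?g = "\<lambda>j. act h j z"
      let ?t = "\<lambda>j. (?a j + ?b j) * tanh (act W j z + ?g j) - (?a j * ?T j + (?b j * ?T j + ?a j * ?g j * (1 - (?T j)\<^sup>2)))"
      have "\<bar>?t j\<bar> \<le> norm h * (K * norm h * ?z) + 2 * norm W * (K * norm h * ?z)\<^sup>2" for j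
      proof -
        have g: "\<bar>?g j\<bar> \<le> K * norm h * ?z" by (rule ah)
        have b: "\<bar>?b j\<bar> \<le> norm h" "\<bar>?a j\<bar> \<le> norm W" by (rule component_le_norm_cart)+
        have "\<bar>?t j\<bar> \<le> \<bar>?b j\<bar> * \<bar>?g j\<bar> + 2 * \<bar>?a j\<bar> * (?g j)\<^sup>2" by (rule tanh_expansion1)
        also have "\<dots> = \<bar>?b j\<bar> * \<bar>?g j\<bar> + 2 * \<bar>?a j\<bar> * \<bar>?g j\<bar>\<^sup>2" by simp
        also have "\<dots> \<le> norm h * (K * norm h * ?z) + 2 * norm W * (K * norm h * ?z)\<^sup>2"
          using b g by (intro add_mono mult_mono power_mono) auto
        finally show ?thesis .
      qed
      from abs_sum_le_card[of ?t, OF this]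
      show "\<bar>(mlp (W + h) z - (mlp W z + mlp_deriv W h z)) $ i\<bar>
          \<le> real CARD('h) * (norm h * (K * norm h * ?z) + 2 * norm W * (K * norm h * ?z)\<^sup>2)"
        by (simp add: mlp_act mlp_deriv_def act_add sum.distrib sum_subtractf)
    qed
    also have "\<dots> \<le> real CARD('d) * (real CARD('h) * (norm h * (K * norm h * ?z\<^sup>2) + 2 * norm W * (K * norm h * ?z)\<^sup>2))"
      by (intro mult_left_mono add_mono order_refl z1) (auto simp: K_def)
    also have "\<dots> = C * (?z\<^sup>2 * (norm h)\<^sup>2)" by (simp add: C_def power_mult_distrib power2_eq_square algebra_simps)
    finally show ?thesis .
  qed
  moreover have "C \<ge> 0" using K by (simp add: C_def)
  ultimately show ?thesis by blast
qed

lemma linear_mlp_deriv: "linear (\<lambda>h. mlp_deriv W h z)"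
  by (rule linearI)
    (simp_all add: vec_eq_iff mlp_deriv_def act_add act_scaleR algebra_simps sum.distrib sum_subtractf sum_distrib_left)

lemma bilinear_mlp_deriv2: "bilinear (\<lambda>h h'. mlp_deriv2 W h h' z)"
  unfolding bilinear_def
  by (intro conjI allI linearI)
    (simp_all add: vec_eq_iff mlp_deriv2_def act_add act_scaleR algebra_simps sum.distrib sum_subtractf sum_distrib_left)

lemma continuous_act: "continuous_on UNIV (act W j)"
  unfolding act_def by (intro continuous_intros)

lemma measurable_mlp [measurable]: "mlp W \<in> borel_measurable borel"
  by (rule borel_measurable_continuous_onI)
    (auto simp: mlp_act[abs_def] intro!: continuous_intros continuous_act)

lemma measurable_mlp_deriv [measurable]: "mlp_deriv W h \<in> borel_measurable borel"
  by (rule borel_measurable_continuous_onI)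
    (auto simp: mlp_deriv_def[abs_def] intro!: continuous_intros continuous_act)

lemma measurable_mlp_deriv2 [measurable]: "mlp_deriv2 W h h' \<in> borel_measurable borel"
  by (rule borel_measurable_continuous_onI)
    (auto simp: mlp_deriv2_def[abs_def] intro!: continuous_intros continuous_act)

lemma mlp_partial_eq: "mlp_partial W k z = mlp_deriv W (axis k 1) z"
proof -
  let ?h = "axis k 1 :: ('a, 'b, 'c) weights"
  have "((\<lambda>t. mlp (W + t *\<^sub>R ?h) z) has_vector_derivative mlp_deriv W ?h z) (at 0)"
    unfolding has_vector_derivative_def
  proof (subst has_derivative_componentwise_within, intro ballI)
    fix b :: "real^'a" assume "b \<in> Basis"
    then obtain i where b: "b = axis i 1" by (auto simp: Basis_vec_def)
    have "((\<lambda>t. mlp (W + t *\<^sub>R ?h) z $ i) has_real_derivative mlp_deriv W ?h z $ i) (at 0)"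
      unfolding mlp_act mlp_deriv_def vec_lambda_beta
      by (auto intro!: derivative_eq_intros sum.cong simp: act_add act_scaleR cosh_real_nonzero algebra_simps)
    then show "((\<lambda>t. mlp (W + t *\<^sub>R ?h) z \<bullet> b) has_derivative (\<lambda>t. (t *\<^sub>R mlp_deriv W ?h z) \<bullet> b)) (at 0)"
      by (simp add: b inner_axis has_field_derivative_def mult_commute_abs)
  qed
  then show ?thesis unfolding mlp_partial_def by (rule vector_derivative_at)
qed

section \<open>Symmetries\<close>

lemma mlp_unit_transform:
  assumes \<pi>: "bij \<pi>" and \<sigma>: "\<And>j. \<sigma> j \<in> {1, -1}"
  shows "mlp (unit_transform \<pi> \<sigma> W) = mlp W"
proof
  fix z
  have a: "act (unit_transform \<pi> \<sigma> W) j z = \<sigma> j * act W (\<pi> j) z" for j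
    by (simp add: act_def unit_transform_def sum_distrib_left algebra_simps)
  have s: "s * w * tanh (s * x) = w * tanh x" if "s \<in> {1, -1}" for s w x :: real
    using that by auto
  have "(\<Sum>j\<in>UNIV. W $ Inl (i, Some (\<pi> j)) * tanh (act W (\<pi> j) z)) = (\<Sum>j\<in>UNIV. W $ Inl (i, Some j) * tanh (act W j z))" for i
    using sum.reindex_bij_betw[of \<pi> UNIV UNIV] \<pi> by simp
  then show "mlp (unit_transform \<pi> \<sigma> W) z = mlp W z"
    by (simp add: mlp_act vec_eq_iff a) (simp add: unit_transform_def s[OF \<sigma>])
qed

lemma weight_equiv_mlp: "weight_equiv V W \<Longrightarrow> mlp W = mlp V"
  unfolding weight_equiv_def using mlp_unit_transform by blast

lemma unit_transform_inverse:
  assumes \<pi>: "bij \<pi>" and \<sigma>: "\<And>j. \<sigma> j \<in> {1, -1}"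
  shows "unit_transform (inv \<pi>) (\<sigma> \<circ> inv \<pi>) (unit_transform \<pi> \<sigma> V) = V"
proof -
  have i: "\<pi> (inv \<pi> j) = j" for j using \<pi> by (simp add: bij_is_surj surj_f_inv_f)
  have s: "s * (s * x) = x" if "s \<in> {1, -1}" for s x :: real using that by auto
  show ?thesis
    unfolding vec_eq_iff unit_transform_def
    by (auto split: sum.split option.split prod.split simp: i s[OF \<sigma>])
qed

lemma weight_equiv_sym:
  assumes "weight_equiv V W" shows "weight_equiv W V"
proof -
  obtain \<pi> \<sigma> where *: "bij \<pi>" "\<And>j. \<sigma> j \<in> {1, -1}" "W = unit_transform \<pi> \<sigma> V"
    using assms unfolding weight_equiv_def by blast
  show ?thesis unfolding weight_equiv_def
    using unit_transform_inverse[where \<sigma>=\<sigma> and V=V, OF *(1,2)] * bij_imp_bij_inv[OF *(1)]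
    by (intro exI[of _ "inv \<pi>"] exI[of _ "\<sigma> \<circ> inv \<pi>"]) auto
qed

lemma continuous_unit_transform: "continuous_on UNIV (unit_transform \<pi> \<sigma>)"
  unfolding unit_transform_def[abs_def]
proof (intro continuous_on_vec_lambda)
  fix q :: "('a, 'b, 'c) weight_index"
  have c: "continuous_on UNIV (\<lambda>W :: ('a, 'b, 'c) weights. c * W $ r)" for c r
    by (intro continuous_intros)
  have c1: "continuous_on UNIV (\<lambda>W :: ('a, 'b, 'c) weights. W $ r)" for r
    by (intro continuous_intros)
  consider i where "q = Inl (i, None)" | i j where "q = Inl (i, Some j)" | j k where "q = Inr (j, k)"
    by (metis option.exhaust surj_pair sumE)
  then show "continuous_on UNIV (\<lambda>W. case q of Inl (i, None) \<Rightarrow> W $ Inl (i, None)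
     | Inl (i, Some j) \<Rightarrow> \<sigma> j * W $ Inl (i, Some (\<pi> j))
     | Inr (j, k) \<Rightarrow> \<sigma> j * W $ Inr (\<pi> j, k))"
    by cases (simp_all add: c c1)
qed

section \<open>Minimisers of perturbed quadratic forms\<close>

lemma outer_prod_vector_mult: "outer_prod u v *v y = (v \<bullet> y) *\<^sub>R u"
  by (simp add: outer_prod_def matrix_vector_mult_def vec_eq_iff inner_vec_def sum_distrib_left sum_distrib_right mult_ac)

lemma norm_outer_prod: "norm (outer_prod u v) = norm u * norm v"
proof -
  have "(norm (outer_prod u v))\<^sup>2 = outer_prod u v \<bullet> outer_prod u v" by (simp add: power2_norm_eq_inner)
  also have "\<dots> = (norm u * norm v)\<^sup>2"
    unfolding inner_outer_prod[of "outer_prod u v"] by (simp add: outer_prod_vector_mult power_mult_distrib power2_norm_eq_inner)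
  finally show ?thesis by (metis norm_ge_zero mult_nonneg_nonneg power2_eq_imp_eq)
qed

lemma bilinear_outer_prod: "bilinear outer_prod"
  unfolding bilinear_def by (intro conjI allI linearI) (simp_all add: outer_prod_def vec_eq_iff algebra_simps)

lemma bounded_bilinear_outer_prod: "bounded_bilinear outer_prod"
  using bilinear_outer_prod bilinear_conv_bounded_bilinear by blast

interpretation outer_prod: bounded_bilinear outer_prod
  by (rule bounded_bilinear_outer_prod)

lemma measurable_outer_prod [measurable]:
  fixes f :: "'x \<Rightarrow> real^'m" and g :: "'x \<Rightarrow> real^'n"
  assumes "f \<in> borel_measurable N" "g \<in> borel_measurable N"
  shows "(\<lambda>x. outer_prod (f x) (g x)) \<in> borel_measurable N"
proof -
  have "continuous_on UNIV (\<lambda>p :: (real^'m) \<times> (real^'n). outer_prod (fst p) (snd p))"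
    by (rule outer_prod.continuous_on[OF continuous_on_fst[OF continuous_on_id] continuous_on_snd[OF continuous_on_id]])
  from borel_measurable_continuous_Pair[OF assms this] show ?thesis by simp
qed

lemma abs_inner_outer_prod_le: "\<bar>G \<bullet> outer_prod u v\<bar> \<le> norm G * (norm u * norm v)"
  using Cauchy_Schwarz_ineq2[of G "outer_prod u v"] by (simp add: norm_outer_prod)

lemma inner_outer_prod_commute:
  assumes "transpose G = G" shows "G \<bullet> outer_prod u v = G \<bullet> outer_prod v u"
  unfolding inner_outer_prod using inner_matrix_transpose[of v G u] by (simp add: assms inner_commute)

lemma pos_def_lower_bound:
  fixes A :: "real^'n^'n"
  assumes "pos_def A"
  obtains c where "c > 0" "\<And>x :: real^'n. c * (norm x)\<^sup>2 \<le> x \<bullet> (A *v x)"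
proof -
  have "continuous_on (sphere 0 1) (\<lambda>x. x \<bullet> (A *v x))"
    by (intro continuous_intros linear_continuous_on matrix_vector_mul_bounded_linear)
  moreover have "axis undefined 1 \<in> sphere (0::real^'n) 1" by (simp add: norm_axis_1)
  then have "sphere (0::real^'n) 1 \<noteq> {}" by blast
  ultimately obtain y where y: "y \<in> sphere 0 1" "\<And>x. x \<in> sphere 0 1 \<Longrightarrow> y \<bullet> (A *v y) \<le> x \<bullet> (A *v x)"
    using continuous_attains_inf[of "sphere 0 1" "\<lambda>x. x \<bullet> (A *v x)"] by auto
  have "y \<noteq> 0" using y(1) by auto
  then have "y \<bullet> (A *v y) > 0" using assms by (auto simp: pos_def_def)
  moreover have "y \<bullet> (A *v y) * (norm x)\<^sup>2 \<le> x \<bullet> (A *v x)" for x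
  proof (cases "x = 0")
    case False
    define u where "u = x /\<^sub>R norm x"
    have "u \<in> sphere 0 1" using False by (simp add: u_def)
    then have "y \<bullet> (A *v y) * (norm x)\<^sup>2 \<le> u \<bullet> (A *v u) * (norm x)\<^sup>2" by (intro mult_right_mono y(2)) auto
    also have "\<dots> = x \<bullet> (A *v x)"
      using False by (simp add: u_def matrix_vector_mult_scaleR power2_eq_square field_simps)
    finally show ?thesis .
  qed simp
  ultimately show ?thesis using that by blast
qed

text \<open>Only values of \<open>Q\<close> at two points are compared. Against 0 the comparison
  gives the rate \<open>norm (h k) \<le> a * m k\<close>. Against the minimiser \<open>g\<close> of
  the exact quadratic it bounds \<open>(h - g) \<bullet> (A *v (h - g))\<close>, the excess of the
  quadratic at \<open>h\<close> over its minimum, by a null sequence times the square of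
  \<open>m k\<close>. Convergence of \<open>h\<close> to 0 is what allows the cubic error to be
  absorbed.\<close>

lemma argmin_perturbed_quadratic:
  fixes A :: "real^'n^'n" and h s :: "nat \<Rightarrow> real^'n" and m \<kappa> c :: "nat \<Rightarrow> real" and Q :: "nat \<Rightarrow> real^'n \<Rightarrow> real"
  assumes A: "pos_def A"
    and err: "\<And>k x. norm x \<le> 1 \<Longrightarrow> \<bar>Q k x - (x \<bullet> (A *v x) - 2 * (x \<bullet> s k))\<bar> \<le> \<kappa> k * ((norm x)\<^sup>2 + norm x * m k) + c k * norm x ^ 3"
    and \<kappa>: "\<kappa> \<longlonglongrightarrow> 0" "\<And>k. 0 \<le> \<kappa> k" and c: "c \<longlonglongrightarrow> c0" "\<And>k. 0 \<le> c k"
    and m: "m \<longlonglongrightarrow> 0" "\<And>k. 0 \<le> m k" and s: "\<And>k. norm (s k) \<le> B * m k" and B: "B \<ge> 0"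
    and h: "h \<longlonglongrightarrow> 0"
    and opt0: "\<forall>\<^sub>F k in sequentially. Q k (h k) \<le> 0"
    and opt: "\<forall>\<^sub>F k in sequentially. Q k (h k) \<le> Q k (matrix_inv A *v s k)"
    and \<eta>: "\<eta> > 0"
  shows "\<forall>\<^sub>F k in sequentially. norm (h k - matrix_inv A *v s k) \<le> \<eta> * m k"
proof -
  obtain l where l: "l > 0" "\<And>x :: real^'n. l * (norm x)\<^sup>2 \<le> x \<bullet> (A *v x)" using pos_def_lower_bound[OF A] by metis
  let ?g = "\<lambda>k. matrix_inv A *v s k"
  have Ag: "A *v ?g k = s k" for k
    by (simp add: matrix_vector_mul_assoc matrix_inv_mult[OF pos_def_invertible[OF A]])
  have sym: "x \<bullet> (A *v y) = y \<bullet> (A *v x)" for x y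
    using A by (metis inner_commute inner_matrix_transpose pos_def_def)
  define b where "b = B / l"
  have b: "b \<ge> 0" using B l by (simp add: b_def)
  have g: "norm (?g k) \<le> b * m k" for k
  proof -
    have "l * (norm (?g k))\<^sup>2 \<le> ?g k \<bullet> s k" using l(2)[of "?g k"] by (simp add: Ag)
    also have "\<dots> \<le> norm (?g k) * (B * m k)"
      using norm_cauchy_schwarz[of "?g k" "s k"] mult_left_mono[OF s[of k], of "norm (?g k)"] by simp
    finally have "norm (?g k) * (l * norm (?g k)) \<le> norm (?g k) * (B * m k)" by (simp add: power2_eq_square mult_ac)
    then have "?g k = 0 \<or> l * norm (?g k) \<le> B * m k" by (metis mult_le_cancel_left_pos norm_eq_zero zero_less_norm_iff)
    then have "l * norm (?g k) \<le> B * m k" using B m(2) by auto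
    then show ?thesis using l(1) by (simp add: b_def field_simps)
  qed
  \<comment> \<open>Solves \<open>l * norm h \<le> (2 * B + 1) * m + (l / 2) * norm h\<close> for
    \<open>norm h\<close>; that inequality holds once \<open>\<kappa> + c * norm h < l / 2\<close>
    and \<open>\<kappa> < 1\<close>.\<close>
  define a where "a = (2 * B + 1) * 2 / l"
  have a: "a \<ge> 0" using B l by (simp add: a_def)
  \<comment> \<open>The expansion errors at \<open>h k\<close> and at the exact minimiser, divided
    by the square of \<open>m k\<close>. One factor of each cubic term is kept aside, as
    \<open>norm (h k)\<close> and \<open>b * m k\<close>, so that \<open>d\<close> tends to 0
    although \<open>c\<close> does not.\<close>
  define d where "d k = \<kappa> k * (a\<^sup>2 + a) + c k * (norm (h k) * a\<^sup>2) + (\<kappa> k * (b\<^sup>2 + b) + c k * (b * m k * b\<^sup>2))" for k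
  have "(\<lambda>k. \<kappa> k + c k * norm (h k)) \<longlonglongrightarrow> 0 + c0 * norm (0 :: real^'n)"
    by (intro tendsto_intros \<kappa> c h)
  then have e1: "\<forall>\<^sub>F k in sequentially. \<kappa> k + c k * norm (h k) < l / 2"
    using l by (intro order_tendstoD) auto
  have e2: "\<forall>\<^sub>F k in sequentially. \<kappa> k < 1" using \<kappa>(1) by (rule order_tendstoD) simp
  have "(\<lambda>k. norm (h k)) \<longlonglongrightarrow> norm (0 :: real^'n)" by (intro tendsto_intros h)
  then have e3: "\<forall>\<^sub>F k in sequentially. norm (h k) < 1" by (rule order_tendstoD) simp
  have "(\<lambda>k. b * m k) \<longlonglongrightarrow> b * 0" by (intro tendsto_intros m)
  then have e4: "\<forall>\<^sub>F k in sequentially. b * m k < 1" by (rule order_tendstoD) simp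
  have "d \<longlonglongrightarrow> 0 * (a\<^sup>2 + a) + c0 * (norm (0 :: real^'n) * a\<^sup>2) + (0 * (b\<^sup>2 + b) + c0 * (b * 0 * b\<^sup>2))"
    unfolding d_def by (intro tendsto_intros \<kappa> c h m)
  then have e5: "\<forall>\<^sub>F k in sequentially. d k < l * \<eta>\<^sup>2" using l \<eta> by (intro order_tendstoD) auto
  show ?thesis
    using e1 e2 e3 e4 e5 opt0 opt
  proof eventually_elim
    case (elim k)
    let ?h = "h k" and ?m = "m k"
    let ?P = "\<lambda>x. x \<bullet> (A *v x) - 2 * (x \<bullet> s k)"
    have m0: "0 \<le> ?m" by (rule m)
    have hs: "?h \<bullet> s k \<le> norm ?h * (B * ?m)"
      using norm_cauchy_schwarz[of ?h "s k"] mult_left_mono[OF s[of k], of "norm ?h"] by simp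
    have "l * (norm ?h)\<^sup>2 \<le> 2 * (norm ?h * (B * ?m)) + \<kappa> k * ((norm ?h)\<^sup>2 + norm ?h * ?m) + c k * norm ?h ^ 3"
      using l(2)[of ?h] err[of ?h k] elim hs by linarith
    also have "\<dots> = norm ?h * (2 * B * ?m + \<kappa> k * ?m + (\<kappa> k + c k * norm ?h) * norm ?h)"
      by (simp add: power2_eq_square power3_eq_cube algebra_simps)
    also have "\<dots> \<le> norm ?h * (2 * B * ?m + 1 * ?m + (l / 2) * norm ?h)"
      using elim m0 by (intro mult_left_mono add_mono mult_right_mono order_refl) auto
    finally have "norm ?h * (l * norm ?h) \<le> norm ?h * ((2 * B + 1) * ?m + (l / 2) * norm ?h)"
      by (simp add: power2_eq_square algebra_simps)
    then have "?h = 0 \<or> l * norm ?h \<le> (2 * B + 1) * ?m + (l / 2) * norm ?h"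
      by (metis mult_le_cancel_left_pos norm_eq_zero zero_less_norm_iff)
    then have hm: "norm ?h \<le> a * ?m"
    proof
      assume "?h = 0" then show ?thesis using a m0 by simp
    next
      assume "l * norm ?h \<le> (2 * B + 1) * ?m + (l / 2) * norm ?h"
      then have "norm ?h * l \<le> (2 * B + 1) * 2 * ?m" by (simp add: algebra_simps)
      then show ?thesis using l(1) by (simp add: a_def field_simps)
    qed
    have E: "\<kappa> k * ((norm x)\<^sup>2 + norm x * ?m) + c k * norm x ^ 3 \<le> (\<kappa> k * (q\<^sup>2 + q) + c k * (p * q\<^sup>2)) * ?m\<^sup>2"
      if x: "norm x \<le> q * ?m" "norm x \<le> p" and q: "0 \<le> q" for x :: "real^'n" and q p
    proof -
      have x2: "(norm x)\<^sup>2 \<le> (q * ?m)\<^sup>2" using x by (intro power_mono) auto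
      have p0: "0 \<le> p" using x(2) norm_ge_zero[of x] by linarith
      have "norm x ^ 3 = norm x * (norm x)\<^sup>2" by (simp add: power2_eq_square power3_eq_cube)
      also have "\<dots> \<le> p * (q * ?m)\<^sup>2" using x x2 p0 by (intro mult_mono) auto
      finally have 3: "norm x ^ 3 \<le> p * (q * ?m)\<^sup>2" .
      have "norm x * ?m \<le> q * ?m * ?m" using x m0 by (intro mult_right_mono) auto
      then have "\<kappa> k * ((norm x)\<^sup>2 + norm x * ?m) + c k * norm x ^ 3 \<le> \<kappa> k * ((q * ?m)\<^sup>2 + q * ?m * ?m) + c k * (p * (q * ?m)\<^sup>2)"
        using x2 3 \<kappa>(2) c(2) by (intro add_mono mult_left_mono) auto
      also have "\<dots> = (\<kappa> k * (q\<^sup>2 + q) + c k * (p * q\<^sup>2)) * ?m\<^sup>2"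
        by (simp add: power2_eq_square algebra_simps)
      finally show ?thesis .
    qed
    have "(?h - ?g k) \<bullet> (A *v (?h - ?g k)) = ?P ?h - ?P (?g k)"
      using sym[of "?g k" ?h] by (simp add: matrix_vector_mult_diff_distrib inner_diff_left inner_diff_right Ag)
        
    also have "\<dots> \<le> (\<kappa> k * (a\<^sup>2 + a) + c k * (norm ?h * a\<^sup>2)) * ?m\<^sup>2 + (\<kappa> k * (b\<^sup>2 + b) + c k * (b * ?m * b\<^sup>2)) * ?m\<^sup>2"
      using err[of ?h k] err[of "?g k" k] E[OF hm order_refl a] E[OF g[of k] g[of k] b] elim g[of k] by linarith
    also have "\<dots> = d k * ?m\<^sup>2" by (simp add: d_def algebra_simps)
    also have "\<dots> \<le> (l * \<eta>\<^sup>2) * ?m\<^sup>2" using elim by (intro mult_right_mono) auto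
    finally have "l * (norm (?h - ?g k))\<^sup>2 \<le> l * (\<eta> * ?m)\<^sup>2"
      using l(2)[of "?h - ?g k"] by (simp add: power_mult_distrib mult_ac)
    then have "(norm (?h - ?g k))\<^sup>2 \<le> (\<eta> * ?m)\<^sup>2" using l(1) by simp
    then show ?case using \<eta> m0 by (simp add: power2_le_iff_abs_le)
  qed
qed

section \<open>Empirical residual covariances of the perceptron model\<close>

text \<open>An observation is the pair \<open>(e, z)\<close> of noise and input, so that the residual at \<open>W\<close> is
  \<open>e + F\<^sub>W\<^sub>0(z) - F\<^sub>W(z)\<close>.\<close>

definition res_prod :: "('d::finite, 'h::finite, 'l::finite) weights \<Rightarrow> ('d, 'h, 'l) weights \<Rightarrow>
    (real^'d) \<times> (real^'l) \<Rightarrow> real^'d^'d" where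
  "res_prod W0 W y = outer_prod (fst y + mlp W0 (snd y) - mlp W (snd y)) (fst y + mlp W0 (snd y) - mlp W (snd y))"

text \<open>A common dominating function. The exponents are the assumed moments of noise and input,
  and independence makes the product integrable.\<close>

definition envelope :: "(real^'d) \<times> (real^'l) \<Rightarrow> real" where
  "envelope y = (1 + norm (fst y))\<^sup>2 * (1 + norm (snd y)) ^ 3"

definition noise_deriv :: "('d::finite, 'h::finite, 'l::finite) weights \<Rightarrow> ('d, 'h, 'l) weight_index \<Rightarrow>
    (real^'d) \<times> (real^'l) \<Rightarrow> real^'d^'d" where
  "noise_deriv W0 p y = outer_prod (fst y) (mlp_deriv W0 (axis p 1) (snd y))"

text \<open>Kept matrix valued and free of any weight: contracting component \<open>p\<close> with
  \<open>G\<close> gives the score for the weight \<open>G\<close>, so one average serves all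
  weights, including those that depend on the data.\<close>

definition score :: "('d::finite, 'h::finite, 'l::finite) weights \<Rightarrow>
    (real^'d) \<times> (real^'l) \<Rightarrow> real^'d^'d^(('d, 'h, 'l) weight_index)" where
  "score W0 y = (\<chi> p. noise_deriv W0 p y)"

definition noise_deriv2 :: "('d::finite, 'h::finite, 'l::finite) weights \<Rightarrow> ('d, 'h, 'l) weight_index \<Rightarrow>
    ('d, 'h, 'l) weight_index \<Rightarrow> (real^'d) \<times> (real^'l) \<Rightarrow> real^'d^'d" where
  "noise_deriv2 W0 p q y = outer_prod (fst y) (mlp_deriv2 W0 (axis p 1) (axis q 1) (snd y))"

definition deriv_prod :: "('d::finite, 'h::finite, 'l::finite) weights \<Rightarrow> ('d, 'h, 'l) weight_index \<Rightarrow>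
    ('d, 'h, 'l) weight_index \<Rightarrow> (real^'d) \<times> (real^'l) \<Rightarrow> real^'d^'d" where
  "deriv_prod W0 p q y = outer_prod (mlp_deriv W0 (axis p 1) (snd y)) (mlp_deriv W0 (axis q 1) (snd y))"

lemma envelope_ge: "(1 + norm (fst y)) ^ i * (1 + norm (snd y)) ^ j \<le> envelope y" if "i \<le> 2" "j \<le> 3"
  unfolding envelope_def using that by (intro mult_mono power_increasing) auto

lemma envelope_ge_1: "1 \<le> envelope y"
  using envelope_ge[of 0 0 y] by simp

lemma axis_sum: "(\<Sum>p\<in>UNIV. h $ p *\<^sub>R axis p 1) = (h :: real^'n)"
  using basis_expansion[of h] by (simp add: scalar_mult_eq_scaleR)

lemma mlp_deriv_axes: "mlp_deriv W h z = (\<Sum>p\<in>UNIV. h $ p *\<^sub>R mlp_deriv W (axis p 1) z)"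
proof -
  have "mlp_deriv W (\<Sum>p\<in>UNIV. h $ p *\<^sub>R axis p 1) z = (\<Sum>p\<in>UNIV. h $ p *\<^sub>R mlp_deriv W (axis p 1) z)"
    by (simp add: linear_sum[OF linear_mlp_deriv] linear_scale[OF linear_mlp_deriv])
  then show ?thesis by (simp add: axis_sum)
qed

lemma mlp_deriv2_axes:
  "mlp_deriv2 W h h z = (\<Sum>p\<in>UNIV. \<Sum>q\<in>UNIV. (h $ p * h $ q) *\<^sub>R mlp_deriv2 W (axis p 1) (axis q 1) z)"
proof -
  have l: "linear (\<lambda>h. mlp_deriv2 W h h' z)" "linear (\<lambda>h'. mlp_deriv2 W h h' z)" for h h'
    using bilinear_mlp_deriv2[of W z] by (auto simp: bilinear_def)
  have "mlp_deriv2 W (\<Sum>p\<in>UNIV. h $ p *\<^sub>R axis p 1) (\<Sum>q\<in>UNIV. h $ q *\<^sub>R axis q 1) z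
      = (\<Sum>p\<in>UNIV. h $ p *\<^sub>R mlp_deriv2 W (axis p 1) (\<Sum>q\<in>UNIV. h $ q *\<^sub>R axis q 1) z)"
    by (simp add: linear_sum[OF l(1)] linear_scale[OF l(1)])
  also have "\<dots> = (\<Sum>p\<in>UNIV. \<Sum>q\<in>UNIV. (h $ p * h $ q) *\<^sub>R mlp_deriv2 W (axis p 1) (axis q 1) z)"
    by (simp add: linear_sum[OF l(2)] linear_scale[OF l(2)] scaleR_sum_right)
  finally show ?thesis by (simp add: axis_sum)
qed

lemma quadratic_form_sum: "x \<bullet> ((A :: real^'n^'n) *v x) = (\<Sum>p\<in>UNIV. \<Sum>q\<in>UNIV. x $ p * x $ q * A $ p $ q)"
  by (simp add: inner_vec_def matrix_vector_mult_def sum_distrib_left mult_ac)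

lemma abs_quadratic_sum_le:
  fixes x :: "real^'n"
  shows "\<bar>\<Sum>p\<in>UNIV. \<Sum>q\<in>UNIV. x $ p * x $ q * c p q\<bar> \<le> (norm x)\<^sup>2 * (\<Sum>p\<in>UNIV. \<Sum>q\<in>UNIV. \<bar>c p q\<bar>)"
proof -
  have "\<bar>\<Sum>p\<in>UNIV. \<Sum>q\<in>UNIV. x $ p * x $ q * c p q\<bar> \<le> (\<Sum>p\<in>UNIV. \<Sum>q\<in>UNIV. \<bar>x $ p * x $ q * c p q\<bar>)"
    by (intro sum_abs[THEN order_trans] sum_mono sum_abs)
  also have "\<dots> \<le> (\<Sum>p\<in>UNIV. \<Sum>q\<in>UNIV. (norm x)\<^sup>2 * \<bar>c p q\<bar>)"
    unfolding abs_mult power2_eq_square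
    by (intro sum_mono mult_right_mono mult_mono component_le_norm_cart) auto
  finally show ?thesis by (simp add: sum_distrib_left)
qed

text \<open>Let \<open>d\<close> be the increment of the perceptron and \<open>J\<close>,
  \<open>B\<close> its first- and second-order parts. Symmetry of \<open>G\<close> merges the cross
  terms into \<open>- 2 * (G \<bullet> outer_prod e d)\<close>, where \<open>d\<close> is replaced
  by \<open>J + B\<close>. In \<open>outer_prod d d\<close> it is replaced by \<open>J\<close> only,
  at the price of \<open>outer_prod (d - J) d + outer_prod J (d - J)\<close>. Every error is then
  cubic in \<open>h\<close> and dominated by \<open>envelope\<close>.\<close>

lemma res_prod_expansion:
  fixes W0 :: "('d::finite, 'h::finite, 'l::finite) weights"
  obtains C where "C \<ge> 0" "\<And>G h (y :: (real^'d) \<times> (real^'l)). transpose G = G \<Longrightarrow> norm h \<le> 1 \<Longrightarrow>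
    \<bar>G \<bullet> res_prod W0 (W0 + h) y - G \<bullet> res_prod W0 W0 y -
      ((\<Sum>p\<in>UNIV. \<Sum>q\<in>UNIV. h $ p * h $ q * (G \<bullet> deriv_prod W0 p q y))
       - 2 * (\<Sum>p\<in>UNIV. \<Sum>q\<in>UNIV. h $ p * h $ q * (G \<bullet> noise_deriv2 W0 p q y))
       - 2 * (\<Sum>p\<in>UNIV. h $ p * (G \<bullet> noise_deriv W0 p y)))\<bar> \<le> C * norm G * norm h ^ 3 * envelope y"
proof -
  obtain C3 where C3: "C3 \<ge> 0" "\<And>h z. norm h \<le> 1 \<Longrightarrow>
      norm (mlp (W0 + h) z - (mlp W0 z + mlp_deriv W0 h z + mlp_deriv2 W0 h h z)) \<le> C3 * ((1 + norm z) ^ 3 * norm h ^ 3)"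
    using mlp_expansion[of W0] by blast
  obtain C1 where C1: "C1 \<ge> 0" "\<And>h z. norm (mlp (W0 + h) z - (mlp W0 z + mlp_deriv W0 h z)) \<le> C1 * ((1 + norm z)\<^sup>2 * (norm h)\<^sup>2)"
    using mlp_expansion1[of W0] by blast
  obtain Cj where Cj: "Cj \<ge> 0" "\<And>h z. norm (mlp_deriv W0 h z) \<le> Cj * ((1 + norm z) * norm h)"
    using mlp_deriv_bound[of W0] by blast
  obtain Cl where Cl: "Cl \<ge> 0" "\<And>h z. norm (mlp (W0 + h) z - mlp W0 z) \<le> Cl * ((1 + norm z) * norm h)"
  proof
    let ?K = "real CARD('d) * (real CARD('h) * (1 + norm W0 * real (CARD('l) + 1)) + 1)"
    show "?K \<ge> 0" by simp
    show "norm (mlp (W0 + h) z - mlp W0 z) \<le> ?K * ((1 + norm z) * norm h)" for h z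
      using mlp_lipschitz[of W0 "norm W0" "W0 + h" z] by simp
  qed
  define C where "C = 2 * C3 + C1 * (Cl + Cj)"
  show thesis
  proof
    show "C \<ge> 0" unfolding C_def using C3(1) C1(1) Cj(1) Cl(1) by simp
    fix G :: "real^'d^'d" and h :: "('d, 'h, 'l) weights" and y :: "(real^'d) \<times> (real^'l)"
    assume G: "transpose G = G" and h: "norm h \<le> 1"
    obtain e z where y: "y = (e, z)" by fastforce
    let ?z = "1 + norm z"
    define J where "J = mlp_deriv W0 h z"
    define B where "B = mlp_deriv2 W0 h h z"
    define d where "d = mlp (W0 + h) z - mlp W0 z"
    define \<rho> where "\<rho> = d - J - B"
    have \<rho>: "norm \<rho> \<le> C3 * (?z ^ 3 * norm h ^ 3)"
      using C3(2)[OF h, of z] by (simp add: \<rho>_def d_def J_def B_def algebra_simps)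
    have dJ: "norm (d - J) \<le> C1 * (?z\<^sup>2 * (norm h)\<^sup>2)"
      using C1(2)[of h z] by (simp add: d_def J_def algebra_simps)
    have d: "norm d \<le> Cl * (?z * norm h)" unfolding d_def by (rule Cl)
    have J: "norm J \<le> Cj * (?z * norm h)" unfolding J_def by (rule Cj)
    note lin = outer_prod.add_left outer_prod.add_right outer_prod.diff_left outer_prod.diff_right
    have r: "res_prod W0 (W0 + h) y = outer_prod (e - d) (e - d)" "res_prod W0 W0 y = outer_prod e e"
      by (simp_all add: res_prod_def y d_def algebra_simps)
    have eJ: "(\<Sum>p\<in>UNIV. h $ p * (G \<bullet> noise_deriv W0 p y)) = G \<bullet> outer_prod e J"
      unfolding J_def mlp_deriv_axes[of W0 h z]
      by (simp add: noise_deriv_def y outer_prod.sum_right outer_prod.scaleR_right inner_sum_right)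
    have eB: "(\<Sum>p\<in>UNIV. \<Sum>q\<in>UNIV. h $ p * h $ q * (G \<bullet> noise_deriv2 W0 p q y)) = G \<bullet> outer_prod e B"
      unfolding B_def mlp_deriv2_axes[of W0 h z]
      by (simp add: noise_deriv2_def y outer_prod.sum_right outer_prod.scaleR_right inner_sum_right)
    have JJ: "(\<Sum>p\<in>UNIV. \<Sum>q\<in>UNIV. h $ p * h $ q * (G \<bullet> deriv_prod W0 p q y)) = G \<bullet> outer_prod J J"
      unfolding J_def mlp_deriv_axes[of W0 h z]
      by (simp add: deriv_prod_def y outer_prod.sum_right outer_prod.sum_left outer_prod.scaleR_left
          outer_prod.scaleR_right inner_sum_right sum_distrib_left mult_ac)
        (subst sum.swap, simp add: mult_ac)
    have "G \<bullet> res_prod W0 (W0 + h) y - G \<bullet> res_prod W0 W0 y -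
      ((\<Sum>p\<in>UNIV. \<Sum>q\<in>UNIV. h $ p * h $ q * (G \<bullet> deriv_prod W0 p q y))
       - 2 * (\<Sum>p\<in>UNIV. \<Sum>q\<in>UNIV. h $ p * h $ q * (G \<bullet> noise_deriv2 W0 p q y))
       - 2 * (\<Sum>p\<in>UNIV. h $ p * (G \<bullet> noise_deriv W0 p y)))
      = G \<bullet> outer_prod (d - J) d + G \<bullet> outer_prod J (d - J) - 2 * (G \<bullet> outer_prod e \<rho>)"
      unfolding eJ eB JJ r \<rho>_def
      using inner_outer_prod_commute[OF G, of d e] by (simp add: lin inner_add_right inner_diff_right)
    also have "\<bar>\<dots>\<bar> \<le> norm G * (norm (d - J) * norm d) + norm G * (norm J * norm (d - J)) + 2 * (norm G * (norm e * norm \<rho>))"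
      using abs_inner_outer_prod_le[of G "d - J" d] abs_inner_outer_prod_le[of G J "d - J"]
        abs_inner_outer_prod_le[of G e \<rho>] by linarith
    also have "\<dots> = norm G * (norm (d - J) * (norm d + norm J) + 2 * (norm e * norm \<rho>))"
      by (simp add: algebra_simps)
    also have "\<dots> \<le> norm G * (C1 * (?z\<^sup>2 * (norm h)\<^sup>2) * (Cl * (?z * norm h) + Cj * (?z * norm h)) + 2 * (norm e * (C3 * (?z ^ 3 * norm h ^ 3))))"
      using dJ d J \<rho> C1(1) by (intro mult_left_mono add_mono mult_mono order_refl) auto
    also have "\<dots> = norm G * norm h ^ 3 * (C1 * (Cl + Cj) * ?z ^ 3 + 2 * C3 * (norm e * ?z ^ 3))"
      by (simp add: power2_eq_square power3_eq_cube algebra_simps)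
    also have "\<dots> \<le> norm G * norm h ^ 3 * (C1 * (Cl + Cj) * envelope y + 2 * C3 * envelope y)"
    proof (intro mult_left_mono add_mono)
      show "?z ^ 3 \<le> envelope y" using envelope_ge[of 0 3 y] by (simp add: y)
      have "norm e * ?z ^ 3 \<le> (1 + norm e) * ?z ^ 3" by (intro mult_right_mono) auto
      then show "norm e * ?z ^ 3 \<le> envelope y" using envelope_ge[of 1 3 y] by (simp add: y)
    qed (use C1(1) Cl(1) Cj(1) C3(1) in auto)
    also have "\<dots> = C * norm G * norm h ^ 3 * envelope y" by (simp add: C_def algebra_simps)
    finally show "\<bar>G \<bullet> res_prod W0 (W0 + h) y - G \<bullet> res_prod W0 W0 y -
      ((\<Sum>p\<in>UNIV. \<Sum>q\<in>UNIV. h $ p * h $ q * (G \<bullet> deriv_prod W0 p q y))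
       - 2 * (\<Sum>p\<in>UNIV. \<Sum>q\<in>UNIV. h $ p * h $ q * (G \<bullet> noise_deriv2 W0 p q y))
       - 2 * (\<Sum>p\<in>UNIV. h $ p * (G \<bullet> noise_deriv W0 p y)))\<bar> \<le> C * norm G * norm h ^ 3 * envelope y" .
  qed
qed

lemma emp_mean_score_nth: "emp_mean x n (score W0) $ p = emp_mean x n (noise_deriv W0 p)"
  by (subst emp_mean_linear[where L="\<lambda>v. v $ p"]) (simp_all add: linear_iff score_def)

text \<open>The deterministic core: along one path the convergence of a few averages suffices. The
  noise averages vanish in the limit, so near \<open>W0\<close> the criterion is the quadratic form
  of \<open>A\<close> minus twice a linear term, and \<open>argmin_perturbed_quadratic\<close>
  applies with \<open>norm (v k)\<close> as the scale \<open>m k\<close>.\<close>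

lemma asymptotic_linearity:
  fixes W0 :: "('d::finite, 'h::finite, 'l::finite) weights" and x :: "nat \<Rightarrow> (real^'d) \<times> (real^'l)"
    and N :: "nat \<Rightarrow> nat" and G :: "nat \<Rightarrow> real^'d^'d" and Ginf :: "real^'d^'d"
    and A :: "real^(('d, 'h, 'l) weight_index)^(('d, 'h, 'l) weight_index)" and T :: "nat \<Rightarrow> ('d, 'h, 'l) weights"
  defines "v k \<equiv> emp_mean x (N k) (score W0)"
  defines "g k \<equiv> matrix_inv A *v (\<chi> p. Ginf \<bullet> v k $ p)"
  defines "U k W \<equiv> G k \<bullet> emp_mean x (N k) (res_prod W0 W)"
  assumes v: "\<And>p. (\<lambda>k. emp_mean x (N k) (noise_deriv W0 p)) \<longlonglongrightarrow> 0"
    and d2: "\<And>p q. (\<lambda>k. emp_mean x (N k) (noise_deriv2 W0 p q)) \<longlonglongrightarrow> 0"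
    and dp: "\<And>p q. (\<lambda>k. emp_mean x (N k) (deriv_prod W0 p q)) \<longlonglongrightarrow> DP p q"
    and env: "(\<lambda>k. emp_mean x (N k) envelope) \<longlonglongrightarrow> E"
    and G: "G \<longlonglongrightarrow> Ginf" "\<And>k. transpose (G k) = G k"
    and A: "pos_def A" "\<And>p q. A $ p $ q = Ginf \<bullet> DP p q"
    and T: "T \<longlonglongrightarrow> W0"
    and opt0: "\<forall>\<^sub>F k in sequentially. U k (T k) \<le> U k W0"
    and opt: "\<forall>\<^sub>F k in sequentially. U k (T k) \<le> U k (W0 + g k)"
    and \<eta>: "\<eta> > 0"
  shows "\<forall>\<^sub>F k in sequentially. norm (T k - W0 - g k) \<le> \<eta> * norm (v k)"
proof -
  obtain C where C: "C \<ge> 0" "\<And>G h (y :: (real^'d) \<times> (real^'l)). transpose G = G \<Longrightarrow> norm h \<le> 1 \<Longrightarrow>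
    \<bar>G \<bullet> res_prod W0 (W0 + h) y - G \<bullet> res_prod W0 W0 y -
      ((\<Sum>p\<in>UNIV. \<Sum>q\<in>UNIV. h $ p * h $ q * (G \<bullet> deriv_prod W0 p q y))
       - 2 * (\<Sum>p\<in>UNIV. \<Sum>q\<in>UNIV. h $ p * h $ q * (G \<bullet> noise_deriv2 W0 p q y))
       - 2 * (\<Sum>p\<in>UNIV. h $ p * (G \<bullet> noise_deriv W0 p y)))\<bar> \<le> C * norm G * norm h ^ 3 * envelope y"
    by (rule res_prod_expansion[of W0]) blast
  let ?P = "real CARD(('d, 'h, 'l) weight_index)"
  let ?m = "\<lambda>k. emp_mean x (N k)"
  define s where "s k = (\<chi> p. Ginf \<bullet> v k $ p)" for k
  \<comment> \<open>Three sources of error: averaged derivative products against \<open>A\<close>,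
    the noise average of second derivatives, and the replacement of \<open>G k\<close> by
    \<open>Ginf\<close> in the linear term. The last one is paired with \<open>norm (v k)\<close>,
    the others with the square of \<open>norm h\<close>.\<close>
  define \<kappa> where "\<kappa> k = (\<Sum>p\<in>UNIV. \<Sum>q\<in>UNIV. \<bar>G k \<bullet> ?m k (deriv_prod W0 p q) - A $ p $ q\<bar>)
    + 2 * (\<Sum>p\<in>UNIV. \<Sum>q\<in>UNIV. \<bar>G k \<bullet> ?m k (noise_deriv2 W0 p q)\<bar>) + 2 * (?P * norm (G k - Ginf))" for k
  define c where "c k = C * norm (G k) * ?m k envelope" for k
  define Q where "Q k h = U k (W0 + h) - U k W0" for k h
  have env0: "0 \<le> ?m k envelope" for k
    by (simp add: emp_mean_def envelope_def sum_nonneg)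
  have vn: "v k $ p = ?m k (noise_deriv W0 p)" for k p by (simp add: v_def emp_mean_score_nth)
  have v0: "v \<longlonglongrightarrow> 0"
    by (rule vec_tendstoI) (simp add: vn v)
  have err: "\<bar>Q k h - (h \<bullet> (A *v h) - 2 * (h \<bullet> s k))\<bar> \<le> \<kappa> k * ((norm h)\<^sup>2 + norm h * norm (v k)) + c k * norm h ^ 3"
    if h: "norm h \<le> 1" for k h
  proof -
    let ?G = "G k"
    let ?f = "\<lambda>y. (\<Sum>p\<in>UNIV. \<Sum>q\<in>UNIV. h $ p * h $ q * (?G \<bullet> deriv_prod W0 p q y))
       - 2 * (\<Sum>p\<in>UNIV. \<Sum>q\<in>UNIV. h $ p * h $ q * (?G \<bullet> noise_deriv2 W0 p q y))
       - 2 * (\<Sum>p\<in>UNIV. h $ p * (?G \<bullet> noise_deriv W0 p y))"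
    let ?DP = "\<Sum>p\<in>UNIV. \<Sum>q\<in>UNIV. h $ p * h $ q * (?G \<bullet> ?m k (deriv_prod W0 p q))"
    let ?D2 = "\<Sum>p\<in>UNIV. \<Sum>q\<in>UNIV. h $ p * h $ q * (?G \<bullet> ?m k (noise_deriv2 W0 p q))"
    let ?D1 = "\<Sum>p\<in>UNIV. h $ p * (?G \<bullet> v k $ p)"
    have mf: "?m k ?f = ?DP - 2 * ?D2 - 2 * ?D1"
      by (simp add: emp_mean_diff emp_mean_sum emp_mean_mult emp_mean_inner vn)
    have "\<bar>Q k h - ?m k ?f\<bar> = norm (?m k (\<lambda>y. ?G \<bullet> res_prod W0 (W0 + h) y - ?G \<bullet> res_prod W0 W0 y - ?f y))"
      by (simp only: Q_def U_def emp_mean_inner emp_mean_diff real_norm_def)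
    also have "\<dots> \<le> ?m k (\<lambda>y. C * norm ?G * norm h ^ 3 * envelope y)"
      by (rule norm_emp_mean_le) (use C(2)[OF G(2) h] in simp)
    also have "\<dots> = c k * norm h ^ 3" by (simp add: emp_mean_mult c_def)
    finally have 1: "\<bar>Q k h - (?DP - 2 * ?D2 - 2 * ?D1)\<bar> \<le> c k * norm h ^ 3" unfolding mf .
    have e2: "?DP - h \<bullet> (A *v h) = (\<Sum>p\<in>UNIV. \<Sum>q\<in>UNIV. h $ p * h $ q * (?G \<bullet> ?m k (deriv_prod W0 p q) - A $ p $ q))"
      by (simp add: quadratic_form_sum sum_subtractf right_diff_distrib)
    have 2: "\<bar>?DP - h \<bullet> (A *v h)\<bar> \<le> (norm h)\<^sup>2 * (\<Sum>p\<in>UNIV. \<Sum>q\<in>UNIV. \<bar>?G \<bullet> ?m k (deriv_prod W0 p q) - A $ p $ q\<bar>)"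
      unfolding e2 by (rule abs_quadratic_sum_le)
    have 3: "\<bar>?D2\<bar> \<le> (norm h)\<^sup>2 * (\<Sum>p\<in>UNIV. \<Sum>q\<in>UNIV. \<bar>?G \<bullet> ?m k (noise_deriv2 W0 p q)\<bar>)"
      by (rule abs_quadratic_sum_le)
    have "?D1 - h \<bullet> s k = (\<Sum>p\<in>UNIV. h $ p * ((?G - Ginf) \<bullet> v k $ p))"
      by (simp add: s_def inner_vec_def[of h] sum_subtractf inner_diff_left right_diff_distrib)
    also have "\<bar>\<dots>\<bar> \<le> ?P * (norm h * (norm (?G - Ginf) * norm (v k)))"
    proof (rule abs_sum_le_card)
      fix p
      have "\<bar>(?G - Ginf) \<bullet> v k $ p\<bar> \<le> norm (?G - Ginf) * norm (v k)"
        by (intro order_trans[OF Cauchy_Schwarz_ineq2] mult_left_mono Finite_Cartesian_Product.norm_nth_le) auto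
      then show "\<bar>h $ p * ((?G - Ginf) \<bullet> v k $ p)\<bar> \<le> norm h * (norm (?G - Ginf) * norm (v k))"
        unfolding abs_mult by (intro mult_mono component_le_norm_cart) auto
    qed
    finally have 4: "\<bar>?D1 - h \<bullet> s k\<bar> \<le> (?P * norm (?G - Ginf)) * (norm h * norm (v k))" by (simp add: mult_ac)
    let ?a = "\<Sum>p\<in>UNIV. \<Sum>q\<in>UNIV. \<bar>?G \<bullet> ?m k (deriv_prod W0 p q) - A $ p $ q\<bar>"
    let ?b = "\<Sum>p\<in>UNIV. \<Sum>q\<in>UNIV. \<bar>?G \<bullet> ?m k (noise_deriv2 W0 p q)\<bar>"
    let ?c = "?P * norm (?G - Ginf)"
    have nn: "0 \<le> ?a" "0 \<le> ?b" "0 \<le> ?c" by (auto intro!: sum_nonneg)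
    have "\<bar>Q k h - (h \<bullet> (A *v h) - 2 * (h \<bullet> s k))\<bar>
        \<le> ((norm h)\<^sup>2 * ?a + 2 * ((norm h)\<^sup>2 * ?b) + 2 * (?c * (norm h * norm (v k)))) + c k * norm h ^ 3"
      using 1 2 3 4 by linarith
    also have "(norm h)\<^sup>2 * ?a + 2 * ((norm h)\<^sup>2 * ?b) + 2 * (?c * (norm h * norm (v k)))
        \<le> \<kappa> k * ((norm h)\<^sup>2 + norm h * norm (v k))"
    proof -
      have "(norm h)\<^sup>2 * ?a + 2 * ((norm h)\<^sup>2 * ?b) + 2 * (?c * (norm h * norm (v k)))
        + (?a * (norm h * norm (v k)) + 2 * (?b * (norm h * norm (v k))) + 2 * (?c * (norm h)\<^sup>2))
        = \<kappa> k * ((norm h)\<^sup>2 + norm h * norm (v k))"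
        unfolding \<kappa>_def by (simp add: distrib_left distrib_right)
      moreover have "0 \<le> ?a * (norm h * norm (v k)) + 2 * (?b * (norm h * norm (v k))) + 2 * (?c * (norm h)\<^sup>2)"
        using nn by (intro add_nonneg_nonneg mult_nonneg_nonneg) auto
      ultimately show ?thesis by linarith
    qed
    finally show ?thesis by simp
  qed
  have \<kappa>: "\<kappa> \<longlonglongrightarrow> (\<Sum>p\<in>(UNIV :: ('d, 'h, 'l) weight_index set). \<Sum>q\<in>(UNIV :: ('d, 'h, 'l) weight_index set). \<bar>Ginf \<bullet> DP p q - A $ p $ q\<bar>)
    + 2 * (\<Sum>p\<in>(UNIV :: ('d, 'h, 'l) weight_index set). \<Sum>q\<in>(UNIV :: ('d, 'h, 'l) weight_index set). \<bar>Ginf \<bullet> 0\<bar>) + 2 * (?P * norm (Ginf - Ginf))"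
    unfolding \<kappa>_def
    by (intro tendsto_add tendsto_mult tendsto_const tendsto_sum tendsto_rabs tendsto_diff tendsto_inner tendsto_norm G(1) dp d2)
  have c: "c \<longlonglongrightarrow> C * norm Ginf * E" unfolding c_def
    by (intro tendsto_mult tendsto_const tendsto_norm G(1) env)
  have "\<forall>\<^sub>F k in sequentially. norm ((T k - W0) - matrix_inv A *v s k) \<le> \<eta> * norm (v k)"
  proof (rule argmin_perturbed_quadratic[where Q=Q and \<kappa>=\<kappa> and c=c and ?c0.0="C * norm Ginf * E" and B="?P * norm Ginf"])
    show "\<kappa> \<longlonglongrightarrow> 0" using \<kappa> by (simp add: A(2))
    show "0 \<le> \<kappa> k" for k unfolding \<kappa>_def by (intro add_nonneg_nonneg mult_nonneg_nonneg sum_nonneg) auto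
    show "0 \<le> c k" for k unfolding c_def using C(1) env0 by simp
    show "(\<lambda>k. norm (v k)) \<longlonglongrightarrow> 0" using v0 by (rule tendsto_norm_zero)
    show "norm (s k) \<le> ?P * norm Ginf * norm (v k)" for k
      unfolding mult.assoc
    proof (rule norm_le_sum_components)
      show "\<bar>s k $ p\<bar> \<le> norm Ginf * norm (v k)" for p unfolding s_def vec_lambda_beta
        by (intro order_trans[OF Cauchy_Schwarz_ineq2] mult_left_mono Finite_Cartesian_Product.norm_nth_le) auto
    qed
    show "(\<lambda>k. T k - W0) \<longlonglongrightarrow> 0" using T by (simp add: LIM_zero_iff)
    show "\<forall>\<^sub>F k in sequentially. Q k (T k - W0) \<le> 0" using opt0 by eventually_elim (simp add: Q_def)
    show "\<forall>\<^sub>F k in sequentially. Q k (T k - W0) \<le> Q k (matrix_inv A *v s k)"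
      using opt by eventually_elim (simp add: Q_def g_def s_def)
  qed (use A(1) c \<eta> err in auto)
  then show ?thesis by (simp add: g_def s_def)
qed

section \<open>Uniform convergence over weights and convergence of representatives\<close>

lemma norm_mlp_residual_le:
  fixes W0 W :: "('d::finite, 'h::finite, 'l::finite) weights"
  assumes "norm W \<le> R"
  shows "norm (e + mlp W0 z - mlp W z) \<le> (1 + real CARD('d) * (real CARD('h) + 1) * (norm W0 + R)) * (1 + norm e)"
proof -
  let ?K = "real CARD('d) * (real CARD('h) + 1)"
  have F: "norm (mlp W z) \<le> ?K * norm W" for W :: "('d, 'h, 'l) weights"
    using norm_mlp_le[of W z] by (simp add: algebra_simps)
  have K: "0 \<le> ?K" by simp
  have "norm (e + mlp W0 z - mlp W z) \<le> norm e + norm (mlp W0 z) + norm (mlp W z)"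
    by (meson norm_triangle_ineq norm_triangle_ineq4 add_right_mono order_trans)
  also have "\<dots> \<le> norm e + ?K * norm W0 + ?K * R"
    using F[of W0] F[of W] mult_left_mono[OF assms K] by linarith
  also have "\<dots> = norm e + ?K * (norm W0 + R)" by (simp add: distrib_left)
  also have "\<dots> \<le> norm e + 1 + ?K * (norm W0 + R) * (1 + norm e)"
  proof -
    have "0 \<le> ?K * (norm W0 + R)"
      using K order_trans[OF norm_ge_zero assms] by (intro mult_nonneg_nonneg add_nonneg_nonneg) auto
    then have "?K * (norm W0 + R) * 1 \<le> ?K * (norm W0 + R) * (1 + norm e)" by (intro mult_left_mono) auto
    then show ?thesis by linarith
  qed
  also have "\<dots> = (1 + ?K * (norm W0 + R)) * (1 + norm e)" by (simp add: distrib_right)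
  finally show ?thesis .
qed

lemma norm_res_prod_le:
  fixes W0 W :: "('d::finite, 'h::finite, 'l::finite) weights"
  shows "\<exists>C\<ge>0. \<forall>y. norm (res_prod W0 W y) \<le> C * envelope y"
proof -
  define C where "C = 1 + real CARD('d) * (real CARD('h) + 1) * (norm W0 + norm W)"
  have "norm (res_prod W0 W y) \<le> C\<^sup>2 * envelope y" for y
  proof -
    have "norm (res_prod W0 W y) \<le> (C * (1 + norm (fst y)))\<^sup>2"
      using norm_mlp_residual_le[of W "norm W" "fst y" W0 "snd y"]
      unfolding res_prod_def norm_outer_prod power2_eq_square C_def by (intro mult_mono) auto
    also have "\<dots> \<le> C\<^sup>2 * envelope y"
      using envelope_ge[of 2 0 y] by (simp add: power_mult_distrib mult_left_mono)
    finally show ?thesis .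
  qed
  then show ?thesis by (intro exI[of _ "C\<^sup>2"]) auto
qed

text \<open>Residuals grow with the noise alone, since the perceptron is bounded in
  \<open>z\<close>, while their differences grow linearly with the input; the product of both stays
  below \<open>envelope\<close>.\<close>

lemma res_prod_lipschitz:
  fixes W0 :: "('d::finite, 'h::finite, 'l::finite) weights"
  shows "\<exists>L\<ge>0. \<forall>V W y. norm V \<le> R \<longrightarrow> norm W \<le> R \<longrightarrow>
    norm (res_prod W0 W y - res_prod W0 V y) \<le> L * norm (W - V) * envelope y"
proof (cases "R \<ge> 0")
  case True
  define C where "C = 1 + real CARD('d) * (real CARD('h) + 1) * (norm W0 + R)"
  define D where "D = real CARD('d) * (real CARD('h) * (1 + R * real (CARD('l) + 1)) + 1)"
  have nn: "0 \<le> C" "0 \<le> D" using True by (auto simp: C_def D_def)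
  have "norm (res_prod W0 W y - res_prod W0 V y) \<le> (2 * C * D) * norm (W - V) * envelope y"
    if V: "norm V \<le> R" and W: "norm W \<le> R" for V W and y :: "(real^'d) \<times> (real^'l)"
  proof -
    obtain e z where y: "y = (e, z)" by fastforce
    let ?r = "\<lambda>W. e + mlp W0 z - mlp W z"
    have r: "norm (?r V) \<le> C * (1 + norm e)" "norm (?r W) \<le> C * (1 + norm e)"
      unfolding C_def by (rule norm_mlp_residual_le V W)+
    have d: "norm (?r W - ?r V) \<le> D * ((1 + norm z) * norm (W - V))"
      using mlp_lipschitz[OF V, of W z] by (simp add: D_def norm_minus_commute algebra_simps)
    have "outer_prod a a - outer_prod b b = outer_prod (a - b) a + outer_prod b (a - b)" for a b :: "real^'d"
      by (simp add: outer_prod.diff_left outer_prod.diff_right)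
    then have eq: "res_prod W0 W y - res_prod W0 V y = outer_prod (?r W - ?r V) (?r W) + outer_prod (?r V) (?r W - ?r V)"
      unfolding res_prod_def y fst_conv snd_conv .
    have "norm (res_prod W0 W y - res_prod W0 V y) \<le> norm (?r W - ?r V) * norm (?r W) + norm (?r V) * norm (?r W - ?r V)"
      unfolding eq norm_outer_prod[symmetric] by (rule norm_triangle_ineq)
    also have "\<dots> = norm (?r W - ?r V) * (norm (?r W) + norm (?r V))" by (simp add: distrib_left mult.commute)
    also have "\<dots> \<le> (D * ((1 + norm z) * norm (W - V))) * (C * (1 + norm e) + C * (1 + norm e))"
      using r d nn by (intro mult_mono add_mono) auto
    also have "\<dots> = (2 * C * D) * norm (W - V) * ((1 + norm e) ^ 1 * (1 + norm z) ^ 1)" by (simp add: algebra_simps)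
    also have "\<dots> \<le> (2 * C * D) * norm (W - V) * envelope y"
      using nn envelope_ge[of 1 1 y] by (intro mult_left_mono) (auto simp: y)
    finally show ?thesis .
  qed
  moreover have "2 * C * D \<ge> 0" using nn by simp
  ultimately show ?thesis by blast
next
  case False
  then have "\<not> norm V \<le> R" for V :: "('d, 'h, 'l) weights" using norm_ge_zero[of V] by linarith
  then show ?thesis by (intro exI[of _ 0]) auto
qed

text \<open>Convergence on a dense set extends to moving parameters, because the Lipschitz constant
  in the parameter is a multiple of \<open>E\<close>, whose empirical means stay bounded. The path
  is fixed, so only countably many functions contribute exceptional null sets.\<close>

lemma emp_mean_continuous_convergence:
  fixes g :: "'p::euclidean_space \<Rightarrow> 'x \<Rightarrow> 'b::real_normed_vector"
  assumes D: "\<And>q e. e > 0 \<Longrightarrow> \<exists>p\<in>D. dist p q < e"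
    and lim: "\<And>p. p \<in> D \<Longrightarrow> (\<lambda>k. emp_mean x (N k) (g p)) \<longlonglongrightarrow> S p"
    and env: "(\<lambda>k. emp_mean x (N k) E) \<longlonglongrightarrow> c" and E: "\<And>y. 0 \<le> E y"
    and L: "\<And>R. \<exists>L\<ge>0. (\<forall>p q y. norm p \<le> R \<longrightarrow> norm q \<le> R \<longrightarrow> norm (g q y - g p y) \<le> L * norm (q - p) * E y) \<and>
        (\<forall>p q. norm p \<le> R \<longrightarrow> norm q \<le> R \<longrightarrow> norm (S q - S p) \<le> L * norm (q - p))"
    and q: "q \<longlonglongrightarrow> q0"
  shows "(\<lambda>k. emp_mean x (N k) (g (q k))) \<longlonglongrightarrow> S q0"
proof (rule metric_LIMSEQ_I)
  fix r :: real assume r: "r > 0"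
  obtain L where L0: "L \<ge> 0"
    and Lg: "\<And>p q y. norm p \<le> norm q0 + 1 \<Longrightarrow> norm q \<le> norm q0 + 1 \<Longrightarrow> norm (g q y - g p y) \<le> L * norm (q - p) * E y"
    and LS: "\<And>p q. norm p \<le> norm q0 + 1 \<Longrightarrow> norm q \<le> norm q0 + 1 \<Longrightarrow> norm (S q - S p) \<le> L * norm (q - p)"
    using L[of "norm q0 + 1"] by blast
  \<comment> \<open>The cap at 1 keeps the points in the ball where \<open>L\<close> is valid.
    Eventually \<open>\<bar>c\<bar> + 1\<close> bounds the mean of \<open>E\<close> and
    \<open>2 * d\<close> the distance of \<open>q k\<close> from \<open>p\<close>; the factor 8
    makes the resulting error at most \<open>r / 4\<close>, and \<open>L + 1\<close> avoids division
    by 0.\<close>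
  define d where "d = min 1 (r / (8 * (L + 1) * (\<bar>c\<bar> + 1)))"
  have d: "d > 0" "d \<le> 1" using r L0 by (auto simp: d_def)
  have dr: "L * (2 * d) * (\<bar>c\<bar> + 1) \<le> r / 4"
  proof -
    have "L * (2 * d) * (\<bar>c\<bar> + 1) \<le> (L + 1) * (2 * d) * (\<bar>c\<bar> + 1)" using d by (intro mult_right_mono) auto
    also have "\<dots> \<le> (L + 1) * (2 * (r / (8 * (L + 1) * (\<bar>c\<bar> + 1)))) * (\<bar>c\<bar> + 1)"
      using L0 by (intro mult_right_mono mult_left_mono) (auto simp: d_def)
    also have "\<dots> = r / 4"
    proof -
      have "a * (2 * (r / (8 * a * b))) * b = r / 4" if "a \<noteq> 0" "b \<noteq> 0" for a b :: real
        using that by (simp add: field_simps)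
      moreover have "L + 1 \<noteq> 0" "\<bar>c\<bar> + 1 \<noteq> 0" using L0 by linarith+
      ultimately show ?thesis by blast
    qed
    finally show ?thesis .
  qed
  obtain p where p: "p \<in> D" "dist p q0 < d" using D[OF d(1)] by blast
  have near: "norm x \<le> norm q0 + 1" if "dist x q0 < d" for x
    using that d norm_triangle_sub[of x q0] by (simp add: dist_norm)
  have "\<forall>\<^sub>F k in sequentially. dist (q k) q0 < d" using q d(1) by (rule tendstoD)
  moreover have "\<forall>\<^sub>F k in sequentially. dist (emp_mean x (N k) (g p)) (S p) < r / 4"
    using lim[OF p(1)] r by (intro tendstoD) auto
  moreover have "\<forall>\<^sub>F k in sequentially. emp_mean x (N k) E < \<bar>c\<bar> + 1"
    using env by (rule order_tendstoD) linarith
  ultimately have "\<forall>\<^sub>F k in sequentially. dist (emp_mean x (N k) (g (q k))) (S q0) < r"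
  proof eventually_elim
    case (elim k)
    have qp: "norm (q k - p) \<le> 2 * d"
    proof -
      have "dist (q k) p \<le> dist (q k) q0 + dist p q0" by (rule dist_triangle2)
      then show ?thesis using elim p(2) by (simp add: dist_norm)
    qed
    have E0: "0 \<le> emp_mean x (N k) E" using E by (simp add: emp_mean_def sum_nonneg)
    have "norm (emp_mean x (N k) (g (q k)) - emp_mean x (N k) (g p)) \<le> emp_mean x (N k) (\<lambda>y. L * norm (q k - p) * E y)"
      unfolding emp_mean_diff[symmetric]
      by (rule norm_emp_mean_le) (use Lg near elim p in auto)
    also have "\<dots> = L * norm (q k - p) * emp_mean x (N k) E" by (simp add: emp_mean_mult)
    also have "\<dots> \<le> L * (2 * d) * (\<bar>c\<bar> + 1)"
      using qp elim L0 E0 d by (intro mult_mono mult_left_mono) auto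
    finally have 1: "dist (emp_mean x (N k) (g (q k))) (emp_mean x (N k) (g p)) \<le> r / 4"
      using dr by (simp add: dist_norm)
    have "norm (S p - S q0) \<le> L * norm (p - q0)"
      using p(2) d by (intro LS near) auto
    also have "\<dots> \<le> L * (2 * d) * 1" using p(2) L0 d by (simp add: dist_norm mult_left_mono)
    also have "\<dots> \<le> L * (2 * d) * (\<bar>c\<bar> + 1)" using L0 d by (intro mult_left_mono) auto
    finally have 2: "dist (S p) (S q0) \<le> r / 4" using dr by (simp add: dist_norm)
    have "dist (emp_mean x (N k) (g (q k))) (S q0) \<le> dist (emp_mean x (N k) (g (q k))) (emp_mean x (N k) (g p))
        + (dist (emp_mean x (N k) (g p)) (S p) + dist (S p) (S q0))"
      using dist_triangle[of "emp_mean x (N k) (g (q k))" "S q0" "emp_mean x (N k) (g p)"]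
        dist_triangle[of "emp_mean x (N k) (g p)" "S q0" "S p"] by linarith
    then show ?case using 1 2 elim r by linarith
  qed
  then show "\<exists>n0. \<forall>k\<ge>n0. dist (emp_mean x (N k) (g (q k))) (S q0) < r"
    by (simp add: eventually_sequentially)
qed

text \<open>A cluster point of \<open>V\<close> is carried to \<open>W0\<close> by some symmetry.
  Applied to \<open>V k\<close>, the same symmetry gives members of its class that approach
  \<open>W0\<close>, and the nearest representative is at least as close. Different subsequences may
  need different symmetries.\<close>

lemma nearest_representative_tendsto:
  fixes W0 :: "('d::finite, 'h::finite, 'l::finite) weights" and V T :: "nat \<Rightarrow> ('d, 'h, 'l) weights"
  assumes K: "compact \<Theta>" "\<And>k. V k \<in> \<Theta>" and T: "\<And>k. nearest_representative W0 (V k) (T k)"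
    and lim: "\<And>s V'. strict_mono (s :: nat \<Rightarrow> nat) \<Longrightarrow> V' \<in> \<Theta> \<Longrightarrow> (\<lambda>k. V (s k)) \<longlonglongrightarrow> V' \<Longrightarrow> weight_equiv W0 V'"
  shows "T \<longlonglongrightarrow> W0"
proof (rule LIMSEQ_subseqI)
  fix r :: "nat \<Rightarrow> nat" assume r: "strict_mono r"
  obtain V' s where s: "V' \<in> \<Theta>" "strict_mono (s :: nat \<Rightarrow> nat)" "((\<lambda>k. V (r k)) \<circ> s) \<longlonglongrightarrow> V'"
    using K unfolding compact_def by (metis (no_types, lifting))
  have rs: "strict_mono (\<lambda>k. r (s k))" using r s(2) by (auto simp: strict_mono_def)
  have V': "(\<lambda>k. V (r (s k))) \<longlonglongrightarrow> V'" using s(3) by (simp add: o_def)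
  have "weight_equiv V' W0" using lim[OF rs s(1) V'] by (rule weight_equiv_sym)
  then obtain \<pi> \<sigma> where *: "bij \<pi>" "\<forall>j. \<sigma> j \<in> {1, -1}" "W0 = unit_transform \<pi> \<sigma> V'"
    unfolding weight_equiv_def by blast
  have "isCont (unit_transform \<pi> \<sigma>) V'"
  proof -
    have "continuous_on (UNIV :: ('d, 'h, 'l) weights set) (unit_transform \<pi> \<sigma>)"
      by (rule continuous_unit_transform)
    then show ?thesis by (simp add: continuous_on_eq_continuous_at)
  qed
  then have "(\<lambda>k. unit_transform \<pi> \<sigma> (V (r (s k)))) \<longlonglongrightarrow> W0"
    unfolding *(3) by (rule isCont_tendsto_compose[OF _ V'])
  then have z: "(\<lambda>k. dist (unit_transform \<pi> \<sigma> (V (r (s k)))) W0) \<longlonglongrightarrow> 0"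
    by (rule tendsto_dist_iff[THEN iffD1])
  have le: "dist (T (r (s k))) W0 \<le> dist (unit_transform \<pi> \<sigma> (V (r (s k)))) W0" for k
  proof -
    have "weight_equiv (V (r (s k))) (unit_transform \<pi> \<sigma> (V (r (s k))))"
      using *(1,2) unfolding weight_equiv_def by (intro exI[of _ \<pi>] exI[of _ \<sigma>]) simp
    then show ?thesis using T[of "r (s k)"] unfolding nearest_representative_def by simp
  qed
  have "(\<lambda>k. dist (T (r (s k))) W0) \<longlonglongrightarrow> 0"
    by (rule tendsto_sandwich[OF _ _ tendsto_const z]) (simp_all add: le)
  then show "\<exists>s :: nat \<Rightarrow> nat. strict_mono s \<and> (\<lambda>k. T (r (s k))) \<longlonglongrightarrow> W0"
    using s(2) tendsto_dist_iff[THEN iffD2] by (intro exI[of _ s] conjI)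
qed

lemma saturation_res_prod_min:
  assumes "W \<in> saturation \<Theta>"
  obtains V where "V \<in> \<Theta>" "mlp V = mlp W"
  using assms weight_equiv_mlp unfolding saturation_def by fastforce

section \<open>The regression model\<close>

lemma measurable_fst_snd_borel [measurable]:
  "(fst :: 'a::second_countable_topology \<times> 'b::second_countable_topology \<Rightarrow> 'a) \<in> borel_measurable borel"
  "(snd :: 'a \<times> 'b \<Rightarrow> 'b) \<in> borel_measurable borel"
  by (auto intro!: borel_measurable_continuous_onI continuous_intros)

lemma measurable_vec_nth [measurable (raw)]:
  fixes f :: "'x \<Rightarrow> real^'n"
  assumes "f \<in> borel_measurable N" shows "(\<lambda>x. f x $ i) \<in> borel_measurable N"
proof -
  have "(\<lambda>v :: real^'n. v $ i) \<in> borel_measurable borel"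
    by (intro borel_measurable_continuous_onI continuous_intros)
  from measurable_compose[OF assms this] show ?thesis .
qed

lemma integral_matrix_nth:
  fixes G :: "'w \<Rightarrow> real^'n^'m"
  assumes "integrable M G"
  shows "(\<integral>\<omega>. G \<omega> \<partial>M) $ i $ j = (\<integral>\<omega>. G \<omega> $ i $ j \<partial>M)"
proof -
  have "bounded_linear (\<lambda>A :: real^'n^'m. A $ i $ j)"
    using bounded_linear_compose[OF bounded_linear_vec_nth[of j] bounded_linear_vec_nth[of i]] by simp
  from integral_bounded_linear[OF this assms] show ?thesis by simp
qed

text \<open>The model in terms of noise and input only; the response is recovered as
  \<open>mlp W0\<close> of the input plus noise. Independence and moments are stated at index 0,
  since the joint law does not depend on the index.\<close>

locale mlp_regression = prob_space M for M :: "'w measure" +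
  fixes eps :: "nat \<Rightarrow> 'w \<Rightarrow> real^'d::finite" and Zs :: "nat \<Rightarrow> 'w \<Rightarrow> real^'l::finite"
    and W0 :: "('d, 'h::finite, 'l) weights" and \<Gamma>0 :: "real^'d^'d"
  assumes indep_pairs: "indep_vars (\<lambda>_. borel) (\<lambda>t \<omega>. (eps t \<omega>, Zs t \<omega>)) UNIV"
    and law: "\<And>t. distr M borel (\<lambda>\<omega>. (eps t \<omega>, Zs t \<omega>)) = distr M borel (\<lambda>\<omega>. (eps 0 \<omega>, Zs 0 \<omega>))"
    and indep_noise: "distr M (borel \<Otimes>\<^sub>M borel) (\<lambda>\<omega>. (eps 0 \<omega>, Zs 0 \<omega>)) = distr M borel (eps 0) \<Otimes>\<^sub>M distr M borel (Zs 0)"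
    and noise_square: "integrable M (\<lambda>\<omega>. (norm (eps 0 \<omega>))\<^sup>2)"
    and noise_centered: "integral\<^sup>L M (eps 0) = 0"
    and noise_cov: "(\<integral>\<omega>. outer_prod (eps 0 \<omega>) (eps 0 \<omega>) \<partial>M) = \<Gamma>0"
    and cov_invertible: "invertible \<Gamma>0"
    and input_cube: "integrable M (\<lambda>\<omega>. (norm (Zs 0 \<omega>)) ^ 3)"
begin

sublocale obs: iid_sequence M "\<lambda>t \<omega>. (eps t \<omega>, Zs t \<omega>)"
  by unfold_locales (rule indep_pairs, rule law)

lemma measurable_noise [measurable]: "eps t \<in> borel_measurable M"
  and measurable_input [measurable]: "Zs t \<in> borel_measurable M"
proof -
  show "eps t \<in> borel_measurable M"
    using measurable_compose[OF obs.X_measurable[of t] measurable_fst_snd_borel(1)] by simp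
  show "Zs t \<in> borel_measurable M"
    using measurable_compose[OF obs.X_measurable[of t] measurable_fst_snd_borel(2)] by simp
qed

lemma expectation_indep:
  fixes f :: "real^'d \<Rightarrow> real" and g :: "real^'l \<Rightarrow> real"
  assumes [measurable]: "f \<in> borel_measurable borel" "g \<in> borel_measurable borel"
    and f: "integrable M (\<lambda>\<omega>. f (eps 0 \<omega>))" and g: "integrable M (\<lambda>\<omega>. g (Zs 0 \<omega>))"
  shows "integrable M (\<lambda>\<omega>. f (eps 0 \<omega>) * g (Zs 0 \<omega>))"
    and "(\<integral>\<omega>. f (eps 0 \<omega>) * g (Zs 0 \<omega>) \<partial>M) = (\<integral>\<omega>. f (eps 0 \<omega>) \<partial>M) * (\<integral>\<omega>. g (Zs 0 \<omega>) \<partial>M)"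
proof -
  interpret F: prob_space "distr M borel (\<lambda>\<omega>. f (eps 0 \<omega>))" by (rule prob_space_distr) measurable
  interpret G: prob_space "distr M borel (\<lambda>\<omega>. g (Zs 0 \<omega>))" by (rule prob_space_distr) measurable
  have e: "distr M borel (\<lambda>\<omega>. f (eps 0 \<omega>)) = distr (distr M borel (eps 0)) borel f"
    "distr M borel (\<lambda>\<omega>. g (Zs 0 \<omega>)) = distr (distr M borel (Zs 0)) borel g"
    by (simp_all add: distr_distr o_def)
  have "distr M borel (\<lambda>\<omega>. f (eps 0 \<omega>)) \<Otimes>\<^sub>M distr M borel (\<lambda>\<omega>. g (Zs 0 \<omega>))
      = distr (distr M borel (eps 0) \<Otimes>\<^sub>M distr M borel (Zs 0)) (borel \<Otimes>\<^sub>M borel) (\<lambda>(x, y). (f x, g y))"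
    unfolding e by (rule pair_measure_distr) (simp_all add: G.sigma_finite_measure_axioms e[symmetric])
  also have "\<dots> = distr M (borel \<Otimes>\<^sub>M borel) (\<lambda>\<omega>. (f (eps 0 \<omega>), g (Zs 0 \<omega>)))"
    unfolding indep_noise[symmetric] by (subst distr_distr) (simp_all add: o_def)
  finally have "indep_var borel (\<lambda>\<omega>. f (eps 0 \<omega>)) borel (\<lambda>\<omega>. g (Zs 0 \<omega>))"
    unfolding indep_var_distribution_eq by (simp add: borel_prod)
  from indep_var_integrable[OF this f g] indep_var_lebesgue_integral[OF this f g]
  show "integrable M (\<lambda>\<omega>. f (eps 0 \<omega>) * g (Zs 0 \<omega>))"
    "(\<integral>\<omega>. f (eps 0 \<omega>) * g (Zs 0 \<omega>) \<partial>M) = (\<integral>\<omega>. f (eps 0 \<omega>) \<partial>M) * (\<integral>\<omega>. g (Zs 0 \<omega>) \<partial>M)" .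
qed

lemma integrable_noise_power: "integrable M (\<lambda>\<omega>. (1 + norm (eps 0 \<omega>))\<^sup>2)"
proof (rule Bochner_Integration.integrable_bound)
  show "integrable M (\<lambda>\<omega>. 2 + 2 * (norm (eps 0 \<omega>))\<^sup>2)" using noise_square by auto
  have "(1 + x)\<^sup>2 \<le> 2 + 2 * x\<^sup>2" for x :: real
    using zero_le_power2[of "1 - x"] by (simp add: power2_eq_square algebra_simps)
  then show "AE \<omega> in M. norm ((1 + norm (eps 0 \<omega>))\<^sup>2) \<le> norm (2 + 2 * (norm (eps 0 \<omega>))\<^sup>2)"
    by (intro AE_I2) simp
qed measurable

lemma integrable_input_power: "integrable M (\<lambda>\<omega>. (1 + norm (Zs 0 \<omega>)) ^ 3)"
proof (rule Bochner_Integration.integrable_bound)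
  show "integrable M (\<lambda>\<omega>. 8 + 8 * (norm (Zs 0 \<omega>)) ^ 3)" using input_cube by auto
  have "(1 + x) ^ 3 \<le> 8 + 8 * x ^ 3" if "0 \<le> x" for x :: real
  proof (cases "x \<le> 1")
    case True
    then have "(1 + x) ^ 3 \<le> 2 ^ 3" using that by (intro power_mono) auto
    also have "(2::real) ^ 3 \<le> 8 + 8 * x ^ 3" using that by simp
    finally show ?thesis .
  next
    case False
    then have "(1 + x) ^ 3 \<le> (2 * x) ^ 3" using that by (intro power_mono) auto
    then show ?thesis by (simp add: power_mult_distrib)
  qed
  then show "AE \<omega> in M. norm ((1 + norm (Zs 0 \<omega>)) ^ 3) \<le> norm (8 + 8 * (norm (Zs 0 \<omega>)) ^ 3)"
    by (intro AE_I2) simp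
qed measurable

lemma integrable_envelope: "integrable M (\<lambda>\<omega>. envelope (eps 0 \<omega>, Zs 0 \<omega>))"
  using expectation_indep(1)[OF _ _ integrable_noise_power integrable_input_power] by (simp add: envelope_def)

lemma measurable_envelope [measurable]: "envelope \<in> borel_measurable borel"
  unfolding envelope_def[abs_def] by measurable

lemma integrable_dominated:
  fixes g :: "(real^'d) \<times> (real^'l) \<Rightarrow> 'b::{banach, second_countable_topology}"
  assumes [measurable]: "g \<in> borel_measurable borel" and C: "\<And>y. norm (g y) \<le> C * envelope y"
  shows "integrable M (\<lambda>\<omega>. g (eps 0 \<omega>, Zs 0 \<omega>))"
proof (rule Bochner_Integration.integrable_bound)
  show "integrable M (\<lambda>\<omega>. C * envelope (eps 0 \<omega>, Zs 0 \<omega>))" using integrable_envelope by simp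
  show "(\<lambda>\<omega>. g (eps 0 \<omega>, Zs 0 \<omega>)) \<in> borel_measurable M"
    using measurable_compose[OF obs.X_measurable assms(1)] .
  have "norm (g y) \<le> norm (C * envelope y)" for y using C[of y] by simp
  then show "AE \<omega> in M. norm (g (eps 0 \<omega>, Zs 0 \<omega>)) \<le> norm (C * envelope (eps 0 \<omega>, Zs 0 \<omega>))"
    by (intro AE_I2)
qed

lemma integrable_noise_coord: "integrable M (\<lambda>\<omega>. eps 0 \<omega> $ i)"
proof (rule Bochner_Integration.integrable_bound[OF integrable_noise_power])
  have "\<bar>x\<bar> \<le> (1 + c)\<^sup>2" if "\<bar>x\<bar> \<le> c" for x c :: real
    using that self_le_power[of "1 + c" 2] abs_ge_zero[of x] by simp
  then show "AE \<omega> in M. norm (eps 0 \<omega> $ i) \<le> norm ((1 + norm (eps 0 \<omega>))\<^sup>2)"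
    by (intro AE_I2) (simp add: component_le_norm_cart)
qed measurable

lemma integrable_input_dominated:
  fixes f :: "real^'l \<Rightarrow> 'b::{banach, second_countable_topology}"
  assumes [measurable]: "f \<in> borel_measurable borel" and C: "\<And>z. norm (f z) \<le> C * (1 + norm z) ^ 3"
  shows "integrable M (\<lambda>\<omega>. f (Zs 0 \<omega>))"
proof (rule Bochner_Integration.integrable_bound)
  show "integrable M (\<lambda>\<omega>. C * (1 + norm (Zs 0 \<omega>)) ^ 3)" using integrable_input_power by simp
  have "norm (f z) \<le> norm (C * (1 + norm z) ^ 3)" for z using C[of z] by simp
  then show "AE \<omega> in M. norm (f (Zs 0 \<omega>)) \<le> norm (C * (1 + norm (Zs 0 \<omega>)) ^ 3)" by (intro AE_I2)
qed measurable

text \<open>Centred noise independent of the input kills every term in which it occurs once: the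
  mean score, the second-derivative term of the expansion, and the cross terms of
  \<open>limit_cov\<close>.\<close>

lemma noise_outer_prod:
  fixes f :: "real^'l \<Rightarrow> real^'n"
  assumes [measurable]: "f \<in> borel_measurable borel" and C: "\<And>z. norm (f z) \<le> C * (1 + norm z) ^ 3"
  shows "integrable M (\<lambda>\<omega>. outer_prod (eps 0 \<omega>) (f (Zs 0 \<omega>)))"
    and "(\<integral>\<omega>. outer_prod (eps 0 \<omega>) (f (Zs 0 \<omega>)) \<partial>M) = 0"
proof -
  have C0: "0 \<le> C" using order_trans[OF norm_ge_zero C[of 0]] by simp
  have "norm (outer_prod (fst y) (f (snd y))) \<le> C * envelope y" for y :: "(real^'d) \<times> (real^'l)"
  proof -
    have "norm (outer_prod (fst y) (f (snd y))) \<le> (1 + norm (fst y)) * (C * (1 + norm (snd y)) ^ 3)"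
      unfolding norm_outer_prod using C C0 by (intro mult_mono) auto
    also have "\<dots> \<le> C * envelope y"
      using mult_left_mono[OF envelope_ge[of 1 3 y] C0] by (simp add: mult_ac)
    finally show ?thesis .
  qed
  from integrable_dominated[OF _ this]
  show i: "integrable M (\<lambda>\<omega>. outer_prod (eps 0 \<omega>) (f (Zs 0 \<omega>)))" by simp
  have fj: "integrable M (\<lambda>\<omega>. f (Zs 0 \<omega>) $ j)" for j
    by (rule integrable_input_dominated[of "\<lambda>z. f z $ j" C])
      (auto intro: order_trans[OF component_le_norm_cart C])
  have e0: "(\<integral>\<omega>. eps 0 \<omega> $ i \<partial>M) = 0" for i
  proof -
    have "integrable M (eps 0)"
    proof (rule Bochner_Integration.integrable_bound[OF integrable_noise_power])
      have "c \<le> (1 + c)\<^sup>2" if "0 \<le> c" for c :: real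
        using that self_le_power[of "1 + c" 2] by simp
      then show "AE \<omega> in M. norm (eps 0 \<omega>) \<le> norm ((1 + norm (eps 0 \<omega>))\<^sup>2)" by (intro AE_I2) simp
    qed measurable
    from integral_bounded_linear[OF bounded_linear_vec_nth[of i] this] show ?thesis
      by (simp add: noise_centered)
  qed
  have "(\<integral>\<omega>. outer_prod (eps 0 \<omega>) (f (Zs 0 \<omega>)) \<partial>M) $ i $ j = 0" for i j
    unfolding integral_matrix_nth[OF i]
    using expectation_indep(2)[of "\<lambda>e. e $ i" "\<lambda>z. f z $ j", OF _ _ integrable_noise_coord fj] e0
    by (simp add: outer_prod_def)
  then show "(\<integral>\<omega>. outer_prod (eps 0 \<omega>) (f (Zs 0 \<omega>)) \<partial>M) = 0" by (simp add: vec_eq_iff)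
qed

text \<open>Expand in coordinates and factor by independence; the means of the noise products are
  the entries of \<open>\<Gamma>0\<close>. This yields the asymptotic variances.\<close>

lemma noise_quadratic:
  fixes f :: "real^'l \<Rightarrow> real^'d"
  assumes [measurable]: "f \<in> borel_measurable borel" and C: "\<And>z. norm (f z) \<le> C * (1 + norm z)"
  shows "integrable M (\<lambda>\<omega>. (eps 0 \<omega> \<bullet> f (Zs 0 \<omega>))\<^sup>2)"
    and "(\<integral>\<omega>. (eps 0 \<omega> \<bullet> f (Zs 0 \<omega>))\<^sup>2 \<partial>M) = (\<integral>\<omega>. f (Zs 0 \<omega>) \<bullet> (\<Gamma>0 *v f (Zs 0 \<omega>)) \<partial>M)"
proof -
  have sq: "(e \<bullet> a)\<^sup>2 = (\<Sum>i\<in>UNIV. \<Sum>j\<in>UNIV. (e $ i * e $ j) * (a $ i * a $ j))" for e a :: "real^'d"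
    by (simp add: inner_vec_def power2_eq_square sum_product mult_ac)
  have C0: "0 \<le> C" using order_trans[OF norm_ge_zero C[of 0]] by simp
  have ee: "integrable M (\<lambda>\<omega>. eps 0 \<omega> $ i * eps 0 \<omega> $ j)" for i j
  proof (rule Bochner_Integration.integrable_bound[OF noise_square])
    have "\<bar>e $ i * e $ j\<bar> \<le> (norm e)\<^sup>2" for e :: "real^'d"
      unfolding abs_mult power2_eq_square by (intro mult_mono component_le_norm_cart) auto
    then show "AE \<omega> in M. norm (eps 0 \<omega> $ i * eps 0 \<omega> $ j) \<le> norm ((norm (eps 0 \<omega>))\<^sup>2)"
      by (intro AE_I2) simp
  qed measurable
  have ff: "integrable M (\<lambda>\<omega>. f (Zs 0 \<omega>) $ i * f (Zs 0 \<omega>) $ j)" for i j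
  proof (rule integrable_input_dominated[of "\<lambda>z. f z $ i * f z $ j" "C\<^sup>2"])
    fix z
    have "\<bar>f z $ i * f z $ j\<bar> \<le> norm (f z) * norm (f z)"
      unfolding abs_mult by (intro mult_mono component_le_norm_cart) auto
    also have "\<dots> \<le> (C * (1 + norm z)) * (C * (1 + norm z))" using C C0 by (intro mult_mono) auto
    also have "\<dots> = C\<^sup>2 * (1 + norm z)\<^sup>2" by (simp add: power2_eq_square algebra_simps)
    also have "\<dots> \<le> C\<^sup>2 * (1 + norm z) ^ 3" by (intro mult_left_mono power_increasing) auto
    finally show "norm (f z $ i * f z $ j) \<le> C\<^sup>2 * (1 + norm z) ^ 3" by simp
  qed measurable
  have g: "\<Gamma>0 $ i $ j = (\<integral>\<omega>. eps 0 \<omega> $ i * eps 0 \<omega> $ j \<partial>M)" for i j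
  proof -
    have "integrable M (\<lambda>\<omega>. outer_prod (eps 0 \<omega>) (eps 0 \<omega>))"
    proof (rule Bochner_Integration.integrable_bound[OF noise_square])
      show "AE \<omega> in M. norm (outer_prod (eps 0 \<omega>) (eps 0 \<omega>)) \<le> norm ((norm (eps 0 \<omega>))\<^sup>2)"
        by (simp add: norm_outer_prod power2_eq_square)
    qed measurable
    from integral_matrix_nth[OF this, of i j] show ?thesis by (simp add: noise_cov) (simp add: outer_prod_def)
  qed
  note ind = expectation_indep[of "\<lambda>e. e $ i * e $ j" "\<lambda>z. f z $ i * f z $ j" for i j, OF _ _ ee ff]
  have ind1: "integrable M (\<lambda>\<omega>. (eps 0 \<omega> $ i * eps 0 \<omega> $ j) * (f (Zs 0 \<omega>) $ i * f (Zs 0 \<omega>) $ j))" for i j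
    by (rule ind(1)) measurable
  have ind2: "(\<integral>\<omega>. (eps 0 \<omega> $ i * eps 0 \<omega> $ j) * (f (Zs 0 \<omega>) $ i * f (Zs 0 \<omega>) $ j) \<partial>M)
      = \<Gamma>0 $ i $ j * (\<integral>\<omega>. f (Zs 0 \<omega>) $ i * f (Zs 0 \<omega>) $ j \<partial>M)" for i j
    unfolding g by (rule ind(2)) measurable
  show "integrable M (\<lambda>\<omega>. (eps 0 \<omega> \<bullet> f (Zs 0 \<omega>))\<^sup>2)"
    unfolding sq by (intro Bochner_Integration.integrable_sum ind1)
  have "(\<integral>\<omega>. (eps 0 \<omega> \<bullet> f (Zs 0 \<omega>))\<^sup>2 \<partial>M) = (\<Sum>i\<in>UNIV. \<Sum>j\<in>UNIV. \<Gamma>0 $ i $ j * (\<integral>\<omega>. f (Zs 0 \<omega>) $ i * f (Zs 0 \<omega>) $ j \<partial>M))"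
    unfolding sq by (simp add: Bochner_Integration.integral_sum Bochner_Integration.integrable_sum ind1 ind2)
  also have "\<dots> = (\<integral>\<omega>. f (Zs 0 \<omega>) \<bullet> (\<Gamma>0 *v f (Zs 0 \<omega>)) \<partial>M)"
    unfolding quadratic_form_sum
    by (simp add: Bochner_Integration.integral_sum Bochner_Integration.integrable_sum ff mult.commute)
  finally show "(\<integral>\<omega>. (eps 0 \<omega> \<bullet> f (Zs 0 \<omega>))\<^sup>2 \<partial>M) = (\<integral>\<omega>. f (Zs 0 \<omega>) \<bullet> (\<Gamma>0 *v f (Zs 0 \<omega>)) \<partial>M)" .
qed

text \<open>If the form of \<open>\<Gamma>0\<close> vanishes at \<open>x\<close>, the noise is
  almost surely orthogonal to \<open>x\<close>, so \<open>\<Gamma>0 *v x\<close>, a mean of noise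
  times its inner product with \<open>x\<close>, is 0. Invertibility then gives
  \<open>x = 0\<close>.\<close>

lemma pos_def_cov: "pos_def \<Gamma>0"
proof -
  have outer_i: "integrable M (\<lambda>\<omega>. outer_prod (eps 0 \<omega>) (eps 0 \<omega>))"
  proof (rule Bochner_Integration.integrable_bound[OF noise_square])
    show "AE \<omega> in M. norm (outer_prod (eps 0 \<omega>) (eps 0 \<omega>)) \<le> norm ((norm (eps 0 \<omega>))\<^sup>2)"
      by (simp add: norm_outer_prod power2_eq_square)
  qed measurable
  have g: "\<Gamma>0 $ i $ j = (\<integral>\<omega>. eps 0 \<omega> $ i * eps 0 \<omega> $ j \<partial>M)" for i j
    using integral_matrix_nth[OF outer_i, of i j] by (simp add: noise_cov) (simp add: outer_prod_def)
  have sym: "transpose \<Gamma>0 = \<Gamma>0" by (simp add: vec_eq_iff transpose_def g mult.commute)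
  have quad: "x \<bullet> (\<Gamma>0 *v x) = (\<integral>\<omega>. (eps 0 \<omega> \<bullet> x)\<^sup>2 \<partial>M)" "integrable M (\<lambda>\<omega>. (eps 0 \<omega> \<bullet> x)\<^sup>2)" for x
  proof -
    have "norm x \<le> norm x * (1 + norm z)" for z :: "real^'l" by (simp add: distrib_left)
    from noise_quadratic[of "\<lambda>_. x", OF _ this]
    show "x \<bullet> (\<Gamma>0 *v x) = (\<integral>\<omega>. (eps 0 \<omega> \<bullet> x)\<^sup>2 \<partial>M)" "integrable M (\<lambda>\<omega>. (eps 0 \<omega> \<bullet> x)\<^sup>2)"
      by (simp_all add: prob_space)
  qed
  have "0 < x \<bullet> (\<Gamma>0 *v x)" if x: "x \<noteq> 0" for x
  proof (rule ccontr)
    assume "\<not> 0 < x \<bullet> (\<Gamma>0 *v x)"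
    moreover have "0 \<le> (\<integral>\<omega>. (eps 0 \<omega> \<bullet> x)\<^sup>2 \<partial>M)" by simp
    ultimately have "(\<integral>\<omega>. (eps 0 \<omega> \<bullet> x)\<^sup>2 \<partial>M) = 0" unfolding quad(1) by linarith
    then have ae: "AE \<omega> in M. (eps 0 \<omega> \<bullet> x)\<^sup>2 = 0"
      using integral_nonneg_eq_0_iff_AE[OF quad(2)[of x]] by simp
    have "(y \<bullet> (\<Gamma>0 *v x)) = 0" for y
    proof -
      have "(\<Gamma>0 \<bullet> outer_prod y x) = (\<integral>\<omega>. outer_prod (eps 0 \<omega>) (eps 0 \<omega>) \<bullet> outer_prod y x \<partial>M)"
        unfolding noise_cov[symmetric] by (rule integral_inner_left[symmetric]) (rule outer_i)
      also have "\<dots> = (\<integral>\<omega>. 0 \<partial>M)"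
      proof (rule integral_cong_AE)
        show "AE \<omega> in M. outer_prod (eps 0 \<omega>) (eps 0 \<omega>) \<bullet> outer_prod y x = 0"
          using ae by eventually_elim (simp add: inner_outer_prod outer_prod_vector_mult)
      qed measurable
      finally show ?thesis by (simp add: inner_outer_prod)
    qed
    from this[of "\<Gamma>0 *v x"] have "\<Gamma>0 *v x = 0" by simp
    then have "matrix_inv \<Gamma>0 *v (\<Gamma>0 *v x) = 0" by simp
    then show False using x by (simp add: matrix_vector_mul_assoc matrix_inv_mult[OF cov_invertible])
  qed
  then show ?thesis using sym by (simp add: pos_def_def)
qed

end

lemma pos_def_nonneg: "pos_def A \<Longrightarrow> 0 \<le> x \<bullet> (A *v x)"
  unfolding pos_def_def by (cases "x = 0") (auto intro: less_imp_le)

lemma pos_def_eq_0D: "pos_def A \<Longrightarrow> x \<bullet> (A *v x) = 0 \<Longrightarrow> x = 0"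
  unfolding pos_def_def by force

lemma pos_def_inner_commute: "pos_def A \<Longrightarrow> x \<bullet> (A *v y) = y \<bullet> (A *v x)"
  using inner_matrix_transpose[of x A y] by (simp add: pos_def_def inner_commute)

section \<open>Information matrices, asymptotic variances and identification\<close>

context mlp_regression
begin

definition limit_cov :: "('d, 'h, 'l) weights \<Rightarrow> real^'d^'d" where
  "limit_cov W = (\<integral>\<omega>. res_prod W0 W (eps 0 \<omega>, Zs 0 \<omega>) \<partial>M)"

definition deriv_cov :: "('d, 'h, 'l) weight_index \<Rightarrow> ('d, 'h, 'l) weight_index \<Rightarrow> real^'d^'d" where
  "deriv_cov p q = (\<integral>\<omega>. deriv_prod W0 p q (eps 0 \<omega>, Zs 0 \<omega>) \<partial>M)"

text \<open>Half of the limiting Hessian at \<open>W0\<close> of least squares with weight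
  \<open>G\<close>; for the weight \<open>matrix_inv \<Gamma>0\<close> it becomes the matrix of the
  theorem.\<close>

definition info :: "real^'d^'d \<Rightarrow> real^(('d, 'h, 'l) weight_index)^(('d, 'h, 'l) weight_index)" where
  "info G = (\<chi> p q. G \<bullet> deriv_cov p q)"

abbreviation J :: "('d, 'h, 'l) weights \<Rightarrow> 'w \<Rightarrow> real^'d" where
  "J h \<omega> \<equiv> mlp_deriv W0 h (Zs 0 \<omega>)"

lemma deriv_bound: "\<exists>C\<ge>0. \<forall>h z. norm (mlp_deriv W0 h z) \<le> C * norm h * (1 + norm z)"
  using mlp_deriv_bound[of W0] by (metis (no_types, lifting) mult.assoc mult.commute)

lemma deriv_quadratic_integrable:
  "integrable M (\<lambda>\<omega>. outer_prod (J u \<omega>) (J v \<omega>))"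
proof -
  obtain C where C: "C \<ge> 0" "\<And>h z. norm (mlp_deriv W0 h z) \<le> C * norm h * (1 + norm z)"
    using deriv_bound by blast
  show ?thesis
  proof (rule integrable_input_dominated[of "\<lambda>z. outer_prod (mlp_deriv W0 u z) (mlp_deriv W0 v z)" "(C * norm u) * (C * norm v)"])
    fix z
    have "norm (outer_prod (mlp_deriv W0 u z) (mlp_deriv W0 v z)) \<le> (C * norm u * (1 + norm z)) * (C * norm v * (1 + norm z))"
      unfolding norm_outer_prod using C by (intro mult_mono) auto
    also have "\<dots> = (C * norm u) * (C * norm v) * (1 + norm z)\<^sup>2" by (simp add: power2_eq_square mult_ac)
    also have "\<dots> \<le> (C * norm u) * (C * norm v) * (1 + norm z) ^ 3"
      using C(1) by (intro mult_left_mono power_increasing) auto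
    finally show "norm (outer_prod (mlp_deriv W0 u z) (mlp_deriv W0 v z)) \<le> (C * norm u) * (C * norm v) * (1 + norm z) ^ 3" .
  qed measurable
qed

text \<open>Writes the form of \<open>info G\<close> as an integral over directional derivatives, so
  that matrix inequalities can be proved pointwise under the integral.\<close>

lemma info_bilinear:
  "u \<bullet> (info G *v v) = (\<integral>\<omega>. J u \<omega> \<bullet> (G *v J v \<omega>) \<partial>M)" "integrable M (\<lambda>\<omega>. J u \<omega> \<bullet> (G *v J v \<omega>))"
proof -
  have ax: "outer_prod (J u \<omega>) (J v \<omega>) = (\<Sum>p\<in>UNIV. \<Sum>q\<in>UNIV. (u $ p * v $ q) *\<^sub>R outer_prod (J (axis p 1) \<omega>) (J (axis q 1) \<omega>))" for \<omega>
    unfolding mlp_deriv_axes[of W0 u] mlp_deriv_axes[of W0 v]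
    by (simp add: outer_prod.sum_right outer_prod.sum_left outer_prod.scaleR_left outer_prod.scaleR_right scaleR_sum_right)
      (subst sum.swap, simp add: mult.commute)
  have "(\<integral>\<omega>. outer_prod (J u \<omega>) (J v \<omega>) \<partial>M) = (\<Sum>p\<in>UNIV. \<Sum>q\<in>UNIV. (u $ p * v $ q) *\<^sub>R deriv_cov p q)"
    unfolding ax deriv_cov_def deriv_prod_def
    by (simp add: Bochner_Integration.integral_sum Bochner_Integration.integrable_sum deriv_quadratic_integrable)
  then have "G \<bullet> (\<integral>\<omega>. outer_prod (J u \<omega>) (J v \<omega>) \<partial>M) = u \<bullet> (info G *v v)"
    by (simp add: info_def inner_sum_right inner_vec_def[of u] matrix_vector_mult_def sum_distrib_left mult_ac)
  also have "G \<bullet> (\<integral>\<omega>. outer_prod (J u \<omega>) (J v \<omega>) \<partial>M) = (\<integral>\<omega>. G \<bullet> outer_prod (J u \<omega>) (J v \<omega>) \<partial>M)"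
    by (rule integral_inner_right[symmetric]) (rule deriv_quadratic_integrable)
  finally show "u \<bullet> (info G *v v) = (\<integral>\<omega>. J u \<omega> \<bullet> (G *v J v \<omega>) \<partial>M)" by (simp add: inner_outer_prod)
  have "integrable M (\<lambda>\<omega>. G \<bullet> outer_prod (J u \<omega>) (J v \<omega>))"
    by (intro integrable_inner_right deriv_quadratic_integrable)
  then show "integrable M (\<lambda>\<omega>. J u \<omega> \<bullet> (G *v J v \<omega>))" by (simp add: inner_outer_prod)
qed

text \<open>If the form of \<open>info G\<close> vanishes at \<open>x\<close>, the derivative in the
  direction \<open>x\<close> is almost surely 0, a condition that does not involve the weight. The
  assumption on the Hessian for the optimal weight thereby covers all competing weights.\<close>

lemma info_pos_def:
  assumes G: "pos_def G" and H: "pos_def (info H)"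
  shows "pos_def (info G)"
proof -
  have symG: "transpose G = G" using G by (simp add: pos_def_def)
  have dt: "G \<bullet> deriv_cov p q = G \<bullet> deriv_cov q p" for p q
  proof -
    have "G \<bullet> deriv_cov p q = (\<integral>\<omega>. G \<bullet> outer_prod (J (axis p 1) \<omega>) (J (axis q 1) \<omega>) \<partial>M)" for p q
      unfolding deriv_cov_def deriv_prod_def
      unfolding snd_conv by (rule integral_inner_right[symmetric]) (rule deriv_quadratic_integrable)
    then show ?thesis using inner_outer_prod_commute[OF symG] by simp
  qed
  have sym: "transpose (info G) = info G" by (simp add: info_def transpose_def vec_eq_iff dt)
  have Gpos: "0 \<le> a \<bullet> (G *v a)" for a by (rule pos_def_nonneg[OF G])
  have "0 < x \<bullet> (info G *v x)" if x: "x \<noteq> 0" for x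
  proof (rule ccontr)
    assume "\<not> 0 < x \<bullet> (info G *v x)"
    moreover have "0 \<le> x \<bullet> (info G *v x)" unfolding info_bilinear by (intro Bochner_Integration.integral_nonneg) (simp add: Gpos)
    ultimately have "(\<integral>\<omega>. J x \<omega> \<bullet> (G *v J x \<omega>) \<partial>M) = 0" using info_bilinear(1)[of x G x] by linarith
    then have "AE \<omega> in M. J x \<omega> \<bullet> (G *v J x \<omega>) = 0"
      using integral_nonneg_eq_0_iff_AE[OF info_bilinear(2)[of x G x]] Gpos by simp
    then have "AE \<omega> in M. J x \<omega> \<bullet> (H *v J x \<omega>) = 0"
    proof eventually_elim
      case (elim \<omega>)
      then have "J x \<omega> = 0" by (rule pos_def_eq_0D[OF G])
      then show ?case by simp
    qed
    then have "(\<integral>\<omega>. J x \<omega> \<bullet> (H *v J x \<omega>) \<partial>M) = 0" by (rule integral_eq_zero_AE)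
    then have "x \<bullet> (info H *v x) = 0" by (simp add: info_bilinear)
    then have "x = 0" by (rule pos_def_eq_0D[OF H])
    then show False using x by simp
  qed
  then show ?thesis using sym by (simp add: pos_def_def)
qed

text \<open>The asymptotic variance of \<open>u \<bullet> T\<close> for the estimator weighted by \<open>G\<close>.\<close>

definition avar :: "real^'d^'d \<Rightarrow> ('d, 'h, 'l) weights \<Rightarrow> real" where
  "avar G u = (\<integral>\<omega>. (eps 0 \<omega> \<bullet> (G *v J (matrix_inv (info G) *v u) \<omega>))\<^sup>2 \<partial>M)"

lemma avar_eq:
  "avar G u = (\<integral>\<omega>. (G *v J (matrix_inv (info G) *v u) \<omega>) \<bullet> (\<Gamma>0 *v (G *v J (matrix_inv (info G) *v u) \<omega>)) \<partial>M)" (is ?eq)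
  and avar_integrable: "integrable M (\<lambda>\<omega>. (eps 0 \<omega> \<bullet> (G *v J w \<omega>))\<^sup>2)" (is ?int)
proof -
  obtain C where C: "C \<ge> 0" "\<And>h z. norm (mlp_deriv W0 h z) \<le> C * norm h * (1 + norm z)"
    using deriv_bound by blast
  obtain K where K: "K > 0" "\<And>a :: real^'d. norm (G *v a) \<le> norm a * K"
    using bounded_linear.pos_bounded[OF matrix_vector_mul_bounded_linear[of G]] by blast
  have b: "norm (G *v mlp_deriv W0 w z) \<le> (C * norm w * K) * (1 + norm z)" for w z
  proof -
    have "norm (G *v mlp_deriv W0 w z) \<le> norm (mlp_deriv W0 w z) * K" by (rule K)
    also have "\<dots> \<le> (C * norm w * (1 + norm z)) * K" using C K by (intro mult_right_mono) auto
    finally show ?thesis by (simp add: mult_ac)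
  qed
  show ?int by (rule noise_quadratic(1)[of "\<lambda>z. G *v mlp_deriv W0 w z", OF _ b]) measurable
  show ?eq unfolding avar_def
    by (rule noise_quadratic(2)[of "\<lambda>z. G *v mlp_deriv W0 (matrix_inv (info G) *v u) z", OF _ b]) measurable
qed

text \<open>For the optimal weight the sandwich form collapses: \<open>\<Gamma>0\<close> cancels one
  of the two factors \<open>matrix_inv \<Gamma>0\<close>, and the information matrix then cancels
  one of the two inverses.\<close>

lemma avar_optimal:
  assumes "pos_def (info (matrix_inv \<Gamma>0))"
  shows "avar (matrix_inv \<Gamma>0) u = u \<bullet> (matrix_inv (info (matrix_inv \<Gamma>0)) *v u)"
proof -
  let ?G = "matrix_inv \<Gamma>0" let ?w = "matrix_inv (info ?G) *v u"
  have "\<Gamma>0 *v (?G *v a) = a" for a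
    by (simp add: matrix_vector_mul_assoc matrix_inv_mult[OF cov_invertible])
  then have "avar ?G u = ?w \<bullet> (info ?G *v ?w)"
    unfolding avar_eq info_bilinear(1) by (simp add: inner_commute)
  also have "info ?G *v ?w = u"
    by (simp add: matrix_vector_mul_assoc matrix_inv_mult[OF pos_def_invertible[OF assms]])
  finally show ?thesis by (simp add: inner_commute)
qed

text \<open>Integrate \<open>2 a \<bullet> b \<le> a \<bullet> \<Gamma>\<^sub>0 a + b \<bullet> \<Gamma>\<^sub>0\<^sup>-\<^sup>1 b\<close> with \<open>a = G J w\<close> and \<open>b = J v\<close>.\<close>

lemma avar_ge:
  assumes I: "pos_def (info (matrix_inv \<Gamma>0))" and G: "pos_def G"
  shows "u \<bullet> (matrix_inv (info (matrix_inv \<Gamma>0)) *v u) \<le> avar G u"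
proof -
  let ?H = "matrix_inv \<Gamma>0"
  let ?w = "matrix_inv (info G) *v u" and ?v = "matrix_inv (info ?H) *v u"
  let ?a = "\<lambda>\<omega>. G *v J ?w \<omega>" and ?b = "\<lambda>\<omega>. J ?v \<omega>"
  have A: "pos_def (info G)" by (rule info_pos_def[OF G I])
  have Aw: "info G *v ?w = u" and Hv: "info ?H *v ?v = u"
    by (simp_all add: matrix_vector_mul_assoc matrix_inv_mult[OF pos_def_invertible[OF A]]
        matrix_inv_mult[OF pos_def_invertible[OF I]])
  have H: "pos_def ?H" by (rule pos_def_matrix_inv[OF pos_def_cov])
  have GH: "\<Gamma>0 *v (?H *v a) = a" for a
    by (simp add: matrix_vector_mul_assoc matrix_inv_mult[OF cov_invertible])
  have sG: "x \<bullet> (\<Gamma>0 *v y) = y \<bullet> (\<Gamma>0 *v x)" for x y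
    by (rule pos_def_inner_commute[OF pos_def_cov])
  have pt: "2 * (a \<bullet> b) \<le> a \<bullet> (\<Gamma>0 *v a) + b \<bullet> (?H *v b)" for a b
  proof -
    let ?c = "a - ?H *v b"
    have "0 \<le> ?c \<bullet> (\<Gamma>0 *v ?c)" by (rule pos_def_nonneg[OF pos_def_cov])
    also have "?c \<bullet> (\<Gamma>0 *v ?c) = a \<bullet> (\<Gamma>0 *v a) - 2 * (a \<bullet> b) + b \<bullet> (?H *v b)"
      using sG[of "?H *v b" a]
      by (simp add: matrix_vector_mult_diff_distrib inner_diff_left inner_diff_right GH inner_commute)
    finally show ?thesis by simp
  qed
  have ab: "integrable M (\<lambda>\<omega>. ?a \<omega> \<bullet> ?b \<omega>)" "(\<integral>\<omega>. ?a \<omega> \<bullet> ?b \<omega> \<partial>M) = ?v \<bullet> u"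
    using info_bilinear[of ?v G ?w] by (simp_all add: inner_commute Aw)
  have aa: "integrable M (\<lambda>\<omega>. ?a \<omega> \<bullet> (\<Gamma>0 *v ?a \<omega>))"
  proof -
    have e: "?a \<omega> \<bullet> (\<Gamma>0 *v ?a \<omega>) = J ?w \<omega> \<bullet> ((G ** \<Gamma>0 ** G) *v J ?w \<omega>)" for \<omega>
      using G inner_matrix_transpose[of "J ?w \<omega>" G "\<Gamma>0 *v ?a \<omega>"]
      by (simp add: matrix_vector_mul_assoc[symmetric] pos_def_def)
    show ?thesis unfolding e by (rule info_bilinear(2))
  qed
  have "2 * (?v \<bullet> u) = (\<integral>\<omega>. 2 * (?a \<omega> \<bullet> ?b \<omega>) \<partial>M)" by (simp add: ab)
  also have "\<dots> \<le> (\<integral>\<omega>. ?a \<omega> \<bullet> (\<Gamma>0 *v ?a \<omega>) + ?b \<omega> \<bullet> (?H *v ?b \<omega>) \<partial>M)"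
    by (rule integral_mono) (use ab aa info_bilinear(2)[of ?v ?H ?v] pt in auto)
  also have "\<dots> = avar G u + ?v \<bullet> u"
    using aa info_bilinear[of ?v ?H ?v] by (simp add: avar_eq Hv)
  finally show ?thesis by (simp add: inner_commute)
qed

lemma measurable_obs_functions [measurable]:
  "res_prod W0 W \<in> borel_measurable borel" "noise_deriv W0 p \<in> borel_measurable borel"
  "noise_deriv2 W0 p q \<in> borel_measurable borel" "deriv_prod W0 p q \<in> borel_measurable borel"
  unfolding res_prod_def[abs_def] noise_deriv_def[abs_def] noise_deriv2_def[abs_def] deriv_prod_def[abs_def]
  by measurable

lemma integrable_res_prod: "integrable M (\<lambda>\<omega>. res_prod W0 W (eps 0 \<omega>, Zs 0 \<omega>))"
proof -
  obtain C where "\<And>y. norm (res_prod W0 W y) \<le> C * envelope y" using norm_res_prod_le[of W0 W] by blast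
  then show ?thesis by (intro integrable_dominated) measurable
qed

lemma limit_cov_lipschitz:
  "\<exists>L\<ge>0. (\<forall>p q y. norm p \<le> R \<longrightarrow> norm q \<le> R \<longrightarrow> norm (res_prod W0 q y - res_prod W0 p y) \<le> L * norm (q - p) * envelope y) \<and>
    (\<forall>p q. norm p \<le> R \<longrightarrow> norm q \<le> R \<longrightarrow> norm (limit_cov q - limit_cov p) \<le> L * norm (q - p))"
proof -
  obtain L where L: "L \<ge> 0" "\<And>p q y. norm p \<le> R \<Longrightarrow> norm q \<le> R \<Longrightarrow>
      norm (res_prod W0 q y - res_prod W0 p y) \<le> L * norm (q - p) * envelope y"
    using res_prod_lipschitz[of R W0] by blast
  let ?E = "\<integral>\<omega>. envelope (eps 0 \<omega>, Zs 0 \<omega>) \<partial>M"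
  \<comment> \<open>As \<open>?E\<close> is at least 1, the single constant \<open>L * ?E\<close>
    serves both the pointwise and the integrated bound.\<close>
  have E1: "1 \<le> ?E"
  proof -
    have "(\<integral>\<omega>. 1 \<partial>M) \<le> ?E"
      by (rule integral_mono) (use integrable_envelope envelope_ge_1 in auto)
    then show ?thesis by (simp add: prob_space)
  qed
  have "norm (limit_cov q - limit_cov p) \<le> (L * ?E) * norm (q - p)" if "norm p \<le> R" "norm q \<le> R" for p q
  proof -
    have "norm (limit_cov q - limit_cov p) = norm (\<integral>\<omega>. res_prod W0 q (eps 0 \<omega>, Zs 0 \<omega>) - res_prod W0 p (eps 0 \<omega>, Zs 0 \<omega>) \<partial>M)"
      by (simp add: limit_cov_def integrable_res_prod)
    also have "\<dots> \<le> (\<integral>\<omega>. norm (res_prod W0 q (eps 0 \<omega>, Zs 0 \<omega>) - res_prod W0 p (eps 0 \<omega>, Zs 0 \<omega>)) \<partial>M)"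
      by (rule integral_norm_bound)
    also have "\<dots> \<le> (\<integral>\<omega>. L * norm (q - p) * envelope (eps 0 \<omega>, Zs 0 \<omega>) \<partial>M)"
      by (rule integral_mono) (use integrable_res_prod integrable_envelope L(2) that in auto)
    finally show ?thesis by (simp add: mult_ac)
  qed
  moreover have "norm (res_prod W0 q y - res_prod W0 p y) \<le> (L * ?E) * norm (q - p) * envelope y"
    if "norm p \<le> R" "norm q \<le> R" for p q y
  proof -
    have "L * norm (q - p) * envelope y * 1 \<le> L * norm (q - p) * envelope y * ?E"
      using E1 L(1) envelope_ge_1[of y] by (intro mult_left_mono mult_nonneg_nonneg) auto
    then show ?thesis using L(2)[OF that, of y] by (simp add: mult_ac)
  qed
  moreover have "0 \<le> L * ?E" using L(1) E1 by simp
  ultimately show ?thesis by blast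
qed

text \<open>The cross terms have mean zero, so the residual covariance is that of the noise plus a
  positive semidefinite bias term. This makes the true function the minimiser in the limit.\<close>

lemma limit_cov_eq:
  "limit_cov W = \<Gamma>0 + (\<integral>\<omega>. outer_prod (mlp W0 (Zs 0 \<omega>) - mlp W (Zs 0 \<omega>)) (mlp W0 (Zs 0 \<omega>) - mlp W (Zs 0 \<omega>)) \<partial>M)"
  and integrable_bias_prod: "integrable M (\<lambda>\<omega>. outer_prod (mlp W0 (Zs 0 \<omega>) - mlp W (Zs 0 \<omega>)) (mlp W0 (Zs 0 \<omega>) - mlp W (Zs 0 \<omega>)))"
proof -
  let ?d = "\<lambda>z. mlp W0 z - mlp W z"
  define C where "C = real CARD('d) * (real CARD('h) * norm W0 + norm W0) + real CARD('d) * (real CARD('h) * norm W + norm W)"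
  have d: "norm (?d z) \<le> C" for z
    using norm_triangle_ineq4[of "mlp W0 z" "mlp W z"] norm_mlp_le[of W0 z] norm_mlp_le[of W z] by (simp add: C_def)
  have C0: "0 \<le> C" by (simp add: C_def)
  have one: "1 \<le> (1 + norm z) ^ 3" for z :: "real^'l" by (rule one_le_power) simp
  have d3: "norm (?d z) \<le> C * (1 + norm z) ^ 3" for z
    using d[of z] mult_left_mono[OF one[of z] C0] by simp
  show dd: "integrable M (\<lambda>\<omega>. outer_prod (?d (Zs 0 \<omega>)) (?d (Zs 0 \<omega>)))"
  proof (rule integrable_input_dominated[of "\<lambda>z. outer_prod (?d z) (?d z)" "C * C"])
    fix z
    have "norm (outer_prod (?d z) (?d z)) \<le> C * C" unfolding norm_outer_prod using d C0 by (intro mult_mono) auto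
    also have "\<dots> \<le> C * C * (1 + norm z) ^ 3" using mult_left_mono[OF one[of z], of "C * C"] C0 by simp
    finally show "norm (outer_prod (?d z) (?d z)) \<le> C * C * (1 + norm z) ^ 3" .
  qed measurable
  have ee: "integrable M (\<lambda>\<omega>. outer_prod (eps 0 \<omega>) (eps 0 \<omega>))"
  proof (rule Bochner_Integration.integrable_bound[OF noise_square])
    show "AE \<omega> in M. norm (outer_prod (eps 0 \<omega>) (eps 0 \<omega>)) \<le> norm ((norm (eps 0 \<omega>))\<^sup>2)"
      by (simp add: norm_outer_prod power2_eq_square)
  qed measurable
  have ed: "integrable M (\<lambda>\<omega>. outer_prod (eps 0 \<omega>) (?d (Zs 0 \<omega>)))" "(\<integral>\<omega>. outer_prod (eps 0 \<omega>) (?d (Zs 0 \<omega>)) \<partial>M) = 0"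
    by (rule noise_outer_prod[of ?d, OF _ d3], measurable)+
  have tr: "bounded_linear (transpose :: real^'d^'d \<Rightarrow> real^'d^'d)"
    by (rule linear_conv_bounded_linear[THEN iffD1]) (auto simp: linear_iff transpose_def vec_eq_iff)
  have swap: "outer_prod (?d (Zs 0 \<omega>)) (eps 0 \<omega>) = transpose (outer_prod (eps 0 \<omega>) (?d (Zs 0 \<omega>)))" for \<omega>
    by (simp add: outer_prod_def transpose_def vec_eq_iff mult.commute)
  have de: "integrable M (\<lambda>\<omega>. outer_prod (?d (Zs 0 \<omega>)) (eps 0 \<omega>))" "(\<integral>\<omega>. outer_prod (?d (Zs 0 \<omega>)) (eps 0 \<omega>) \<partial>M) = 0"
    unfolding swap using integrable_bounded_linear[OF tr ed(1)] integral_bounded_linear[OF tr ed(1)]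
    by (auto simp: ed(2) linear_0[OF bounded_linear.linear[OF tr]])
  have "res_prod W0 W (eps 0 \<omega>, Zs 0 \<omega>) = outer_prod (eps 0 \<omega>) (eps 0 \<omega>) + outer_prod (eps 0 \<omega>) (?d (Zs 0 \<omega>))
      + outer_prod (?d (Zs 0 \<omega>)) (eps 0 \<omega>) + outer_prod (?d (Zs 0 \<omega>)) (?d (Zs 0 \<omega>))" for \<omega>
  proof -
    have "outer_prod (a + b) (a + b) = outer_prod a a + outer_prod a b + outer_prod b a + outer_prod b b" for a b :: "real^'d"
      by (simp add: outer_prod.add_left outer_prod.add_right)
    from this[of "eps 0 \<omega>" "?d (Zs 0 \<omega>)"] show ?thesis by (simp add: res_prod_def add_diff_eq)
  qed
  then show "limit_cov W = \<Gamma>0 + (\<integral>\<omega>. outer_prod (?d (Zs 0 \<omega>)) (?d (Zs 0 \<omega>)) \<partial>M)"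
    unfolding limit_cov_def using ee ed de dd by (simp add: noise_cov)
qed

lemma limit_cov_truth: "limit_cov W0 = \<Gamma>0"
  unfolding limit_cov_eq by simp (simp add: outer_prod_def zero_vec_def[symmetric])

text \<open>The excess over \<open>\<Gamma>0\<close> is the mean of the nonnegative form of
  \<open>G\<close> at the bias. If it is not positive, the bias vanishes almost surely.\<close>

lemma mlp_AE_eqI:
  assumes G: "pos_def G" and le: "G \<bullet> limit_cov W \<le> G \<bullet> \<Gamma>0"
  shows "AE \<omega> in M. mlp W (Zs 0 \<omega>) = mlp W0 (Zs 0 \<omega>)"
proof -
  let ?d = "\<lambda>\<omega>. mlp W0 (Zs 0 \<omega>) - mlp W (Zs 0 \<omega>)"
  have Gpos: "0 \<le> a \<bullet> (G *v a)" for a by (rule pos_def_nonneg[OF G])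
  have i: "integrable M (\<lambda>\<omega>. ?d \<omega> \<bullet> (G *v ?d \<omega>))"
    using integrable_inner_right[of G, OF integrable_bias_prod] by (simp add: inner_outer_prod)
  have "(\<integral>\<omega>. ?d \<omega> \<bullet> (G *v ?d \<omega>) \<partial>M) = G \<bullet> (\<integral>\<omega>. outer_prod (?d \<omega>) (?d \<omega>) \<partial>M)"
    unfolding inner_outer_prod[symmetric] by (rule integral_inner_right) (rule integrable_bias_prod)
  also have "\<dots> \<le> 0" using le by (simp add: limit_cov_eq inner_add_right)
  finally have "(\<integral>\<omega>. ?d \<omega> \<bullet> (G *v ?d \<omega>) \<partial>M) \<le> 0" .
  moreover have "0 \<le> (\<integral>\<omega>. ?d \<omega> \<bullet> (G *v ?d \<omega>) \<partial>M)" by (intro Bochner_Integration.integral_nonneg) (rule Gpos)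
  ultimately have "(\<integral>\<omega>. ?d \<omega> \<bullet> (G *v ?d \<omega>) \<partial>M) = 0" by linarith
  then have "AE \<omega> in M. ?d \<omega> \<bullet> (G *v ?d \<omega>) = 0"
    using integral_nonneg_eq_0_iff_AE[OF i] Gpos by simp
  then show ?thesis
  proof eventually_elim
    case (elim \<omega>)
    then have "?d \<omega> = 0" by (rule pos_def_eq_0D[OF G])
    then show ?case by simp
  qed
qed

end

section \<open>Continuity of inversion, stability of positive definiteness, log-determinants\<close>

lemma bounded_bilinear_matrix_mult: "bounded_bilinear ((**) :: real^'n^'n \<Rightarrow> real^'n^'n \<Rightarrow> real^'n^'n)"
  unfolding bilinear_conv_bounded_bilinear[symmetric] bilinear_def
  by (intro conjI allI linearI)
    (simp_all add: vec_eq_iff matrix_matrix_mult_def algebra_simps sum.distrib sum_distrib_left)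

text \<open>The inverses satisfy \<open>?X - ?Y = - (?X ** ((A k - B) ** ?Y))\<close>. For
  \<open>A k\<close> close to \<open>B\<close> this first gives
  \<open>norm ?X \<le> 2 * norm ?Y\<close>, by absorbing half of \<open>norm ?X\<close>, and then a
  Lipschitz bound.\<close>

lemma tendsto_matrix_inv:
  fixes A :: "nat \<Rightarrow> real^'n^'n"
  assumes lim: "A \<longlonglongrightarrow> B" and inv: "\<forall>\<^sub>F k in sequentially. invertible (A k)" "invertible B"
  shows "(\<lambda>k. matrix_inv (A k)) \<longlonglongrightarrow> matrix_inv B"
proof -
  have "\<exists>K>0. \<forall>(X :: real^'n^'n) (Y :: real^'n^'n). norm (X ** Y) \<le> norm X * norm Y * K"
    using bounded_bilinear.pos_bounded[OF bounded_bilinear_matrix_mult[where 'n='n]] by simp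
  then obtain K where K: "K > 0" "\<And>(X :: real^'n^'n) (Y :: real^'n^'n). norm (X ** Y) \<le> norm X * norm Y * K" by auto
  let ?b = "norm (matrix_inv B)"
  let ?d = "\<lambda>k. norm (A k - B)"
  have d: "?d \<longlonglongrightarrow> 0" using lim by (simp add: LIM_zero tendsto_norm_zero)
  then have "(\<lambda>k. K * K * ?b * ?d k) \<longlonglongrightarrow> K * K * ?b * 0" by (intro tendsto_intros)
  then have small: "\<forall>\<^sub>F k in sequentially. K * K * ?b * ?d k < 1/2" by (rule order_tendstoD) simp
  have "\<forall>\<^sub>F k in sequentially. norm (matrix_inv (A k) - matrix_inv B) \<le> (2 * K * K * ?b * ?b) * ?d k"
    using small inv(1)
  proof eventually_elim
    case (elim k)
    let ?X = "matrix_inv (A k)" let ?Y = "matrix_inv B"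
    have e: "?X - ?Y = - (?X ** ((A k - B) ** ?Y))"
    proof -
      have "?X ** ((A k - B) ** ?Y) = ?X ** (A k ** ?Y) - ?X ** (B ** ?Y)"
        by (simp add: bounded_bilinear.diff_left[OF bounded_bilinear_matrix_mult]
            bounded_bilinear.diff_right[OF bounded_bilinear_matrix_mult])
      also have "\<dots> = ?Y - ?X"
        using elim(2) inv(2) by (simp add: matrix_mul_assoc matrix_inv_mult)
      finally show ?thesis by simp
    qed
    have n: "norm (?X - ?Y) \<le> norm ?X * (K * K * ?b * ?d k)"
    proof -
      have "norm (?X - ?Y) \<le> norm ?X * norm ((A k - B) ** ?Y) * K" unfolding e norm_minus_cancel by (rule K)
      also have "\<dots> \<le> norm ?X * (?d k * ?b * K) * K" using K by (intro mult_right_mono mult_left_mono) auto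
      finally show ?thesis by (simp add: mult_ac)
    qed
    have "norm ?X \<le> ?b + norm (?X - ?Y)" by (metis norm_triangle_sub)
    also have "\<dots> \<le> ?b + norm ?X * (1/2)" using n mult_left_mono[OF less_imp_le[OF elim(1)], of "norm ?X"] by simp
    finally have "norm ?X \<le> 2 * ?b" by simp
    then have "norm ?X * (K * K * ?b * ?d k) \<le> (2 * ?b) * (K * K * ?b * ?d k)"
      using K by (intro mult_right_mono) auto
    then show ?case using n by (simp add: mult_ac)
  qed
  moreover have "(\<lambda>k. (2 * K * K * ?b * ?b) * ?d k) \<longlonglongrightarrow> 0"
    using tendsto_mult[OF tendsto_const[of "2 * K * K * ?b * ?b"] d] by simp
  ultimately have "(\<lambda>k. matrix_inv (A k) - matrix_inv B) \<longlonglongrightarrow> 0" by (rule Lim_null_comparison)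
  then show ?thesis by (rule LIM_zero_cancel)
qed

text \<open>At \<open>x\<close> the form moves by at most \<open>dist (A k) B\<close> times the
  square of \<open>norm x\<close>, which is eventually less than the coercivity bound
  \<open>l\<close> of \<open>B\<close> allows.\<close>

lemma eventually_pos_def:
  fixes A :: "nat \<Rightarrow> real^'n^'n"
  assumes lim: "A \<longlonglongrightarrow> B" and B: "pos_def B" and sym: "\<And>k. transpose (A k) = A k"
  shows "\<forall>\<^sub>F k in sequentially. pos_def (A k)"
proof -
  obtain l where l: "l > 0" "\<And>x :: real^'n. l * (norm x)\<^sup>2 \<le> x \<bullet> (B *v x)"
    using pos_def_lower_bound[OF B] by metis
  have "\<forall>\<^sub>F k in sequentially. dist (A k) B < l" using lim l(1) by (rule tendstoD)
  then show ?thesis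
  proof eventually_elim
    case (elim k)
    have "0 < x \<bullet> (A k *v x)" if x: "x \<noteq> 0" for x
    proof -
      have "\<bar>(A k - B) \<bullet> outer_prod x x\<bar> \<le> norm (A k - B) * (norm x * norm x)" by (rule abs_inner_outer_prod_le)
      also have "\<dots> < l * (norm x)\<^sup>2" using elim x by (simp add: dist_norm power2_eq_square)
      finally have "\<bar>x \<bullet> (A k *v x) - x \<bullet> (B *v x)\<bar> < l * (norm x)\<^sup>2"
        by (simp add: inner_outer_prod matrix_vector_mult_diff_rdistrib inner_diff_right)
      then show ?thesis using l(2)[of x] by linarith
    qed
    then show ?case using sym by (simp add: pos_def_def)
  qed
qed

lemma inner_matrix_inv_self:
  fixes A :: "real^'n^'n"
  assumes "pos_def A" shows "matrix_inv A \<bullet> A = CARD('n)"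
proof -
  have "matrix_inv A \<bullet> A = trace (matrix_inv A ** A)"
    using pos_def_matrix_inv[OF assms] by (simp add: trace_mult_inner pos_def_def)
  then show ?thesis by (simp add: matrix_inv_mult[OF pos_def_invertible[OF assms]] trace_I)
qed

lemma transpose_res_prod: "transpose (emp_mean x n (res_prod W0 W)) = emp_mean x n (res_prod W0 W)"
proof -
  have "linear (transpose :: real^'a^'a \<Rightarrow> real^'a^'a)" by (auto simp: linear_iff transpose_def vec_eq_iff)
  from emp_mean_linear[OF this, of x n "res_prod W0 W"]
  have "transpose (emp_mean x n (res_prod W0 W)) = emp_mean x n (\<lambda>y. transpose (res_prod W0 W y))" .
  moreover have "transpose (res_prod W0 W y) = res_prod W0 W y" for y
    by (simp add: res_prod_def outer_prod_def transpose_def mult.commute)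
  ultimately show ?thesis by simp
qed

lemma res_prod_cong: "mlp V = mlp W \<Longrightarrow> res_prod W0 V = res_prod W0 W"
  by (simp add: res_prod_def[abs_def])

text \<open>The log-determinant cost as a function of the residual covariance alone, with the same
  convention for singular matrices.\<close>

definition log_det :: "real^'n^'n \<Rightarrow> ereal" where
  "log_det A = (if det A > 0 then ereal (ln (det A)) else - \<infinity>)"

text \<open>Without \<open>det B > 0\<close> both values could be \<open>- \<infinity>\<close> and
  the order of the determinants would be lost. If only \<open>det A\<close> fails to be positive,
  the conclusion is immediate.\<close>

lemma log_det_le_imp_det_le: "log_det A \<le> log_det B \<Longrightarrow> det B > 0 \<Longrightarrow> det A \<le> det B"
  by (auto simp: log_det_def split: if_splits)

section \<open>Paths along which the empirical means converge\<close>

context mlp_regression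
begin

abbreviation sample :: "'w \<Rightarrow> nat \<Rightarrow> (real^'d) \<times> (real^'l)" where
  "sample \<omega> \<equiv> \<lambda>t. (eps t \<omega>, Zs t \<omega>)"

text \<open>Everything the pathwise arguments use, for one path and one sequence \<open>N\<close> of
  sample sizes. Moving weights and further subsequences are built into the first clause, because
  consistency extracts a subsequence that depends on the path.\<close>

definition good :: "'w \<Rightarrow> (nat \<Rightarrow> nat) \<Rightarrow> bool" where
  "good \<omega> N \<longleftrightarrow>
    (\<forall>s Ws W. strict_mono (s :: nat \<Rightarrow> nat) \<longrightarrow> Ws \<longlonglongrightarrow> W \<longrightarrow>
       (\<lambda>k. emp_mean (sample \<omega>) (N (s k)) (res_prod W0 (Ws k))) \<longlonglongrightarrow> limit_cov W) \<and>
    (\<forall>p. (\<lambda>k. emp_mean (sample \<omega>) (N k) (noise_deriv W0 p)) \<longlonglongrightarrow> 0) \<and>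
    (\<forall>p q. (\<lambda>k. emp_mean (sample \<omega>) (N k) (noise_deriv2 W0 p q)) \<longlonglongrightarrow> 0) \<and>
    (\<forall>p q. (\<lambda>k. emp_mean (sample \<omega>) (N k) (deriv_prod W0 p q)) \<longlonglongrightarrow> deriv_cov p q) \<and>
    (\<exists>E. (\<lambda>k. emp_mean (sample \<omega>) (N k) envelope) \<longlonglongrightarrow> E)"

lemma noise_deriv_mean:
  "integrable M (\<lambda>\<omega>. noise_deriv W0 p (eps 0 \<omega>, Zs 0 \<omega>))" "(\<integral>\<omega>. noise_deriv W0 p (eps 0 \<omega>, Zs 0 \<omega>) \<partial>M) = 0"
proof -
  obtain C where C: "C \<ge> 0" "\<And>h z. norm (mlp_deriv W0 h z) \<le> C * norm h * (1 + norm z)"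
    using deriv_bound by blast
  have "norm (mlp_deriv W0 h z) \<le> (C * norm h) * (1 + norm z) ^ 3" for h z
  proof -
    have "1 + norm z \<le> (1 + norm z) ^ 3" by (rule self_le_power) auto
    from mult_left_mono[OF this, of "C * norm h"] show ?thesis using C(1) C(2)[of h z] by simp
  qed
  from noise_outer_prod[OF measurable_mlp_deriv this]
  show "integrable M (\<lambda>\<omega>. noise_deriv W0 p (eps 0 \<omega>, Zs 0 \<omega>))" "(\<integral>\<omega>. noise_deriv W0 p (eps 0 \<omega>, Zs 0 \<omega>) \<partial>M) = 0"
    by (simp_all add: noise_deriv_def)
qed

lemma noise_deriv2_mean:
  "integrable M (\<lambda>\<omega>. noise_deriv2 W0 p q (eps 0 \<omega>, Zs 0 \<omega>))" "(\<integral>\<omega>. noise_deriv2 W0 p q (eps 0 \<omega>, Zs 0 \<omega>) \<partial>M) = 0"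
proof -
  obtain C where C: "C \<ge> 0" "\<And>h h' z. norm (mlp_deriv2 W0 h h' z) \<le> C * ((1 + norm z)\<^sup>2 * norm h * norm h')"
    using mlp_deriv2_bound[of W0] by blast
  have "norm (mlp_deriv2 W0 h h' z) \<le> (C * norm h * norm h') * (1 + norm z) ^ 3" for h h' z
  proof -
    have "(1 + norm z)\<^sup>2 \<le> (1 + norm z) ^ 3" by (rule power_increasing) auto
    from mult_left_mono[OF this, of "C * norm h * norm h'"] show ?thesis
      using C(1) C(2)[of h h' z] by (simp add: mult_ac)
  qed
  from noise_outer_prod[OF measurable_mlp_deriv2 this]
  show "integrable M (\<lambda>\<omega>. noise_deriv2 W0 p q (eps 0 \<omega>, Zs 0 \<omega>))" "(\<integral>\<omega>. noise_deriv2 W0 p q (eps 0 \<omega>, Zs 0 \<omega>) \<partial>M) = 0"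
    by (simp_all add: noise_deriv2_def)
qed

text \<open>Almost sure convergence is asked of countably many functions only: residual products at
  a countable dense set of weights and finitely many derivative terms. The clause on moving weights
  follows by \<open>emp_mean_continuous_convergence\<close>.\<close>

lemma good_subseq:
  assumes r: "strict_mono (r :: nat \<Rightarrow> nat)"
  shows "\<exists>s :: nat \<Rightarrow> nat. strict_mono s \<and> (AE \<omega> in M. good \<omega> (\<lambda>k. r (s k)))"
proof -
  obtain D :: "('d, 'h, 'l) weights set" where D: "countable D" "\<And>X. open X \<Longrightarrow> X \<noteq> {} \<Longrightarrow> \<exists>d\<in>D. d \<in> X"
    using countable_dense_exists by blast
  have dense: "\<exists>p\<in>D. dist p q < e" if "e > 0" for q e
  proof -
    have "ball q e \<noteq> {}" using that by simp
    then obtain p where "p \<in> D" "p \<in> ball q e" using D(2)[OF open_ball] by blast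
    then show ?thesis by (auto simp: dist_commute)
  qed
  define F where "F = res_prod W0 ` D \<union> range (noise_deriv W0) \<union> range (\<lambda>(p, q). noise_deriv2 W0 p q)
     \<union> range (\<lambda>(p, q). deriv_prod W0 p q)"
  have "countable F" unfolding F_def using D(1) by (intro countable_Un countable_image) (auto simp: uncountable_def)
  moreover have "F \<noteq> {}" by (auto simp: F_def)
  moreover have "f \<in> borel_measurable borel \<and> integrable M (\<lambda>\<omega>. f (eps 0 \<omega>, Zs 0 \<omega>))" if "f \<in> F" for f
    using that unfolding F_def
    by (auto simp: integrable_res_prod noise_deriv_mean noise_deriv2_mean)
      (simp add: deriv_prod_def deriv_quadratic_integrable)
  ultimately obtain s :: "nat \<Rightarrow> nat" where s: "strict_mono s" "AE \<omega> in M.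
      (\<forall>f\<in>F. (\<lambda>k. emp_mean (sample \<omega>) (r (s k)) f) \<longlonglongrightarrow> (\<integral>\<omega>. f (eps 0 \<omega>, Zs 0 \<omega>) \<partial>M)) \<and>
      (\<lambda>k. emp_mean (sample \<omega>) (r (s k)) envelope) \<longlonglongrightarrow> (\<integral>\<omega>. envelope (eps 0 \<omega>, Zs 0 \<omega>) \<partial>M)"
    using obs.lln_subseq_set[of F envelope r, OF _ _ _ _ measurable_envelope integrable_envelope r] by blast
  have "AE \<omega> in M. good \<omega> (\<lambda>k. r (s k))"
    using s(2)
  proof eventually_elim
    case (elim \<omega>)
    let ?x = "sample \<omega>"
    have lF: "(\<lambda>k. emp_mean ?x (r (s k)) f) \<longlonglongrightarrow> (\<integral>\<omega>. f (eps 0 \<omega>, Zs 0 \<omega>) \<partial>M)" if "f \<in> F" for f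
      using elim that by blast
    have lE: "(\<lambda>k. emp_mean ?x (r (s k)) envelope) \<longlonglongrightarrow> (\<integral>\<omega>. envelope (eps 0 \<omega>, Zs 0 \<omega>) \<partial>M)"
      using elim by blast
    have "(\<lambda>k. emp_mean ?x (r (s (s' k))) (res_prod W0 (Ws k))) \<longlonglongrightarrow> limit_cov W"
      if s': "strict_mono (s' :: nat \<Rightarrow> nat)" and Ws: "Ws \<longlonglongrightarrow> W" for s' Ws W
    proof (rule emp_mean_continuous_convergence[where g="res_prod W0" and S=limit_cov and E=envelope and D=D
          and N="\<lambda>k. r (s (s' k))"])
      show "\<exists>p\<in>D. dist p q < e" if "e > 0" for q e using dense[OF that] .
      show "(\<lambda>k. emp_mean ?x (r (s (s' k))) (res_prod W0 p)) \<longlonglongrightarrow> limit_cov p" if "p \<in> D" for p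
        using LIMSEQ_subseq_LIMSEQ[OF lF s', of "res_prod W0 p"] that by (auto simp: F_def limit_cov_def o_def)
      show "(\<lambda>k. emp_mean ?x (r (s (s' k))) envelope) \<longlonglongrightarrow> (\<integral>\<omega>. envelope (eps 0 \<omega>, Zs 0 \<omega>) \<partial>M)"
        using LIMSEQ_subseq_LIMSEQ[OF lE s'] by (simp add: o_def)
      show "0 \<le> envelope y" for y :: "(real^'d) \<times> (real^'l)"
        by (simp add: envelope_def)
    qed (rule limit_cov_lipschitz, rule Ws)
    moreover have "(\<lambda>k. emp_mean ?x (r (s k)) (noise_deriv W0 p)) \<longlonglongrightarrow> 0" for p
      using lF[of "noise_deriv W0 p"] by (simp add: F_def noise_deriv_mean)
    moreover have "(\<lambda>k. emp_mean ?x (r (s k)) (noise_deriv2 W0 p q)) \<longlonglongrightarrow> 0" for p q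
      using lF[of "noise_deriv2 W0 p q"] by (force simp: F_def noise_deriv2_mean)
    moreover have "(\<lambda>k. emp_mean ?x (r (s k)) (deriv_prod W0 p q)) \<longlonglongrightarrow> deriv_cov p q" for p q
      using lF[of "deriv_prod W0 p q"] by (force simp: F_def deriv_cov_def)
    ultimately show ?case unfolding good_def using lE by blast
  qed
  then show ?thesis using s(1) by blast
qed

lemma pos_def_limit_cov: "pos_def (limit_cov W)"
proof -
  let ?d = "\<lambda>\<omega>. mlp W0 (Zs 0 \<omega>) - mlp W (Zs 0 \<omega>)"
  let ?B = "\<integral>\<omega>. outer_prod (?d \<omega>) (?d \<omega>) \<partial>M"
  have "?B $ i $ j = ?B $ j $ i" for i j
    unfolding integral_matrix_nth[OF integrable_bias_prod] by (simp add: outer_prod_def mult.commute)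
  then have sB: "transpose ?B = ?B" by (simp add: transpose_def vec_eq_iff)
  have "transpose (limit_cov W) = limit_cov W"
    using pos_def_cov sB by (simp add: limit_cov_eq pos_def_def) (simp add: transpose_def vec_eq_iff)
  moreover have "0 < x \<bullet> (limit_cov W *v x)" if "x \<noteq> 0" for x
  proof -
    have "x \<bullet> (?B *v x) = (\<integral>\<omega>. outer_prod (?d \<omega>) (?d \<omega>) \<bullet> outer_prod x x \<partial>M)"
      by (subst integral_inner_left) (simp_all add: inner_outer_prod integrable_bias_prod)
    also have "\<dots> = (\<integral>\<omega>. (x \<bullet> ?d \<omega>)\<^sup>2 \<partial>M)"
      by (simp add: inner_outer_prod outer_prod_vector_mult power2_eq_square inner_commute)
    finally have "0 \<le> x \<bullet> (?B *v x)" by simp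
    then show ?thesis using pos_def_cov that
      by (simp add: limit_cov_eq matrix_vector_mult_add_rdistrib inner_add_right pos_def_def add_pos_nonneg)
  qed
  ultimately show ?thesis by (simp add: pos_def_def)
qed

text \<open>The leading term of the estimation error for the limiting weight \<open>G\<close>: a
  linear image of an average of centred i.i.d. variables, hence accessible to the central limit
  theorem.\<close>

definition lin :: "real^'d^'d \<Rightarrow> nat \<Rightarrow> 'w \<Rightarrow> ('d, 'h, 'l) weights" where
  "lin G n \<omega> = matrix_inv (info G) *v (\<chi> p. G \<bullet> emp_mean (sample \<omega>) n (score W0) $ p)"

lemma lin_tendsto_0:
  assumes "good \<omega> N" shows "(\<lambda>k. lin G (N k) \<omega>) \<longlonglongrightarrow> 0"
proof -
  have "(\<lambda>k. (\<chi> p. G \<bullet> emp_mean (sample \<omega>) (N k) (score W0) $ p)) \<longlonglongrightarrow> 0"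
  proof (rule vec_tendstoI)
    fix p
    have "(\<lambda>k. G \<bullet> emp_mean (sample \<omega>) (N k) (noise_deriv W0 p)) \<longlonglongrightarrow> G \<bullet> 0"
      using assms unfolding good_def by (intro tendsto_intros) blast
    then show "(\<lambda>k. (\<chi> p. G \<bullet> emp_mean (sample \<omega>) (N k) (score W0) $ p) $ p) \<longlonglongrightarrow> 0 $ p"
      by (simp add: emp_mean_score_nth)
  qed
  from bounded_linear.tendsto[OF matrix_vector_mul_bounded_linear this]
  show ?thesis by (simp add: lin_def)
qed

end

section \<open>Asymptotic linearity of the estimators\<close>

locale mlp_estimation = mlp_regression M eps Zs W0 \<Gamma>0
  for M :: "'w measure" and eps :: "nat \<Rightarrow> 'w \<Rightarrow> real^'d::finite" and Zs :: "nat \<Rightarrow> 'w \<Rightarrow> real^'l::finite"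
    and W0 :: "('d, 'h::finite, 'l) weights" and \<Gamma>0 :: "real^'d^'d" +
  fixes \<Theta> :: "('d, 'h, 'l) weights set"
  assumes compact_param: "compact \<Theta>"
    and true_param: "W0 \<in> \<Theta>" "W0 \<in> interior (saturation \<Theta>)"
    and identifiable: "\<And>W. W \<in> \<Theta> \<Longrightarrow> (AE \<omega> in M. mlp W (Zs 0 \<omega>) = mlp W0 (Zs 0 \<omega>)) \<Longrightarrow> weight_equiv W0 W"
    and info_pos: "pos_def (info (matrix_inv \<Gamma>0))"
begin

abbreviation emp_cov :: "'w \<Rightarrow> nat \<Rightarrow> ('d, 'h, 'l) weights \<Rightarrow> real^'d^'d" where
  "emp_cov \<omega> n W \<equiv> emp_mean (sample \<omega>) n (res_prod W0 W)"

text \<open>The minimiser is compared with \<open>W0 + lin\<close>, which therefore has to be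
  admissible. The interior is that of the saturation: if \<open>\<Theta>\<close> holds few
  representatives of each class, \<open>W0\<close> may lie on its boundary.\<close>

lemma eventually_lin_in_saturation:
  assumes "good \<omega> N" shows "\<forall>\<^sub>F k in sequentially. W0 + lin G (N k) \<omega> \<in> saturation \<Theta>"
proof -
  have "(\<lambda>k. W0 + lin G (N k) \<omega>) \<longlonglongrightarrow> W0 + 0" by (intro tendsto_intros lin_tendsto_0 assms)
  then have "(\<lambda>k. W0 + lin G (N k) \<omega>) \<longlonglongrightarrow> W0" by simp
  then have "\<forall>\<^sub>F k in sequentially. W0 + lin G (N k) \<omega> \<in> interior (saturation \<Theta>)"
    by (rule topological_tendstoD) (simp_all add: true_param)
  then show ?thesis by eventually_elim (use interior_subset in blast)
qed

text \<open>The costs depend on the weights through \<open>mlp\<close> only, which symmetries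
  preserve. A minimum over \<open>\<Theta>\<close> is therefore one over the saturation and passes
  to the representative \<open>T\<close>; the parameter \<open>c\<close> covers both
  criteria.\<close>

lemma minimal_on_saturation:
  fixes c :: "real^'d^'d \<Rightarrow> 'c::preorder"
  assumes T: "nearest_representative W0 V T" and min: "\<And>W. W \<in> \<Theta> \<Longrightarrow> c (emp_cov \<omega> n V) \<le> c (emp_cov \<omega> n W)"
    and W: "W \<in> saturation \<Theta>"
  shows "c (emp_cov \<omega> n T) \<le> c (emp_cov \<omega> n W)"
proof -
  obtain V' where V': "V' \<in> \<Theta>" "mlp V' = mlp W" using W by (rule saturation_res_prod_min)
  have "mlp T = mlp V" using T weight_equiv_mlp unfolding nearest_representative_def by blast
  then show ?thesis using min[OF V'(1)] res_prod_cong[OF V'(2), of W0] res_prod_cong[of T V W0] by simp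
qed

lemma truth_in_saturation: "W0 \<in> saturation \<Theta>"
  using true_param(2) interior_subset by blast

lemma goodD:
  assumes "good \<omega> N"
  shows "\<And>s Ws W. strict_mono (s :: nat \<Rightarrow> nat) \<Longrightarrow> Ws \<longlonglongrightarrow> W \<Longrightarrow> (\<lambda>k. emp_cov \<omega> (N (s k)) (Ws k)) \<longlonglongrightarrow> limit_cov W"
    and "\<And>Ws W. Ws \<longlonglongrightarrow> W \<Longrightarrow> (\<lambda>k. emp_cov \<omega> (N k) (Ws k)) \<longlonglongrightarrow> limit_cov W"
    and "\<And>p. (\<lambda>k. emp_mean (sample \<omega>) (N k) (noise_deriv W0 p)) \<longlonglongrightarrow> 0"
    and "\<And>p q. (\<lambda>k. emp_mean (sample \<omega>) (N k) (noise_deriv2 W0 p q)) \<longlonglongrightarrow> 0"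
    and "\<And>p q. (\<lambda>k. emp_mean (sample \<omega>) (N k) (deriv_prod W0 p q)) \<longlonglongrightarrow> deriv_cov p q"
    and "\<exists>E. (\<lambda>k. emp_mean (sample \<omega>) (N k) envelope) \<longlonglongrightarrow> E"
proof -
  note g = assms[unfolded good_def]
  show 1: "strict_mono s \<Longrightarrow> Ws \<longlonglongrightarrow> W \<Longrightarrow> (\<lambda>k. emp_cov \<omega> (N (s k)) (Ws k)) \<longlonglongrightarrow> limit_cov W"
    for s :: "nat \<Rightarrow> nat" and Ws W using g by blast
  show "Ws \<longlonglongrightarrow> W \<Longrightarrow> (\<lambda>k. emp_cov \<omega> (N k) (Ws k)) \<longlonglongrightarrow> limit_cov W" for Ws W
    using 1[of id Ws W] by (simp add: strict_mono_id)
qed (use assms in \<open>simp_all add: good_def\<close>)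

text \<open>The common end of both proofs. The comparison is assumed only eventually and along
  admissible sequences tending to \<open>W0\<close>, because for the log-determinant it rests on
  residual covariances that become positive definite from some index on. It is applied to the
  constant sequence \<open>W0\<close> and to \<open>W0 + lin\<close>.\<close>

lemma linear_of_weighted_minimum:
  assumes good: "good \<omega> N" and G: "pos_def Ginf"
    and Gk: "G \<longlonglongrightarrow> Ginf" "\<And>k. transpose (G k) = G k" and T: "T \<longlonglongrightarrow> W0"
    and opt: "\<And>Ws. Ws \<longlonglongrightarrow> W0 \<Longrightarrow> \<forall>\<^sub>F k in sequentially. Ws k \<in> saturation \<Theta> \<Longrightarrow>
      \<forall>\<^sub>F k in sequentially. G k \<bullet> emp_cov \<omega> (N k) (T k) \<le> G k \<bullet> emp_cov \<omega> (N k) (Ws k)"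
    and \<eta>: "\<eta> > 0"
  shows "\<forall>\<^sub>F k in sequentially. norm (T k - W0 - lin Ginf (N k) \<omega>) \<le> \<eta> * norm (emp_mean (sample \<omega>) (N k) (score W0))"
proof -
  obtain E where E: "(\<lambda>k. emp_mean (sample \<omega>) (N k) envelope) \<longlonglongrightarrow> E" using goodD(6)[OF good] by blast
  have l0: "(\<lambda>k. W0 + lin Ginf (N k) \<omega>) \<longlonglongrightarrow> W0"
    using tendsto_add[OF tendsto_const lin_tendsto_0[OF good]] by simp
  show ?thesis
    unfolding lin_def
  proof (rule asymptotic_linearity[where A="info Ginf" and DP=deriv_cov and E=E and G=G])
    show "\<forall>\<^sub>F k in sequentially. G k \<bullet> emp_cov \<omega> (N k) (T k) \<le> G k \<bullet> emp_cov \<omega> (N k) W0"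
      by (rule opt) (simp_all add: truth_in_saturation)
    show "\<forall>\<^sub>F k in sequentially. G k \<bullet> emp_cov \<omega> (N k) (T k) \<le> G k \<bullet> emp_cov \<omega> (N k)
        (W0 + matrix_inv (info Ginf) *v (\<chi> p. Ginf \<bullet> emp_mean (sample \<omega>) (N k) (score W0) $ p))"
      using opt[OF l0 eventually_lin_in_saturation[OF good]] by (simp add: lin_def)
    show "pos_def (info Ginf)" by (rule info_pos_def[OF G info_pos])
    show "info Ginf $ p $ q = Ginf \<bullet> deriv_cov p q" for p q by (simp add: info_def)
  qed (use goodD(3-5)[OF good] E Gk T \<eta> in auto)
qed

text \<open>With a constant weight the minimality passes to the limit: a cluster point
  \<open>V'\<close> satisfies
  \<open>G \<bullet> limit_cov V' \<le> G \<bullet> limit_cov W0\<close>, and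
  \<open>mlp_AE_eqI\<close> identifies its function.\<close>

lemma gls_linear:
  assumes good: "good \<omega> N" and G: "pos_def G"
    and V: "\<And>k. V k \<in> \<Theta>" "\<And>k. nearest_representative W0 (V k) (T k)"
    and min: "\<And>k W. W \<in> \<Theta> \<Longrightarrow> G \<bullet> emp_cov \<omega> (N k) (V k) \<le> G \<bullet> emp_cov \<omega> (N k) W"
    and \<eta>: "\<eta> > 0"
  shows "\<forall>\<^sub>F k in sequentially. norm (T k - W0 - lin G (N k) \<omega>) \<le> \<eta> * norm (emp_mean (sample \<omega>) (N k) (score W0))"
proof -
  have T: "T \<longlonglongrightarrow> W0"
  proof (rule nearest_representative_tendsto[OF compact_param V])
    fix s :: "nat \<Rightarrow> nat" and V' assume s: "strict_mono s" and V': "V' \<in> \<Theta>" "(\<lambda>k. V (s k)) \<longlonglongrightarrow> V'"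
    have "(\<lambda>k. G \<bullet> emp_cov \<omega> (N (s k)) (V (s k))) \<longlonglongrightarrow> G \<bullet> limit_cov V'"
      by (rule tendsto_inner[OF tendsto_const goodD(1)[OF good s V'(2)]])
    moreover have "(\<lambda>k. G \<bullet> emp_cov \<omega> (N (s k)) W0) \<longlonglongrightarrow> G \<bullet> limit_cov W0"
      by (rule tendsto_inner[OF tendsto_const goodD(1)[OF good s tendsto_const]])
    ultimately have "G \<bullet> limit_cov V' \<le> G \<bullet> limit_cov W0"
      by (rule LIMSEQ_le) (use min true_param(1) in blast)
    then show "weight_equiv W0 V'"
      using identifiable[OF V'(1) mlp_AE_eqI[OF G]] by (simp add: limit_cov_truth)
  qed
  show ?thesis
  proof (rule linear_of_weighted_minimum[OF good G tendsto_const _ T _ \<eta>])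
    show "transpose G = G" using G by (simp add: pos_def_def)
    fix Ws assume "\<forall>\<^sub>F k in sequentially. Ws k \<in> saturation \<Theta>"
    then show "\<forall>\<^sub>F k in sequentially. G \<bullet> emp_cov \<omega> (N k) (T k) \<le> G \<bullet> emp_cov \<omega> (N k) (Ws k)"
    proof eventually_elim
      case (elim k)
      show ?case by (rule minimal_on_saturation[where c="\<lambda>S. G \<bullet> S", OF V(2) min elim])
    qed
  qed
qed

text \<open>The minimiser of the log-determinant is a weighted least squares estimator whose weight is the
  inverse of its own empirical residual covariance, by \<open>det A \<le> det B \<Longrightarrow> tr (A\<^sup>-\<^sup>1 B) \<ge> d\<close>.\<close>

lemma log_det_linear:
  assumes good: "good \<omega> N"
    and V: "\<And>k. V k \<in> \<Theta>" "\<And>k. nearest_representative W0 (V k) (T k)"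
    and min: "\<And>k W. W \<in> \<Theta> \<Longrightarrow> log_det (emp_cov \<omega> (N k) (V k)) \<le> log_det (emp_cov \<omega> (N k) W)"
    and \<eta>: "\<eta> > 0"
  shows "\<forall>\<^sub>F k in sequentially. norm (T k - W0 - lin (matrix_inv \<Gamma>0) (N k) \<omega>) \<le> \<eta> * norm (emp_mean (sample \<omega>) (N k) (score W0))"
proof -
  have det0: "0 < det \<Gamma>0" by (rule pos_def_det[OF pos_def_cov])
  have cont_det: "(\<lambda>k. det (A k)) \<longlonglongrightarrow> det B" if "A \<longlonglongrightarrow> B" for A and B :: "real^'d^'d"
    unfolding det_def by (intro tendsto_intros tendsto_vec_nth that)
  have T: "T \<longlonglongrightarrow> W0"
  proof (rule nearest_representative_tendsto[OF compact_param V])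
    fix s :: "nat \<Rightarrow> nat" and V' assume s: "strict_mono s" and V': "V' \<in> \<Theta>" "(\<lambda>k. V (s k)) \<longlonglongrightarrow> V'"
    let ?S = "limit_cov V'"
    have S: "pos_def ?S" by (rule pos_def_limit_cov)
    have 1: "(\<lambda>k. det (emp_cov \<omega> (N (s k)) (V (s k)))) \<longlonglongrightarrow> det ?S"
      by (rule cont_det[OF goodD(1)[OF good s V'(2)]])
    have 2: "(\<lambda>k. det (emp_cov \<omega> (N (s k)) W0)) \<longlonglongrightarrow> det \<Gamma>0"
      using cont_det[OF goodD(1)[OF good s tendsto_const[of W0]]] by (simp add: limit_cov_truth)
    have "\<forall>\<^sub>F k in sequentially. 0 < det (emp_cov \<omega> (N (s k)) W0)"
      using 2 det0 by (rule order_tendstoD)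
    then have "\<forall>\<^sub>F k in sequentially. det (emp_cov \<omega> (N (s k)) (V (s k))) \<le> det (emp_cov \<omega> (N (s k)) W0)"
      by eventually_elim (rule log_det_le_imp_det_le[OF min[OF true_param(1)]])
    then have "det ?S \<le> det \<Gamma>0" by (rule tendsto_le[OF sequentially_bot 2 1])
    \<comment> \<open>Consistency from determinants alone: for the weight
      \<open>matrix_inv ?S\<close> the cluster point has value \<open>CARD('d)\<close>, and by the
      determinant inequality \<open>\<Gamma>0\<close> has at least this value, as
      \<open>mlp_AE_eqI\<close> requires.\<close>
    then have "matrix_inv ?S \<bullet> ?S \<le> matrix_inv ?S \<bullet> \<Gamma>0"
      using inner_matrix_inv_ge_card[OF S pos_def_cov] by (simp add: inner_matrix_inv_self[OF S])
    then show "weight_equiv W0 V'"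
      by (rule identifiable[OF V'(1) mlp_AE_eqI[OF pos_def_matrix_inv[OF S]]])
  qed
  let ?S = "\<lambda>k. emp_cov \<omega> (N k) (T k)"
  have S: "?S \<longlonglongrightarrow> \<Gamma>0" using goodD(2)[OF good T] by (simp add: limit_cov_truth)
  have pd: "\<forall>\<^sub>F k in sequentially. pos_def (?S k)"
    by (rule eventually_pos_def[OF S pos_def_cov transpose_res_prod])
  \<comment> \<open>The default keeps \<open>G k\<close> symmetric for every \<open>k\<close>. It
    concerns finitely many \<open>k\<close>, so neither the limit nor the eventual comparison sees
    it.\<close>
  define G where "G k = (if pos_def (?S k) then matrix_inv (?S k) else matrix_inv \<Gamma>0)" for k
  have symG: "transpose (G k) = G k" for k
    using pos_def_matrix_inv[OF pos_def_cov] pos_def_matrix_inv[of "?S k"] by (simp add: G_def pos_def_def)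
  have "(\<lambda>k. matrix_inv (?S k)) \<longlonglongrightarrow> matrix_inv \<Gamma>0"
    by (rule tendsto_matrix_inv[OF S]) (use pd in \<open>auto elim: eventually_mono simp: pos_def_invertible cov_invertible\<close>)
  then have Glim: "G \<longlonglongrightarrow> matrix_inv \<Gamma>0"
    by (rule Lim_transform_eventually) (use pd in \<open>auto elim: eventually_mono simp: G_def\<close>)
  show ?thesis
  proof (rule linear_of_weighted_minimum[OF good pos_def_matrix_inv[OF pos_def_cov] Glim symG T _ \<eta>])
    fix Ws assume Ws: "Ws \<longlonglongrightarrow> W0" "\<forall>\<^sub>F k in sequentially. Ws k \<in> saturation \<Theta>"
    have "\<forall>\<^sub>F k in sequentially. pos_def (emp_cov \<omega> (N k) (Ws k))"
      using goodD(2)[OF good Ws(1)] by (intro eventually_pos_def[OF _ pos_def_cov transpose_res_prod]) (simp add: limit_cov_truth)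
    then show "\<forall>\<^sub>F k in sequentially. G k \<bullet> emp_cov \<omega> (N k) (T k) \<le> G k \<bullet> emp_cov \<omega> (N k) (Ws k)"
      using pd Ws(2)
    proof eventually_elim
      case (elim k)
      have "log_det (?S k) \<le> log_det (emp_cov \<omega> (N k) (Ws k))"
        by (rule minimal_on_saturation[where c=log_det, OF V(2) min elim(3)])
      then have "det (?S k) \<le> det (emp_cov \<omega> (N k) (Ws k))"
        by (rule log_det_le_imp_det_le) (rule pos_def_det[OF elim(1)])
      \<comment> \<open>With \<open>G k\<close> the inverse of \<open>?S k\<close>, the left side
        equals \<open>CARD('d)\<close>, which is the lower bound for the right side.\<close>
      then show ?case
        using inner_matrix_inv_ge_card[OF elim(2) elim(1)] elim(2) by (simp add: G_def inner_matrix_inv_self)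
    qed
  qed
qed

end

section \<open>Central limit theorem for the linear term\<close>

lemma borel_measurable_vec_lambda:
  fixes f :: "'x \<Rightarrow> 'n::finite \<Rightarrow> 'a::euclidean_space"
  assumes "\<And>i. (\<lambda>x. f x i) \<in> borel_measurable N"
  shows "(\<lambda>x. \<chi> i. f x i) \<in> borel_measurable N"
proof (subst borel_measurable_euclidean_space, intro ballI)
  fix b :: "'a^'n" assume "b \<in> Basis"
  then obtain i a where b: "b = axis i a" by (auto simp: Basis_vec_def)
  show "(\<lambda>x. (\<chi> i. f x i) \<bullet> b) \<in> borel_measurable N"
    using assms[of i] by (simp add: b inner_axis)
qed

context mlp_regression
begin

lemma measurable_score [measurable]: "score W0 \<in> borel_measurable borel"
proof -
  have "(\<lambda>y. score W0 y) \<in> borel_measurable borel"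
    unfolding score_def[abs_def] by (rule borel_measurable_vec_lambda) measurable
  then show ?thesis .
qed

lemma score_square_integrable: "integrable M (\<lambda>\<omega>. (norm (score W0 (eps 0 \<omega>, Zs 0 \<omega>)))\<^sup>2)"
  and score_mean: "(\<integral>\<omega>. score W0 (eps 0 \<omega>, Zs 0 \<omega>) \<partial>M) = 0"
proof -
  obtain C where C: "C \<ge> 0" "\<And>h z. norm (mlp_deriv W0 h z) \<le> C * norm h * (1 + norm z)"
    using deriv_bound by blast
  let ?P = "real CARD(('d, 'h, 'l) weight_index)"
  have b: "norm (score W0 y) \<le> ?P * C * ((1 + norm (fst y)) * (1 + norm (snd y)))" for y
  proof -
    have nd: "norm (noise_deriv W0 p y) \<le> C * ((1 + norm (fst y)) * (1 + norm (snd y)))" for p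
    proof -
      have "norm (noise_deriv W0 p y) \<le> (1 + norm (fst y)) * (C * (1 + norm (snd y)))"
        unfolding noise_deriv_def norm_outer_prod using C(2)[of "axis p 1" "snd y"]
        by (intro mult_mono) (auto simp: norm_axis_1)
      then show ?thesis by (simp add: mult_ac)
    qed
    have "norm (score W0 y) \<le> (\<Sum>p\<in>UNIV. norm (score W0 y $ p))"
      unfolding norm_vec_def by (rule L2_set_le_sum) simp
    also have "\<dots> \<le> (\<Sum>p\<in>(UNIV :: ('d, 'h, 'l) weight_index set). C * ((1 + norm (fst y)) * (1 + norm (snd y))))"
      using nd by (intro sum_mono) (simp add: score_def)
    finally show ?thesis by simp
  qed
  have b2: "norm ((norm (score W0 y))\<^sup>2) \<le> (?P * C)\<^sup>2 * envelope y" for y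
  proof -
    have "(norm (score W0 y))\<^sup>2 \<le> (?P * C * ((1 + norm (fst y)) * (1 + norm (snd y))))\<^sup>2"
      using b by (intro power_mono) auto
    also have "\<dots> = (?P * C)\<^sup>2 * ((1 + norm (fst y))\<^sup>2 * (1 + norm (snd y))\<^sup>2)" by (simp add: power_mult_distrib)
    also have "\<dots> \<le> (?P * C)\<^sup>2 * envelope y" using envelope_ge[of 2 2 y] by (intro mult_left_mono) auto
    finally show ?thesis by simp
  qed
  show "integrable M (\<lambda>\<omega>. (norm (score W0 (eps 0 \<omega>, Zs 0 \<omega>)))\<^sup>2)"
    by (rule integrable_dominated[OF _ b2]) measurable
  have "norm (score W0 y) \<le> (?P * C) * envelope y" for y
    using b[of y] mult_left_mono[OF envelope_ge[of 1 1 y], of "?P * C"] C(1) by simp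
  then have i: "integrable M (\<lambda>\<omega>. score W0 (eps 0 \<omega>, Zs 0 \<omega>))"
    by (rule integrable_dominated[OF measurable_score])
  have "(\<integral>\<omega>. score W0 (eps 0 \<omega>, Zs 0 \<omega>) \<partial>M) $ p = 0" for p
    using integral_bounded_linear[OF bounded_linear_vec_nth[of p] i] by (simp add: score_def noise_deriv_mean)
  then show "(\<integral>\<omega>. score W0 (eps 0 \<omega>, Zs 0 \<omega>) \<partial>M) = 0" by (simp add: vec_eq_iff)
qed

text \<open>The symmetric inverse is moved over to \<open>u\<close>, which leaves an average of
  scalar variables; this is the Cramer-Wold reduction to one dimension.\<close>

lemma inner_lin:
  assumes "pos_def (info G)"
  shows "u \<bullet> lin G n \<omega> = emp_mean (sample \<omega>) n (\<lambda>y. fst y \<bullet> (G *v mlp_deriv W0 (matrix_inv (info G) *v u) (snd y)))"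
proof -
  let ?w = "matrix_inv (info G) *v u"
  have "u \<bullet> lin G n \<omega> = ?w \<bullet> (\<chi> p. G \<bullet> emp_mean (sample \<omega>) n (noise_deriv W0 p))"
    unfolding lin_def emp_mean_score_nth
    by (subst pos_def_inner_commute[OF pos_def_matrix_inv[OF assms]]) (rule inner_commute)
  also have "\<dots> = (\<Sum>p\<in>UNIV. ?w $ p * (G \<bullet> emp_mean (sample \<omega>) n (noise_deriv W0 p)))"
    by (simp add: inner_vec_def[of ?w])
  also have "\<dots> = emp_mean (sample \<omega>) n (\<lambda>y. \<Sum>p\<in>UNIV. ?w $ p * (G \<bullet> noise_deriv W0 p y))"
    by (simp add: emp_mean_sum emp_mean_mult emp_mean_inner)
  also have "(\<lambda>y. \<Sum>p\<in>UNIV. ?w $ p * (G \<bullet> noise_deriv W0 p y)) = (\<lambda>y. fst y \<bullet> (G *v mlp_deriv W0 ?w (snd y)))"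
  proof
    fix y :: "(real^'d) \<times> (real^'l)"
    have "(\<Sum>p\<in>UNIV. ?w $ p * (G \<bullet> noise_deriv W0 p y)) = G \<bullet> outer_prod (fst y) (mlp_deriv W0 ?w (snd y))"
      unfolding mlp_deriv_axes[of W0 ?w]
      by (simp add: noise_deriv_def outer_prod.sum_right outer_prod.scaleR_right inner_sum_right)
    then show "(\<Sum>p\<in>UNIV. ?w $ p * (G \<bullet> noise_deriv W0 p y)) = fst y \<bullet> (G *v mlp_deriv W0 ?w (snd y))"
      by (simp add: inner_outer_prod)
  qed
  finally show ?thesis .
qed

text \<open>The linear part has the stated limit by the scalar central limit theorem. The scaled
  error is at most \<open>\<eta>\<close> times the scaled norm of the mean score, which is bounded
  in L2, so it vanishes in probability and does not change the limit.\<close>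

lemma char_limit_of_linear:
  assumes G: "pos_def (info G)"
    and T: "\<And>n. n \<ge> 1 \<Longrightarrow> T n \<in> borel_measurable M"
    and lin: "\<And>r :: nat \<Rightarrow> nat. strict_mono r \<Longrightarrow> \<exists>s :: nat \<Rightarrow> nat. strict_mono s \<and> (AE \<omega> in M. \<forall>\<eta>>0. \<forall>\<^sub>F k in sequentially.
      norm (T (r (s k)) \<omega> - W0 - lin G (r (s k)) \<omega>) \<le> \<eta> * norm (emp_mean (sample \<omega>) (r (s k)) (score W0)))"
  shows "(\<lambda>n. \<integral>\<omega>. cis (u \<bullet> (sqrt (real n) *\<^sub>R (T n \<omega> - W0))) \<partial>M) \<longlonglongrightarrow> exp (- avar G u / 2)"
    and "\<And>n. (\<lambda>\<omega>. sqrt (real n) *\<^sub>R (T n \<omega> - W0)) \<in> borel_measurable M"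
proof -
  let ?A = "\<lambda>n \<omega>. sqrt (real n) *\<^sub>R (T n \<omega> - W0)"
  let ?B = "\<lambda>n \<omega>. sqrt (real n) *\<^sub>R lin G n \<omega>"
  let ?V = "\<lambda>n \<omega>. sqrt (real n) * norm (emp_mean (sample \<omega>) n (score W0))"
  \<comment> \<open>Nothing is known about \<open>T 0\<close>, but at \<open>n = 0\<close> the
    factor \<open>sqrt 0\<close> makes the function constant.\<close>
  show mA: "?A n \<in> borel_measurable M" for n
    using T[of n] by (cases "n = 0") auto
  have ms: "(\<lambda>\<omega>. emp_mean (sample \<omega>) n (score W0)) \<in> borel_measurable M" for n
    by (rule obs.emp_mean_measurable) measurable
  have "(\<lambda>\<omega>. (\<chi> p. G \<bullet> emp_mean (sample \<omega>) n (score W0) $ p)) \<in> borel_measurable M" for n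
    by (rule borel_measurable_vec_lambda) (unfold emp_mean_score_nth,
        intro borel_measurable_inner borel_measurable_const obs.emp_mean_measurable measurable_obs_functions)
  from measurable_compose[OF this borel_measurable_matrix_vector_mult]
  have ml: "lin G n \<in> borel_measurable M" for n unfolding lin_def[abs_def] .
  have mB: "?B n \<in> borel_measurable M" for n using ml by simp
  let ?w = "matrix_inv (info G) *v u"
  let ?g = "\<lambda>y :: (real^'d) \<times> (real^'l). fst y \<bullet> (G *v mlp_deriv W0 ?w (snd y))"
  have gm: "?g \<in> borel_measurable borel" by measurable
  have g0: "(\<integral>\<omega>. ?g (eps 0 \<omega>, Zs 0 \<omega>) \<partial>M) = 0"
  proof -
    obtain C where C: "C \<ge> 0" "\<And>h z. norm (mlp_deriv W0 h z) \<le> C * norm h * (1 + norm z)"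
      using deriv_bound by blast
    have "norm (mlp_deriv W0 ?w z) \<le> (C * norm ?w) * (1 + norm z) ^ 3" for z
    proof -
      have "1 + norm z \<le> (1 + norm z) ^ 3" by (rule self_le_power) auto
      from mult_left_mono[OF this, of "C * norm ?w"] show ?thesis using C(1) C(2)[of ?w z] by simp
    qed
    note o = noise_outer_prod[OF measurable_mlp_deriv this]
    have "(\<integral>\<omega>. ?g (eps 0 \<omega>, Zs 0 \<omega>) \<partial>M) = (\<integral>\<omega>. G \<bullet> outer_prod (eps 0 \<omega>) (J ?w \<omega>) \<partial>M)"
      by (simp add: inner_outer_prod)
    also have "\<dots> = G \<bullet> (\<integral>\<omega>. outer_prod (eps 0 \<omega>) (J ?w \<omega>) \<partial>M)"
      by (rule integral_inner_right) (rule o(1))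
    finally show ?thesis by (simp add: o(2))
  qed
  have gs: "integrable M (\<lambda>\<omega>. (?g (eps 0 \<omega>, Zs 0 \<omega>))\<^sup>2)"
    using avar_integrable[of G ?w] by simp
  have limB: "(\<lambda>n. \<integral>\<omega>. cis (u \<bullet> ?B n \<omega>) \<partial>M) \<longlonglongrightarrow> exp (- avar G u / 2)"
    using obs.clt_char[OF gm g0 gs] by (simp add: inner_lin[OF G] avar_def)
  have "(\<lambda>n. \<integral>\<omega>. min 1 (norm (?A n \<omega> - ?B n \<omega>)) \<partial>M) \<longlonglongrightarrow> 0"
  proof (rule expectation_min_1_tendsto_0[where V="?V" and C="\<integral>\<omega>. (norm (score W0 (eps 0 \<omega>, Zs 0 \<omega>)))\<^sup>2 \<partial>M"])
    show "(\<lambda>\<omega>. norm (?A n \<omega> - ?B n \<omega>)) \<in> borel_measurable M" for n using mA[of n] mB[of n] by measurable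
    show "?V n \<in> borel_measurable M" for n using ms[of n] by measurable
    show "integrable M (\<lambda>\<omega>. (?V n \<omega>)\<^sup>2)" "(\<integral>\<omega>. (?V n \<omega>)\<^sup>2 \<partial>M) \<le> (\<integral>\<omega>. (norm (score W0 (eps 0 \<omega>, Zs 0 \<omega>)))\<^sup>2 \<partial>M)" for n
      by (rule obs.second_moment_emp_mean[OF measurable_score score_mean score_square_integrable])+
    fix r :: "nat \<Rightarrow> nat" assume "strict_mono r"
    then obtain s :: "nat \<Rightarrow> nat" where s: "strict_mono s" "AE \<omega> in M. \<forall>\<eta>>0. \<forall>\<^sub>F k in sequentially.
      norm (T (r (s k)) \<omega> - W0 - lin G (r (s k)) \<omega>) \<le> \<eta> * norm (emp_mean (sample \<omega>) (r (s k)) (score W0))"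
      using lin by blast
    have "AE \<omega> in M. \<forall>\<eta>>0. \<forall>\<^sub>F k in sequentially. norm (?A (r (s k)) \<omega> - ?B (r (s k)) \<omega>) \<le> \<eta> * ?V (r (s k)) \<omega>"
      using s(2)
    proof eventually_elim
      case (elim \<omega>)
      show ?case
      proof (intro allI impI)
        fix \<eta> :: real assume "\<eta> > 0"
        with elim have "\<forall>\<^sub>F k in sequentially.
          norm (T (r (s k)) \<omega> - W0 - lin G (r (s k)) \<omega>) \<le> \<eta> * norm (emp_mean (sample \<omega>) (r (s k)) (score W0))" by blast
        then show "\<forall>\<^sub>F k in sequentially. norm (?A (r (s k)) \<omega> - ?B (r (s k)) \<omega>) \<le> \<eta> * ?V (r (s k)) \<omega>"
        proof eventually_elim
          case (elim k)
          have "?A (r (s k)) \<omega> - ?B (r (s k)) \<omega> = sqrt (real (r (s k))) *\<^sub>R (T (r (s k)) \<omega> - W0 - lin G (r (s k)) \<omega>)"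
            by (simp add: scaleR_diff_right)
          then have "norm (?A (r (s k)) \<omega> - ?B (r (s k)) \<omega>) = sqrt (real (r (s k))) * norm (T (r (s k)) \<omega> - W0 - lin G (r (s k)) \<omega>)"
            by simp
          also have "\<dots> \<le> sqrt (real (r (s k))) * (\<eta> * norm (emp_mean (sample \<omega>) (r (s k)) (score W0)))"
            using elim by (intro mult_left_mono) auto
          finally show ?case by (simp add: mult_ac)
        qed
      qed
    qed
    then show "\<exists>s :: nat \<Rightarrow> nat. strict_mono s \<and> (AE \<omega> in M. \<forall>\<eta>>0. \<forall>\<^sub>F k in sequentially.
        norm (?A (r (s k)) \<omega> - ?B (r (s k)) \<omega>) \<le> \<eta> * ?V (r (s k)) \<omega>)"
      using s(1) by blast
  qed simp_all
  from char_tendsto_close[OF mA mB this limB]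
  show "(\<lambda>n. \<integral>\<omega>. cis (u \<bullet> ?A n \<omega>) \<partial>M) \<longlonglongrightarrow> exp (- avar G u / 2)" .
qed

end

section \<open>Limit laws of the two estimators and their comparison\<close>

context mlp_estimation
begin

lemma linear_along_subsequences:
  assumes step: "\<And>\<omega> N. \<omega> \<in> space M \<Longrightarrow> good \<omega> N \<Longrightarrow> (\<And>k. N k \<ge> (1 :: nat)) \<Longrightarrow> P \<omega> N"
    and r: "strict_mono (r :: nat \<Rightarrow> nat)"
  shows "\<exists>s :: nat \<Rightarrow> nat. strict_mono s \<and> (AE \<omega> in M. P \<omega> (\<lambda>k. r (s k)))"
proof -
  \<comment> \<open>\<open>r 0\<close> may be 0, a sample size at which estimators are
    unconstrained; dropping it leaves sample sizes of at least 1.\<close>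
  have "strict_mono (\<lambda>k. r (Suc k))" using r by (auto simp: strict_mono_def)
  then obtain s where s: "strict_mono (s :: nat \<Rightarrow> nat)" "AE \<omega> in M. good \<omega> (\<lambda>k. r (Suc (s k)))"
    using good_subseq by blast
  have "1 \<le> r (Suc (s k))" for k
    using seq_suble[OF r, of "Suc (s k)"] by simp
  from s(2) AE_space have "AE \<omega> in M. P \<omega> (\<lambda>k. r (Suc (s k)))"
  proof eventually_elim
    case (elim \<omega>)
    show ?case by (rule step[OF elim(2,1)]) fact
  qed
  moreover have "strict_mono (\<lambda>k. Suc (s k))" using s(1) by (auto simp: strict_mono_def)
  ultimately show ?thesis by (intro exI[of _ "\<lambda>k. Suc (s k)"]) simp
qed

lemma gls_char_limit:
  assumes G: "pos_def G" and T: "\<And>n. n \<ge> 1 \<Longrightarrow> T n \<in> borel_measurable M"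
    and min: "\<And>n \<omega>. n \<ge> 1 \<Longrightarrow> \<omega> \<in> space M \<Longrightarrow> \<exists>V\<in>\<Theta>. nearest_representative W0 V (T n \<omega>) \<and>
      (\<forall>W\<in>\<Theta>. G \<bullet> emp_cov \<omega> n V \<le> G \<bullet> emp_cov \<omega> n W)"
  shows "(\<lambda>n. \<integral>\<omega>. cis (u \<bullet> (sqrt (real n) *\<^sub>R (T n \<omega> - W0))) \<partial>M) \<longlonglongrightarrow> exp (- avar G u / 2)"
    and "\<And>n. (\<lambda>\<omega>. sqrt (real n) *\<^sub>R (T n \<omega> - W0)) \<in> borel_measurable M"
proof -
  have "\<forall>\<^sub>F k in sequentially. norm (T (N k) \<omega> - W0 - lin G (N k) \<omega>) \<le> \<eta> * norm (emp_mean (sample \<omega>) (N k) (score W0))"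
    if \<omega>: "\<omega> \<in> space M" "good \<omega> N" "\<And>k. N k \<ge> 1" and \<eta>: "\<eta> > 0" for \<omega> N \<eta>
  proof -
    have "\<forall>k. \<exists>V. V \<in> \<Theta> \<and> nearest_representative W0 V (T (N k) \<omega>) \<and>
      (\<forall>W\<in>\<Theta>. G \<bullet> emp_cov \<omega> (N k) (V) \<le> G \<bullet> emp_cov \<omega> (N k) W)"
      using min[OF \<omega>(3) \<omega>(1)] by blast
    from choice[OF this] obtain V where V: "\<And>k. V k \<in> \<Theta>" "\<And>k. nearest_representative W0 (V k) (T (N k) \<omega>)"
      "\<And>k W. W \<in> \<Theta> \<Longrightarrow> G \<bullet> emp_cov \<omega> (N k) (V k) \<le> G \<bullet> emp_cov \<omega> (N k) W"
      by blast
    show ?thesis by (rule gls_linear[OF \<omega>(2) G V \<eta>])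
  qed
  then have lin: "\<exists>s :: nat \<Rightarrow> nat. strict_mono s \<and> (AE \<omega> in M. \<forall>\<eta>>0. \<forall>\<^sub>F k in sequentially.
      norm (T (r (s k)) \<omega> - W0 - lin G (r (s k)) \<omega>) \<le> \<eta> * norm (emp_mean (sample \<omega>) (r (s k)) (score W0)))"
    if "strict_mono r" for r :: "nat \<Rightarrow> nat"
    using that by (intro linear_along_subsequences[where P="\<lambda>\<omega> N. \<forall>\<eta>>0. \<forall>\<^sub>F k in sequentially.
      norm (T (N k) \<omega> - W0 - lin G (N k) \<omega>) \<le> \<eta> * norm (emp_mean (sample \<omega>) (N k) (score W0))"]) blast+
  show "(\<lambda>n. \<integral>\<omega>. cis (u \<bullet> (sqrt (real n) *\<^sub>R (T n \<omega> - W0))) \<partial>M) \<longlonglongrightarrow> exp (- avar G u / 2)"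
    "\<And>n. (\<lambda>\<omega>. sqrt (real n) *\<^sub>R (T n \<omega> - W0)) \<in> borel_measurable M"
    by (rule char_limit_of_linear[OF info_pos_def[OF G info_pos] T lin]; assumption)+
qed

lemma log_det_char_limit:
  assumes T: "\<And>n. n \<ge> 1 \<Longrightarrow> T n \<in> borel_measurable M"
    and min: "\<And>n \<omega>. n \<ge> 1 \<Longrightarrow> \<omega> \<in> space M \<Longrightarrow> \<exists>V\<in>\<Theta>. nearest_representative W0 V (T n \<omega>) \<and>
      (\<forall>W\<in>\<Theta>. log_det (emp_cov \<omega> n V) \<le> log_det (emp_cov \<omega> n W))"
  shows "(\<lambda>n. \<integral>\<omega>. cis (u \<bullet> (sqrt (real n) *\<^sub>R (T n \<omega> - W0))) \<partial>M) \<longlonglongrightarrow> exp (- avar (matrix_inv \<Gamma>0) u / 2)"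
    and "\<And>n. (\<lambda>\<omega>. sqrt (real n) *\<^sub>R (T n \<omega> - W0)) \<in> borel_measurable M"
proof -
  let ?G = "matrix_inv \<Gamma>0"
  have "\<forall>\<^sub>F k in sequentially. norm (T (N k) \<omega> - W0 - lin ?G (N k) \<omega>) \<le> \<eta> * norm (emp_mean (sample \<omega>) (N k) (score W0))"
    if \<omega>: "\<omega> \<in> space M" "good \<omega> N" "\<And>k. N k \<ge> 1" and \<eta>: "\<eta> > 0" for \<omega> N \<eta>
  proof -
    have "\<forall>k. \<exists>V. V \<in> \<Theta> \<and> nearest_representative W0 V (T (N k) \<omega>) \<and>
      (\<forall>W\<in>\<Theta>. log_det (emp_cov \<omega> (N k) (V)) \<le> log_det (emp_cov \<omega> (N k) W))"
      using min[OF \<omega>(3) \<omega>(1)] by blast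
    from choice[OF this] obtain V where V: "\<And>k. V k \<in> \<Theta>" "\<And>k. nearest_representative W0 (V k) (T (N k) \<omega>)"
      "\<And>k W. W \<in> \<Theta> \<Longrightarrow> log_det (emp_cov \<omega> (N k) (V k)) \<le> log_det (emp_cov \<omega> (N k) W)"
      by blast
    show ?thesis by (rule log_det_linear[OF \<omega>(2) V \<eta>])
  qed
  then have lin: "\<exists>s :: nat \<Rightarrow> nat. strict_mono s \<and> (AE \<omega> in M. \<forall>\<eta>>0. \<forall>\<^sub>F k in sequentially.
      norm (T (r (s k)) \<omega> - W0 - lin ?G (r (s k)) \<omega>) \<le> \<eta> * norm (emp_mean (sample \<omega>) (r (s k)) (score W0)))"
    if "strict_mono r" for r :: "nat \<Rightarrow> nat"
    using that by (intro linear_along_subsequences[where P="\<lambda>\<omega> N. \<forall>\<eta>>0. \<forall>\<^sub>F k in sequentially.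
      norm (T (N k) \<omega> - W0 - lin ?G (N k) \<omega>) \<le> \<eta> * norm (emp_mean (sample \<omega>) (N k) (score W0))"]) blast+
  show "(\<lambda>n. \<integral>\<omega>. cis (u \<bullet> (sqrt (real n) *\<^sub>R (T n \<omega> - W0))) \<partial>M) \<longlonglongrightarrow> exp (- avar ?G u / 2)"
    "\<And>n. (\<lambda>\<omega>. sqrt (real n) *\<^sub>R (T n \<omega> - W0)) \<in> borel_measurable M"
    by (rule char_limit_of_linear[OF info_pos T lin]; assumption)+
qed

end

text \<open>A competitor comes with an arbitrary asymptotic covariance \<open>S\<close>. As the
  limit of its characteristic function is already known, the form of \<open>S\<close> has to agree
  with the computed variance.\<close>

lemma char_limit_eq_mv_normal_form:
  fixes X :: "nat \<Rightarrow> 'w \<Rightarrow> real^'n"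
  assumes M: "prob_space M" and X: "\<And>n. X n \<in> borel_measurable M" and S: "pos_def S"
    and lim: "converges_in_law M X (mv_normal 0 S)"
    and char: "(\<lambda>n. \<integral>\<omega>. cis (u \<bullet> X n \<omega>) \<partial>M) \<longlonglongrightarrow> complex_of_real (exp (- v / 2))"
  shows "u \<bullet> (S *v u) = v"
proof -
  interpret prob_space M by (rule M)
  note X[measurable]
  have "Re (\<integral>\<omega>. cis (u \<bullet> X n \<omega>) \<partial>M) = (\<integral>\<omega>. cos (u \<bullet> X n \<omega>) \<partial>M)" for n
    by (subst integral_Re[symmetric]) (auto intro!: integrable_const_bound[of _ 1])
  then have "(\<lambda>n. \<integral>\<omega>. cos (u \<bullet> X n \<omega>) \<partial>M) \<longlonglongrightarrow> exp (- v / 2)"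
    using tendsto_Re[OF char] by simp
  then have "exp (- (u \<bullet> (S *v u)) / 2) = exp (- v / 2)"
    using converges_in_law_mv_normal_char[OF S lim] LIMSEQ_unique by blast
  then show ?thesis by simp
qed

lemma minimum_estimatorD:
  fixes C :: "nat \<Rightarrow> 'w \<Rightarrow> ('d::finite, 'h::finite, 'l::finite) weights \<Rightarrow> 'c::linorder"
  assumes "minimum_estimator M \<Theta> W0 C T" "n \<ge> 1"
  shows "T n \<in> borel_measurable M"
    and "\<omega> \<in> space M \<Longrightarrow> \<exists>V\<in>\<Theta>. nearest_representative W0 V (T n \<omega>) \<and> (\<forall>W\<in>\<Theta>. C n \<omega> V \<le> C n \<omega> W)"
proof -
  show "T n \<in> borel_measurable M" using assms unfolding minimum_estimator_def by blast
  assume "\<omega> \<in> space M"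
  then obtain V where V: "is_arg_min (C n \<omega>) (\<lambda>W. W \<in> \<Theta>) V" "nearest_representative W0 V (T n \<omega>)"
    using assms unfolding minimum_estimator_def by blast
  then show "\<exists>V\<in>\<Theta>. nearest_representative W0 V (T n \<omega>) \<and> (\<forall>W\<in>\<Theta>. C n \<omega> V \<le> C n \<omega> W)"
    by (intro bexI[of _ V]) (auto simp: is_arg_min_def not_less)
qed

theorem mainTheorem5:
  fixes M :: "'w measure"
    and Y :: "'w \<Rightarrow> real^'d::finite" and Z :: "'w \<Rightarrow> real^'l::finite"
    and Ys :: "nat \<Rightarrow> 'w \<Rightarrow> real^'d" and Zs :: "nat \<Rightarrow> 'w \<Rightarrow> real^'l"
    and eps :: "nat \<Rightarrow> 'w \<Rightarrow> real^'d"
    and \<Gamma>0 :: "real^'d^'d"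
    and \<Theta> :: "('d, 'h::finite, 'l) weights set"
    and W0 :: "('d, 'h, 'l) weights"
    and What Wstar :: "nat \<Rightarrow> 'w \<Rightarrow> ('d, 'h, 'l) weights"
  defines "I0 \<equiv> information_matrix M \<Gamma>0 Z W0"
  assumes M: "prob_space M"
    and generic_pair: "Y \<in> borel_measurable M" "Z \<in> borel_measurable M"
    and indep_pairs:
      "prob_space.indep_vars M (\<lambda>_. borel) (\<lambda>t \<omega>. (Ys t \<omega>, Zs t \<omega>)) UNIV"
    and same_law: "\<And>t. distr M borel (\<lambda>\<omega>. (Ys t \<omega>, Zs t \<omega>)) = distr M borel (\<lambda>\<omega>. (Y \<omega>, Z \<omega>))"
    and model: "\<And>t \<omega>. \<omega> \<in> space M \<Longrightarrow> Ys t \<omega> = mlp W0 (Zs t \<omega>) + eps t \<omega>"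
    and noise_indep: "prob_space.indep_vars M (\<lambda>_. borel) eps UNIV"
    and noise_same_law: "\<And>t. distr M borel (eps t) = distr M borel (eps 0)"
    and noise_indep_input: 
      "\<And>t. distr M (borel \<Otimes>\<^sub>M borel) (\<lambda>\<omega>. (eps t \<omega>, Zs t \<omega>))
           = distr M borel (eps t) \<Otimes>\<^sub>M distr M borel (Zs t)"
    and noise_square: "\<And>t. integrable M (\<lambda>\<omega>. (norm (eps t \<omega>))\<^sup>2)"
    and noise_centered: "\<And>t. integral\<^sup>L M (eps t) = 0"
    and noise_cov: "\<And>t. covariance_matrix M (eps t) = \<Gamma>0" "invertible \<Gamma>0"
    and Z_cube: "integrable M (\<lambda>\<omega>. (norm (Z \<omega>)) ^ 3)"
    and compact_param: "compact \<Theta>"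
    and true_param: "W0 \<in> \<Theta>" "W0 \<in> interior (saturation \<Theta>)"
    and no_redundant: "\<And>W j. W \<in> \<Theta> \<Longrightarrow> \<not> redundant_unit W j"
    and identifiable:
      "\<And>W. W \<in> \<Theta> \<Longrightarrow> (AE \<omega> in M. mlp W (Z \<omega>) = mlp W0 (Z \<omega>)) \<Longrightarrow> weight_equiv W0 W"
    and hessian: "pos_def (2 *\<^sub>R I0)"
    and What: "minimum_estimator M \<Theta> W0 (log_det_cost Ys Zs) What"
    and Wstar: "minimum_estimator M \<Theta> W0 (gls_cost \<Gamma>0 Ys Zs) Wstar"
  shows "converges_in_law M (\<lambda>n \<omega>. sqrt (real n) *\<^sub>R (What n \<omega> - W0)) (mv_normal 0 (matrix_inv I0))
       \<and> converges_in_law M (\<lambda>n \<omega>. sqrt (real n) *\<^sub>R (Wstar n \<omega> - W0)) (mv_normal 0 (matrix_inv I0))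
       \<and> same_asymptotic_covariance M W0 What Wstar
       \<and> asymptotically_optimal M W0 (gls_estimators M Ys Zs \<Theta> W0) Wstar
       \<and> asymptotically_optimal M W0 (gls_estimators M Ys Zs \<Theta> W0) What"
proof -
  interpret prob_space M by (rule M)
  have pair_m [measurable]: "(\<lambda>\<omega>. (Ys t \<omega>, Zs t \<omega>)) \<in> borel_measurable M" for t
    using indep_pairs unfolding indep_vars_def by auto
  have [measurable]: "Ys t \<in> borel_measurable M" "Zs t \<in> borel_measurable M" for t
    using measurable_compose[OF pair_m measurable_fst_snd_borel(1)]
      measurable_compose[OF pair_m measurable_fst_snd_borel(2)] by simp_all
  note generic_pair[measurable]
  \<comment> \<open>The model equation is assumed on \<open>space M\<close> only. With the noise
    taken as this difference it holds everywhere, and the costs become functions of \<open>e\<close>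
    and \<open>Zs\<close> without a side condition.\<close>
  define e where "e t \<omega> = Ys t \<omega> - mlp W0 (Zs t \<omega>)" for t \<omega>
  have e: "e t \<omega> = eps t \<omega>" if "\<omega> \<in> space M" for t \<omega>
    using model[OF that] by (simp add: e_def)
  have [measurable]: "e t \<in> borel_measurable M" for t unfolding e_def by measurable
  have eps_m [measurable]: "eps t \<in> borel_measurable M" for t
    using noise_indep unfolding indep_vars_def by auto
  let ?g = "\<lambda>p. (fst p - mlp W0 (snd p), snd p)"
  have g: "(\<lambda>p :: (real^'d) \<times> (real^'l). ?g p) \<in> borel_measurable borel" by measurable
  have eg: "(\<lambda>\<omega>. (e t \<omega>, Zs t \<omega>)) = (\<lambda>\<omega>. ?g (Ys t \<omega>, Zs t \<omega>))" for t
    by (simp add: e_def)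
  \<comment> \<open>Moments, information and identifiability are assumed for the generic
    \<open>Z\<close>, whereas the locales speak of \<open>Zs 0\<close>; only the law matters in each
    of them.\<close>
  have law_pair: "distr M borel (Zs 0) = distr M borel Z"
  proof -
    have "distr (distr M borel (\<lambda>\<omega>. (Ys 0 \<omega>, Zs 0 \<omega>))) borel snd = distr (distr M borel (\<lambda>\<omega>. (Y \<omega>, Z \<omega>))) borel snd"
      by (simp only: same_law)
    then show ?thesis by (simp add: distr_distr o_def)
  qed
  have Z_integral: "(\<integral>\<omega>. f (Z \<omega>) \<partial>M) = (\<integral>\<omega>. f (Zs 0 \<omega>) \<partial>M)"
    if [measurable]: "f \<in> borel_measurable borel" for f :: "real^'l \<Rightarrow> real^'d^'d"
  proof -
    have "(\<integral>\<omega>. f (Z \<omega>) \<partial>M) = integral\<^sup>L (distr M borel Z) f" by (simp add: integral_distr)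
    also have "\<dots> = (\<integral>\<omega>. f (Zs 0 \<omega>) \<partial>M)" unfolding law_pair[symmetric] by (simp add: integral_distr)
    finally show ?thesis .
  qed
  interpret R: mlp_regression M e Zs W0 \<Gamma>0
  proof
    show "indep_vars (\<lambda>_. borel) (\<lambda>t \<omega>. (e t \<omega>, Zs t \<omega>)) UNIV"
      unfolding eg by (rule indep_vars_compose2[OF indep_pairs]) (rule g)
    show "distr M borel (\<lambda>\<omega>. (e t \<omega>, Zs t \<omega>)) = distr M borel (\<lambda>\<omega>. (e 0 \<omega>, Zs 0 \<omega>))" for t
    proof -
      have "distr M borel (\<lambda>\<omega>. (e t \<omega>, Zs t \<omega>)) = distr (distr M borel (\<lambda>\<omega>. (Ys t \<omega>, Zs t \<omega>))) borel ?g" for t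
        unfolding eg by (subst distr_distr[OF g pair_m]) (simp add: o_def)
      then show ?thesis by (simp only: same_law)
    qed
    have e0: "distr M borel (e 0) = distr M borel (eps 0)" by (rule distr_cong) (simp_all add: e)
    show "distr M (borel \<Otimes>\<^sub>M borel) (\<lambda>\<omega>. (e 0 \<omega>, Zs 0 \<omega>)) = distr M borel (e 0) \<Otimes>\<^sub>M distr M borel (Zs 0)"
      unfolding e0 using noise_indep_input[of 0] by (subst distr_cong[OF refl refl]) (simp_all add: e)
    show "integrable M (\<lambda>\<omega>. (norm (e 0 \<omega>))\<^sup>2)"
      using noise_square[of 0] by (subst Bochner_Integration.integrable_cong[OF refl]) (simp_all add: e)
    show "integral\<^sup>L M (e 0) = 0"
      using noise_centered[of 0] by (subst Bochner_Integration.integral_cong[OF refl]) (simp_all add: e)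
    have "(\<integral>\<omega>. outer_prod (eps 0 \<omega>) (eps 0 \<omega>) \<partial>M) = \<Gamma>0"
      using noise_cov(1)[of 0] by (simp add: covariance_matrix_def noise_centered)
    then show "(\<integral>\<omega>. outer_prod (e 0 \<omega>) (e 0 \<omega>) \<partial>M) = \<Gamma>0"
      by (subst Bochner_Integration.integral_cong[OF refl]) (simp_all add: e)
    show "invertible \<Gamma>0" by (rule noise_cov(2))
    have "integrable (distr M borel Z) (\<lambda>z. norm z ^ 3)" using Z_cube by (simp add: integrable_distr_eq)
    then show "integrable M (\<lambda>\<omega>. norm (Zs 0 \<omega>) ^ 3)"
      unfolding law_pair[symmetric] by (simp add: integrable_distr_eq)
  qed
  have symG: "transpose (matrix_inv \<Gamma>0) = matrix_inv \<Gamma>0"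
    using pos_def_matrix_inv[OF R.pos_def_cov] by (simp add: pos_def_def)
  have I0: "I0 = R.info (matrix_inv \<Gamma>0)"
  proof -
    have "(\<integral>\<omega>. outer_prod (mlp_partial W0 k (Z \<omega>)) (mlp_partial W0 l (Z \<omega>)) \<partial>M) = R.deriv_cov k l" for k l
      unfolding mlp_partial_eq R.deriv_cov_def deriv_prod_def snd_conv
      by (rule Z_integral[of "\<lambda>z. outer_prod (mlp_deriv W0 (axis k 1) z) (mlp_deriv W0 (axis l 1) z)"]) measurable
    then show ?thesis
      by (simp add: I0_def information_matrix_def R.info_def trace_mult_inner symG)
  qed
  have I0_pos: "pos_def I0"
    using hessian by (auto simp: pos_def_def transpose_def vec_eq_iff scaleR_matrix_vector_assoc[symmetric])
  interpret E: mlp_estimation M e Zs W0 \<Gamma>0 \<Theta>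
  proof
    fix W assume W: "W \<in> \<Theta>" "AE \<omega> in M. mlp W (Zs 0 \<omega>) = mlp W0 (Zs 0 \<omega>)"
    have m: "{z \<in> space borel. mlp W z = mlp W0 z} \<in> sets borel" by measurable
    have "AE z in distr M borel Z. mlp W z = mlp W0 z"
      unfolding law_pair[symmetric] using W(2) by (subst AE_distr_iff[OF _ m]) auto
    then have "AE \<omega> in M. mlp W (Z \<omega>) = mlp W0 (Z \<omega>)" by (subst (asm) AE_distr_iff[OF _ m]) auto
    then show "weight_equiv W0 W" by (rule identifiable[OF W(1)])
  qed (use compact_param true_param I0_pos in \<open>simp_all add: I0\<close>)
  \<comment> \<open>Both costs factor through the empirical residual covariance, the form in which
    the two limit lemmas expect them.\<close>
  have emp_cov: "E.emp_cov \<omega> n W = (1 / real n) *\<^sub>R (\<Sum>t=1..n. outer_prod (residual Ys Zs \<omega> W t) (residual Ys Zs \<omega> W t))" for \<omega> n W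
    by (simp add: emp_mean_def res_prod_def residual_def e_def)
  have gls: "gls_cost \<Gamma> Ys Zs n \<omega> W = matrix_inv \<Gamma> \<bullet> E.emp_cov \<omega> n W" for \<Gamma> n \<omega> W
    unfolding emp_cov by (simp add: gls_cost_def inner_sum_right inner_outer_prod)
  have log_det: "log_det_cost Ys Zs n \<omega> W = log_det (E.emp_cov \<omega> n W)" for n \<omega> W
    unfolding emp_cov by (simp add: log_det_cost_def log_det_def Let_def)
  let ?V = "matrix_inv I0"
  let ?X = "\<lambda>T n \<omega>. sqrt (real n) *\<^sub>R (T n \<omega> - W0)"
  have V: "pos_def ?V" by (rule pos_def_matrix_inv[OF I0_pos])
  have avar: "R.avar (matrix_inv \<Gamma>0) u = u \<bullet> (?V *v u)" for u
    using R.avar_optimal I0_pos by (simp add: I0)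
  have gls_char: "(\<lambda>n. \<integral>\<omega>. cis (u \<bullet> ?X T n \<omega>) \<partial>M) \<longlonglongrightarrow> exp (- R.avar (matrix_inv \<Gamma>) u / 2)"
      "?X T n \<in> borel_measurable M"
    if \<Gamma>: "pos_def \<Gamma>" and T: "minimum_estimator M \<Theta> W0 (gls_cost \<Gamma> Ys Zs) T" for \<Gamma> T u n
    by (rule E.gls_char_limit[OF pos_def_matrix_inv[OF \<Gamma>] minimum_estimatorD[OF T, unfolded gls]]; assumption)+
  have Wstar_law: "converges_in_law M (?X Wstar) (mv_normal 0 ?V)"
    using gls_char[OF R.pos_def_cov Wstar] by (intro converges_in_law_mv_normalI[OF M _ V]) (simp_all add: avar)
  have What_law: "converges_in_law M (?X What) (mv_normal 0 ?V)"
  proof (rule converges_in_law_mv_normalI[OF M _ V])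
    show "?X What n \<in> borel_measurable M" for n
      by (rule E.log_det_char_limit[OF minimum_estimatorD[OF What, unfolded log_det]]; assumption)
    show "(\<lambda>n. \<integral>\<omega>. cis (u \<bullet> ?X What n \<omega>) \<partial>M) \<longlonglongrightarrow> exp (- (u \<bullet> (?V *v u)) / 2)" for u
      unfolding avar[symmetric]
      by (rule E.log_det_char_limit[OF minimum_estimatorD[OF What, unfolded log_det]]; assumption)
  qed
  have ac: "asymptotic_covariance M W0 What ?V" "asymptotic_covariance M W0 Wstar ?V"
    using V What_law Wstar_law by (simp_all add: asymptotic_covariance_def)
  have lower: "pos_semidef (V' - ?V)"
    if T: "T \<in> gls_estimators M Ys Zs \<Theta> W0" and V': "asymptotic_covariance M W0 T V'" for T V'
  proof -
    obtain \<Gamma> where \<Gamma>: "pos_def \<Gamma>" "minimum_estimator M \<Theta> W0 (gls_cost \<Gamma> Ys Zs) T"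
      using T by (auto simp: gls_estimators_def)
    have V'': "pos_def V'" "converges_in_law M (?X T) (mv_normal 0 V')"
      using V' by (simp_all add: asymptotic_covariance_def)
    \<comment> \<open>The form of the competitor's covariance is its computed variance
      \<open>avar\<close>, which \<open>avar_ge\<close> bounds below in every direction; this is the
      Loewner order.\<close>
    have "u \<bullet> (?V *v u) \<le> u \<bullet> (V' *v u)" for u
    proof -
      have "u \<bullet> (?V *v u) \<le> R.avar (matrix_inv \<Gamma>) u"
        unfolding I0 by (rule R.avar_ge) (use I0_pos \<Gamma>(1) in \<open>simp_all add: I0 pos_def_matrix_inv\<close>)
      also have "\<dots> = u \<bullet> (V' *v u)"
        by (rule char_limit_eq_mv_normal_form[OF M gls_char(2)[OF \<Gamma>] V'' gls_char(1)[OF \<Gamma>], symmetric])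
      finally show ?thesis .
    qed
    moreover have "transpose (V' - ?V) = V' - ?V"
      using V V''(1) by (simp add: pos_def_def transpose_def vec_eq_iff)
    ultimately show ?thesis
      by (simp add: pos_semidef_def matrix_vector_mult_diff_rdistrib inner_diff_right)
  qed
  show ?thesis
    using What_law Wstar_law ac lower
    by (auto simp: same_asymptotic_covariance_def asymptotically_optimal_def)
qed

end
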